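(* Let $n\geq2$, $\alpha\in(0,1)$ and $p\geq\bar p$, where $$\bar p=1+\frac{2}{n-2(1+\alpha)^{-1}}.$$ Moreover, let $p<1+\frac2{n-2}$ if $n\geq3$. Then there exists $\varepsilon>0$ such that for any $u_0,u_1\in L^1\cap L^p$ satisfying $$\|u_0\|_{L^1\cap L^p}\leq\varepsilon,\qquad \|u_1\|_{L^1\cap L^p}\leq\varepsilon,$$ there exists a unique global solution $u\in\mathcal C([0,\infty),L^1\cap L^p)$ to the Cauchy problem $$\partial_t^{1+\alpha}u-\Delta u=|u|^p\ \ (t>0,\ x\in\mathbb{R}^n),\qquad u(0,x)=u_0(x),\qquad u_t(0,x)=u_1(x).$$ Moreover, the solution satisfies the decay estimate $$\|u(t,\cdot)\|_{L^q}\leq C\,(1+t)^{1-\frac n2(1+\alpha)\left(1-\frac1q\right)}\bigl(\|u_0\|_{L^1\cap L^p}+\|u_1\|_{L^1\cap L^p}\bigr)\qquad\text{for all } q\in[1,p],\ t\geq0,$$ where $C>0$ does not depend on the data.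
   Context: $L^q=L^q(\mathbb{R}^n)$ and $\|g\|_{L^1\cap L^p}=\|g\|_{L^1}+\|g\|_{L^p}$. For $\alpha\in(0,1)$, $\partial_t^{1+\alpha}u=J^{1-\alpha}(\partial_t^2u)$ is the Caputo fractional derivative in time, where $J^{\beta}g(t)=\frac1{\Gamma(\beta)}\int_0^t(t-s)^{\beta-1}g(s)\,ds$. The Mittag-Leffler functions are $E_{1+\alpha,\beta}(z)=\sum_{k=0}^\infty\frac{z^k}{\Gamma(k+\alpha k+\beta)}$. Let $\mathfrak F^{-1}$ be the inverse Fourier transform in $x$, $\mathfrak F^{-1}g(x)=(2\pi)^{-n}\int_{\mathbb{R}^n}e^{ix\cdot\xi}g(\xi)\,d\xi$ (extended to tempered distributions), and for $t>0$ let $G_{1+\alpha,\beta}(t,\cdot)=\mathfrak F^{-1}\bigl(E_{1+\alpha,\beta}(-t^{1+\alpha}|\xi|^2)\bigr)$. A (global) solution $u\in\mathcal C([0,\infty),L^1\cap L^p)$ to the Cauchy problem is a function satisfying $$u(t,\cdot)=G_{1+\alpha,1}(t,\cdot)*u_0+t\,G_{1+\alpha,2}(t,\cdot)*u_1+\int_0^t(t-s)^{\alpha}\,G_{1+\alpha,1+\alpha}(t-s,\cdot)*|u(s,\cdot)|^p\,ds$$ for all $t>0$, with $u(0,\cdot)=u_0$, where $*$ denotes convolution in $x$. *)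

theory Defs
  imports "HOL-Analysis.Analysis"
begin

text \<open>Elements of \<open>L\<^sup>q\<close> are represented by real-valued Borel functions; equality in \<open>L\<^sup>q\<close> is
  equality almost everywhere.\<close>

definition Lq_space :: "real \<Rightarrow> ('a::euclidean_space \<Rightarrow> real) set" where
  "Lq_space q = {g \<in> borel_measurable borel. integrable lborel (\<lambda>x. \<bar>g x\<bar> powr q)}"

definition Lq_norm :: "real \<Rightarrow> ('a::euclidean_space \<Rightarrow> real) \<Rightarrow> real" where
  "Lq_norm q g = (\<integral>x. \<bar>g x\<bar> powr q \<partial>lborel) powr (1 / q)"

definition L1p_space :: "real \<Rightarrow> ('a::euclidean_space \<Rightarrow> real) set" where
  "L1p_space p = Lq_space 1 \<inter> Lq_space p"

definition L1p_norm :: "real \<Rightarrow> ('a::euclidean_space \<Rightarrow> real) \<Rightarrow> real" where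
  "L1p_norm p g = Lq_norm 1 g + Lq_norm p g"

definition C_L1p :: "real \<Rightarrow> (real \<Rightarrow> 'a::euclidean_space \<Rightarrow> real) set" where
  "C_L1p p = {u. (\<forall>t\<ge>0. u t \<in> L1p_space p) \<and>
     (\<forall>t\<ge>0. ((\<lambda>s. L1p_norm p (\<lambda>x. u s x - u t x)) \<longlongrightarrow> 0) (at t within {0..}))}"

definition convol :: "('a::euclidean_space \<Rightarrow> real) \<Rightarrow> ('a \<Rightarrow> real) \<Rightarrow> 'a \<Rightarrow> real" where
  "convol g f x = (\<integral>y. g (x - y) * f y \<partial>lborel)"

definition mittag_leffler :: "real \<Rightarrow> real \<Rightarrow> real \<Rightarrow> real" where
  "mittag_leffler a b z = (\<Sum>k. z ^ k / Gamma (a * real k + b))"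

text \<open>Iterated derivatives along a list of directions; lists of basis vectors play the role of
  multi-indices.\<close>

primrec iter_deriv :: "'a::euclidean_space list \<Rightarrow> ('a \<Rightarrow> complex) \<Rightarrow> 'a \<Rightarrow> complex" where
  "iter_deriv [] \<phi> = \<phi>"
| "iter_deriv (v # vs) \<phi> = (\<lambda>x. frechet_derivative (iter_deriv vs \<phi>) (at x) v)"

text \<open>The Schwartz space. Total differentiability of all iterated partial derivatives is the same
  as smoothness.\<close>

definition schwartz :: "('a::euclidean_space \<Rightarrow> complex) set" where
  "schwartz = {\<phi>. \<forall>vs. set vs \<subseteq> Basis \<longrightarrow>
     (\<forall>x. iter_deriv vs \<phi> differentiable (at x)) \<and>
     (\<forall>k::nat. \<exists>B. \<forall>x. norm x ^ k * norm (iter_deriv vs \<phi> x) \<le> B)}"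

definition inv_fourier :: "('a::euclidean_space \<Rightarrow> complex) \<Rightarrow> 'a \<Rightarrow> complex" where
  "inv_fourier \<phi> x = (1 / of_real ((2 * pi) ^ DIM('a))) *
     (\<integral>\<xi>. exp (\<i> * of_real (x \<bullet> \<xi>)) * \<phi> \<xi> \<partial>lborel)"

text \<open>The inverse Fourier transform of the tempered distribution given by the function \<open>m\<close>, as a
  functional on Schwartz functions (defined by duality).\<close>

definition inv_fourier_distr ::
  "('a::euclidean_space \<Rightarrow> real) \<Rightarrow> ('a \<Rightarrow> complex) \<Rightarrow> complex" where
  "inv_fourier_distr m \<phi> = (\<integral>\<xi>. of_real (m \<xi>) * inv_fourier \<phi> \<xi> \<partial>lborel)"

definition represents_distr ::
  "('a::euclidean_space \<Rightarrow> real) \<Rightarrow> (('a \<Rightarrow> complex) \<Rightarrow> complex) \<Rightarrow> bool" where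
  "represents_distr g T \<longleftrightarrow> (\<forall>\<phi>\<in>schwartz.
     integrable lborel (\<lambda>x. of_real (g x) * \<phi> x) \<and>
     (\<integral>x. of_real (g x) * \<phi> x \<partial>lborel) = T \<phi>)"

text \<open>The kernel \<open>G\<^bsub>1+\<alpha>,\<beta>\<^esub>(t,\<sqdot>)\<close>. In general the symbol is not
  integrable, so the transform is that of tempered distributions. It is an integrable real-valued
  function, unique up to null sets; the choice of the representative does not affect any value
  of \<open>convol\<close>.\<close>

definition G_kernel :: "real \<Rightarrow> real \<Rightarrow> real \<Rightarrow> 'a::euclidean_space \<Rightarrow> real" where
  "G_kernel \<alpha> \<beta> t = (SOME g. represents_distr g
     (inv_fourier_distr (\<lambda>\<xi>. mittag_leffler (1 + \<alpha>) \<beta> (- (t powr (1 + \<alpha>)) * (norm \<xi>)\<^sup>2))))"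

text \<open>Since the kernels are integrable, the convolutions and the time integral below converge
  absolutely for almost every \<open>x\<close> whenever the data are in \<open>L1p_space p\<close> and \<open>u \<in> C_L1p p\<close>.\<close>

definition global_solution ::
  "real \<Rightarrow> real \<Rightarrow> ('a::euclidean_space \<Rightarrow> real) \<Rightarrow> ('a \<Rightarrow> real) \<Rightarrow> (real \<Rightarrow> 'a \<Rightarrow> real) \<Rightarrow> bool" where
  "global_solution \<alpha> p u0 u1 u \<longleftrightarrow>
     u \<in> C_L1p p \<and>
     (AE x in lborel. u 0 x = u0 x) \<and>
     (\<forall>t>0. AE x in lborel.
        u t x = convol (G_kernel \<alpha> 1 t) u0 x
              + t * convol (G_kernel \<alpha> 2 t) u1 x
              + (LINT s:{0..t}|lborel. (t - s) powr \<alpha> *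
                   convol (G_kernel \<alpha> (1 + \<alpha>) (t - s)) (\<lambda>y. \<bar>u s y\<bar> powr p) x))"

end

theory Submission
  imports Defs "HOL-Probability.Probability" "HOL-Complex_Analysis.Complex_Analysis" "HOL-Real_Asymp.Real_Asymp"
begin

text \<open>Write \<open>\<gamma> = 1 + \<alpha>\<close>, \<open>n\<close> for the space dimension, and \<open>D = \<gamma> (n/2) (1 - 1/p)\<close>.
The proof has a linear half, which produces the kernels and their decay, and a nonlinear half, which is a
fixed point argument in a ball of functions with prescribed growth.

The kernels. Bending Hankel's contour shows that, for \<open>1 < \<gamma> < 2\<close> and \<open>\<mu> \<ge> 0\<close>, the value
\<open>E\<^bsub>\<gamma>,\<beta>\<^esub>(-\<mu>)\<close> is the imaginary part of \<open>\<integral> w(\<rho>) exp (- \<rho> \<sigma> \<mu>) d\<rho>\<close> over the positive half-line,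
where \<open>w\<close> decays exponentially, \<open>|\<sigma>| = 1\<close> and \<open>Re \<sigma> > 0\<close>
(\<open>mittag_leffler_laplace_representation\<close>). For \<open>\<mu> = T |\<xi>|\<^sup>2\<close> the exponential is the
symbol of the heat kernel at the complex time \<open>\<rho> T \<sigma>\<close>. Hence the kernel is a superposition of complex heat
kernels, thus an honest function; it is self-similar, and its \<open>L\<^sup>q\<close> norm is a constant times
\<open>T\<close> to the power \<open>- (n/2) (1 - 1/q)\<close> provided that this exponent exceeds \<open>-1\<close>, which makes the
singularity at \<open>\<rho> = 0\<close> integrable (\<open>fractional_kernel\<close>). For \<open>q = p\<close> this is the upper bound on \<open>p\<close>.
A function that represents a given tempered distribution is unique almost everywhere
(\<open>represents_distr_unique\<close>), so convolution with \<open>G_kernel\<close> is convolution with this kernel.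

The fixed point. The linear part of the solution is bounded by a multiple of \<open>1 + t\<close> in \<open>L\<^sup>1\<close> and of
\<open>(1 + t)\<close> to the power \<open>1 - D\<close> in \<open>L\<^sup>p\<close>. If \<open>u\<close> obeys these bounds, then the \<open>L\<^sup>1\<close> norm of \<open>|u(s)|\<^sup>p\<close>
is at most a multiple of \<open>(1 + s)\<close> to the power \<open>p (1 - D)\<close>, and \<open>p (1 - D) \<le> - \<alpha>\<close> is a
reformulation of the lower bound on \<open>p\<close>. Convolving with the kernel, once from \<open>L\<^sup>1\<close> to \<open>L\<^sup>1\<close> and once from
\<open>L\<^sup>1\<close> to \<open>L\<^sup>p\<close>, and integrating against \<open>(t - s)\<^sup>\<alpha>\<close> gives back the same growth (\<open>Lq_le_Duhamel_decay\<close>).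
Therefore Picard iteration contracts for small data (\<open>small_data_solution\<close>), and the decay for \<open>q\<close> between
\<open>1\<close> and \<open>p\<close> follows by interpolation. Uniqueness holds among all continuous solutions, small or not, because on a
bounded time interval the difference of two solutions contracts in a supremum norm with an exponential weight
(\<open>solution_unique\<close>).\<close>

section \<open>Quantitative bounds in \<open>L\<^sup>q\<close>\<close>

abbreviation jointly_measurable ::
  "('a::topological_space \<Rightarrow> 'b::topological_space \<Rightarrow> 'c::topological_space) \<Rightarrow> bool" where
  "jointly_measurable u \<equiv> (\<lambda>(t, x). u t x) \<in> borel_measurable (borel \<Otimes>\<^sub>M borel)"

text \<open>Bounds are kept as a relation between a function and a number rather than as inequalities for \<open>Lq_norm\<close>.
The nonnegative integral makes finiteness part of the bound, so integrability never has to be shown separately.\<close>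

definition Lq_le :: "real \<Rightarrow> ('a::euclidean_space \<Rightarrow> real) \<Rightarrow> real \<Rightarrow> bool" where
  "Lq_le q f B \<longleftrightarrow> f \<in> borel_measurable borel \<and> 0 \<le> B \<and>
     (\<integral>\<^sup>+x. ennreal (\<bar>f x\<bar> powr q) \<partial>lborel) \<le> ennreal (B powr q)"

lemma Lq_le_measurable: "Lq_le q f B \<Longrightarrow> f \<in> borel_measurable borel"
  and Lq_le_nonneg: "Lq_le q f B \<Longrightarrow> 0 \<le> B"
  and Lq_le_nn_integral: "Lq_le q f B \<Longrightarrow>
        (\<integral>\<^sup>+x. ennreal (\<bar>f x\<bar> powr q) \<partial>lborel) \<le> ennreal (B powr q)"
  by (auto simp: Lq_le_def)

lemma Lq_le_mono:
  assumes "Lq_le q g A" "f \<in> borel_measurable borel" "AE x in lborel. \<bar>f x\<bar> \<le> \<bar>g x\<bar>"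
    and "A \<le> B" "0 \<le> q"
  shows "Lq_le q f B"
proof -
  have "(\<integral>\<^sup>+x. ennreal (\<bar>f x\<bar> powr q) \<partial>lborel) \<le> (\<integral>\<^sup>+x. ennreal (\<bar>g x\<bar> powr q) \<partial>lborel)"
    using assms(3) \<open>0 \<le> q\<close> by (intro nn_integral_mono_AE) (auto elim!: eventually_mono intro!: ennreal_leI powr_mono2)
  also have "\<dots> \<le> ennreal (A powr q)" using assms(1) by (rule Lq_le_nn_integral)
  also have "\<dots> \<le> ennreal (B powr q)"
    using assms Lq_le_nonneg[OF assms(1)] by (intro ennreal_leI powr_mono2) auto
  finally show ?thesis using assms Lq_le_nonneg[OF assms(1)] by (auto simp: Lq_le_def)
qed

lemma Lq_le_weaken: "Lq_le q f A \<Longrightarrow> A \<le> B \<Longrightarrow> 0 \<le> q \<Longrightarrow> Lq_le q f B"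
  by (rule Lq_le_mono) (auto dest: Lq_le_measurable)

lemma Lq_le_AE_cong:
  "Lq_le q g A \<Longrightarrow> f \<in> borel_measurable borel \<Longrightarrow> AE x in lborel. f x = g x \<Longrightarrow> 0 \<le> q \<Longrightarrow> Lq_le q f A"
  by (rule Lq_le_mono[where g=g]) (auto elim: eventually_mono)

lemma Lq_le_cmult:
  assumes "Lq_le q f B"
  shows "Lq_le q (\<lambda>x. c * f x) (\<bar>c\<bar> * B)"
proof -
  have [measurable]: "f \<in> borel_measurable borel" using assms by (rule Lq_le_measurable)
  have "(\<integral>\<^sup>+x. ennreal (\<bar>c * f x\<bar> powr q) \<partial>lborel)
      = ennreal (\<bar>c\<bar> powr q) * (\<integral>\<^sup>+x. ennreal (\<bar>f x\<bar> powr q) \<partial>lborel)"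
    by (subst nn_integral_cmult[symmetric]) (auto simp: abs_mult powr_mult ennreal_mult)
  also have "\<dots> \<le> ennreal (\<bar>c\<bar> powr q) * ennreal (B powr q)"
    using assms by (intro mult_left_mono Lq_le_nn_integral) auto
  also have "\<dots> = ennreal ((\<bar>c\<bar> * B) powr q)"
    using Lq_le_nonneg[OF assms] by (simp add: powr_mult ennreal_mult)
  finally show ?thesis using assms by (auto simp: Lq_le_def)
qed

lemma Lq_le_minus: "Lq_le q f B \<Longrightarrow> Lq_le q (\<lambda>x. - f x) B"
  using Lq_le_cmult[of q f B "-1"] by simp

lemma Lq_le_zero: "0 \<le> B \<Longrightarrow> Lq_le q (\<lambda>x. 0) B"
  by (simp add: Lq_le_def)

lemma Lq_le_closed:
  assumes "\<And>B'. B < B' \<Longrightarrow> Lq_le q f B'" "0 \<le> B" "0 < q"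
  shows "Lq_le q f B"
proof -
  have "((\<lambda>B'. ennreal (B' powr q)) \<longlongrightarrow> ennreal (B powr q)) (at_right B)"
    using assms by (intro tendsto_ennrealI tendsto_powr' tendsto_intros)
       (auto simp: eventually_at_right_field intro: exI[of _ "B+1"])
  moreover have "eventually (\<lambda>B'. (\<integral>\<^sup>+x. ennreal (\<bar>f x\<bar> powr q) \<partial>lborel) \<le> ennreal (B' powr q)) (at_right B)"
    using assms(1) by (auto simp: eventually_at_right_field Lq_le_def intro: exI[of _ "B+1"])
  ultimately have "(\<integral>\<^sup>+x. ennreal (\<bar>f x\<bar> powr q) \<partial>lborel) \<le> ennreal (B powr q)"
    by (rule tendsto_lowerbound) simp
  then show ?thesis using assms(1)[of "B+1"] assms(2) by (auto simp: Lq_le_def)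
qed

text \<open>This is Fatou's lemma.\<close>

lemma Lq_le_LIMSEQ:
  assumes f: "\<And>k. Lq_le q (f k) B" and lim: "AE x in lborel. (\<lambda>k. f k x) \<longlonglongrightarrow> g x"
    and g[measurable]: "g \<in> borel_measurable borel" and q: "0 < q"
  shows "Lq_le q g B"
proof -
  have [measurable]: "f k \<in> borel_measurable borel" for k using f by (rule Lq_le_measurable)
  have *: "(\<lambda>k. \<bar>f k x\<bar> powr q) \<longlonglongrightarrow> \<bar>g x\<bar> powr q" if "(\<lambda>k. f k x) \<longlonglongrightarrow> g x" for x
    using q that by (intro tendsto_powr' tendsto_intros) auto
  have "(\<integral>\<^sup>+x. ennreal (\<bar>g x\<bar> powr q) \<partial>lborel) = (\<integral>\<^sup>+x. liminf (\<lambda>k. ennreal (\<bar>f k x\<bar> powr q)) \<partial>lborel)"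
    using lim by (intro nn_integral_cong_AE)
      (auto elim!: eventually_mono intro!: lim_imp_Liminf[symmetric] tendsto_ennrealI *)
  also have "\<dots> \<le> liminf (\<lambda>k. \<integral>\<^sup>+x. ennreal (\<bar>f k x\<bar> powr q) \<partial>lborel)"
    by (rule nn_integral_liminf) simp
  also have "\<dots> \<le> limsup (\<lambda>k. \<integral>\<^sup>+x. ennreal (\<bar>f k x\<bar> powr q) \<partial>lborel)"
    by (rule Liminf_le_Limsup) simp
  also have "\<dots> \<le> ennreal (B powr q)"
    by (rule Limsup_bounded) (use f in \<open>auto simp: Lq_le_def\<close>)
  finally show ?thesis using Lq_le_nonneg[OF f[of 0]] g by (auto simp: Lq_le_def)
qed

text \<open>The convex function \<open>x\<^sup>q\<close> lies above its tangent at \<open>c\<close>.\<close>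

lemma powr_above_tangent:
  fixes x c q :: real
  assumes "1 \<le> q" "0 \<le> x" "0 < c"
  shows "q * c powr (q - 1) * x \<le> x powr q + (q - 1) * c powr q"
proof (cases "q = 1")
  case False
  then have q: "q > 1" using assms by simp
  have "x * c powr (q - 1) \<le> x powr q / q + (c powr (q - 1)) powr (q / (q - 1)) / (q / (q - 1))"
    using q assms by (intro Youngs_inequality) (auto simp: field_simps)
  also have "(c powr (q - 1)) powr (q / (q - 1)) = c powr q"
    using q by (simp add: powr_powr)
  finally have "x * c powr (q - 1) * q \<le> (x powr q / q + c powr q / (q / (q - 1))) * q"
    using q by (intro mult_right_mono) auto
  moreover have eq: "(X / q + Y / (q / (q - 1))) * q = X + (q - 1) * Y" for X Y :: real
    using q by (simp add: field_simps)
  ultimately have "x * c powr (q - 1) * q \<le> x powr q + (q - 1) * c powr q"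
    unfolding eq by blast
  then show ?thesis by (simp only: mult_ac)
qed (use assms in auto)

text \<open>The pointwise bound \<open>|h| \<le> 1 + |h|\<^sup>q\<close> reduces integrability of \<open>w h\<close> to that of \<open>w\<close> and \<open>w |h|\<^sup>q\<close>.\<close>

lemma integrable_weighted_if_powr:
  fixes w h :: "'s \<Rightarrow> real"
  assumes w: "\<And>s. 0 \<le> w s" "integrable M w" and [measurable]: "h \<in> borel_measurable M"
    and q: "1 \<le> q" and fin: "(\<integral>\<^sup>+s. ennreal (w s * \<bar>h s\<bar> powr q) \<partial>M) < \<infinity>"
  shows "integrable M (\<lambda>s. w s * h s)" "integrable M (\<lambda>s. w s * \<bar>h s\<bar> powr q)"
proof -
  have [measurable]: "w \<in> borel_measurable M" using w by auto
  show i: "integrable M (\<lambda>s. w s * \<bar>h s\<bar> powr q)"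
    using fin w by (intro integrableI_bounded) (auto simp: abs_mult)
  have *: "\<bar>y\<bar> \<le> 1 + \<bar>y\<bar> powr q" for y :: real
  proof (cases "\<bar>y\<bar> \<le> 1")
    case False
    then have "\<bar>y\<bar> powr 1 \<le> \<bar>y\<bar> powr q" using q by (intro powr_mono) auto
    then show ?thesis using False by simp
  qed (use powr_ge_zero[of "\<bar>y\<bar>" q] in linarith)
  show "integrable M (\<lambda>s. w s * h s)"
    using Bochner_Integration.integrable_add[OF w(2) i]
  proof (rule Bochner_Integration.integrable_bound)
    have "w s * \<bar>h s\<bar> \<le> w s + w s * \<bar>h s\<bar> powr q" for s
      using mult_left_mono[OF *[of "h s"] w(1)[of s]] by (simp add: algebra_simps)
    then show "AE s in M. norm (w s * h s) \<le> norm (w s + w s * \<bar>h s\<bar> powr q)"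
      using w(1) by (intro AE_I2) (simp add: abs_mult)
  qed simp
qed

text \<open>Jensen's inequality for \<open>x\<^sup>q\<close>, proved by integrating the tangent inequality at the mean.\<close>

lemma weighted_integral_powr_le:
  fixes w h :: "'s \<Rightarrow> real"
  assumes w: "\<And>s. 0 \<le> w s" "integrable M w" "(\<integral>s. w s \<partial>M) \<le> B" "0 < B"
    and [measurable]: "h \<in> borel_measurable M" and q: "1 \<le> q"
  shows "ennreal (\<bar>\<integral>s. w s * h s \<partial>M\<bar> powr q)
    \<le> ennreal (B powr (q - 1)) * (\<integral>\<^sup>+s. ennreal (w s * \<bar>h s\<bar> powr q) \<partial>M)"
proof (cases "(\<integral>\<^sup>+s. ennreal (w s * \<bar>h s\<bar> powr q) \<partial>M) < \<infinity>")
  case False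
  then have "(\<integral>\<^sup>+s. ennreal (w s * \<bar>h s\<bar> powr q) \<partial>M) = \<infinity>" by (simp add: not_less top_unique)
  then show ?thesis using \<open>0 < B\<close> by (simp add: ennreal_mult_top)
next
  case True
  note i = integrable_weighted_if_powr[OF w(1,2) _ q True, simplified]
  have i1: "integrable M (\<lambda>s. w s * \<bar>h s\<bar>)"
    using integrable_abs[OF i(1)] w(1) by (simp add: abs_mult)
  define m where "m = (\<integral>s. w s * \<bar>h s\<bar> \<partial>M)"
  define Q where "Q = (\<integral>s. w s * \<bar>h s\<bar> powr q \<partial>M)"
  have m0: "0 \<le> m" using w unfolding m_def by (intro integral_nonneg_AE) auto
  have "m powr q \<le> B powr (q - 1) * Q"
  proof (cases "m = 0")
    case True
    have "0 \<le> Q" using w unfolding Q_def by (intro integral_nonneg_AE) auto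
    then show ?thesis using True by simp
  next
    case False
    define c where "c = m / B"
    have c: "0 < c" using False m0 w by (simp add: c_def)
    have "(\<integral>s. q * c powr (q - 1) * (w s * \<bar>h s\<bar>) \<partial>M)
        \<le> (\<integral>s. w s * \<bar>h s\<bar> powr q + (q - 1) * c powr q * w s \<partial>M)"
    proof (rule integral_mono)
      show "q * c powr (q - 1) * (w s * \<bar>h s\<bar>) \<le> w s * \<bar>h s\<bar> powr q + (q - 1) * c powr q * w s" for s
        using mult_left_mono[OF powr_above_tangent[OF q abs_ge_zero c], OF w(1), of s "h s"]
        by (simp add: algebra_simps)
    qed (use i i1 w in auto)
    then have "q * c powr (q - 1) * m \<le> Q + (q - 1) * c powr q * (\<integral>s. w s \<partial>M)"
      using i i1 w by (simp add: m_def Q_def)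
    also have "\<dots> \<le> Q + (q - 1) * c powr q * B"
      using q w by (intro add_left_mono mult_left_mono) auto
    also have "c powr q * B = c powr (q - 1) * m"
      using c w(4) m0 False by (simp add: c_def powr_diff)
    then have "Q + (q - 1) * c powr q * B = Q + (q - 1) * c powr (q - 1) * m"
      by (simp add: mult.assoc)
    finally have "c powr (q - 1) * m \<le> Q" by (simp add: algebra_simps)
    then have "B powr (q - 1) * (c powr (q - 1) * m) \<le> B powr (q - 1) * Q"
      by (intro mult_left_mono) auto
    moreover have "B powr (q - 1) * (c powr (q - 1) * m) = (B * c) powr (q - 1) * m"
      using c w by (simp add: powr_mult)
    moreover have "(B * c) powr (q - 1) * m = m powr q"
      using c w m0 False by (simp add: c_def powr_diff)
    ultimately show ?thesis by simp
  qed
  moreover have "\<bar>\<integral>s. w s * h s \<partial>M\<bar> \<le> m"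
    using integral_abs_bound[of M "\<lambda>s. w s * h s"] w(1) by (simp add: m_def abs_mult)
  ultimately have "\<bar>\<integral>s. w s * h s \<partial>M\<bar> powr q \<le> B powr (q - 1) * Q"
    using q by (meson abs_ge_zero order_trans powr_mono2 zero_le_one)
  moreover have "(\<integral>\<^sup>+s. ennreal (w s * \<bar>h s\<bar> powr q) \<partial>M) = ennreal Q"
    unfolding Q_def using i w by (intro nn_integral_eq_integral) auto
  ultimately show ?thesis
    by (simp add: ennreal_mult'[symmetric] ennreal_leI)
qed

text \<open>Minkowski's integral inequality with the weight split off: Jensen's inequality is applied at every \<open>x\<close>, and
Tonelli's theorem then exchanges the integrals. All mapping properties of convolutions below are instances, with
\<open>M\<close> Lebesgue measure on space, on time, or on both.\<close>

lemma Lq_le_integral: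
  fixes w :: "'s \<Rightarrow> real" and h :: "'s \<Rightarrow> 'a::euclidean_space \<Rightarrow> real"
  assumes M: "sigma_finite_measure M"
    and w: "\<And>s. 0 \<le> w s" "integrable M w" "(\<integral>s. w s \<partial>M) \<le> B"
    and hm[measurable]: "(\<lambda>(s, x). h s x) \<in> borel_measurable (M \<Otimes>\<^sub>M borel)"
    and h: "\<And>s. s \<in> space M \<Longrightarrow> w s \<noteq> 0 \<Longrightarrow> Lq_le q (h s) C"
    and q: "1 \<le> q" and C: "0 \<le> C"
  shows "Lq_le q (\<lambda>x. \<integral>s. w s * h s x \<partial>M) (B * C)"
    and "AE x in lborel. integrable M (\<lambda>s. w s * h s x)"
proof -
  interpret M: sigma_finite_measure M by fact
  interpret P: pair_sigma_finite M "lborel :: 'a measure" ..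
  have [measurable]: "w \<in> borel_measurable M" using w by auto
  have sets_eq: "sets (M \<Otimes>\<^sub>M lborel) = sets (M \<Otimes>\<^sub>M (borel :: 'a measure))"
    by (intro sets_pair_measure_cong) auto
  have hm2[measurable]: "(\<lambda>(s, x). h s x) \<in> borel_measurable (M \<Otimes>\<^sub>M lborel)"
    unfolding measurable_cong_sets[OF sets_eq refl] by (rule hm)
  have hs[measurable]: "(\<lambda>s. h s x) \<in> borel_measurable M" for x
    using measurable_compose[OF measurable_Pair2' hm, of x] by simp
  have meas[measurable]: "(\<lambda>x. \<integral>s. w s * h s x \<partial>M) \<in> borel_measurable borel"
  proof -
    have "(\<lambda>(x, s). w s * h s x) \<in> borel_measurable (borel \<Otimes>\<^sub>M M)" by measurable
    then show ?thesis by (rule M.borel_measurable_lebesgue_integral)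
  qed
  have "0 \<le> (\<integral>s. w s \<partial>M)" by (rule integral_nonneg_AE) (simp add: w(1))
  then have "B \<ge> 0" using w(3) by simp
  have "(\<integral>\<^sup>+x. \<integral>\<^sup>+s. ennreal (w s * \<bar>h s x\<bar> powr q) \<partial>M \<partial>lborel)
      = (\<integral>\<^sup>+s. \<integral>\<^sup>+x. ennreal (w s * \<bar>h s x\<bar> powr q) \<partial>lborel \<partial>M)"
    by (rule P.Fubini') measurable
  also have "\<dots> = (\<integral>\<^sup>+s. ennreal (w s) * (\<integral>\<^sup>+x. ennreal (\<bar>h s x\<bar> powr q) \<partial>lborel) \<partial>M)"
  proof (rule nn_integral_cong)
    fix s assume s: "s \<in> space M"
    have [measurable]: "h s \<in> borel_measurable borel"
      using measurable_compose[OF measurable_Pair1'[OF s] hm] by simp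
    show "(\<integral>\<^sup>+x. ennreal (w s * \<bar>h s x\<bar> powr q) \<partial>lborel)
      = ennreal (w s) * (\<integral>\<^sup>+x. ennreal (\<bar>h s x\<bar> powr q) \<partial>lborel)"
      by (subst nn_integral_cmult[symmetric]) (auto simp: ennreal_mult w)
  qed
  also have "\<dots> \<le> (\<integral>\<^sup>+s. ennreal (w s) * ennreal (C powr q) \<partial>M)"
  proof (rule nn_integral_mono)
    fix s assume s: "s \<in> space M"
    show "ennreal (w s) * (\<integral>\<^sup>+x. ennreal (\<bar>h s x\<bar> powr q) \<partial>lborel) \<le> ennreal (w s) * ennreal (C powr q)"
    proof (cases "w s = 0")
      case False
      then show ?thesis using h[OF s] by (intro mult_left_mono) (auto dest: Lq_le_nn_integral)
    qed simp
  qed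
  also have "\<dots> = ennreal (C powr q) * ennreal (\<integral>s. w s \<partial>M)"
    using w by (simp add: nn_integral_multc nn_integral_eq_integral mult.commute)
  finally have tot: "(\<integral>\<^sup>+x. \<integral>\<^sup>+s. ennreal (w s * \<bar>h s x\<bar> powr q) \<partial>M \<partial>lborel)
    \<le> ennreal (C powr q) * ennreal (\<integral>s. w s \<partial>M)" .
  have mm[measurable]: "(\<lambda>x. \<integral>\<^sup>+s. ennreal (w s * \<bar>h s x\<bar> powr q) \<partial>M) \<in> borel_measurable borel"
    by measurable
  have "AE x in lborel. (\<integral>\<^sup>+s. ennreal (w s * \<bar>h s x\<bar> powr q) \<partial>M) \<noteq> \<infinity>"
  proof (rule nn_integral_PInf_AE)
    show "(\<integral>\<^sup>+x. \<integral>\<^sup>+s. ennreal (w s * \<bar>h s x\<bar> powr q) \<partial>M \<partial>lborel) \<noteq> \<infinity>"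
      using tot by (metis ennreal_mult_less_top ennreal_less_top infinity_ennreal_def leD)
  qed simp
  then show "AE x in lborel. integrable M (\<lambda>s. w s * h s x)"
  proof eventually_elim
    case (elim x)
    show ?case
      by (rule integrable_weighted_if_powr(1)[OF w(1,2) hs q]) (use elim in \<open>simp add: less_top[symmetric]\<close>)
  qed
  have pos: "Lq_le q (\<lambda>x. \<integral>s. w s * h s x \<partial>M) (B' * C)" if "B < B'" for B'
  proof -
    have B': "0 < B'" using that \<open>0 \<le> B\<close> by simp
    have "(\<integral>\<^sup>+x. ennreal (\<bar>\<integral>s. w s * h s x \<partial>M\<bar> powr q) \<partial>lborel)
      \<le> (\<integral>\<^sup>+x. ennreal (B' powr (q - 1)) * (\<integral>\<^sup>+s. ennreal (w s * \<bar>h s x\<bar> powr q) \<partial>M) \<partial>lborel)"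
      using w that by (intro nn_integral_mono weighted_integral_powr_le q B') auto
    also have "\<dots> = ennreal (B' powr (q - 1)) * (\<integral>\<^sup>+x. (\<integral>\<^sup>+s. ennreal (w s * \<bar>h s x\<bar> powr q) \<partial>M) \<partial>lborel)"
      by (rule nn_integral_cmult) simp
    also have "\<dots> \<le> ennreal (B' powr (q - 1)) * (ennreal (C powr q) * ennreal (\<integral>s. w s \<partial>M))"
      by (intro mult_left_mono tot) auto
    also have "\<dots> \<le> ennreal (B' powr (q - 1)) * (ennreal (C powr q) * ennreal B')"
      using w that by (intro mult_left_mono ennreal_leI) auto
    also have "\<dots> = ennreal (B' powr (q - 1) * (C powr q * B'))"
      using B' by (simp add: ennreal_mult)
    also have "B' powr (q - 1) * (C powr q * B') = (B' * C) powr q"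
      using B' C by (simp add: powr_mult powr_diff)
    finally show ?thesis using B' C by (auto simp: Lq_le_def)
  qed
  show "Lq_le q (\<lambda>x. \<integral>s. w s * h s x \<partial>M) (B * C)"
  proof (cases "C = 0")
    case True
    then show ?thesis using pos[of "B + 1"] by simp
  next
    case False
    show ?thesis
    proof (rule Lq_le_closed)
      fix D assume "B * C < D"
      then have "B < D / C" using False C by (simp add: field_simps)
      from pos[OF this] show "Lq_le q (\<lambda>x. \<integral>s. w s * h s x \<partial>M) D" using False by simp
    qed (use q C \<open>0 \<le> B\<close> in auto)
  qed
qed

text \<open>Minkowski's inequality is the integral version on a space with two points, with the bounds themselves as weights.\<close>

lemma Lq_le_add:
  assumes f: "Lq_le q f A" and g: "Lq_le q g B" and q: "1 \<le> q"
  shows "Lq_le q (\<lambda>x. f x + g x) (A + B)"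
proof -
  note [measurable] = Lq_le_measurable[OF f] Lq_le_measurable[OF g]
  have pos: "Lq_le q (\<lambda>x. f x + g x) (A' + B')" if "A < A'" "B < B'" for A' B'
  proof -
    have A': "0 < A'" "0 < B'" using that Lq_le_nonneg[OF f] Lq_le_nonneg[OF g] by auto
    define w where "w = (\<lambda>s::bool. if s then A' else B')"
    define h where "h = (\<lambda>s x. if s then f x / A' else g x / B')"
    have "Lq_le q (\<lambda>x. \<integral>s. w s * h s x \<partial>count_space UNIV) ((A' + B') * 1)"
    proof (rule Lq_le_integral(1))
      show "sigma_finite_measure (count_space (UNIV :: bool set))"
        by (rule sigma_finite_measure_count_space_finite) simp
      show "integrable (count_space UNIV) w" by (rule integrable_count_space) simp
      show "(\<integral>s. w s \<partial>count_space UNIV) \<le> A' + B'"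
        by (simp add: lebesgue_integral_count_space_finite UNIV_bool w_def)
      show "(\<lambda>(s, x). h s x) \<in> borel_measurable (count_space UNIV \<Otimes>\<^sub>M borel)"
        unfolding h_def by measurable
      show "Lq_le q (h s) 1" for s
        using Lq_le_weaken[OF Lq_le_cmult[OF f, of "1/A'"], of 1] that A' q
          Lq_le_weaken[OF Lq_le_cmult[OF g, of "1/B'"], of 1] by (cases s) (auto simp: h_def)
    qed (use A' q in \<open>auto simp: w_def\<close>)
    moreover have "(\<integral>s. w s * h s x \<partial>count_space UNIV) = f x + g x" for x
      using A' by (simp add: lebesgue_integral_count_space_finite UNIV_bool w_def h_def)
    ultimately show ?thesis by simp
  qed
  show ?thesis
  proof (rule Lq_le_closed)
    fix D assume "A + B < D"
    then show "Lq_le q (\<lambda>x. f x + g x) D"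
      using pos[of "A + (D - A - B) / 2" "B + (D - A - B) / 2"] by (simp add: field_simps)
  qed (use q Lq_le_nonneg[OF f] Lq_le_nonneg[OF g] in auto)
qed

lemma Lq_le_diff:
  "Lq_le q f A \<Longrightarrow> Lq_le q g B \<Longrightarrow> 1 \<le> q \<Longrightarrow> Lq_le q (\<lambda>x. f x - g x) (A + B)"
  using Lq_le_add[OF _ Lq_le_minus, of q f A g B] by simp

lemma Lq_le_1_iff:
  "Lq_le 1 f B \<longleftrightarrow> integrable lborel f \<and> f \<in> borel_measurable borel \<and> (\<integral>x. \<bar>f x\<bar> \<partial>lborel) \<le> B" (is "?l = ?r")
proof
  assume ?l
  then have m: "f \<in> borel_measurable borel" and *: "(\<integral>\<^sup>+x. ennreal \<bar>f x\<bar> \<partial>lborel) \<le> ennreal B" and B: "0 \<le> B"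
    by (auto simp: Lq_le_def)
  have i: "integrable lborel f"
    using m * by (intro integrableI_bounded) (auto intro: le_less_trans)
  then have "(\<integral>\<^sup>+x. ennreal \<bar>f x\<bar> \<partial>lborel) = ennreal (\<integral>x. \<bar>f x\<bar> \<partial>lborel)"
    by (intro nn_integral_eq_integral) auto
  with i m * B show ?r by (simp add: ennreal_le_iff)
next
  assume r: ?r
  then have "(\<integral>\<^sup>+x. ennreal \<bar>f x\<bar> \<partial>lborel) = ennreal (\<integral>x. \<bar>f x\<bar> \<partial>lborel)"
    by (intro nn_integral_eq_integral) auto
  moreover have "0 \<le> (\<integral>x. \<bar>f x\<bar> \<partial>lborel)" by simp
  ultimately show ?l using r order_trans[of 0 "\<integral>x. \<bar>f x\<bar> \<partial>lborel" B]
    by (auto simp: Lq_le_def intro: ennreal_leI)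
qed

lemma Lq_le_imp_Lq:
  assumes "Lq_le q f B" "0 < q"
  shows "f \<in> Lq_space q" "Lq_norm q f \<le> B"
proof -
  have [measurable]: "f \<in> borel_measurable borel" and B: "0 \<le> B" using assms by (auto simp: Lq_le_def)
  have *: "(\<integral>\<^sup>+x. ennreal (\<bar>f x\<bar> powr q) \<partial>lborel) \<le> ennreal (B powr q)" using assms by (auto simp: Lq_le_def)
  have i: "integrable lborel (\<lambda>x. \<bar>f x\<bar> powr q)"
    using * by (intro integrableI_bounded) (auto intro: le_less_trans)
  then show "f \<in> Lq_space q" by (simp add: Lq_space_def)
  have "(\<integral>x. \<bar>f x\<bar> powr q \<partial>lborel) \<le> B powr q"
    using * i by (simp add: nn_integral_eq_integral)
  then have "Lq_norm q f \<le> (B powr q) powr (1/q)"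
    unfolding Lq_norm_def using assms(2) by (intro powr_mono2) auto
  then show "Lq_norm q f \<le> B" using assms B by (simp add: powr_powr)
qed

lemma Lq_le_Lq_norm:
  assumes "f \<in> Lq_space q" "0 < q"
  shows "Lq_le q f (Lq_norm q f)"
proof -
  have i: "integrable lborel (\<lambda>x. \<bar>f x\<bar> powr q)" and [measurable]: "f \<in> borel_measurable borel"
    using assms by (auto simp: Lq_space_def)
  have "(\<integral>\<^sup>+x. ennreal (\<bar>f x\<bar> powr q) \<partial>lborel) = ennreal (\<integral>x. \<bar>f x\<bar> powr q \<partial>lborel)"
    using i by (intro nn_integral_eq_integral) auto
  moreover have "0 \<le> (\<integral>x. \<bar>f x\<bar> powr q \<partial>lborel)" by simp
  ultimately show ?thesis using assms(2) by (simp add: Lq_le_def Lq_norm_def powr_powr)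
qed

lemma Lq_le_0_imp_AE:
  assumes "Lq_le q f 0" "0 < q"
  shows "AE x in lborel. f x = 0"
proof -
  have [measurable]: "f \<in> borel_measurable borel" using assms by (auto simp: Lq_le_def)
  have "(\<integral>\<^sup>+x. ennreal (\<bar>f x\<bar> powr q) \<partial>lborel) = 0" using assms by (auto simp: Lq_le_def)
  then have "AE x in lborel. ennreal (\<bar>f x\<bar> powr q) = 0"
    by (subst (asm) nn_integral_0_iff_AE) auto
  then show ?thesis by eventually_elim (auto simp: ennreal_eq_0_iff)
qed

text \<open>Hoelder interpolation between the exponents \<open>1\<close> and \<open>p\<close>. The relation between the bounds is an
equation for powers, so the interpolation exponent need not be named.\<close>

lemma Lq_le_interpolate:
  assumes f1: "Lq_le 1 f A" and fp: "Lq_le p f B" and p: "1 < p" and q: "1 \<le> q" "q \<le> p"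
    and AB: "0 < A" "0 < B" and R: "R \<ge> 0" "A powr ((p - q) / (p - 1)) * (B powr p) powr ((q - 1) / (p - 1)) = R powr q"
  shows "Lq_le q f R"
proof -
  define a where "a = (p - q) / (p - 1)"
  define b where "b = (q - 1) / (p - 1)"
  have ab: "0 \<le> a" "0 \<le> b" "a + b = 1" "a + b * p = q"
    using p q by (auto simp: a_def b_def add_divide_distrib[symmetric]) (simp add: field_simps)
  have [measurable]: "f \<in> borel_measurable borel" using f1 by (auto simp: Lq_le_def)
  have pt: "\<bar>y\<bar> powr q \<le> R powr q * (a / A * \<bar>y\<bar> + b / B powr p * \<bar>y\<bar> powr p)" for y :: real
  proof (cases "y = 0")
    case False
    have "(\<bar>y\<bar> / A) powr a * (\<bar>y\<bar> powr p / B powr p) powr b \<le> a * (\<bar>y\<bar> / A) + b * (\<bar>y\<bar> powr p / B powr p)"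
      using ab AB False by (intro Youngs_inequality_0) auto
    moreover have "(\<bar>y\<bar> / A) powr a * (\<bar>y\<bar> powr p / B powr p) powr b = \<bar>y\<bar> powr q / R powr q"
      using AB unfolding R(2)[symmetric] a_def[symmetric] b_def[symmetric]
      by (simp add: powr_divide powr_powr powr_add[symmetric] ab(4)[symmetric] mult.commute)
    moreover have "0 < R powr q" unfolding R(2)[symmetric] using AB by simp
    ultimately show ?thesis by (simp add: field_simps)
  qed auto
  have Rq: "0 \<le> R powr q" by simp
  have "(\<integral>\<^sup>+x. ennreal (\<bar>f x\<bar> powr q) \<partial>lborel)
    \<le> (\<integral>\<^sup>+x. ennreal (R powr q) * (ennreal (a / A) * ennreal \<bar>f x\<bar> + ennreal (b / B powr p) * ennreal (\<bar>f x\<bar> powr p)) \<partial>lborel)"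
  proof (rule nn_integral_mono)
    fix x
    have "ennreal (R powr q) * (ennreal (a / A) * ennreal \<bar>f x\<bar> + ennreal (b / B powr p) * ennreal (\<bar>f x\<bar> powr p))
      = ennreal (R powr q * (a / A * \<bar>f x\<bar> + b / B powr p * \<bar>f x\<bar> powr p))"
      using ab(1,2) AB by (simp add: ennreal_mult'[symmetric] ennreal_plus[symmetric] del: ennreal_plus)
    then show "ennreal (\<bar>f x\<bar> powr q) \<le> ennreal (R powr q) * (ennreal (a / A) * ennreal \<bar>f x\<bar> + ennreal (b / B powr p) * ennreal (\<bar>f x\<bar> powr p))"
      using pt[of "f x"] by (simp add: ennreal_leI)
  qed
  also have "\<dots> = ennreal (R powr q) * (ennreal (a / A) * (\<integral>\<^sup>+x. ennreal \<bar>f x\<bar> \<partial>lborel)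
      + ennreal (b / B powr p) * (\<integral>\<^sup>+x. ennreal (\<bar>f x\<bar> powr p) \<partial>lborel))"
    by (simp add: nn_integral_cmult nn_integral_add)
  also have "\<dots> \<le> ennreal (R powr q) * (ennreal (a / A) * ennreal A + ennreal (b / B powr p) * ennreal (B powr p))"
    using Lq_le_nn_integral[OF f1] Lq_le_nn_integral[OF fp] AB
    by (intro mult_left_mono add_mono) auto
  also have "\<dots> = ennreal (R powr q)"
    using ab AB by (simp add: ennreal_mult'[symmetric] ennreal_plus[symmetric] del: ennreal_plus)
  finally show ?thesis using R by (simp add: Lq_le_def)
qed

lemma abs_powr_diff_le:
  fixes u v p :: real
  assumes "1 \<le> p"
  shows "\<bar>\<bar>u\<bar> powr p - \<bar>v\<bar> powr p\<bar> \<le> p * \<bar>u - v\<bar> * (max \<bar>u\<bar> \<bar>v\<bar>) powr (p - 1)"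
proof -
  have *: "\<bar>a\<bar> powr p - \<bar>b\<bar> powr p \<le> p * \<bar>a - b\<bar> * \<bar>a\<bar> powr (p - 1)" if "\<bar>b\<bar> \<le> \<bar>a\<bar>" for a b :: real
  proof (cases "a = 0")
    case False
    have "p * \<bar>a\<bar> powr (p - 1) * \<bar>b\<bar> \<le> \<bar>b\<bar> powr p + (p - 1) * \<bar>a\<bar> powr p"
      using assms False by (intro powr_above_tangent) auto
    moreover have "\<bar>a\<bar> powr p = \<bar>a\<bar> powr (p - 1) * \<bar>a\<bar>" using False by (simp add: powr_diff)
    ultimately have "\<bar>a\<bar> powr p - \<bar>b\<bar> powr p \<le> p * \<bar>a\<bar> powr (p - 1) * (\<bar>a\<bar> - \<bar>b\<bar>)"
      by (simp add: algebra_simps)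
    also have "\<dots> \<le> p * \<bar>a\<bar> powr (p - 1) * \<bar>a - b\<bar>"
      using assms by (intro mult_left_mono) auto
    finally show ?thesis by (simp add: mult_ac)
  qed (use that in auto)
  show ?thesis
  proof (cases "\<bar>v\<bar> \<le> \<bar>u\<bar>")
    case True
    then have "\<bar>v\<bar> powr p \<le> \<bar>u\<bar> powr p" using assms by (intro powr_mono2) auto
    then show ?thesis using *[OF True] True by (simp add: max_def)
  next
    case False
    then have "\<bar>u\<bar> powr p \<le> \<bar>v\<bar> powr p" using assms by (intro powr_mono2) auto
    then show ?thesis using *[of u v] False by (simp add: max_def abs_minus_commute)
  qed
qed

lemma Lq_le_powr:
  "Lq_le p u M \<Longrightarrow> Lq_le 1 (\<lambda>x. \<bar>u x\<bar> powr p) (M powr p)"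
  by (auto simp: Lq_le_def)

text \<open>This is Hoelder's inequality applied to the mean value bound for the power. It makes \<open>u \<mapsto> |u|\<^sup>p\<close>
locally Lipschitz from \<open>L\<^sup>p\<close> to \<open>L\<^sup>1\<close>.\<close>

lemma Lq_le_powr_diff:
  assumes u: "Lq_le p u M" and v: "Lq_le p v M" and uv: "Lq_le p (\<lambda>x. u x - v x) d" and p: "1 < p"
  shows "Lq_le 1 (\<lambda>x. \<bar>u x\<bar> powr p - \<bar>v x\<bar> powr p) (2 * p * M powr (p - 1) * d)"
proof -
  have [measurable]: "u \<in> borel_measurable borel" "v \<in> borel_measurable borel"
    using u v by (auto simp: Lq_le_def)
  (* The argument divides by both bounds, hence is carried out for larger, positive ones. *)
  have pos: "Lq_le 1 (\<lambda>x. \<bar>u x\<bar> powr p - \<bar>v x\<bar> powr p) (2 * p * M' powr (p - 1) * d')"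
    if "M < M'" "d < d'" for M' d'
  proof -
    have pos: "0 < M'" "0 < d'" using that Lq_le_nonneg[OF u] Lq_le_nonneg[OF uv] by auto
    define c where "c = p * d' * M' powr (p - 1)"
    have c: "0 < c" using pos p by (simp add: c_def)
    define e1 where "e1 = 1 / (p * d' powr p)"
    define e2 where "e2 = (p - 1) / (p * M' powr p)"
    have e: "0 \<le> e1" "0 \<le> e2" using p by (auto simp: e1_def e2_def)
    (* Young's inequality at the scales d' and M' takes the place of Hoelder's inequality: the two
       terms have integrals at most 1/p and 2(p-1)/p, with sum at most 2. *)
    have pt: "\<bar>\<bar>y\<bar> powr p - \<bar>z\<bar> powr p\<bar> \<le> c * (e1 * \<bar>y - z\<bar> powr p + e2 * (\<bar>y\<bar> powr p + \<bar>z\<bar> powr p))" for y z :: real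
    proof -
      have mx: "(max \<bar>y\<bar> \<bar>z\<bar>) powr p \<le> \<bar>y\<bar> powr p + \<bar>z\<bar> powr p" by (auto simp: max_def)
      have "\<bar>y - z\<bar> / d' * ((max \<bar>y\<bar> \<bar>z\<bar> / M') powr (p - 1))
        \<le> (\<bar>y - z\<bar> / d') powr p / p + ((max \<bar>y\<bar> \<bar>z\<bar> / M') powr (p - 1)) powr (p / (p - 1)) / (p / (p - 1))"
        using p pos by (intro Youngs_inequality) (auto simp: field_simps)
      also have "((max \<bar>y\<bar> \<bar>z\<bar> / M') powr (p - 1)) powr (p / (p - 1)) = (max \<bar>y\<bar> \<bar>z\<bar> / M') powr p"
        using p by (simp add: powr_powr)
      also have "(\<bar>y - z\<bar> / d') powr p / p + (max \<bar>y\<bar> \<bar>z\<bar> / M') powr p / (p / (p - 1))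
          = e1 * \<bar>y - z\<bar> powr p + e2 * (max \<bar>y\<bar> \<bar>z\<bar>) powr p"
        using p pos by (simp add: e1_def e2_def powr_divide field_simps)
      also have "\<dots> \<le> e1 * \<bar>y - z\<bar> powr p + e2 * (\<bar>y\<bar> powr p + \<bar>z\<bar> powr p)"
        using e mx by (intro add_left_mono mult_left_mono) auto
      finally have "c * (\<bar>y - z\<bar> / d' * ((max \<bar>y\<bar> \<bar>z\<bar> / M') powr (p - 1))) \<le> c * (e1 * \<bar>y - z\<bar> powr p + e2 * (\<bar>y\<bar> powr p + \<bar>z\<bar> powr p))"
        using c by (intro mult_left_mono) auto
      moreover have "c * (\<bar>y - z\<bar> / d' * ((max \<bar>y\<bar> \<bar>z\<bar> / M') powr (p - 1))) = p * \<bar>y - z\<bar> * (max \<bar>y\<bar> \<bar>z\<bar>) powr (p - 1)"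
        using pos by (simp add: c_def powr_divide)
      ultimately show ?thesis using abs_powr_diff_le[of p y z] p by simp
    qed
    have "(\<integral>\<^sup>+x. ennreal (\<bar>\<bar>u x\<bar> powr p - \<bar>v x\<bar> powr p\<bar> powr 1) \<partial>lborel)
      \<le> (\<integral>\<^sup>+x. ennreal c * (ennreal e1 * ennreal (\<bar>u x - v x\<bar> powr p) +
            ennreal e2 * (ennreal (\<bar>u x\<bar> powr p) + ennreal (\<bar>v x\<bar> powr p))) \<partial>lborel)"
    proof (rule nn_integral_mono)
      fix x
      have "ennreal c * (ennreal e1 * ennreal (\<bar>u x - v x\<bar> powr p) +
            ennreal e2 * (ennreal (\<bar>u x\<bar> powr p) + ennreal (\<bar>v x\<bar> powr p)))
        = ennreal (c * (e1 * \<bar>u x - v x\<bar> powr p + e2 * (\<bar>u x\<bar> powr p + \<bar>v x\<bar> powr p)))"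
        using c e by (simp add: ennreal_mult'[symmetric] ennreal_plus[symmetric] del: ennreal_plus)
      then show "ennreal (\<bar>\<bar>u x\<bar> powr p - \<bar>v x\<bar> powr p\<bar> powr 1) \<le> ennreal c * (ennreal e1 * ennreal (\<bar>u x - v x\<bar> powr p) +
            ennreal e2 * (ennreal (\<bar>u x\<bar> powr p) + ennreal (\<bar>v x\<bar> powr p)))"
        using pt[of "u x" "v x"] by (simp add: ennreal_leI)
    qed
    also have "\<dots> = ennreal c * (ennreal e1 * (\<integral>\<^sup>+x. ennreal (\<bar>u x - v x\<bar> powr p) \<partial>lborel) +
            ennreal e2 * ((\<integral>\<^sup>+x. ennreal (\<bar>u x\<bar> powr p) \<partial>lborel) + (\<integral>\<^sup>+x. ennreal (\<bar>v x\<bar> powr p) \<partial>lborel)))"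
      by (simp add: nn_integral_cmult nn_integral_add)
    also have "\<dots> \<le> ennreal c * (ennreal e1 * ennreal (d' powr p) + ennreal e2 * (ennreal (M' powr p) + ennreal (M' powr p)))"
      using Lq_le_nn_integral[OF Lq_le_weaken[OF u, of M']] Lq_le_nn_integral[OF Lq_le_weaken[OF v, of M']]
        Lq_le_nn_integral[OF Lq_le_weaken[OF uv, of d']] that p
      by (intro mult_left_mono add_mono) auto
    also have "\<dots> = ennreal (c * (e1 * d' powr p + e2 * (2 * M' powr p)))"
      using c e by (simp add: ennreal_mult'[symmetric] ennreal_plus[symmetric] del: ennreal_plus)
    also have "\<dots> \<le> ennreal (c * 2)"
    proof (intro ennreal_leI mult_left_mono)
      have "e1 * d' powr p + e2 * (2 * M' powr p) = 1 / p + 2 * (p - 1) / p"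
        using p pos by (simp add: e1_def e2_def)
      also have "\<dots> \<le> 2" using p by (simp add: field_simps)
      finally show "e1 * d' powr p + e2 * (2 * M' powr p) \<le> 2" .
    qed (use c in auto)
    finally show ?thesis using c p pos by (simp add: Lq_le_def c_def mult_ac)
  qed
  show ?thesis
  proof -
    have "((\<lambda>e. 2 * p * (M + e) powr (p - 1) * (d + e)) \<longlongrightarrow> 2 * p * (M + 0) powr (p - 1) * (d + 0)) (at_right 0)"
      using p Lq_le_nonneg[OF u] by (intro tendsto_powr' tendsto_intros)
        (auto simp: eventually_at_right_field intro!: exI[of _ 1])
    then have lim: "((\<lambda>e. ennreal (2 * p * (M + e) powr (p - 1) * (d + e))) \<longlongrightarrow> ennreal (2 * p * M powr (p - 1) * d)) (at_right 0)"
      by (intro tendsto_ennrealI) simp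
    have "(\<integral>\<^sup>+x. ennreal \<bar>\<bar>u x\<bar> powr p - \<bar>v x\<bar> powr p\<bar> \<partial>lborel) \<le> ennreal (2 * p * M powr (p - 1) * d)"
    proof (rule tendsto_lowerbound[OF lim])
      show "\<forall>\<^sub>F e in at_right 0. (\<integral>\<^sup>+x. ennreal \<bar>\<bar>u x\<bar> powr p - \<bar>v x\<bar> powr p\<bar> \<partial>lborel) \<le> ennreal (2 * p * (M + e) powr (p - 1) * (d + e))"
        unfolding eventually_at_right_field
      proof (intro exI[of _ 1] conjI allI impI)
        fix e :: real assume "0 < e"
        then have "Lq_le 1 (\<lambda>x. \<bar>u x\<bar> powr p - \<bar>v x\<bar> powr p) (2 * p * (M + e) powr (p - 1) * (d + e))"
          by (intro pos) auto
        from Lq_le_nn_integral[OF this] Lq_le_nonneg[OF this]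
        show "(\<integral>\<^sup>+x. ennreal \<bar>\<bar>u x\<bar> powr p - \<bar>v x\<bar> powr p\<bar> \<partial>lborel) \<le> ennreal (2 * p * (M + e) powr (p - 1) * (d + e))"
          by (simp only: powr_one abs_ge_zero abs_abs)
      qed simp
    qed simp
    then show ?thesis using Lq_le_nonneg[OF u] Lq_le_nonneg[OF uv] p by (simp add: Lq_le_def)
  qed
qed

section \<open>Convolution, dilation and continuity in \<open>L\<^sup>q\<close>\<close>

lemma nn_integral_lborel_affine:
  fixes f :: "'a::euclidean_space \<Rightarrow> ennreal"
  assumes [measurable]: "f \<in> borel_measurable borel" and c: "c \<noteq> 0"
  shows "(\<integral>\<^sup>+x. f x \<partial>lborel) = ennreal (\<bar>c\<bar> ^ DIM('a)) * (\<integral>\<^sup>+x. f (t + c *\<^sub>R x) \<partial>lborel)"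
  by (subst lborel_affine[OF c, of t])
     (simp add: nn_integral_density nn_integral_distr nn_integral_cmult)

lemma integrable_lborel_affine:
  fixes f :: "'a::euclidean_space \<Rightarrow> 'b::{banach, second_countable_topology}"
  assumes f: "integrable lborel f" and c: "c \<noteq> 0"
  shows "integrable lborel (\<lambda>x. f (t + c *\<^sub>R x))"
proof -
  have [measurable]: "f \<in> borel_measurable borel" using f by auto
  have "ennreal (\<bar>c\<bar> ^ DIM('a)) * (\<integral>\<^sup>+x. norm (f (t + c *\<^sub>R x)) \<partial>lborel) < \<infinity>"
    using f by (subst nn_integral_lborel_affine[symmetric]) (auto simp: c integrable_iff_bounded)
  then have "(\<integral>\<^sup>+x. norm (f (t + c *\<^sub>R x)) \<partial>lborel) < \<infinity>"
    using c by (auto simp: ennreal_mult_less_top)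
  then show ?thesis by (intro integrableI_bounded) auto
qed

lemma integral_lborel_affine:
  fixes f :: "'a::euclidean_space \<Rightarrow> 'b::{banach, second_countable_topology}"
  assumes c: "c \<noteq> 0"
  shows "(\<integral>x. f x \<partial>lborel) = \<bar>c\<bar> ^ DIM('a) *\<^sub>R (\<integral>x. f (t + c *\<^sub>R x) \<partial>lborel)"
proof cases
  assume f: "integrable lborel f"
  then have [measurable]: "f \<in> borel_measurable borel" by auto
  show ?thesis
    using integrable_lborel_affine[OF f c, of t] c
    by (subst lborel_affine[OF c, of t]) (simp add: integral_density integral_distr)
next
  assume n: "\<not> integrable lborel f"
  have "\<not> integrable lborel (\<lambda>x. f (t + c *\<^sub>R x))"
  proof
    assume "integrable lborel (\<lambda>x. f (t + c *\<^sub>R x))"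
    from integrable_lborel_affine[OF this, of "1/c" "- (1/c) *\<^sub>R t"] n show False
      using c by (simp add: scaleR_diff_right)
  qed
  with n show ?thesis by (simp add: not_integrable_integral_eq)
qed

lemma AE_lborel_affine:
  fixes P :: "'a::euclidean_space \<Rightarrow> bool"
  assumes "AE x in lborel. P x" "c \<noteq> 0"
  shows "AE x in lborel. P (t + c *\<^sub>R x)"
proof -
  obtain N where N: "N \<in> null_sets lborel" "{x. \<not> P x} \<subseteq> N"
    using assms(1) by (auto simp: eventually_ae_filter)
  then have [measurable]: "N \<in> sets borel" by auto
  have [measurable]: "(\<lambda>x. t + c *\<^sub>R x) \<in> borel_measurable borel" by measurable
  have "(\<integral>\<^sup>+x. indicator N x \<partial>lborel) = ennreal (\<bar>c\<bar> ^ DIM('a)) * (\<integral>\<^sup>+x. indicator N (t + c *\<^sub>R x) \<partial>lborel)"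
    by (rule nn_integral_lborel_affine) (auto simp: assms)
  moreover have "(\<integral>\<^sup>+x. indicator N x \<partial>lborel) = 0" using N by auto
  ultimately have "(\<integral>\<^sup>+x. indicator N (t + c *\<^sub>R x) \<partial>lborel) = 0" using assms(2) by simp
  then have "AE x in lborel. (indicator N (t + c *\<^sub>R x) :: ennreal) = 0"
    by (subst (asm) nn_integral_0_iff_AE) auto
  then show ?thesis
    by (rule eventually_mono) (use N(2) in \<open>auto simp: indicator_def split: if_splits\<close>)
qed

lemma AE_lborel_reflect:
  fixes P :: "'a::euclidean_space \<Rightarrow> bool"
  shows "AE y in lborel. P y \<Longrightarrow> AE y in lborel. P (x - y)"
  using AE_lborel_affine[of P "-1" x] by simp

lemma Lq_le_shift:
  fixes f :: "'a::euclidean_space \<Rightarrow> real"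
  assumes "Lq_le q f B"
  shows "Lq_le q (\<lambda>x. f (x - h)) B"
proof -
  note [measurable] = Lq_le_measurable[OF assms]
  have "(\<integral>\<^sup>+x. ennreal (\<bar>f x\<bar> powr q) \<partial>lborel) = (\<integral>\<^sup>+x. ennreal (\<bar>f (x - h)\<bar> powr q) \<partial>lborel)"
    by (subst nn_integral_lborel_affine[of _ 1 "-h"]) auto
  then show ?thesis using assms by (simp add: Lq_le_def)
qed

lemma convol_commute: "convol g f x = convol f g x"
  unfolding convol_def
  by (subst integral_lborel_affine[of "-1" _ x]) (simp_all add: mult.commute)

lemma convol_cong_AE_left:
  assumes [measurable]: "g \<in> borel_measurable borel" "g' \<in> borel_measurable borel" "f \<in> borel_measurable borel"
    and "AE y in lborel. g y = g' y"
  shows "convol g f x = convol g' f x"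
  unfolding convol_def
  using AE_lborel_reflect[OF assms(4), of x] by (intro integral_cong_AE) (auto elim: eventually_mono)

lemma convol_cong_AE_right:
  assumes [measurable]: "g \<in> borel_measurable borel" "f \<in> borel_measurable borel" "f' \<in> borel_measurable borel"
    and "AE y in lborel. f y = f' y"
  shows "convol g f x = convol g f' x"
  unfolding convol_def
  using assms(4) by (intro integral_cong_AE) (auto elim: eventually_mono)

text \<open>Young's inequality for an integrable factor, which serves as the weight in Minkowski's integral inequality.\<close>

lemma Lq_le_convol:
  assumes f: "Lq_le 1 f A" and g: "Lq_le q g B" and q: "1 \<le> q"
  shows "Lq_le q (convol g f) (A * B)" "Lq_le q (convol f g) (A * B)"
    and "AE x in lborel. integrable lborel (\<lambda>y. g (x - y) * f y)"
proof -
  note [measurable] = Lq_le_measurable[OF f] Lq_le_measurable[OF g]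
  have f': "integrable lborel f" "(\<integral>x. \<bar>f x\<bar> \<partial>lborel) \<le> A" using f by (auto simp: Lq_le_1_iff)
  have hm: "(\<lambda>(y, x). sgn (f y) * g (x - y)) \<in> borel_measurable (lborel \<Otimes>\<^sub>M borel)"
    by measurable
  have h: "Lq_le q (\<lambda>x. sgn (f y) * g (x - y)) B" for y
    using Lq_le_weaken[OF Lq_le_cmult[OF Lq_le_shift[OF g, of y], of "sgn (f y)"], of B] q Lq_le_nonneg[OF g]
    by (auto simp: sgn_real_def split: if_splits)
  have sg: "\<bar>a\<bar> * (sgn a * b) = b * a" for a b :: real by (simp add: sgn_real_def)
  have "Lq_le q (\<lambda>x. \<integral>y. \<bar>f y\<bar> * (sgn (f y) * g (x - y)) \<partial>lborel) (A * B)"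
    using f' Lq_le_nonneg[OF g]
    by (intro Lq_le_integral(1)[where M=lborel, OF sigma_finite_lborel _ _ _ hm] h q) auto
  then show r: "Lq_le q (convol g f) (A * B)" by (simp add: sg convol_def[abs_def])
  then show "Lq_le q (convol f g) (A * B)" by (simp add: convol_commute[of f g, abs_def])
  have "AE x in lborel. integrable lborel (\<lambda>y. \<bar>f y\<bar> * (sgn (f y) * g (x - y)))"
    using f' Lq_le_nonneg[OF g]
    by (intro Lq_le_integral(2)[where M=lborel and B=A and C=B and q=q, OF sigma_finite_lborel _ _ _ hm] h q) auto
  then show "AE x in lborel. integrable lborel (\<lambda>y. g (x - y) * f y)" by (simp add: sg)
qed

text \<open>Dominated convergence in \<open>L\<^sup>q\<close>.\<close>

lemma eventually_Lq_le_dominated: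
  fixes u :: "nat \<Rightarrow> 'a::euclidean_space \<Rightarrow> real"
  assumes u[measurable]: "\<And>n. u n \<in> borel_measurable borel"
    and lim: "AE x in lborel. (\<lambda>n. u n x) \<longlonglongrightarrow> 0"
    and dom: "\<And>n. AE x in lborel. \<bar>u n x\<bar> \<le> b x"
    and b: "integrable lborel (\<lambda>x. \<bar>b x\<bar> powr q)" and q: "0 < q" and e: "0 < e"
  shows "\<forall>\<^sub>F n in sequentially. Lq_le q (u n) e"
proof -
  have "(\<lambda>n. \<integral>x. \<bar>u n x\<bar> powr q \<partial>lborel) \<longlonglongrightarrow> (\<integral>x. 0 \<partial>(lborel::'a measure))"
  proof (rule integral_dominated_convergence)
    show "AE x in lborel. (\<lambda>n. \<bar>u n x\<bar> powr q) \<longlonglongrightarrow> 0"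
      using lim
    proof eventually_elim
      case (elim x)
      have "(\<lambda>n. \<bar>u n x\<bar> powr q) \<longlonglongrightarrow> \<bar>0\<bar> powr q"
        using q elim by (intro tendsto_powr' tendsto_intros) auto
      then show ?case using q by simp
    qed
    show "AE x in lborel. norm (\<bar>u n x\<bar> powr q) \<le> \<bar>b x\<bar> powr q" for n
      using dom[of n] by eventually_elim (use q in \<open>auto intro!: powr_mono2\<close>)
  qed (use b in auto)
  then have "\<forall>\<^sub>F n in sequentially. (\<integral>x. \<bar>u n x\<bar> powr q \<partial>lborel) < e powr q"
    using e by (intro order_tendstoD(2)) auto
  then show ?thesis
  proof eventually_elim
    case (elim n)
    have i: "integrable lborel (\<lambda>x. \<bar>u n x\<bar> powr q)"
      using b by (rule Bochner_Integration.integrable_bound)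
        (use dom[of n] q in \<open>auto elim!: eventually_mono intro!: powr_mono2\<close>)
    then have "(\<integral>\<^sup>+x. ennreal (\<bar>u n x\<bar> powr q) \<partial>lborel) = ennreal (\<integral>x. \<bar>u n x\<bar> powr q \<partial>lborel)"
      by (intro nn_integral_eq_integral) auto
    then show ?case using elim e by (auto simp: Lq_le_def intro!: ennreal_leI)
  qed
qed

lemma integrable_indicator_cball:
  fixes c R q :: real
  shows "integrable lborel (\<lambda>x::'a::euclidean_space. \<bar>c * indicator (cball 0 R) x\<bar> powr q)"
proof -
  have "integrable lborel (indicator (cball 0 R) :: 'a \<Rightarrow> real)"
    by (rule integrable_real_indicator) (use emeasure_lborel_cball_finite[of "0::'a" R] in \<open>auto simp: less_top\<close>)
  then have "integrable lborel (\<lambda>x::'a. \<bar>c\<bar> powr q * indicator (cball 0 R) x)"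
    by (intro integrable_mult_right) auto
  moreover have "\<bar>c * indicator (cball 0 R) x\<bar> powr q = \<bar>c\<bar> powr q * indicator (cball 0 R) x" for x :: 'a
    by (auto simp: indicator_def)
  ultimately show ?thesis by simp
qed

text \<open>A measurable function is almost everywhere the limit of continuous functions. Clipping the values and multiplying by a
cut-off, for \<open>f\<close> and the approximations alike, makes the convergence dominated.\<close>

lemma Lq_approx_continuous:
  fixes f :: "'a::euclidean_space \<Rightarrow> real"
  assumes f: "Lq_le q f B" and q: "1 \<le> q" and e: "0 < e"
  obtains g R where "continuous_on UNIV g" "\<And>x. norm x > R \<Longrightarrow> g x = 0" "Lq_le q (\<lambda>x. f x - g x) e"
proof -
  note [measurable] = Lq_le_measurable[OF f]
  have fi: "integrable lborel (\<lambda>x. \<bar>f x\<bar> powr q)"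
    using Lq_le_imp_Lq(1)[OF f] q by (auto simp: Lq_space_def)
  define ct where "ct = (\<lambda>m (x::'a). max 0 (min 1 (real m + 1 - norm x)))"
  define cl where "cl = (\<lambda>m y. max (- real m) (min (real m) y))"
  have ct: "0 \<le> ct m x" "ct m x \<le> 1" "norm x > real m + 1 \<Longrightarrow> ct m x = 0" for m x by (auto simp: ct_def)
  have cl: "\<bar>cl m y\<bar> \<le> real m" "\<bar>cl m y\<bar> \<le> \<bar>y\<bar>" "\<bar>y - cl m y\<bar> \<le> \<bar>y\<bar>" for m y by (auto simp: cl_def)
  have [measurable]: "ct m \<in> borel_measurable borel" "cl m \<in> borel_measurable borel" for m
    unfolding ct_def cl_def by measurable
  have "\<forall>\<^sub>F m in sequentially. Lq_le q (\<lambda>x. f x - ct m x * cl m (f x)) (e/2)"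
  proof (rule eventually_Lq_le_dominated)
    show "AE x in lborel. (\<lambda>m. f x - ct m x * cl m (f x)) \<longlonglongrightarrow> 0"
    proof (rule AE_I2)
      fix x
      obtain N :: nat where N: "norm x + \<bar>f x\<bar> \<le> real N" using real_arch_simple by blast
      have "f x - ct m x * cl m (f x) = 0" if "m \<ge> N" for m
      proof -
        have "norm x + \<bar>f x\<bar> \<le> real m" using N that by linarith
        then have "ct m x = 1" "\<bar>f x\<bar> \<le> real m" using norm_ge_zero[of x] abs_ge_zero[of "f x"]
          unfolding ct_def by linarith+
        then show ?thesis unfolding cl_def by (simp add: abs_le_iff max_def min_def)
      qed
      then show "(\<lambda>m. f x - ct m x * cl m (f x)) \<longlonglongrightarrow> 0"
        by (intro tendsto_eventually) (auto simp: eventually_sequentially)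
    qed
    show "AE x in lborel. \<bar>f x - ct m x * cl m (f x)\<bar> \<le> 2 * \<bar>f x\<bar>" for m
    proof (rule AE_I2)
      fix x
      have "\<bar>ct m x * cl m (f x)\<bar> \<le> 1 * \<bar>f x\<bar>"
        unfolding abs_mult using ct(1,2)[of m x] cl(2)[of m "f x"] by (intro mult_mono) auto
      then show "\<bar>f x - ct m x * cl m (f x)\<bar> \<le> 2 * \<bar>f x\<bar>" by linarith
    qed
    have "(\<lambda>x. \<bar>2 * \<bar>f x\<bar>\<bar> powr q) = (\<lambda>x. 2 powr q * \<bar>f x\<bar> powr q)"
      by (simp add: abs_mult powr_mult)
    then show "integrable lborel (\<lambda>x. \<bar>2 * \<bar>f x\<bar>\<bar> powr q)" using fi by simp
  qed (use q e in auto)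
  then obtain m where m: "Lq_le q (\<lambda>x. f x - ct m x * cl m (f x)) (e/2)"
    by (auto simp: eventually_sequentially)
  have "f \<in> borel_measurable lebesgue"
    by (intro measurable_completion) simp
  then have "f measurable_on UNIV"
    by (rule lebesgue_measurable_imp_measurable_on) simp
  then obtain N h where h: "negligible N" "\<And>n. continuous_on UNIV (h n)"
     "\<And>x. x \<notin> N \<Longrightarrow> (\<lambda>n. h n x) \<longlonglongrightarrow> f x"
    unfolding measurable_on_def by auto
  have [measurable]: "h n \<in> borel_measurable borel" for n
    using h(2) by (rule borel_measurable_continuous_onI)
  have "AE x in lebesgue. (\<lambda>n. h n x) \<longlonglongrightarrow> f x"
    using h(1,3) by (intro AE_I'[of N]) (auto simp: negligible_iff_null_sets)
  then have hf: "AE x in lborel. (\<lambda>n. h n x) \<longlonglongrightarrow> f x"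
    using AE_completion_iff[of _ lborel] by blast
  have "\<forall>\<^sub>F n in sequentially. Lq_le q (\<lambda>x. ct m x * cl m (f x) - ct m x * cl m (h n x)) (e/2)"
  proof (rule eventually_Lq_le_dominated)
    show "AE x in lborel. (\<lambda>n. ct m x * cl m (f x) - ct m x * cl m (h n x)) \<longlonglongrightarrow> 0"
      using hf
    proof eventually_elim
      case (elim x)
      then have "(\<lambda>n. ct m x * cl m (f x) - ct m x * cl m (h n x)) \<longlonglongrightarrow> ct m x * cl m (f x) - ct m x * cl m (f x)"
        unfolding cl_def by (intro tendsto_intros) auto
      then show ?case by simp
    qed
    show "AE x in lborel. \<bar>ct m x * cl m (f x) - ct m x * cl m (h n x)\<bar> \<le> (2 * real m) * indicator (cball 0 (real m + 1)) x" for n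
    proof (rule AE_I2)
      fix x
      show "\<bar>ct m x * cl m (f x) - ct m x * cl m (h n x)\<bar> \<le> (2 * real m) * indicator (cball 0 (real m + 1)) x"
      proof (cases "norm x > real m + 1")
        case False
        have "\<bar>ct m x\<bar> * \<bar>cl m (f x) - cl m (h n x)\<bar> \<le> 1 * (2 * real m)"
          using ct(1,2)[of m x] cl(1)[of m "f x"] cl(1)[of m "h n x"] by (intro mult_mono) auto
        then show ?thesis using False by (simp add: right_diff_distrib[symmetric] abs_mult)
      qed (simp add: ct)
    qed
    show "integrable lborel (\<lambda>x::'a. \<bar>(2 * real m) * indicator (cball 0 (real m + 1)) x\<bar> powr q)"
      by (rule integrable_indicator_cball)
  qed (use q e in auto)
  then obtain n where n: "Lq_le q (\<lambda>x. ct m x * cl m (f x) - ct m x * cl m (h n x)) (e/2)"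
    by (auto simp: eventually_sequentially)
  show thesis
  proof (rule that[of "\<lambda>x. ct m x * cl m (h n x)" "real m + 1"])
    show "continuous_on UNIV (\<lambda>x. ct m x * cl m (h n x))"
      unfolding ct_def cl_def by (intro continuous_intros continuous_on_max continuous_on_min h(2))
    show "Lq_le q (\<lambda>x. f x - ct m x * cl m (h n x)) e"
      using Lq_le_add[OF m n q] by simp
  qed (simp add: ct)
qed

text \<open>Translation is an isometry, so it suffices to treat the continuous functions of compact support, which are uniformly
continuous.\<close>

lemma Lq_translation_continuous:
  fixes f :: "'a::euclidean_space \<Rightarrow> real"
  assumes f: "Lq_le q f B" and q: "1 \<le> q" and e: "0 < e"
  shows "\<exists>\<delta>>0. \<forall>h. norm h < \<delta> \<longrightarrow> Lq_le q (\<lambda>x. f (x - h) - f x) e"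
proof (rule ccontr)
  assume neg: "\<not> ?thesis"
  have "\<forall>k. \<exists>h. norm h < 1 / (real k + 1) \<and> \<not> Lq_le q (\<lambda>x. f (x - h) - f x) e"
  proof
    fix k :: nat
    have "0 < 1 / (real k + 1)" by simp
    then show "\<exists>h. norm h < 1 / (real k + 1) \<and> \<not> Lq_le q (\<lambda>x. f (x - h) - f x) e" using neg by blast
  qed
  then obtain h where h: "\<And>k. norm (h k) < 1 / (real k + 1)" "\<And>k. \<not> Lq_le q (\<lambda>x. f (x - h k) - f x) e"
    by metis
  obtain g R where g: "continuous_on UNIV g" "\<And>x. norm x > R \<Longrightarrow> g x = 0" "Lq_le q (\<lambda>x. f x - g x) (e/3)"
    using Lq_approx_continuous[OF f q, of "e/3"] e by auto
  have [measurable]: "g \<in> borel_measurable borel"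
    using g(1) by (rule borel_measurable_continuous_onI)
  have h0: "h \<longlonglongrightarrow> 0"
  proof (rule Lim_null_comparison)
    show "\<forall>\<^sub>F k in sequentially. norm (h k) \<le> 1 / (real k + 1)" using h(1) by (intro always_eventually allI less_imp_le)
    show "(\<lambda>k. 1 / (real k + 1)) \<longlonglongrightarrow> 0" by real_asymp
  qed
  have "compact (g ` cball 0 R)"
    using g(1) by (intro compact_continuous_image continuous_on_subset[OF g(1)]) auto
  then obtain M where "\<forall>y\<in>g ` cball 0 R. norm y \<le> M" by (meson bounded_iff compact_imp_bounded)
  then have M: "\<bar>g x\<bar> \<le> \<bar>M\<bar>" for x
  proof (cases "norm x \<le> R")
    case True
    then have "\<bar>g x\<bar> \<le> M" using \<open>\<forall>y\<in>g ` cball 0 R. norm y \<le> M\<close> by simp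
    then show ?thesis by linarith
  qed (use g(2)[of x] in simp)
  have "\<forall>\<^sub>F k in sequentially. Lq_le q (\<lambda>x. g (x - h k) - g x) (e/3)"
  proof (rule eventually_Lq_le_dominated)
    show "AE x in lborel. (\<lambda>k. g (x - h k) - g x) \<longlonglongrightarrow> 0"
    proof (rule AE_I2)
      fix x
      have "isCont g x" using g(1) by (simp add: continuous_on_eq_continuous_at)
      moreover have "(\<lambda>k. x - h k) \<longlonglongrightarrow> x" using tendsto_diff[OF tendsto_const h0, of x] by simp
      ultimately have "(\<lambda>k. g (x - h k)) \<longlonglongrightarrow> g x" by (rule isCont_tendsto_compose)
      then show "(\<lambda>k. g (x - h k) - g x) \<longlonglongrightarrow> 0" by (simp add: LIM_zero)
    qed
    show "AE x in lborel. \<bar>g (x - h k) - g x\<bar> \<le> (2 * \<bar>M\<bar>) * indicator (cball 0 (R + 1)) x" for k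
    proof (rule AE_I2)
      fix x
      have hk: "norm (h k) \<le> 1" using h(1)[of k] by (rule order_trans[OF less_imp_le]) simp
      show "\<bar>g (x - h k) - g x\<bar> \<le> (2 * \<bar>M\<bar>) * indicator (cball 0 (R + 1)) x"
      proof (cases "norm x \<le> R + 1")
        case True
        then show ?thesis using M[of x] M[of "x - h k"] by auto
      next
        case False
        then have "norm (x - h k) > R" using norm_triangle_ineq2[of x "h k"] hk by linarith
        then show ?thesis using False g(2) by simp
      qed
    qed
    show "integrable lborel (\<lambda>x::'a. \<bar>(2 * \<bar>M\<bar>) * indicator (cball 0 (R + 1)) x\<bar> powr q)"
      by (rule integrable_indicator_cball)
  qed (use q e in auto)
  then obtain k where k: "Lq_le q (\<lambda>x. g (x - h k) - g x) (e/3)" by (auto simp: eventually_sequentially)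
  have "Lq_le q (\<lambda>x. (f (x - h k) - g (x - h k)) + (g (x - h k) - g x)) (e/3 + e/3)"
    by (rule Lq_le_add[OF Lq_le_shift[OF g(3)] k q])
  from Lq_le_diff[OF this g(3) q] have "Lq_le q (\<lambda>x. f (x - h k) - f x) e" by simp
  with h(2) show False by blast
qed

lemma integral_tail_small:
  fixes g :: "'a::euclidean_space \<Rightarrow> real"
  assumes g: "integrable lborel g" and e: "0 < e"
  shows "\<exists>R>0. (\<integral>y. \<bar>g y\<bar> * indicator (- cball 0 R) y \<partial>lborel) < e"
proof -
  have [measurable]: "g \<in> borel_measurable borel" using g by auto
  have "(\<lambda>k::nat. \<integral>y. \<bar>g y\<bar> * indicator (- cball 0 (real k)) y \<partial>lborel) \<longlonglongrightarrow> (\<integral>y. 0 \<partial>(lborel :: 'a measure))"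
  proof (rule integral_dominated_convergence[where w="\<lambda>y. \<bar>g y\<bar>"])
    show "AE y in lborel. (\<lambda>k. \<bar>g y\<bar> * indicator (- cball 0 (real k)) y) \<longlonglongrightarrow> 0"
    proof (rule AE_I2)
      fix y :: 'a
      obtain N :: nat where N: "norm y \<le> real N" using real_arch_simple by blast
      show "(\<lambda>k. \<bar>g y\<bar> * indicator (- cball 0 (real k)) y) \<longlonglongrightarrow> 0"
        by (intro tendsto_eventually) (use N in \<open>auto simp: eventually_sequentially indicator_def intro!: exI[of _ N]\<close>)
    qed
  qed (use g in \<open>auto simp: indicator_def\<close>)
  then have "\<forall>\<^sub>F k in sequentially. (\<integral>y. \<bar>g y\<bar> * indicator (- cball 0 (real k)) y \<partial>lborel) < e"
    using e by (intro order_tendstoD(2)) auto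
  then obtain N where "\<And>k. k \<ge> N \<Longrightarrow> (\<integral>y. \<bar>g y\<bar> * indicator (- cball 0 (real k)) y \<partial>lborel) < e"
    by (auto simp: eventually_sequentially)
  from this[of "Suc N"] show ?thesis by (intro exI[of _ "real (Suc N)"]) auto
qed

text \<open>Convolution with a dilated kernel, written so that the dilation parameter acts on \<open>f\<close>. A self-similar kernel
turns into this form, in which time zero is no longer singular.\<close>

definition dilconv :: "('a::euclidean_space \<Rightarrow> real) \<Rightarrow> real \<Rightarrow> ('a \<Rightarrow> real) \<Rightarrow> 'a \<Rightarrow> real" where
  "dilconv g a f x = (\<integral>y. g y * f (x - a *\<^sub>R y) \<partial>lborel)"

lemma
  assumes g: "Lq_le 1 g A" and f: "Lq_le q f B" and q: "1 \<le> q"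
  shows Lq_le_dilconv: "Lq_le q (dilconv g a f) (A * B)"
    and AE_integrable_dilconv: "AE x in lborel. integrable lborel (\<lambda>y. g y * f (x - a *\<^sub>R y))"
proof -
  note [measurable] = Lq_le_measurable[OF f] Lq_le_measurable[OF g]
  have g': "integrable lborel g" "(\<integral>x. \<bar>g x\<bar> \<partial>lborel) \<le> A" using g by (auto simp: Lq_le_1_iff)
  have hm: "(\<lambda>(y, x). sgn (g y) * f (x - a *\<^sub>R y)) \<in> borel_measurable (lborel \<Otimes>\<^sub>M borel)"
    by measurable
  have h: "Lq_le q (\<lambda>x. sgn (g y) * f (x - a *\<^sub>R y)) B" for y
    using Lq_le_weaken[OF Lq_le_cmult[OF Lq_le_shift[OF f, of "a *\<^sub>R y"], of "sgn (g y)"], of B] q Lq_le_nonneg[OF f]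
    by (auto simp: sgn_real_def split: if_splits)
  have sg: "\<bar>c\<bar> * (sgn c * b) = c * b" for c b :: real by (simp add: sgn_real_def)
  have "Lq_le q (\<lambda>x. \<integral>y. \<bar>g y\<bar> * (sgn (g y) * f (x - a *\<^sub>R y)) \<partial>lborel) (A * B)"
    using g' Lq_le_nonneg[OF f]
    by (intro Lq_le_integral(1)[where M=lborel, OF sigma_finite_lborel _ _ _ hm] h q) auto
  then show r: "Lq_le q (dilconv g a f) (A * B)" by (simp add: sg dilconv_def[abs_def])
  have "AE x in lborel. integrable lborel (\<lambda>y. \<bar>g y\<bar> * (sgn (g y) * f (x - a *\<^sub>R y)))"
    using g' Lq_le_nonneg[OF f]
    by (intro Lq_le_integral(2)[where M=lborel and B=A and C=B and q=q, OF sigma_finite_lborel _ _ _ hm] h q) auto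
  then show "AE x in lborel. integrable lborel (\<lambda>y. g y * f (x - a *\<^sub>R y))" by (simp add: sg)
qed

lemma dilconv_0: "dilconv g 0 f x = (\<integral>y. g y \<partial>lborel) * f x"
  by (simp add: dilconv_def)

text \<open>The difference is an average, with weight \<open>g\<close>, of differences of translates of \<open>f\<close>. On a large ball the
translates are close to each other; outside the ball little of the mass of \<open>g\<close> is left. The case
\<open>a0 = 0\<close> says that dilates of \<open>g\<close> form an approximate identity.\<close>

lemma dilconv_continuous:
  fixes g f :: "'a::euclidean_space \<Rightarrow> real"
  assumes g: "Lq_le 1 g A" and f: "Lq_le q f B" and q: "1 \<le> q" and e: "0 < e"
  shows "\<exists>\<delta>>0. \<forall>a. \<bar>a - a0\<bar> < \<delta> \<longrightarrow> Lq_le q (\<lambda>x. dilconv g a f x - dilconv g a0 f x) e"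
proof -
  note [measurable] = Lq_le_measurable[OF f] Lq_le_measurable[OF g]
  have g': "integrable lborel g" "(\<integral>x. \<bar>g x\<bar> \<partial>lborel) \<le> A" using g by (auto simp: Lq_le_1_iff)
  have AB: "0 \<le> A" "0 \<le> B" using Lq_le_nonneg f g by auto
  define e1 where "e1 = e / (4 * (B + 1))"
  define e2 where "e2 = e / (2 * (A + 1))"
  have e12: "0 < e1" "0 < e2" using e AB by (auto simp: e1_def e2_def)
  obtain R where R: "R > 0" "(\<integral>y. \<bar>g y\<bar> * indicator (- cball 0 R) y \<partial>lborel) < e1"
    using integral_tail_small[OF g'(1) e12(1)] by blast
  obtain d where d: "d > 0" "\<And>h. norm h < d \<Longrightarrow> Lq_le q (\<lambda>x. f (x - h) - f x) e2"
    using Lq_translation_continuous[OF f q e12(2)] by blast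
  show ?thesis
  proof (intro exI[of _ "d / R"] conjI allI impI)
    fix a assume a: "\<bar>a - a0\<bar> < d / R"
    (* w2 y bounds the norm of the difference of the two translates by a*y and a0*y. Dividing h by w2
       makes its norm at most 1, so the weight w carries the whole estimate. *)
    define w2 where "w2 = (\<lambda>y::'a. if norm y \<le> R then e2 else 2 * (B + 1))"
    have w2: "0 < w2 y" for y using e12 AB by (simp add: w2_def)
    have [measurable]: "w2 \<in> borel_measurable borel" unfolding w2_def by measurable
    define w where "w = (\<lambda>y. \<bar>g y\<bar> * w2 y)"
    define h where "h = (\<lambda>y x. sgn (g y) * (f (x - a *\<^sub>R y) - f (x - a0 *\<^sub>R y)) / w2 y)"
    have hm: "(\<lambda>(y, x). h y x) \<in> borel_measurable (lborel \<Otimes>\<^sub>M borel)"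
      unfolding h_def by measurable
    have d1: "Lq_le q (\<lambda>x. f (x - a *\<^sub>R y) - f (x - a0 *\<^sub>R y)) (w2 y)" for y
    proof (cases "norm y \<le> R")
      case True
      have "norm ((a - a0) *\<^sub>R y) < d"
      proof (cases "y = 0")
        case False
        have "\<bar>a - a0\<bar> * norm y \<le> \<bar>a - a0\<bar> * R" using True by (intro mult_left_mono) auto
        also have "\<dots> < d" using a R by (simp add: field_simps)
        finally show ?thesis by simp
      qed (use d in simp)
      from Lq_le_shift[OF d(2)[OF this], of "a0 *\<^sub>R y"] True show ?thesis
        by (simp add: w2_def algebra_simps)
    next
      case False
      have "Lq_le q (\<lambda>x. f (x - a *\<^sub>R y) - f (x - a0 *\<^sub>R y)) (B + B)"
        by (intro Lq_le_diff Lq_le_shift f q)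
      then show ?thesis by (rule Lq_le_weaken) (use False q in \<open>auto simp: w2_def\<close>)
    qed
    have h1: "Lq_le q (h y) 1" for y
      using Lq_le_weaken[OF Lq_le_cmult[OF d1, of "sgn (g y) / w2 y" y], of 1] w2[of y] q
      by (auto simp: h_def sgn_real_def abs_mult split: if_splits)
    have wi: "integrable lborel (\<lambda>y. e2 * \<bar>g y\<bar> + 2 * (B + 1) * (\<bar>g y\<bar> * indicator (- cball 0 R) y))"
      using g' by (intro Bochner_Integration.integrable_add integrable_mult_right integrable_real_mult_indicator integrable_abs) auto
    have wle: "w y \<le> e2 * \<bar>g y\<bar> + 2 * (B + 1) * (\<bar>g y\<bar> * indicator (- cball 0 R) y)" for y
      using e12 AB by (auto simp: w_def w2_def mult_ac)
    have w0: "0 \<le> w y" for y using less_imp_le[OF w2] by (simp add: w_def)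
    have wint: "integrable lborel w"
      using wi by (rule Bochner_Integration.integrable_bound) (use wle w0 in \<open>auto simp: w_def intro!: AE_I2 order_trans[OF _ abs_ge_self]\<close>)
    have "(\<integral>y. w y \<partial>lborel) \<le> (\<integral>y. e2 * \<bar>g y\<bar> + 2 * (B + 1) * (\<bar>g y\<bar> * indicator (- cball 0 R) y) \<partial>lborel)"
      using wint wi wle by (intro integral_mono) auto
    also have "\<dots> = e2 * (\<integral>y. \<bar>g y\<bar> \<partial>lborel) + 2 * (B + 1) * (\<integral>y. \<bar>g y\<bar> * indicator (- cball 0 R) y \<partial>lborel)"
      using g' by (subst Bochner_Integration.integral_add) (auto intro!: integrable_mult_right integrable_real_mult_indicator)
    also have "\<dots> \<le> e2 * (A + 1) + 2 * (B + 1) * e1"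
      using g' R e12 AB by (intro add_mono mult_left_mono) auto
    also have "e2 * (A + 1) = e / 2" "2 * (B + 1) * e1 = e / 2"
      using AB unfolding e1_def e2_def by (simp_all add: divide_simps)
    then have "e2 * (A + 1) + 2 * (B + 1) * e1 = e" by simp
    finally have wB: "(\<integral>y. w y \<partial>lborel) \<le> e" .
    have L: "Lq_le q (\<lambda>x. \<integral>y. w y * h y x \<partial>lborel) (e * 1)"
      by (rule Lq_le_integral(1)[OF sigma_finite_lborel w0 wint wB hm h1 q]) auto
    have wh: "w y * h y x = g y * f (x - a *\<^sub>R y) - g y * f (x - a0 *\<^sub>R y)" for y x
      using w2[of y] by (auto simp: w_def h_def sgn_real_def field_simps)
    show "Lq_le q (\<lambda>x. dilconv g a f x - dilconv g a0 f x) e"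
    proof (rule Lq_le_AE_cong[OF L[simplified]])
      show "(\<lambda>x. dilconv g a f x - dilconv g a0 f x) \<in> borel_measurable borel"
        using Lq_le_measurable[OF Lq_le_dilconv[OF g f q]] by measurable
      show "AE x in lborel. dilconv g a f x - dilconv g a0 f x = (\<integral>y. w y * h y x \<partial>lborel)"
        using AE_integrable_dilconv[OF g f q, of a] AE_integrable_dilconv[OF g f q, of a0]
        by eventually_elim (simp add: wh dilconv_def)
    qed (use q in auto)
  qed (use d R in auto)
qed

text \<open>Continuity on \<open>[0, \<infinity>)\<close> with values in \<open>L\<^sup>q\<close>.\<close>

definition Lq_cont :: "real \<Rightarrow> (real \<Rightarrow> 'a::euclidean_space \<Rightarrow> real) \<Rightarrow> bool" where
  "Lq_cont q v \<longleftrightarrow> (\<forall>t\<ge>0. \<forall>e>0. \<exists>\<delta>>0. \<forall>s\<ge>0. \<bar>s - t\<bar> < \<delta> \<longrightarrow> Lq_le q (\<lambda>x. v s x - v t x) e)"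

lemma Lq_cont_uniform:
  assumes v: "Lq_cont q v" and q: "1 \<le> q" and e: "0 < e"
  shows "\<exists>\<delta>>0. \<forall>s\<in>{0..T}. \<forall>t\<in>{0..T}. \<bar>s - t\<bar> < \<delta> \<longrightarrow> Lq_le q (\<lambda>x. v s x - v t x) e"
proof -
  have "\<forall>t. \<exists>\<delta>>0. t \<ge> 0 \<longrightarrow> (\<forall>s\<ge>0. \<bar>s - t\<bar> < \<delta> \<longrightarrow> Lq_le q (\<lambda>x. v s x - v t x) (e/2))"
  proof
    fix t :: real
    show "\<exists>\<delta>>0. t \<ge> 0 \<longrightarrow> (\<forall>s\<ge>0. \<bar>s - t\<bar> < \<delta> \<longrightarrow> Lq_le q (\<lambda>x. v s x - v t x) (e/2))"
    proof (cases "t \<ge> 0")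
      case True
      then show ?thesis using v e unfolding Lq_cont_def by (meson half_gt_zero)
    qed (auto intro: exI[of _ 1])
  qed
  then obtain d where d: "\<And>t. d t > 0"
    "\<And>t s. t \<ge> 0 \<Longrightarrow> s \<ge> 0 \<Longrightarrow> \<bar>s - t\<bar> < d t \<Longrightarrow> Lq_le q (\<lambda>x. v s x - v t x) (e/2)"
    by metis
  obtain \<delta> where \<delta>: "\<delta> > 0" "\<And>x. x \<in> {0..T} \<Longrightarrow> \<exists>G\<in>(\<lambda>t. ball t (d t)) ` {0..T}. ball x \<delta> \<subseteq> G"
  proof (rule Heine_Borel_lemma[of "{0..T}" "(\<lambda>t. ball t (d t)) ` {0..T}"])
    show "{0..T} \<subseteq> \<Union> ((\<lambda>t. ball t (d t)) ` {0..T})" using d(1) by auto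
  qed auto
  show ?thesis
  proof (intro exI[of _ \<delta>] conjI ballI impI)
    fix s t assume st: "s \<in> {0..T}" "t \<in> {0..T}" "\<bar>s - t\<bar> < \<delta>"
    obtain r where r: "r \<in> {0..T}" "ball s \<delta> \<subseteq> ball r (d r)" using \<delta>(2)[OF st(1)] by auto
    have "s \<in> ball s \<delta>" "t \<in> ball s \<delta>" using st \<delta>(1) by (auto simp: dist_real_def)
    then have "dist r s < d r" "dist r t < d r" using r(2) unfolding subset_iff mem_ball by blast+
    then have "\<bar>s - r\<bar> < d r" "\<bar>t - r\<bar> < d r" by (simp_all add: dist_real_def abs_minus_commute)
    then have "Lq_le q (\<lambda>x. v s x - v r x) (e/2)" "Lq_le q (\<lambda>x. v t x - v r x) (e/2)"
      using r st by (auto intro!: d(2))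
    from Lq_le_diff[OF this q] show "Lq_le q (\<lambda>x. v s x - v t x) e" by simp
  qed (use \<delta> in auto)
qed

lemma Lq_cont_bounded:
  assumes v: "Lq_cont q v" and vq: "\<And>t. t \<ge> 0 \<Longrightarrow> v t \<in> Lq_space q" and q: "1 \<le> q"
  shows "\<exists>M>0. \<forall>t\<in>{0..T}. Lq_le q (v t) M"
proof -
  obtain d where d: "d > 0" "\<And>s t. s \<in> {0..T} \<Longrightarrow> t \<in> {0..T} \<Longrightarrow> \<bar>s - t\<bar> < d \<Longrightarrow> Lq_le q (\<lambda>x. v s x - v t x) 1"
    using Lq_cont_uniform[OF v q, of 1 T] by auto
  have step: "\<exists>M>0. \<forall>t\<in>{0..T}. t \<le> real k * (d/2) \<longrightarrow> Lq_le q (v t) M" for k :: nat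
  proof (induction k)
    case 0
    have "Lq_le q (v 0) (Lq_norm q (v 0) + 1)"
      using Lq_le_weaken[OF Lq_le_Lq_norm[OF vq[of 0]]] q by simp
    moreover have "0 \<le> Lq_norm q (v 0)" by (simp add: Lq_norm_def)
    ultimately show ?case
      by (intro exI[of _ "Lq_norm q (v 0) + 1"]) auto
  next
    case (Suc k)
    then obtain M where M: "M > 0" "\<And>t. t \<in> {0..T} \<Longrightarrow> t \<le> real k * (d/2) \<Longrightarrow> Lq_le q (v t) M" by auto
    show ?case
    proof (intro exI[of _ "1 + M"] conjI ballI impI)
      fix t assume t: "t \<in> {0..T}" "t \<le> real (Suc k) * (d/2)"
      define s where "s = max 0 (t - d/2)"
      have s: "s \<in> {0..T}" "s \<le> real k * (d/2)" "\<bar>t - s\<bar> < d"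
        using t d(1) by (auto simp: s_def max_def algebra_simps)
      have "Lq_le q (\<lambda>x. (v t x - v s x) + v s x) (1 + M)"
        by (intro Lq_le_add d(2) M(2) s t q)
      then show "Lq_le q (v t) (1 + M)" by simp
    qed (use M in auto)
  qed
  obtain k :: nat where k: "T / (d/2) \<le> real k" using real_arch_simple by blast
  then have "T \<le> real k * (d/2)" using d(1) by (simp add: field_simps)
  with step[of k] show ?thesis by fastforce
qed

lemma AE_tendsto_0_if_Lq_le_geometric:
  assumes f: "\<And>k. k \<ge> k0 \<Longrightarrow> Lq_le q (f k) ((1/2) ^ k)" and q: "1 \<le> q"
  shows "AE x in lborel. (\<lambda>k. f k x) \<longlonglongrightarrow> 0"
proof -
  define g where "g = (\<lambda>k x. f (k + k0) x)"
  have g: "Lq_le q (g k) ((1/2) ^ k)" for k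
    unfolding g_def by (rule Lq_le_weaken[OF f]) (use q in \<open>auto simp: power_add intro!: mult_left_le power_le_one\<close>)
  note [measurable] = Lq_le_measurable[OF g]
  have "(\<integral>\<^sup>+x. (\<Sum>k. ennreal (\<bar>g k x\<bar> powr q)) \<partial>lborel) = (\<Sum>k. \<integral>\<^sup>+x. ennreal (\<bar>g k x\<bar> powr q) \<partial>lborel)"
    by (rule nn_integral_suminf) simp
  also have "\<dots> \<le> (\<Sum>k. ennreal ((1/2) ^ k))"
  proof (intro suminf_le summableI)
    fix k
    have "((1/2) ^ k) powr q \<le> ((1/2::real) ^ k) powr 1"
      using q by (intro powr_mono') (auto simp: power_le_one)
    then show "(\<integral>\<^sup>+x. ennreal (\<bar>g k x\<bar> powr q) \<partial>lborel) \<le> ennreal ((1/2) ^ k)"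
      using Lq_le_nn_integral[OF g, of k] by (auto intro: order_trans ennreal_leI)
  qed
  also have "\<dots> = ennreal (\<Sum>k. (1/2) ^ k)"
    by (rule suminf_ennreal2) (auto intro: summable_geometric)
  also have "\<dots> < \<infinity>" by simp
  finally have "AE x in lborel. (\<Sum>k. ennreal (\<bar>g k x\<bar> powr q)) \<noteq> \<infinity>"
    by (intro nn_integral_PInf_AE) auto
  then show ?thesis
  proof eventually_elim
    case (elim x)
    then have "summable (\<lambda>k. \<bar>g k x\<bar> powr q)" by (intro summable_suminf_not_top) auto
    then have "(\<lambda>k. \<bar>g k x\<bar> powr q) \<longlonglongrightarrow> 0" by (rule summable_LIMSEQ_zero)
    then have "(\<lambda>k. (\<bar>g k x\<bar> powr q) powr (1/q)) \<longlonglongrightarrow> 0 powr (1/q)"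
      using q by (intro tendsto_powr' tendsto_const) auto
    then have "(\<lambda>k. \<bar>g k x\<bar>) \<longlonglongrightarrow> 0" using q by (simp add: powr_powr)
    then have "(\<lambda>k. g k x) \<longlonglongrightarrow> 0" by (rule tendsto_rabs_zero_cancel)
    then show ?case unfolding g_def by (rule LIMSEQ_offset)
  qed
qed

text \<open>Fubini's theorem needs joint measurability in time and space, which a continuous curve of equivalence classes does
not provide. Freezing time on finer and finer grids gives jointly measurable functions; if the grids are fine enough for
geometric convergence, the limit exists almost everywhere at each time.\<close>

lemma jointly_measurable_version:
  fixes v :: "real \<Rightarrow> 'a::euclidean_space \<Rightarrow> real"
  assumes v: "Lq_cont q v" and vm[measurable]: "\<And>t. t \<ge> 0 \<Longrightarrow> v t \<in> borel_measurable borel" and q: "1 \<le> q"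
  obtains V where "jointly_measurable V"
    "\<And>t. t \<ge> 0 \<Longrightarrow> AE x in lborel. V t x = v t x"
proof -
  have "\<forall>k::nat. \<exists>m::nat. m > 0 \<and> (\<forall>s\<in>{0..real k}. \<forall>t\<in>{0..real k}. \<bar>s - t\<bar> < 1 / real m \<longrightarrow> Lq_le q (\<lambda>x. v s x - v t x) ((1/2) ^ k))"
  proof
    fix k :: nat
    obtain d where d: "d > 0" "\<forall>s\<in>{0..real k}. \<forall>t\<in>{0..real k}. \<bar>s - t\<bar> < d \<longrightarrow> Lq_le q (\<lambda>x. v s x - v t x) ((1/2) ^ k)"
      using Lq_cont_uniform[OF v q, of "(1/2) ^ k" "real k"] by auto
    obtain m :: nat where m: "1 / real (Suc m) < d"
      using d(1) nat_approx_posE by blast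
    show "\<exists>m::nat. m > 0 \<and> (\<forall>s\<in>{0..real k}. \<forall>t\<in>{0..real k}. \<bar>s - t\<bar> < 1 / real m \<longrightarrow> Lq_le q (\<lambda>x. v s x - v t x) ((1/2) ^ k))"
      using d(2) m by (intro exI[of _ "Suc m"]) (auto simp del: of_nat_Suc)
  qed
  then obtain m where m: "\<And>k::nat. m k > (0::nat)" "\<And>k s t. s \<in> {0..real k} \<Longrightarrow> t \<in> {0..real k} \<Longrightarrow> \<bar>s - t\<bar> < 1 / real (m k) \<Longrightarrow> Lq_le q (\<lambda>x. v s x - v t x) ((1/2) ^ k)"
    by metis
  (* The maximum with 0 keeps the frozen time in the half-line on which v is controlled. *)
  define W where "W = (\<lambda>k t x. v (max 0 (of_int \<lfloor>t * real (m k)\<rfloor> / real (m k))) x)"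
  have Wm[measurable]: "(\<lambda>z. W k (fst z) (snd z)) \<in> borel_measurable (borel \<Otimes>\<^sub>M borel)" for k
  proof -
    have f: "(\<lambda>z::real \<times> 'a. v (max 0 (of_int i / real (m k))) (snd z)) \<in> borel_measurable (borel \<Otimes>\<^sub>M borel)" for i :: int
      by (rule measurable_compose[OF measurable_snd vm]) simp
    have g: "(\<lambda>z::real \<times> 'a. \<lfloor>fst z * real (m k)\<rfloor>) \<in> measurable (borel \<Otimes>\<^sub>M borel) (count_space UNIV)"
      by measurable
    show ?thesis unfolding W_def by (rule measurable_compose_countable[OF f g])
  qed
  define V where "V = (\<lambda>t x. lim (\<lambda>k. W k t x))"
  show thesis
  proof (rule that[of V])
    show "jointly_measurable V"
      unfolding V_def case_prod_beta by (rule borel_measurable_lim_metric) (rule Wm)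
    fix t :: real assume t: "t \<ge> 0"
    obtain k0 :: nat where k0: "t \<le> real k0" using real_arch_simple by blast
    have "Lq_le q (\<lambda>x. W k t x - v t x) ((1/2) ^ k)" if "k \<ge> k0" for k
    proof -
      have mk: "0 < real (m k)" using m(1) by simp
      have fl: "of_int \<lfloor>t * real (m k)\<rfloor> \<le> t * real (m k)" "t * real (m k) < of_int \<lfloor>t * real (m k)\<rfloor> + 1"
        by linarith+
      define s where "s = of_int \<lfloor>t * real (m k)\<rfloor> / real (m k)"
      have s: "s \<le> t" "0 \<le> s"
        using fl mk t by (auto simp: s_def field_simps)
      have "t * real (m k) - of_int \<lfloor>t * real (m k)\<rfloor> < 1" using fl by linarith
      then have "(t * real (m k) - of_int \<lfloor>t * real (m k)\<rfloor>) / real (m k) < 1 / real (m k)"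
        using mk by (intro divide_strict_right_mono)
      then have s2: "t - s < 1 / real (m k)" using mk by (simp add: s_def diff_divide_distrib)
      have "Lq_le q (\<lambda>x. v s x - v t x) ((1/2) ^ k)"
        using s s2 t k0 that by (intro m(2)) auto
      then show ?thesis using s by (simp add: W_def s_def[symmetric])
    qed
    then have "AE x in lborel. (\<lambda>k. W k t x - v t x) \<longlonglongrightarrow> 0"
      by (rule AE_tendsto_0_if_Lq_le_geometric) (use q in auto)
    then show "AE x in lborel. V t x = v t x"
    proof eventually_elim
      case (elim x)
      then have "(\<lambda>k. W k t x) \<longlonglongrightarrow> v t x" by (rule LIM_zero_cancel)
      then show ?case unfolding V_def by (rule limI)
    qed
  qed
qed

section \<open>Holomorphic dependence on parameters and Laplace transforms\<close>

text \<open>Cauchy's inequality on small discs turns the bound for the integrand into one for its derivative, so dominated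
convergence applies to the difference quotients.\<close>

lemma
  fixes F :: "complex \<Rightarrow> 's \<Rightarrow> complex"
  assumes r: "0 < r"
    and meas: "\<And>w. w \<in> ball w0 r \<Longrightarrow> F w \<in> borel_measurable M"
    and hol: "\<And>s. s \<in> space M \<Longrightarrow> (\<lambda>w. F w s) holomorphic_on ball w0 r"
    and bound: "\<And>w s. w \<in> ball w0 r \<Longrightarrow> s \<in> space M \<Longrightarrow> norm (F w s) \<le> g s"
    and g: "integrable M g"
  shows has_field_derivative_integral_param:
      "((\<lambda>w. \<integral>s. F w s \<partial>M) has_field_derivative (\<integral>s. deriv (\<lambda>w. F w s) w0 \<partial>M)) (at w0)"
    and integrable_deriv_param: "integrable M (\<lambda>s. deriv (\<lambda>w. F w s) w0)"
proof -
  define D where "D = (\<lambda>s. deriv (\<lambda>w. F w s) w0)"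
  have w0: "w0 \<in> ball w0 r" using r by simp
  have int: "integrable M (F w)" if "w \<in> ball w0 r" for w
    using g meas[OF that] by (rule Bochner_Integration.integrable_bound)
      (use bound[OF that] in \<open>auto intro!: AE_I2 intro: order_trans[OF _ abs_ge_self]\<close>)
  have der: "((\<lambda>w. F w s) has_field_derivative deriv (\<lambda>w. F w s) z) (at z)"
    if "z \<in> ball w0 r" "s \<in> space M" for z s
    using holomorphic_derivI[OF hol[OF that(2)] open_ball that(1)] .
  have dbound: "norm (deriv (\<lambda>w. F w s) z) \<le> 3 * g s / r"
    if z: "z \<in> ball w0 (r/2)" and s: "s \<in> space M" for z s
  proof -
    have sub: "cball z (r/3) \<subseteq> ball w0 r"
    proof
      fix x assume "x \<in> cball z (r/3)"
      then have "dist w0 x \<le> dist w0 z + r/3" using dist_triangle[of w0 x z] by simp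
      then show "x \<in> ball w0 r" using z r by simp
    qed
    have "norm ((deriv ^^ 1) (\<lambda>w. F w s) z) \<le> fact 1 * g s / (r/3) ^ 1"
    proof (rule Cauchy_inequality)
      show "(\<lambda>w. F w s) holomorphic_on ball z (r/3)"
        using hol[OF s] by (rule holomorphic_on_subset) (use sub in force)
      show "continuous_on (cball z (r/3)) (\<lambda>w. F w s)"
        using hol[OF s] sub by (meson continuous_on_subset holomorphic_on_imp_continuous_on)
      show "norm (F x s) \<le> g s" if "norm (z - x) = r/3" for x
      proof -
        have "x \<in> cball z (r/3)" using that by (simp add: dist_norm)
        then show ?thesis using sub s by (intro bound) auto
      qed
    qed (use r in simp)
    then show ?thesis using r by (simp add: field_simps)
  qed
  have lip: "norm (F w s - F w0 s) \<le> 3 * g s / r * norm (w - w0)"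
    if w: "w \<in> ball w0 (r/2)" and s: "s \<in> space M" for w s
  proof (rule field_differentiable_bound[where S="ball w0 (r/2)" and f'="deriv (\<lambda>w. F w s)"])
    fix z assume z: "z \<in> ball w0 (r/2)"
    then have "z \<in> ball w0 r" using r by auto
    then show "((\<lambda>w. F w s) has_field_derivative deriv (\<lambda>w. F w s) z) (at z within ball w0 (r/2))"
      using der s has_field_derivative_at_within by blast
    show "norm (deriv (\<lambda>w. F w s) z) \<le> 3 * g s / r" by (rule dbound[OF z s])
  qed (use w r in auto)
  have seq: "(\<lambda>n. ((\<integral>s. F (X n) s \<partial>M) - (\<integral>s. F w0 s \<partial>M)) / (X n - w0)) \<longlonglongrightarrow> (\<integral>s. D s \<partial>M) \<and> D \<in> borel_measurable M"
    if X: "\<And>n. X n \<noteq> w0" "X \<longlonglongrightarrow> w0" "\<And>n. X n \<in> ball w0 (r/2)" for X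
  proof -
    have Xr: "X n \<in> ball w0 r" for n using X(3)[of n] r by auto
    have lim: "(\<lambda>n. (F (X n) s - F w0 s) / (X n - w0)) \<longlonglongrightarrow> D s" if s: "s \<in> space M" for s
    proof -
      have "((\<lambda>w. (F w s - F w0 s) / (w - w0)) \<longlongrightarrow> D s) (at w0)"
        using der[OF w0 s] unfolding has_field_derivative_iff D_def .
      then show ?thesis using X(1,2) by (auto simp: tendsto_at_iff_sequentially o_def)
    qed
    have m: "(\<lambda>s. (F (X n) s - F w0 s) / (X n - w0)) \<in> borel_measurable M" for n
      using meas[OF Xr, of n] meas[OF w0] by measurable
    have Dm: "D \<in> borel_measurable M"
      by (rule borel_measurable_LIMSEQ_metric[OF m lim])
    have "(\<lambda>n. \<integral>s. (F (X n) s - F w0 s) / (X n - w0) \<partial>M) \<longlonglongrightarrow> (\<integral>s. D s \<partial>M)"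
    proof (rule integral_dominated_convergence[where w="\<lambda>s. 3 * g s / r"])
      show "AE s in M. norm ((F (X n) s - F w0 s) / (X n - w0)) \<le> 3 * g s / r" for n
      proof (rule AE_I2)
        fix s assume s: "s \<in> space M"
        show "norm ((F (X n) s - F w0 s) / (X n - w0)) \<le> 3 * g s / r"
          using lip[OF X(3) s, of n] X(1)[of n] by (simp add: norm_divide divide_le_eq)
      qed
    qed (use g lim m Dm in auto)
    then show ?thesis using int[OF Xr] int[OF w0] Dm by simp
  qed
  have Dm: "D \<in> borel_measurable M"
  proof -
    have "(\<lambda>n. w0 + of_real (r / (3 * (real n + 1)))) \<longlonglongrightarrow> w0 + of_real 0"
      by (intro tendsto_intros) real_asymp
    moreover have "w0 + of_real (r / (3 * (real n + 1))) \<in> ball w0 (r/2)" for n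
    proof -
      define x where "x = r / (3 * (real n + 1))"
      have "r * 2 < r * (3 * (real n + 1))" using r by (intro mult_strict_left_mono) auto
      then have "x < r / 2" "0 < x" using r by (auto simp: x_def field_simps)
      then show ?thesis unfolding x_def[symmetric] by (simp add: dist_norm)
    qed
    moreover have "w0 + of_real (r / (3 * (real n + 1))) \<noteq> w0" for n
      using r by (simp del: of_real_divide of_real_mult of_real_add) 
    ultimately show ?thesis using seq[of "\<lambda>n. w0 + of_real (r / (3 * (real n + 1)))"] by auto
  qed
  show "integrable M (\<lambda>s. deriv (\<lambda>w. F w s) w0)"
  proof -
    have "integrable M (\<lambda>s. 3 * g s / r)" using g by simp
    then show ?thesis unfolding D_def[symmetric] using Dm
    proof (rule Bochner_Integration.integrable_bound)
      have "norm (D s) \<le> norm (3 * g s / r)" if "s \<in> space M" for s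
        using dbound[of w0 s] that r unfolding D_def real_norm_def
        by (intro order_trans[OF _ abs_ge_self]) simp
      then show "AE s in M. norm (D s) \<le> norm (3 * g s / r)" by (rule AE_I2)
    qed
  qed
  show "((\<lambda>w. \<integral>s. F w s \<partial>M) has_field_derivative (\<integral>s. deriv (\<lambda>w. F w s) w0 \<partial>M)) (at w0)"
    unfolding has_field_derivative_iff tendsto_at_iff_sequentially o_def
  proof (intro allI impI)
    fix X :: "nat \<Rightarrow> complex" assume X: "\<forall>i. X i \<in> UNIV - {w0}" "X \<longlonglongrightarrow> w0"
    have "\<forall>\<^sub>F n in sequentially. X n \<in> ball w0 (r/2)"
      using X(2) r by (intro topological_tendstoD) auto
    then obtain N where N: "\<And>n. n \<ge> N \<Longrightarrow> X n \<in> ball w0 (r/2)" by (auto simp: eventually_sequentially)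
    have "(\<lambda>n. ((\<integral>s. F (X (n + N)) s \<partial>M) - (\<integral>s. F w0 s \<partial>M)) / (X (n + N) - w0)) \<longlonglongrightarrow> (\<integral>s. D s \<partial>M)"
      using X N LIMSEQ_ignore_initial_segment[OF X(2), of N]
      by (intro seq[THEN conjunct1, of "\<lambda>n. X (n + N)"]) auto
    then show "(\<lambda>n. ((\<integral>s. F (X n) s \<partial>M) - (\<integral>s. F w0 s \<partial>M)) / (X n - w0)) \<longlonglongrightarrow> (\<integral>s. deriv (\<lambda>w. F w s) w0 \<partial>M)"
      unfolding D_def by (rule LIMSEQ_offset)
  qed
qed

text \<open>Euler's integral with the variable scaled.\<close>

lemma
  fixes a w :: real
  assumes a: "0 < a" and w: "0 < w"
  shows set_integrable_Gamma_real: "set_integrable lborel {0<..} (\<lambda>r. r powr (a - 1) * exp (- (w * r)))"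
    and Gamma_integral_scaled_real:
      "(LINT r:{0<..}|lborel. r powr (a - 1) * exp (- (w * r))) = Gamma a * w powr (- a)"
proof -
  define f where "f = (\<lambda>r::real. indicator {0<..} r * (r powr (a - 1) * exp (- r)))"
  have fm[measurable]: "f \<in> borel_measurable borel" unfolding f_def by measurable
  have f0: "0 \<le> f r" for r by (simp add: f_def)
  have "f r = (if r \<in> {0..} then r powr (a - 1) / exp r else 0)" for r
    by (cases "r = 0") (auto simp: f_def indicator_def exp_minus field_simps)
  then have "f = (\<lambda>r. if r \<in> {0..} then r powr (a - 1) / exp r else 0)"
    by (rule ext)
  then have "(f has_integral Gamma a) UNIV"
    using Gamma_integral_real[OF a] by (simp only: has_integral_restrict_UNIV)
  then have nn: "(\<integral>\<^sup>+r. f r \<partial>lborel) = ennreal (Gamma a)"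
    by (rule nn_integral_has_integral_lborel[OF fm f0])
  have fi: "integrable lborel f"
    using nn f0 by (intro integrableI_nonneg) auto
  have "ennreal (\<integral>r. f r \<partial>lborel) = ennreal (Gamma a)"
    using nn fi f0 by (simp add: nn_integral_eq_integral)
  then have f1: "(\<integral>r. f r \<partial>lborel) = Gamma a"
    using Gamma_real_pos[OF a] f0 by (simp add: ennreal_inj)
  have fw: "f (0 + w * r) = w powr (a - 1) * (indicator {0<..} r *\<^sub>R (r powr (a - 1) * exp (- (w * r))))" for r
    using w by (auto simp: f_def indicator_def powr_mult zero_less_mult_iff)
  have "integrable lborel (\<lambda>r. f (0 + w * r))"
    using fi w by (intro lborel_integrable_real_affine) auto
  then have "integrable lborel (\<lambda>r. w powr (a - 1) * (indicator {0<..} r *\<^sub>R (r powr (a - 1) * exp (- (w * r)))))"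
    unfolding fw .
  then show i: "set_integrable lborel {0<..} (\<lambda>r. r powr (a - 1) * exp (- (w * r)))"
    unfolding set_integrable_def using w by simp
  have "Gamma a = \<bar>w\<bar> *\<^sub>R (\<integral>r. f (0 + w * r) \<partial>lborel)"
    unfolding f1[symmetric] using w by (intro lborel_integral_real_affine) auto
  also have "\<dots> = w * w powr (a - 1) * (LINT r:{0<..}|lborel. r powr (a - 1) * exp (- (w * r)))"
    unfolding fw set_lebesgue_integral_def using w by simp
  also have "w * w powr (a - 1) = w powr a" using w by (simp add: powr_diff)
  finally show "(LINT r:{0<..}|lborel. r powr (a - 1) * exp (- (w * r))) = Gamma a * w powr (- a)"
    using w by (simp add: powr_minus field_simps)
qed

lemma set_integrable_exp_decay:
  "0 < (\<delta>::real) \<Longrightarrow> set_integrable lborel {0<..} (\<lambda>r. exp (- (\<delta> * r)))"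
  using set_integrable_Gamma_real[of 1 \<delta>] unfolding set_integrable_def
  by (rule back_subst[of "integrable lborel"]) (auto simp: indicator_def fun_eq_iff)

text \<open>Both sides are holomorphic in the right half plane, so by the identity theorem they agree there if they
agree on the positive reals. This moves Gamma integrals and Gaussian integrals to complex parameters.\<close>

lemma
  fixes c :: "'s \<Rightarrow> complex" and k :: "'s \<Rightarrow> real"
  assumes [measurable]: "c \<in> borel_measurable M" "k \<in> borel_measurable M"
    and k: "\<And>s. 0 \<le> k s"
    and int: "\<And>x. 0 < x \<Longrightarrow> integrable M (\<lambda>s. norm (c s) * exp (- (x * k s)))"
    and w: "0 < Re w"
  shows integrable_laplace: "integrable M (\<lambda>s. c s * exp (- (w * of_real (k s))))"
    and laplace_eq_if_eq_on_reals: "\<And>H. H holomorphic_on {w. 0 < Re w} \<Longrightarrow>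
      (\<And>x. 0 < x \<Longrightarrow> (\<integral>s. c s * exp (- (of_real x * of_real (k s))) \<partial>M) = H (of_real x)) \<Longrightarrow>
      (\<integral>s. c s * exp (- (w * of_real (k s))) \<partial>M) = H w"
proof -
  define F where "F = (\<lambda>w s. c s * exp (- (w * of_real (k s))))"
  have Fm[measurable]: "F w \<in> borel_measurable M" for w unfolding F_def by measurable
  have nF: "norm (F w s) = norm (c s) * exp (- (Re w * k s))" for w s
    by (simp add: F_def norm_mult)
  have "integrable M (F w)"
    using int[OF w] by (rule Bochner_Integration.integrable_bound) (auto simp: nF)
  then show "integrable M (\<lambda>s. c s * exp (- (w * of_real (k s))))" by (simp add: F_def)
  have op: "open {w::complex. 0 < Re w}" by (rule open_halfspace_Re_gt)
  have hol: "(\<lambda>w. \<integral>s. F w s \<partial>M) holomorphic_on {w. 0 < Re w}"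
    unfolding holomorphic_on_open[OF op]
  proof safe
    fix w0 :: complex assume w0: "0 < Re w0"
    define g where "g = (\<lambda>s. norm (c s) * exp (- (Re w0 / 2 * k s)))"
    have "((\<lambda>w. \<integral>s. F w s \<partial>M) has_field_derivative (\<integral>s. deriv (\<lambda>w. F w s) w0 \<partial>M)) (at w0)"
    proof (rule has_field_derivative_integral_param[where r="Re w0 / 2" and g=g])
      show "integrable M g" using int[of "Re w0 / 2"] w0 by (simp add: g_def)
      fix w s assume "w \<in> ball w0 (Re w0 / 2)"
      then have "Re w0 / 2 \<le> Re w" using abs_Re_le_cmod[of "w0 - w"] by (simp add: dist_norm)
      then have "Re w0 / 2 * k s \<le> Re w * k s" using k by (intro mult_right_mono)
      then show "norm (F w s) \<le> g s" unfolding nF g_def by (intro mult_left_mono) auto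
    next
      show "(\<lambda>w. F w s) holomorphic_on ball w0 (Re w0 / 2)" for s
        unfolding F_def by (intro holomorphic_intros)
    qed (use w0 Fm in auto)
    then show "\<exists>f'. ((\<lambda>w. \<integral>s. F w s \<partial>M) has_field_derivative f') (at w0)" by blast
  qed
  have lp: "1 islimpt complex_of_real ` {0<..}"
    unfolding islimpt_approachable
  proof (intro allI impI)
    fix e :: real assume "0 < e"
    then show "\<exists>x'\<in>complex_of_real ` {0<..}. x' \<noteq> 1 \<and> dist x' 1 < e"
      by (intro bexI[of _ "of_real (1 + e/2)"] conjI) (auto simp: dist_norm complex_eq_iff norm_divide)
  qed
  fix H assume H: "H holomorphic_on {w. 0 < Re w}"
    "\<And>x. 0 < x \<Longrightarrow> (\<integral>s. c s * exp (- (of_real x * of_real (k s))) \<partial>M) = H (of_real x)"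
  have "(\<integral>s. F w s \<partial>M) - H w = 0"
  proof (rule analytic_continuation[of "\<lambda>w. (\<integral>s. F w s \<partial>M) - H w" "{w. 0 < Re w}" "complex_of_real ` {0<..}" 1])
    show "(\<lambda>w. (\<integral>s. F w s \<partial>M) - H w) holomorphic_on {w. 0 < Re w}"
      using hol H(1) by (rule holomorphic_on_diff)
    show "connected {w. 0 < Re w}" by (rule convex_connected) (rule convex_halfspace_Re_gt)
  qed (use op lp H(2) w in \<open>auto simp: F_def\<close>)
  then show "(\<integral>s. c s * exp (- (w * of_real (k s))) \<partial>M) = H w" by (simp add: F_def)
qed

lemma
  fixes w :: complex
  assumes a: "0 < a" and w: "0 < Re w"
  shows set_integrable_Gamma_complex:
      "set_integrable lborel {0<..} (\<lambda>r. of_real (r powr (a - 1)) * exp (- (w * of_real r)))"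
    and Gamma_integral_scaled_complex:
      "(LINT r:{0<..}|lborel. of_real (r powr (a - 1)) * exp (- (w * of_real r))) = of_real (Gamma a) * w powr of_real (- a)"
proof -
  define c where "c = (\<lambda>r::real. complex_of_real (indicator {0<..} r * r powr (a - 1)))"
  define k where "k = (\<lambda>r::real. indicator {0<..} r * r)"
  have ck: "c r * exp (- (w * of_real (k r))) = indicator {0<..} r *\<^sub>R (of_real (r powr (a - 1)) * exp (- (w * of_real r)))" for w r
    by (auto simp: c_def k_def indicator_def)
  have [measurable]: "c \<in> borel_measurable lborel" "k \<in> borel_measurable lborel" unfolding c_def k_def by measurable
  have k: "0 \<le> k r" for r by (auto simp: k_def indicator_def)
  have int: "integrable lborel (\<lambda>r. norm (c r) * exp (- (x * k r)))" if "0 < x" for x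
  proof -
    have "norm (c r) * exp (- (x * k r)) = indicator {0<..} r *\<^sub>R (r powr (a - 1) * exp (- (x * r)))" for r
      by (auto simp: c_def k_def indicator_def)
    then show ?thesis using set_integrable_Gamma_real[OF a that] by (simp only: set_integrable_def)
  qed
  show "set_integrable lborel {0<..} (\<lambda>r. of_real (r powr (a - 1)) * exp (- (w * of_real r)))"
    using integrable_laplace[of c lborel k, OF _ _ k int w] unfolding ck set_integrable_def by simp
  have "(\<integral>r. c r * exp (- (w * of_real (k r))) \<partial>lborel) = of_real (Gamma a) * w powr of_real (- a)"
  proof (rule laplace_eq_if_eq_on_reals[OF _ _ k int w])
    show "(\<lambda>w. of_real (Gamma a) * w powr of_real (- a)) holomorphic_on {w. 0 < Re w}"
      by (intro holomorphic_intros) (auto simp: complex_nonpos_Reals_iff)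
    fix x :: real assume x: "0 < x"
    have "c r * exp (- (of_real x * of_real (k r))) = of_real (indicator {0<..} r *\<^sub>R (r powr (a - 1) * exp (- (x * r))))" for r
      unfolding ck by (simp add: exp_of_real[symmetric] scaleR_conv_of_real)
    then have "(\<integral>r. c r * exp (- (of_real x * of_real (k r))) \<partial>lborel) = of_real (LINT r:{0<..}|lborel. r powr (a - 1) * exp (- (x * r)))"
      unfolding set_lebesgue_integral_def by (simp only: integral_complex_of_real)
    then show "(\<integral>r. c r * exp (- (of_real x * of_real (k r))) \<partial>lborel) = of_real (Gamma a) * of_real x powr of_real (- a)"
      using Gamma_integral_scaled_real[OF a x] x by (simp add: powr_of_real[symmetric])
  qed simp_all
  then show "(LINT r:{0<..}|lborel. of_real (r powr (a - 1)) * exp (- (w * of_real r))) = of_real (Gamma a) * w powr of_real (- a)"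
    unfolding ck set_lebesgue_integral_def .
qed

lemma exp_integral_complex:
  "0 < Re w \<Longrightarrow> (LINT r:{0<..}|lborel. exp (- (w * of_real r))) = 1 / w"
proof -
  assume w: "0 < Re w"
  have "(LINT r:{0<..}|lborel. exp (- (w * of_real r))) = (LINT r:{0<..}|lborel. of_real (r powr (1 - 1)) * exp (- (w * of_real r)))"
    by (rule set_lebesgue_integral_cong) auto
  also have "\<dots> = 1 / w" using Gamma_integral_scaled_complex[of 1 w] w by (simp add: powr_minus divide_inverse)
  finally show ?thesis .
qed

lemma norm_powr_of_real: fixes z :: complex shows "z \<noteq> 0 \<Longrightarrow> norm (z powr of_real a) = norm z powr a"
  by (simp add: powr_def norm_exp_eq_Re)

lemma cis_powr: 
  assumes "0 < c" "- pi < t" "t \<le> pi"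
  shows "(of_real c * cis t) powr of_real a = of_real (c powr a) * cis (a * t)"
proof -
  have "Ln (of_real c * cis t) = of_real (ln c) + \<i> * of_real t"
    using assms by (simp add: Ln_times_of_real Ln_cis Ln_of_real)
  then show ?thesis using assms
    by (simp add: powr_def cis_conv_exp exp_add[symmetric] exp_of_real[symmetric] algebra_simps)
qed

section \<open>Hankel's formula on a bent ray\<close>

text \<open>The sector of opening \<open>2 \<phi>\<close> around the positive axis, described without the argument so that openness and
stability under sums are immediate.\<close>

definition sector :: "real \<Rightarrow> complex set" where
  "sector \<phi> = {y. 0 < Re y \<and> \<bar>Im y\<bar> < tan \<phi> * Re y}"

lemma open_sector: "open (sector \<phi>)"
  unfolding sector_def by (intro open_Collect_conj open_Collect_less continuous_intros)

lemma sector_add: "x \<in> sector \<phi> \<Longrightarrow> y \<in> sector \<phi> \<Longrightarrow> x + y \<in> sector \<phi>"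
  unfolding sector_def by (auto simp: algebra_simps)

lemma sector_scale: "x \<in> sector \<phi> \<Longrightarrow> 0 < c \<Longrightarrow> of_real c * x \<in> sector \<phi>"
  unfolding sector_def by (auto simp: abs_mult mult.left_commute)

lemma cis_in_sector:
  assumes "\<bar>t\<bar> < \<phi>" "\<phi> < pi / 2"
  shows "cis t \<in> sector \<phi>"
proof -
  have c: "0 < cos t" using assms by (intro cos_gt_zero_pi) auto
  have "tan \<bar>t\<bar> < tan \<phi>" using assms by (intro tan_monotone) auto
  moreover have "tan \<bar>t\<bar> = \<bar>sin t\<bar> / cos t"
  proof (cases "t \<ge> 0")
    case True
    then have "0 \<le> sin t" using assms by (intro sin_ge_zero) auto
    then show ?thesis using True by (simp add: tan_def)
  next
    case False
    then have "0 \<le> sin (-t)" using assms by (intro sin_ge_zero) auto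
    then show ?thesis using False by (simp add: tan_def)
  qed
  ultimately show ?thesis using c by (simp add: sector_def field_simps)
qed

lemma sector_nonzero: "y \<in> sector \<phi> \<Longrightarrow> y \<noteq> 0" "y \<in> sector \<phi> \<Longrightarrow> y \<notin> \<real>\<^sub>\<le>\<^sub>0" "y \<in> sector \<phi> \<Longrightarrow> 0 < norm y"
  by (auto simp: sector_def complex_nonpos_Reals_iff)

text \<open>The power multiplies arguments by \<open>a\<close>, so it stays in a sector on which the real part controls the norm.\<close>

lemma Re_powr_sector:
  assumes y: "y \<in> sector \<phi>" and \<phi>: "0 < \<phi>" "\<phi> < pi/2" and a: "0 \<le> a" "a * \<phi> \<le> pi / 2"
  shows "norm y powr a * cos (a * \<phi>) \<le> Re (y powr of_real a)"
proof -
  have Re: "0 < Re y" "\<bar>Im y\<bar> < tan \<phi> * Re y" using y by (auto simp: sector_def)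
  have "Im (Ln y) = arctan (Im y / Re y)"
    using Re(1) sector_nonzero(1)[OF y] by (simp add: arg_conv_arctan flip: Arg_eq_Im_Ln)
  moreover have "\<bar>arctan (Im y / Re y)\<bar> < \<phi>"
  proof -
    have "\<bar>Im y / Re y\<bar> < tan \<phi>" using Re by (simp add: abs_divide field_simps)
    then have "arctan \<bar>Im y / Re y\<bar> < arctan (tan \<phi>)" by (simp only: arctan_less_iff)
    then show ?thesis using \<phi> by (simp add: abs_arctan arctan_tan)
  qed
  ultimately have th: "\<bar>Im (Ln y)\<bar> \<le> \<phi>" by simp
  have "cos (a * \<phi>) \<le> cos \<bar>a * Im (Ln y)\<bar>"
  proof (rule cos_monotone_0_pi_le)
    show "\<bar>a * Im (Ln y)\<bar> \<le> a * \<phi>" using a th by (simp add: abs_mult mult_left_mono)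
    show "a * \<phi> \<le> pi" using a(2) pi_gt_zero by linarith
  qed simp
  also have "\<dots> = cos (a * Im (Ln y))" by simp
  finally have "norm y powr a * cos (a * \<phi>) \<le> norm y powr a * cos (a * Im (Ln y))"
    by (intro mult_left_mono) auto
  also have "\<dots> = Re (y powr of_real a)"
    using sector_nonzero(1)[OF y] by (simp add: powr_def Re_exp)
  finally show ?thesis .
qed

text \<open>One half of Hankel's contour is the ray that starts at \<open>c\<close> and has direction \<open>cis (2 \<omega>)\<close>, pointing to the left.
Multiplying by \<open>cis (- \<omega>)\<close> rotates it into a sector around the positive axis, see \<open>cis_times_yray\<close>, where powers are
controlled by the real part. The other half is the complex conjugate; taking imaginary
parts accounts for it.\<close>

definition yray :: "real \<Rightarrow> complex \<Rightarrow> real \<Rightarrow> complex" where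
  "yray \<omega> c r = c * cis (- \<omega>) + of_real r * cis \<omega>"

lemma yray_sector:
  assumes "0 < \<omega>" "\<omega> < \<phi>" "\<phi> < pi/2" "c * cis (- \<omega>) \<in> sector \<phi>" "0 \<le> r"
  shows "yray \<omega> c r \<in> sector \<phi>"
proof (cases "r = 0")
  case False
  then show ?thesis unfolding yray_def using assms by (intro sector_add sector_scale cis_in_sector) auto
qed (use assms in \<open>simp add: yray_def\<close>)

lemma yray_sector_real:
  assumes "0 < \<omega>" "\<omega> < \<phi>" "\<phi> < pi/2" "0 < c" "0 \<le> r"
  shows "yray \<omega> (of_real c) r \<in> sector \<phi>"
  using assms by (intro yray_sector sector_scale cis_in_sector) auto

lemma Re_yray_real: "Re (yray \<omega> (of_real c) r) = (c + r) * cos \<omega>"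
  by (simp add: yray_def algebra_simps)

lemma cis_times_yray: "cis \<omega> * yray \<omega> c r = c + of_real r * cis (2 * \<omega>)"
  by (simp add: yray_def algebra_simps cis_mult flip: mult.assoc)

lemma yray_DERIV:
  "((\<lambda>c. yray \<omega> c r) has_field_derivative cis (- \<omega>)) (at c)"
  "((\<lambda>r. yray \<omega> c r) has_vector_derivative cis \<omega>) (at r)"
  unfolding yray_def
  by (auto intro!: derivative_eq_intros has_vector_derivative_real_field simp: has_vector_derivative_def scaleR_conv_of_real)

definition ray_integral :: "real \<Rightarrow> (complex \<Rightarrow> complex) \<Rightarrow> complex \<Rightarrow> complex" where
  "ray_integral \<omega> f c = (LINT r:{0<..}|lborel. f (yray \<omega> c r) * cis (2 * \<omega>))"

text \<open>Integrands whose growth is that of the exponential along the contour: since \<open>cos (2 \<omega>) < 0\<close>, they decay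
exponentially along the ray.\<close>

locale ray_integrand =
  fixes \<omega> \<phi> :: real and f :: "complex \<Rightarrow> complex"
  assumes \<omega>: "pi / 4 < \<omega>" "\<omega> < \<phi>" "\<phi> < pi / 2"
    and hol: "f holomorphic_on sector \<phi>"
    and bound: "\<And>m. 0 < m \<Longrightarrow> \<exists>A. \<forall>y\<in>sector \<phi>. m \<le> Re y \<longrightarrow> norm (f y) \<le> A * exp (Re (cis \<omega> * y))"
begin

abbreviation I :: "complex \<Rightarrow> complex" where "I \<equiv> ray_integral \<omega> f"

lemma \<omega>0: "0 < \<omega>" using \<omega>(1) pi_gt_zero by linarith

lemma cos2: "cos (2 * \<omega>) < 0"
proof -
  have "0 < sin (2 * \<omega> - pi/2)" using \<omega> by (intro sin_gt_zero) auto
  then show ?thesis by (simp add: sin_diff)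
qed

lemma cos1: "0 < cos \<omega>" using \<omega> \<omega>0 by (intro cos_gt_zero) auto

lemma measurable_ray:
  assumes "c * cis (- \<omega>) \<in> sector \<phi>"
  shows "(\<lambda>r. indicator {0<..} r *\<^sub>R (f (yray \<omega> c r) * cis (2 * \<omega>))) \<in> borel_measurable borel"
proof (rule borel_measurable_continuous_on_indicator)
  have "continuous_on {0<..} (\<lambda>r. f (yray \<omega> c r))"
  proof (rule continuous_on_compose2[OF holomorphic_on_imp_continuous_on[OF hol]])
    show "continuous_on {0<..} (yray \<omega> c)" unfolding yray_def by (intro continuous_intros)
    show "yray \<omega> c ` {0<..} \<subseteq> sector \<phi>" using assms \<omega> \<omega>0 by (auto intro!: yray_sector)
  qed
  then show "continuous_on {0<..} (\<lambda>r. f (yray \<omega> c r) * cis (2 * \<omega>))" by (intro continuous_intros)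
qed simp

lemma local_bound:
  assumes "0 < c0"
  obtains \<delta> A where "0 < \<delta>" "0 \<le> A" "\<And>c. c \<in> ball (of_real c0) \<delta> \<Longrightarrow> c * cis (- \<omega>) \<in> sector \<phi>"
    "\<And>c r. c \<in> ball (of_real c0) \<delta> \<Longrightarrow> 0 \<le> r \<Longrightarrow> norm (f (yray \<omega> c r)) \<le> A * exp (- (- cos (2 * \<omega>) * r))"
proof -
  have "of_real c0 * cis (- \<omega>) \<in> sector \<phi>" using assms \<omega> \<omega>0 by (intro sector_scale cis_in_sector) auto
  then obtain d where d: "0 < d" "ball (of_real c0 * cis (- \<omega>)) d \<subseteq> sector \<phi>"
    using open_sector by (meson open_contains_ball)
  define m where "m = c0 * cos \<omega> / 2"
  have m: "0 < m" using assms cos1 by (simp add: m_def)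
  obtain A where A: "\<And>y. y \<in> sector \<phi> \<Longrightarrow> m \<le> Re y \<Longrightarrow> norm (f y) \<le> A * exp (Re (cis \<omega> * y))"
    using bound[OF m] by blast
  define \<delta> where "\<delta> = min d m"
  have c1: "c * cis (- \<omega>) \<in> sector \<phi>" if "c \<in> ball (of_real c0) \<delta>" for c
  proof -
    have "norm (of_real c0 * cis (- \<omega>) - c * cis (- \<omega>)) = norm (of_real c0 - c)"
      by (simp add: left_diff_distrib[symmetric] norm_mult)
    then show ?thesis using that d(2) by (auto simp: \<delta>_def dist_norm)
  qed
  show thesis
  proof (rule that[OF _ _ c1])
    show "0 < \<delta>" using d m by (simp add: \<delta>_def)
    show "0 \<le> \<bar>A\<bar> * exp (c0 + m)" by simp
    fix c :: complex and r :: real assume c: "c \<in> ball (of_real c0) \<delta>" and r: "0 \<le> r"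
    have nc: "norm (of_real c0 - c) \<le> m" using c by (simp add: \<delta>_def dist_norm)
    have "Re (of_real c0 * cis (- \<omega>)) - Re (c * cis (- \<omega>)) \<le> norm (of_real c0 * cis (- \<omega>) - c * cis (- \<omega>))"
      using complex_Re_le_cmod[of "of_real c0 * cis (- \<omega>) - c * cis (- \<omega>)"] by simp
    also have "\<dots> \<le> m" using nc by (simp add: left_diff_distrib[symmetric] norm_mult)
    finally have "m \<le> Re (c * cis (- \<omega>))" by (simp add: m_def)
    moreover have "0 \<le> r * cos \<omega>" using r cos1 by simp
    ultimately have "m \<le> Re (yray \<omega> c r)" by (simp add: yray_def)
    then have "norm (f (yray \<omega> c r)) \<le> A * exp (Re (cis \<omega> * yray \<omega> c r))"
      using c1[OF c] r \<omega> \<omega>0 by (intro A yray_sector) auto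
    also have "\<dots> \<le> \<bar>A\<bar> * exp (Re (cis \<omega> * yray \<omega> c r))"
      by (intro mult_right_mono) auto
    also have "Re (cis \<omega> * yray \<omega> c r) = Re c + r * cos (2 * \<omega>)"
      by (simp add: cis_times_yray)
    also have "\<bar>A\<bar> * exp (Re c + r * cos (2 * \<omega>)) \<le> \<bar>A\<bar> * exp ((c0 + m) + r * cos (2 * \<omega>))"
      using nc complex_Re_le_cmod[of "c - of_real c0"] by (intro mult_left_mono) (auto simp: norm_minus_commute)
    finally show "norm (f (yray \<omega> c r)) \<le> \<bar>A\<bar> * exp (c0 + m) * exp (- (- cos (2 * \<omega>) * r))"
      by (simp add: exp_add mult_ac)
  qed
qed

lemma set_integrable_ray:
  assumes "0 < c"
  shows "set_integrable lborel {0<..} (\<lambda>r. f (yray \<omega> (of_real c) r) * cis (2 * \<omega>))"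
proof -
  obtain \<delta> A where dA: "0 < \<delta>" "0 \<le> A" "\<And>c'. c' \<in> ball (of_real c) \<delta> \<Longrightarrow> c' * cis (- \<omega>) \<in> sector \<phi>"
    "\<And>c' r. c' \<in> ball (of_real c) \<delta> \<Longrightarrow> 0 \<le> r \<Longrightarrow> norm (f (yray \<omega> c' r)) \<le> A * exp (- (- cos (2 * \<omega>) * r))"
    using local_bound[OF assms] by blast
  have "integrable lborel (\<lambda>r. A * (indicator {0<..} r *\<^sub>R exp (- (- cos (2 * \<omega>) * r))))"
    using set_integrable_exp_decay[of "- cos (2 * \<omega>)"] cos2 unfolding set_integrable_def by simp
  then show ?thesis unfolding set_integrable_def
    by (rule Bochner_Integration.integrable_bound)
       (use dA measurable_ray in \<open>auto simp: norm_mult indicator_def\<close>)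
qed

text \<open>The derivative of the integrand in the starting point \<open>c\<close> is, up to a constant, its derivative in the
parameter \<open>r\<close>. Hence it integrates to a boundary term. This replaces Cauchy's theorem for unbounded
contours.\<close>

lemma
  assumes c0: "0 < c0"
  shows I_DERIV: "(I has_field_derivative - f (of_real c0 * cis (- \<omega>))) (at (of_real c0))"
    and ray_FTC: "(LINT r:{0<..}|lborel. deriv f (yray \<omega> (of_real c0) r) * cis \<omega>) = - f (of_real c0 * cis (- \<omega>))"
proof -
  obtain \<delta> A where dA: "0 < \<delta>" "0 \<le> A" "\<And>c. c \<in> ball (of_real c0) \<delta> \<Longrightarrow> c * cis (- \<omega>) \<in> sector \<phi>"
    "\<And>c r. c \<in> ball (of_real c0) \<delta> \<Longrightarrow> 0 \<le> r \<Longrightarrow> norm (f (yray \<omega> c r)) \<le> A * exp (- (- cos (2 * \<omega>) * r))"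
    using local_bound[OF c0] by blast
  define F where "F = (\<lambda>c r. indicator {0<..} r *\<^sub>R (f (yray \<omega> c r) * cis (2 * \<omega>)))"
  define g where "g = (\<lambda>r. A * (indicator {0<..} r *\<^sub>R exp (- (- cos (2 * \<omega>) * r))))"
  have gi: "integrable lborel g"
    using set_integrable_exp_decay[of "- cos (2 * \<omega>)"] cos2 unfolding set_integrable_def g_def by simp
  have Fm: "F c \<in> borel_measurable lborel" if "c \<in> ball (of_real c0) \<delta>" for c
    using measurable_ray[OF dA(3)[OF that]] by (simp add: F_def)
  have cone: "yray \<omega> c r \<in> sector \<phi>" if "c \<in> ball (of_real c0) \<delta>" "0 \<le> r" for c r
    using that dA \<omega> \<omega>0 by (intro yray_sector) auto
  have fd: "(f has_field_derivative deriv f y) (at y)" if "y \<in> sector \<phi>" for y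
    using holomorphic_derivI[OF hol open_sector that] .
  have Fd: "((\<lambda>c. F c r) has_field_derivative indicator {0<..} r *\<^sub>R (deriv f (yray \<omega> c r) * cis \<omega>)) (at c)"
    if "c \<in> ball (of_real c0) \<delta>" for c r
  proof (cases "0 < r")
    case True
    have "((\<lambda>c. f (yray \<omega> c r) * cis (2 * \<omega>)) has_field_derivative (deriv f (yray \<omega> c r) * cis (- \<omega>)) * cis (2 * \<omega>)) (at c)"
      using True that by (intro DERIV_cmult_right DERIV_chain2[OF fd yray_DERIV(1)] cone) auto
    then show ?thesis using True by (simp add: F_def mult.assoc cis_mult)
  qed (simp add: F_def)
  have Fh: "(\<lambda>c. F c r) holomorphic_on ball (of_real c0) \<delta>" for r
    using Fd unfolding holomorphic_on_open[OF open_ball] by blast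
  have Fb: "norm (F c r) \<le> g r" if "c \<in> ball (of_real c0) \<delta>" for c r
    using dA(4)[OF that, of r] by (auto simp: F_def g_def norm_mult indicator_def)
  have dF: "deriv (\<lambda>c. F c r) (of_real c0) = indicator {0<..} r *\<^sub>R (deriv f (yray \<omega> (of_real c0) r) * cis \<omega>)" for r
    using Fd[of "of_real c0" r] dA(1) by (intro DERIV_imp_deriv) auto
  note D = has_field_derivative_integral_param[where F=F and M=lborel, OF dA(1) Fm Fh Fb gi, unfolded dF]
  note Di = integrable_deriv_param[where F=F and M=lborel, OF dA(1) Fm Fh Fb gi, unfolded dF]
  let ?G = "\<lambda>r. f (yray \<omega> (of_real c0) r)"
  have c0b: "of_real c0 \<in> ball (of_real c0 :: complex) \<delta>" using dA(1) by simp
  have ei: "einterval 0 \<infinity> = {0::real<..}" by (auto simp: einterval_def)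
  have "(LBINT r=0..\<infinity>. deriv f (yray \<omega> (of_real c0) r) * cis \<omega>) = 0 - ?G 0"
  proof (rule interval_integral_FTC_integrable)
    show "(0::ereal) < \<infinity>" by simp
    fix r assume r: "0 < ereal r" "ereal r < \<infinity>"
    have y: "yray \<omega> (of_real c0) r \<in> sector \<phi>" using r c0b by (intro cone) auto
    show "(?G has_vector_derivative deriv f (yray \<omega> (of_real c0) r) * cis \<omega>) (at r)"
      using field_vector_diff_chain_at[OF yray_DERIV(2) fd[OF y]] by (simp add: o_def mult.commute)
    show "isCont (\<lambda>r. deriv f (yray \<omega> (of_real c0) r) * cis \<omega>) r"
    proof (rule isCont_mult[OF isCont_o2[where f="yray \<omega> (of_real c0)" and g="deriv f"] continuous_const])
      show "isCont (yray \<omega> (of_real c0)) r" unfolding yray_def by (intro continuous_intros)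
      show "isCont (deriv f) (yray \<omega> (of_real c0) r)"
        by (rule DERIV_isCont[OF holomorphic_derivI[OF holomorphic_deriv[OF hol open_sector] open_sector y]])
    qed
  next
    show "set_integrable lborel (einterval 0 \<infinity>) (\<lambda>r. deriv f (yray \<omega> (of_real c0) r) * cis \<omega>)"
      unfolding ei set_integrable_def by (rule Di)
    have y0: "yray \<omega> (of_real c0) 0 \<in> sector \<phi>" using c0b by (intro cone) auto
    have "isCont (\<lambda>r. f (yray \<omega> (of_real c0) r)) 0"
    proof (rule isCont_o2[where f="yray \<omega> (of_real c0)" and g=f])
      show "isCont (yray \<omega> (of_real c0)) 0" unfolding yray_def by (intro continuous_intros)
      show "isCont f (yray \<omega> (of_real c0) 0)" using fd[OF y0] by (rule DERIV_isCont)
    qed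
    then have "(?G \<longlongrightarrow> ?G 0) (at_right 0)" unfolding isCont_def using filterlim_at_split by blast
    then show "((?G \<circ> real_of_ereal) \<longlongrightarrow> ?G 0) (at_right 0)"
      by (simp add: zero_ereal_def ereal_tendsto_simps)
    have "(?G \<longlongrightarrow> 0) at_top"
    proof (rule Lim_null_comparison)
      show "\<forall>\<^sub>F r in at_top. norm (?G r) \<le> A * exp (- (- cos (2 * \<omega>) * r))"
        using eventually_ge_at_top[of 0] by eventually_elim (use dA(4) c0b in auto)
      have "((\<lambda>r. A * exp (- (d * r))) \<longlongrightarrow> 0) at_top" if "0 < d" for d :: real
        using that by real_asymp
      from this[of "- cos (2 * \<omega>)"] cos2
      show "((\<lambda>r. A * exp (- (- cos (2 * \<omega>) * r))) \<longlongrightarrow> 0) at_top" by linarith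
    qed
    then show "((?G \<circ> real_of_ereal) \<longlongrightarrow> 0) (at_left \<infinity>)"
      by (simp add: ereal_tendsto_simps)
  qed
  moreover have "(LBINT r=0..\<infinity>. deriv f (yray \<omega> (of_real c0) r) * cis \<omega>) =
     (\<integral>r. indicator {0<..} r *\<^sub>R (deriv f (yray \<omega> (of_real c0) r) * cis \<omega>) \<partial>lborel)"
    unfolding interval_lebesgue_integral_def set_lebesgue_integral_def ei by simp
  moreover have "?G 0 = f (of_real c0 * cis (- \<omega>))" by (simp add: yray_def)
  ultimately have eq: "(\<integral>r. indicator {0<..} r *\<^sub>R (deriv f (yray \<omega> (of_real c0) r) * cis \<omega>) \<partial>lborel) = - f (of_real c0 * cis (- \<omega>))"
    by (simp only: diff_0)
  then show "(LINT r:{0<..}|lborel. deriv f (yray \<omega> (of_real c0) r) * cis \<omega>) = - f (of_real c0 * cis (- \<omega>))"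
    unfolding set_lebesgue_integral_def .
  have "I = (\<lambda>c. \<integral>r. F c r \<partial>lborel)" by (intro ext) (simp only: ray_integral_def F_def set_lebesgue_integral_def)
  then show "(I has_field_derivative - f (of_real c0 * cis (- \<omega>))) (at (of_real c0))" using D eq by simp
qed

text \<open>If the integrand is real at the starting points, the boundary term does not contribute to the imaginary part.\<close>

lemma Im_I_const:
  assumes real: "\<And>c. 0 < c \<Longrightarrow> Im (f (of_real c * cis (- \<omega>))) = 0" and c: "0 < c1" "0 < c2"
  shows "Im (I (of_real c1)) = Im (I (of_real c2))"
proof -
  have "\<exists>k. \<forall>x\<in>{0<..}. Im (I (of_real x)) = k"
  proof (rule has_field_derivative_zero_constant)
    fix x :: real assume "x \<in> {0<..}"
    then have "((\<lambda>x. I (of_real x)) has_vector_derivative - f (of_real x * cis (- \<omega>))) (at x)"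
      by (intro has_vector_derivative_real_field I_DERIV) auto
    then have "((\<lambda>x. Im (I (of_real x))) has_vector_derivative Im (- f (of_real x * cis (- \<omega>)))) (at x)"
      by (rule bounded_linear.has_vector_derivative[OF bounded_linear_Im])
    then show "((\<lambda>x. Im (I (of_real x))) has_field_derivative 0) (at x within {0<..})"
      using real[of x] \<open>x \<in> {0<..}\<close>
      by (auto simp: has_real_derivative_iff_has_vector_derivative intro: has_vector_derivative_at_within)
  qed auto
  then show ?thesis using c by auto
qed

end

text \<open>The function \<open>exp z / z\<^sup>b\<close> in the rotated variable \<open>z = cis \<omega> * y\<close>. The power is
split into \<open>cis (- (b \<omega>))\<close> and \<open>y\<close> to the power \<open>-b\<close>, so that it is only taken in the right half plane.\<close>

definition hankel_integrand :: "real \<Rightarrow> real \<Rightarrow> complex \<Rightarrow> complex" where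
  "hankel_integrand \<omega> b y = exp (cis \<omega> * y) * cis (- (b * \<omega>)) * y powr of_real (- b)"

lemma norm_hankel_integrand:
  "y \<noteq> 0 \<Longrightarrow> norm (hankel_integrand \<omega> b y) = exp (Re (cis \<omega> * y)) * norm y powr (- b)"
  unfolding hankel_integrand_def norm_mult norm_powr_of_real by (simp add: norm_exp_eq_Re)

lemma sector_norm_ge: "y \<in> sector \<phi> \<Longrightarrow> m \<le> Re y \<Longrightarrow> m \<le> norm y"
  using complex_Re_le_cmod[of y] by linarith

lemma ray_integrand_hankel:
  assumes "pi / 4 < \<omega>" "\<omega> < \<phi>" "\<phi> < pi / 2" "0 \<le> b"
  shows "ray_integrand \<omega> \<phi> (hankel_integrand \<omega> b)"
proof
  show "hankel_integrand \<omega> b holomorphic_on sector \<phi>"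
    unfolding hankel_integrand_def by (intro holomorphic_intros) (auto simp: sector_nonzero)
  show "\<exists>A. \<forall>y\<in>sector \<phi>. m \<le> Re y \<longrightarrow> norm (hankel_integrand \<omega> b y) \<le> A * exp (Re (cis \<omega> * y))" if m: "0 < m" for m
  proof (intro exI[of _ "m powr (- b)"] ballI impI)
    fix y assume y: "y \<in> sector \<phi>" "m \<le> Re y"
    have "norm y powr (- b) \<le> m powr (- b)"
      using sector_norm_ge[OF y] m assms by (intro powr_mono2') auto
    then show "norm (hankel_integrand \<omega> b y) \<le> m powr (- b) * exp (Re (cis \<omega> * y))"
      unfolding norm_hankel_integrand[OF sector_nonzero(1)[OF y(1)]] by (simp add: mult.commute mult_right_mono)
  qed
qed (use assms in auto)

lemma hankel_integrand_real:
  assumes "0 < \<omega>" "\<omega> < pi" "0 < c"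
  shows "hankel_integrand \<omega> b (of_real c * cis (- \<omega>)) = of_real (exp c * c powr (- b))"
proof -
  have "cis \<omega> * (of_real c * cis (- \<omega>)) = of_real c" by (simp add: cis_mult mult.left_commute[of "cis \<omega>"])
  then have "hankel_integrand \<omega> b (of_real c * cis (- \<omega>)) = exp (of_real c) * cis (- (b * \<omega>)) * (of_real c * cis (- \<omega>)) powr of_real (- b)"
    unfolding hankel_integrand_def by (simp only:)
  also have "(of_real c * cis (- \<omega>)) powr of_real (- b) = of_real (c powr (- b)) * cis (- b * (- \<omega>))"
    using assms by (intro cis_powr) auto
  finally show ?thesis by (simp add: cis_mult exp_of_real mult.left_commute)
qed

lemma deriv_hankel_integrand:
  assumes "y \<in> sector \<phi>"
  shows "deriv (hankel_integrand \<omega> b) y = cis \<omega> * (hankel_integrand \<omega> b y - of_real b * hankel_integrand \<omega> (b + 1) y)"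
proof (rule DERIV_imp_deriv)
  note [simp] = sector_nonzero[OF assms]
  have "((\<lambda>y. exp (cis \<omega> * y) * cis (- (b * \<omega>)) * y powr of_real (- b)) has_field_derivative
     exp (cis \<omega> * y) * cis \<omega> * cis (- (b * \<omega>)) * y powr of_real (- b)
      + exp (cis \<omega> * y) * cis (- (b * \<omega>)) * (of_real (- b) * y powr (of_real (- b) - 1))) (at y)"
    by (auto intro!: derivative_eq_intros simp del: of_real_minus)
  moreover have cis_split: "cis (- (b * \<omega>)) = cis \<omega> * cis (- ((b + 1) * \<omega>))" by (simp add: cis_mult algebra_simps)
  moreover have exponent: "of_real (- b) - 1 = (of_real (- (b + 1)) :: complex)" by simp
  have "e * c * k * P + e * k * (of_real (- b) * Q) = c * (e * k * P - of_real b * (e * l * Q))"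
    if "k = c * l" for e c k l P Q :: complex
    using that by (simp add: algebra_simps)
  note this[OF cis_split]
  ultimately show "(hankel_integrand \<omega> b has_field_derivative cis \<omega> * (hankel_integrand \<omega> b y - of_real b * hankel_integrand \<omega> (b + 1) y)) (at y)"
    unfolding hankel_integrand_def[abs_def] exponent by (simp only:)
qed

text \<open>Integration by parts; the boundary term is real because the integrand is real on the positive axis.\<close>

lemma hankel_recurrence:
  assumes \<omega>: "pi / 4 < \<omega>" "\<omega> < \<phi>" "\<phi> < pi / 2" and b: "0 \<le> b" and c: "0 < c"
  shows "Im (ray_integral \<omega> (hankel_integrand \<omega> b) (of_real c)) = b * Im (ray_integral \<omega> (hankel_integrand \<omega> (b + 1)) (of_real c))"
proof -
  interpret A: ray_integrand \<omega> \<phi> "hankel_integrand \<omega> b" by (intro ray_integrand_hankel \<omega> b)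
  interpret B: ray_integrand \<omega> \<phi> "hankel_integrand \<omega> (b + 1)" using b by (intro ray_integrand_hankel \<omega>) auto
  have i: "set_integrable lborel {0<..} (\<lambda>r. of_real b * (hankel_integrand \<omega> (b + 1) (yray \<omega> (of_real c) r) * cis (2 * \<omega>)))"
    using B.set_integrable_ray[OF c] by (rule set_integrable_mult_right)
  have "ray_integral \<omega> (hankel_integrand \<omega> b) (of_real c) - of_real b * ray_integral \<omega> (hankel_integrand \<omega> (b + 1)) (of_real c)
     = (LINT r:{0<..}|lborel. hankel_integrand \<omega> b (yray \<omega> (of_real c) r) * cis (2 * \<omega>)
          - of_real b * (hankel_integrand \<omega> (b + 1) (yray \<omega> (of_real c) r) * cis (2 * \<omega>)))"
    unfolding ray_integral_def set_integral_diff(2)[OF A.set_integrable_ray[OF c] i] set_integral_mult_right ..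
  also have "\<dots> = (LINT r:{0<..}|lborel. deriv (hankel_integrand \<omega> b) (yray \<omega> (of_real c) r) * cis \<omega>)"
  proof (rule set_lebesgue_integral_cong)
    show "\<forall>r. r \<in> {0<..} \<longrightarrow> hankel_integrand \<omega> b (yray \<omega> (of_real c) r) * cis (2 * \<omega>)
          - of_real b * (hankel_integrand \<omega> (b + 1) (yray \<omega> (of_real c) r) * cis (2 * \<omega>)) = deriv (hankel_integrand \<omega> b) (yray \<omega> (of_real c) r) * cis \<omega>"
    proof (intro allI impI)
      fix r :: real assume "r \<in> {0<..}"
      then have y: "yray \<omega> (of_real c) r \<in> sector \<phi>" using \<omega> A.\<omega>0 c by (intro yray_sector_real) auto
      have "cis (2 * \<omega>) = cis \<omega> * cis \<omega>" by (simp add: cis_mult)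
      then show "hankel_integrand \<omega> b (yray \<omega> (of_real c) r) * cis (2 * \<omega>)
          - of_real b * (hankel_integrand \<omega> (b + 1) (yray \<omega> (of_real c) r) * cis (2 * \<omega>)) = deriv (hankel_integrand \<omega> b) (yray \<omega> (of_real c) r) * cis \<omega>"
        unfolding deriv_hankel_integrand[OF y] by (simp add: algebra_simps)
    qed
  qed simp
  also have "\<dots> = - of_real (exp c * c powr (- b))"
    using A.ray_FTC[OF c] hankel_integrand_real[of \<omega> c b] A.\<omega>0 \<omega> c by simp
  finally have "Im (ray_integral \<omega> (hankel_integrand \<omega> b) (of_real c) - of_real b * ray_integral \<omega> (hankel_integrand \<omega> (b + 1)) (of_real c)) = 0"
    by simp
  then show ?thesis by simp
qed

lemma tendsto_hankel_integrand:
  assumes "(Y \<longlongrightarrow> y) F" "(b \<longlongrightarrow> b0) F" "y \<notin> \<real>\<^sub>\<le>\<^sub>0"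
  shows "((\<lambda>k. hankel_integrand \<omega> (b k) (Y k)) \<longlongrightarrow> hankel_integrand \<omega> b0 y) F"
proof -
  have "((\<lambda>k. cis (- (b k * \<omega>))) \<longlongrightarrow> cis (- (b0 * \<omega>))) F"
    unfolding cis_conv_exp by (intro tendsto_intros assms)
  then show ?thesis
    unfolding hankel_integrand_def
    using assms by (intro tendsto_intros tendsto_powr_complex) auto
qed

text \<open>For \<open>b < 1\<close> the singularity at the origin is integrable. The starting point is moved to the origin, where
the integral is a complex Gamma integral, and the reflection formula evaluates its imaginary part.\<close>

lemma hankel_formula_0_1:
  assumes \<omega>: "pi / 4 < \<omega>" "\<omega> < \<phi>" "\<phi> < pi / 2" and b: "0 < b" "b < 1" and c: "0 < c"
  shows "Im (ray_integral \<omega> (hankel_integrand \<omega> b) (of_real c)) = pi / Gamma b"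
proof -
  interpret A: ray_integrand \<omega> \<phi> "hankel_integrand \<omega> b" using b by (intro ray_integrand_hankel \<omega>) auto
  define f where "f = (\<lambda>c r. indicator {0<..} r *\<^sub>R (hankel_integrand \<omega> b (yray \<omega> (of_real c) r) * cis (2 * \<omega>)))"
  define d where "d = - cos (2 * \<omega>)"
  have d: "0 < d" using A.cos2 by (simp add: d_def)
  define g where "g = (\<lambda>r. (exp 1 * cos \<omega> powr (- b)) * (indicator {0<..} r *\<^sub>R (r powr ((1 - b) - 1) * exp (- (d * r)))))"
  define w where "w = - cis (2 * \<omega>)"
  define K where "K = cis (2 * \<omega> - 2 * (b * \<omega>))"
  have w: "0 < Re w" using A.cos2 by (simp add: w_def)
  have f0: "f 0 r = K * (indicator {0<..} r *\<^sub>R (of_real (r powr ((1 - b) - 1)) * exp (- (w * of_real r))))" for r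
  proof (cases "0 < r")
    case True
    have y: "yray \<omega> 0 r = of_real r * cis \<omega>" by (simp add: yray_def)
    have "(of_real r * cis \<omega>) powr of_real (- b) = of_real (r powr (- b)) * cis (- b * \<omega>)"
      using True A.\<omega>0 \<omega> by (intro cis_powr) auto
    moreover have "cis \<omega> * (of_real r * cis \<omega>) = - (w * of_real r)" by (simp add: w_def cis_mult algebra_simps flip: mult.assoc)
    moreover have "cis (- (b * \<omega>)) * cis (- b * \<omega>) * cis (2 * \<omega>) = K" by (simp add: K_def cis_mult algebra_simps)
    ultimately show ?thesis using True unfolding f_def of_real_0 y hankel_integrand_def
      by (simp add: mult_ac)
  qed (simp add: f_def)
  have gi: "integrable lborel g"
    using set_integrable_Gamma_real[of "1 - b" d] b d unfolding g_def set_integrable_def by simp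
  have fm: "f c \<in> borel_measurable lborel" if "0 < c" for c
  proof -
    have "of_real c * cis (- \<omega>) \<in> sector \<phi>" using that \<omega> A.\<omega>0 by (intro sector_scale cis_in_sector) auto
    from A.measurable_ray[OF this] show ?thesis by (simp add: f_def)
  qed
  have fb: "norm (f c r) \<le> g r" if c: "0 < c" "c \<le> 1" for c r
  proof (cases "0 < r")
    case True
    have y: "yray \<omega> (of_real c) r \<in> sector \<phi>" using \<omega> A.\<omega>0 c True by (intro yray_sector_real) auto
    have "r * cos \<omega> \<le> norm (yray \<omega> (of_real c) r)"
      using y Re_yray_real[of \<omega> c r] c A.cos1 by (intro sector_norm_ge) (auto simp: algebra_simps)
    then have "norm (yray \<omega> (of_real c) r) powr (- b) \<le> (r * cos \<omega>) powr (- b)"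
      using b True A.cos1 by (intro powr_mono2') auto
    also have "\<dots> = r powr (- b) * cos \<omega> powr (- b)" using True A.cos1 by (simp add: powr_mult)
    finally have 1: "norm (yray \<omega> (of_real c) r) powr (- b) \<le> r powr (- b) * cos \<omega> powr (- b)" .
    have 2: "exp (Re (cis \<omega> * yray \<omega> (of_real c) r)) \<le> exp (1 + - (d * r))"
      unfolding cis_times_yray using c by (simp add: d_def)
    have "norm (f c r) = exp (Re (cis \<omega> * yray \<omega> (of_real c) r)) * norm (yray \<omega> (of_real c) r) powr (- b)"
      using True by (simp add: f_def norm_mult norm_hankel_integrand[OF sector_nonzero(1)[OF y]])
    also have "\<dots> \<le> exp (1 + - (d * r)) * (r powr (- b) * cos \<omega> powr (- b))"
      using 1 2 by (intro mult_mono) auto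
    also have "\<dots> = g r" using True unfolding exp_add by (simp add: g_def mult_ac)
    finally show ?thesis .
  qed (simp add: f_def g_def)
  define C where "C = (\<lambda>k::nat. 1 / (real k + 1))"
  have C: "0 < C k" "C k \<le> 1" for k by (auto simp: C_def)
  have C0: "C \<longlonglongrightarrow> 0" unfolding C_def by real_asymp
  have lim: "(\<lambda>k. f (C k) r) \<longlonglongrightarrow> f 0 r" for r
  proof (cases "0 < r")
    case True
    have "(\<lambda>k. hankel_integrand \<omega> b (yray \<omega> (of_real (C k)) r)) \<longlonglongrightarrow> hankel_integrand \<omega> b (yray \<omega> (of_real 0) r)"
    proof (rule tendsto_hankel_integrand)
      show "(\<lambda>k. yray \<omega> (of_real (C k)) r) \<longlonglongrightarrow> yray \<omega> (of_real 0) r"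
        unfolding yray_def by (intro tendsto_intros C0)
      have "of_real r * cis \<omega> \<in> sector \<phi>" using True \<omega> A.\<omega>0 by (intro sector_scale cis_in_sector) auto
      then show "yray \<omega> (of_real 0) r \<notin> \<real>\<^sub>\<le>\<^sub>0" by (auto simp: yray_def dest: sector_nonzero)
    qed auto
    then show ?thesis unfolding f_def by (intro tendsto_intros) auto
  qed (simp add: f_def)
  have "(\<lambda>k. \<integral>r. f (C k) r \<partial>lborel) \<longlonglongrightarrow> (\<integral>r. f 0 r \<partial>lborel)"
  proof (rule integral_dominated_convergence)
    show "f 0 \<in> borel_measurable lborel" unfolding f0[abs_def] by measurable
  qed (use fm fb C lim gi in auto)
  then have "(\<lambda>k. Im (\<integral>r. f (C k) r \<partial>lborel)) \<longlonglongrightarrow> Im (\<integral>r. f 0 r \<partial>lborel)" by (rule tendsto_Im)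
  moreover have "Im (\<integral>r. f (C k) r \<partial>lborel) = Im (ray_integral \<omega> (hankel_integrand \<omega> b) (of_real c))" for k
  proof -
    have "(\<integral>r. f (C k) r \<partial>lborel) = ray_integral \<omega> (hankel_integrand \<omega> b) (of_real (C k))"
      by (simp only: f_def ray_integral_def set_lebesgue_integral_def)
    then show ?thesis
      using A.Im_I_const[of "C k" c] C c hankel_integrand_real[of \<omega> _ b] A.\<omega>0 \<omega> by simp
  qed
  ultimately have "Im (ray_integral \<omega> (hankel_integrand \<omega> b) (of_real c)) = Im (\<integral>r. f 0 r \<partial>lborel)"
    by (simp add: LIMSEQ_const_iff)
  also have "(\<integral>r. f 0 r \<partial>lborel) = K * (of_real (Gamma (1 - b)) * w powr of_real (- (1 - b)))"
  proof -
    have "(\<integral>r. f 0 r \<partial>lborel) = K * (LINT r:{0<..}|lborel. of_real (r powr ((1 - b) - 1)) * exp (- (w * of_real r)))"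
      unfolding f0 set_lebesgue_integral_def by (rule integral_mult_right_zero)
    also have "(LINT r:{0<..}|lborel. of_real (r powr ((1 - b) - 1)) * exp (- (w * of_real r))) = of_real (Gamma (1 - b)) * w powr of_real (- (1 - b))"
      using b w by (intro Gamma_integral_scaled_complex) auto
    finally show ?thesis .
  qed
  also have "w powr of_real (- (1 - b)) = cis (- (1 - b) * (2 * \<omega> - pi))"
  proof -
    have "w = of_real 1 * cis (2 * \<omega> - pi)" by (simp add: w_def complex_eq_iff cos_diff sin_diff)
    also have "\<dots> powr of_real (- (1 - b)) = of_real (1 powr (- (1 - b))) * cis (- (1 - b) * (2 * \<omega> - pi))"
      using \<omega> A.\<omega>0 by (intro cis_powr) auto
    finally show ?thesis by simp
  qed
  also have "K * (of_real (Gamma (1 - b)) * cis (- (1 - b) * (2 * \<omega> - pi))) = of_real (Gamma (1 - b)) * cis (pi - pi * b)"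
    by (simp add: K_def cis_mult algebra_simps flip: mult.assoc)
  also have "Im \<dots> = Gamma (1 - b) * sin (pi * b)" by simp
  also have "\<dots> = pi / Gamma b"
  proof -
    have "of_real (Gamma b * Gamma (1 - b)) = (of_real (pi / sin (pi * b)) :: complex)"
    proof -
      have "Gamma (1 - complex_of_real b) = of_real (Gamma (1 - b))"
        using Gamma_complex_of_real[of "1 - b"] by simp
      then show ?thesis
        using Gamma_reflection_complex[of "of_real b"] by (simp add: Gamma_complex_of_real sin_of_real flip: of_real_mult)
    qed
    then have "Gamma b * Gamma (1 - b) = pi / sin (pi * b)" by (simp only: of_real_eq_iff)
    moreover have "0 < sin (pi * b)" using b by (intro sin_gt_zero) (auto simp: field_simps)
    ultimately show ?thesis using Gamma_real_pos[OF b(1)] by (simp add: field_simps)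
  qed
  finally show ?thesis .
qed

text \<open>The limit of the previous case as \<open>b\<close> increases to \<open>1\<close>.\<close>

lemma hankel_formula_1:
  assumes \<omega>: "pi / 4 < \<omega>" "\<omega> < \<phi>" "\<phi> < pi / 2" and c: "0 < c"
  shows "Im (ray_integral \<omega> (hankel_integrand \<omega> 1) (of_real c)) = pi / Gamma 1"
proof -
  interpret A: ray_integrand \<omega> \<phi> "hankel_integrand \<omega> 1" by (intro ray_integrand_hankel \<omega>) auto
  define f where "f = (\<lambda>b r. indicator {0<..} r *\<^sub>R (hankel_integrand \<omega> b (yray \<omega> (of_real c) r) * cis (2 * \<omega>)))"
  define m where "m = min 1 (c * cos \<omega>)"
  have m: "0 < m" "m \<le> 1" "m \<le> c * cos \<omega>" using c A.cos1 by (auto simp: m_def)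
  define B where "B = (\<lambda>k::nat. 1 - 1 / (real k + 2))"
  have B: "0 < B k" "B k < 1" for k by (auto simp: B_def field_simps)
  have B1: "B \<longlonglongrightarrow> 1" unfolding B_def by real_asymp
  define d where "d = - cos (2 * \<omega>)"
  have d: "0 < d" using A.cos2 by (simp add: d_def)
  define g where "g = (\<lambda>r. (exp c / m) * (indicator {0<..} r *\<^sub>R exp (- (d * r))))"
  have fm: "f b \<in> borel_measurable lborel" if "0 \<le> b" for b
  proof -
    interpret B: ray_integrand \<omega> \<phi> "hankel_integrand \<omega> b" by (intro ray_integrand_hankel \<omega> that)
    have "of_real c * cis (- \<omega>) \<in> sector \<phi>" using c \<omega> A.\<omega>0 by (intro sector_scale cis_in_sector) auto
    from B.measurable_ray[OF this] show ?thesis by (simp add: f_def)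
  qed
  have y: "yray \<omega> (of_real c) r \<in> sector \<phi>" if "0 < r" for r using \<omega> A.\<omega>0 c that by (intro yray_sector_real) auto
  have fb: "norm (f b r) \<le> g r" if b: "0 < b" "b < 1" for b r
  proof (cases "0 < r")
    case True
    have "c * cos \<omega> \<le> (c + r) * cos \<omega>" using True A.cos1 by (intro mult_right_mono) auto
    then have "m \<le> norm (yray \<omega> (of_real c) r)"
      using y[OF True] Re_yray_real[of \<omega> c r] m by (intro sector_norm_ge) auto
    then have "norm (yray \<omega> (of_real c) r) powr (- b) \<le> m powr (- b)"
      using b m by (intro powr_mono2') auto
    also have "\<dots> \<le> m powr (- 1)" using b m by (intro powr_mono') auto
    finally have 1: "norm (yray \<omega> (of_real c) r) powr (- b) \<le> 1 / m" using m by (simp add: powr_minus divide_inverse)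
    have "norm (f b r) = exp (c - d * r) * norm (yray \<omega> (of_real c) r) powr (- b)"
      using True by (simp add: f_def norm_mult norm_hankel_integrand[OF sector_nonzero(1)[OF y]] cis_times_yray d_def)
    also have "\<dots> \<le> exp (c - d * r) * (1 / m)" using 1 by (intro mult_left_mono) auto
    also have "\<dots> = g r" using True unfolding exp_diff by (simp add: g_def exp_minus divide_inverse)
    finally show ?thesis .
  qed (simp add: f_def g_def)
  have "(\<lambda>k. \<integral>r. f (B k) r \<partial>lborel) \<longlonglongrightarrow> (\<integral>r. f 1 r \<partial>lborel)"
  proof (rule integral_dominated_convergence)
    show "integrable lborel g"
      using set_integrable_exp_decay[OF d] unfolding g_def set_integrable_def by simp
    show "AE r in lborel. (\<lambda>k. f (B k) r) \<longlonglongrightarrow> f 1 r"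
    proof (rule AE_I2)
      fix r
      show "(\<lambda>k. f (B k) r) \<longlonglongrightarrow> f 1 r"
      proof (cases "0 < r")
        case True
        have "(\<lambda>k. hankel_integrand \<omega> (B k) (yray \<omega> (of_real c) r)) \<longlonglongrightarrow> hankel_integrand \<omega> 1 (yray \<omega> (of_real c) r)"
          using y[OF True] by (intro tendsto_hankel_integrand B1) (auto dest: sector_nonzero)
        then show ?thesis unfolding f_def by (intro tendsto_intros) auto
      qed (simp add: f_def)
    qed
  qed (use fm fb B less_imp_le[OF B(1)] in auto)
  then have "(\<lambda>k. Im (\<integral>r. f (B k) r \<partial>lborel)) \<longlonglongrightarrow> Im (\<integral>r. f 1 r \<partial>lborel)" by (rule tendsto_Im)
  moreover have I: "(\<integral>r. f b r \<partial>lborel) = ray_integral \<omega> (hankel_integrand \<omega> b) (of_real c)" for b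
    by (simp only: f_def ray_integral_def set_lebesgue_integral_def)
  ultimately have "(\<lambda>k. pi / Gamma (B k)) \<longlonglongrightarrow> Im (ray_integral \<omega> (hankel_integrand \<omega> 1) (of_real c))"
    using hankel_formula_0_1[OF \<omega> B c] by simp
  moreover have "(\<lambda>k. pi / Gamma (B k)) \<longlonglongrightarrow> pi / Gamma 1"
    by (intro tendsto_intros B1) auto
  ultimately show ?thesis by (rule LIMSEQ_unique)
qed

text \<open>The recurrences of both sides in \<open>b\<close> agree, which reduces the claim to \<open>b \<le> 1\<close>.\<close>

theorem hankel_formula:
  assumes \<omega>: "pi / 4 < \<omega>" "\<omega> < \<phi>" "\<phi> < pi / 2" and b: "0 < b" and c: "0 < c"
  shows "Im (ray_integral \<omega> (hankel_integrand \<omega> b) (of_real c)) = pi / Gamma b"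
proof -
  have *: "Im (ray_integral \<omega> (hankel_integrand \<omega> b) (of_real c)) = pi / Gamma b" if "0 < b" "b \<le> real n + 1" for n b
    using that
  proof (induction n arbitrary: b)
    case 0
    then show ?case using hankel_formula_0_1[OF \<omega> _ _ c, of b] hankel_formula_1[OF \<omega> c] by (cases "b = 1") auto
  next
    case (Suc n)
    show ?case
    proof (cases "b \<le> 1")
      case True
      then show ?thesis using Suc.IH[of b] Suc.prems by simp
    next
      case False
      have "Im (ray_integral \<omega> (hankel_integrand \<omega> (b - 1)) (of_real c)) = pi / Gamma (b - 1)"
        using Suc.IH[of "b - 1"] Suc.prems False by simp
      moreover have "Gamma b = (b - 1) * Gamma (b - 1)"
        using Gamma_plus1[of "b - 1"] False by (auto simp: nonpos_Ints_def)
      moreover have "0 < Gamma (b - 1)" using False by (intro Gamma_real_pos) auto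
      moreover have "Im (ray_integral \<omega> (hankel_integrand \<omega> (b - 1)) (of_real c)) = (b - 1) * Im (ray_integral \<omega> (hankel_integrand \<omega> b) (of_real c))"
        using hankel_recurrence[OF \<omega> _ c, of "b - 1"] False by simp
      moreover have "X = pi / (e * G)" if "pi / G = e * X" "0 < G" "0 < e" for X G e :: real
        using that by (simp add: field_simps)
      ultimately show ?thesis using False by simp
    qed
  qed
  obtain n :: nat where "b \<le> real n" using real_arch_simple by blast
  then show ?thesis using b by (intro *[of _ n]) auto
qed


section \<open>The Mittag-Leffler function as a Laplace transform\<close>

text \<open>The function \<open>exp z\<close> times the quotient of \<open>z\<close> to the power \<open>\<gamma> - \<beta>\<close> and \<open>z\<^sup>\<gamma> + \<mu>\<close>, with
\<open>z = cis \<omega> * y\<close>.\<close>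

definition ml_integrand :: "real \<Rightarrow> real \<Rightarrow> real \<Rightarrow> real \<Rightarrow> complex \<Rightarrow> complex" where
  "ml_integrand \<omega> \<gamma> \<beta> \<mu> y =
     exp (cis \<omega> * y) * cis ((\<gamma> - \<beta>) * \<omega>) * y powr of_real (\<gamma> - \<beta>) / (cis (\<gamma> * \<omega>) * y powr of_real \<gamma> + of_real \<mu>)"

text \<open>As \<open>\<gamma> \<phi> < \<pi>/2\<close>, both \<open>y\<^sup>\<gamma>\<close> and \<open>\<mu> cis (- (\<gamma> \<omega>))\<close> lie in the right half plane,
so they cannot cancel.\<close>

lemma ml_denominator:
  assumes y: "y \<in> sector \<phi>" and \<omega>: "0 < \<omega>" "\<omega> < \<phi>" and \<phi>: "\<phi> < pi / 2" and \<gamma>: "0 < \<gamma>" "\<gamma> * \<phi> < pi / 2" and \<mu>: "0 \<le> \<mu>"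
  shows "cis (\<gamma> * \<omega>) * y powr of_real \<gamma> + of_real \<mu> = cis (\<gamma> * \<omega>) * (y powr of_real \<gamma> + cis (- (\<gamma> * \<omega>)) * of_real \<mu>)"
    and "norm y powr \<gamma> * cos (\<gamma> * \<phi>) \<le> Re (y powr of_real \<gamma> + cis (- (\<gamma> * \<omega>)) * of_real \<mu>)"
    and "0 < norm y powr \<gamma> * cos (\<gamma> * \<phi>)"
    and "norm y powr \<gamma> * cos (\<gamma> * \<phi>) \<le> norm (cis (\<gamma> * \<omega>) * y powr of_real \<gamma> + of_real \<mu>)"
proof -
  show 1: "cis (\<gamma> * \<omega>) * y powr of_real \<gamma> + of_real \<mu> = cis (\<gamma> * \<omega>) * (y powr of_real \<gamma> + cis (- (\<gamma> * \<omega>)) * of_real \<mu>)"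
    by (simp add: distrib_left cis_mult flip: mult.assoc)
  have "\<gamma> * \<omega> < \<gamma> * \<phi>" using \<omega> \<gamma> by simp
  moreover have "0 < \<gamma> * \<omega>" using \<omega> \<gamma> by simp
  ultimately have "0 < \<gamma> * \<omega>" "\<gamma> * \<omega> < pi / 2" "0 < \<gamma> * \<phi>" using \<gamma> by linarith+
  then have c: "0 < cos (\<gamma> * \<omega>)" "0 < cos (\<gamma> * \<phi>)" using \<gamma> cos_gt_zero by blast+
  show 2: "norm y powr \<gamma> * cos (\<gamma> * \<phi>) \<le> Re (y powr of_real \<gamma> + cis (- (\<gamma> * \<omega>)) * of_real \<mu>)"
    using Re_powr_sector[OF y, of \<gamma>] \<omega> \<phi> \<gamma> c \<mu> by (simp add: add_increasing2)
  show "0 < norm y powr \<gamma> * cos (\<gamma> * \<phi>)" using c sector_nonzero(1)[OF y] by simp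
  have "norm (cis (\<gamma> * \<omega>) * y powr of_real \<gamma> + of_real \<mu>) = norm (y powr of_real \<gamma> + cis (- (\<gamma> * \<omega>)) * of_real \<mu>)"
    unfolding 1 by (simp add: norm_mult)
  then show "norm y powr \<gamma> * cos (\<gamma> * \<phi>) \<le> norm (cis (\<gamma> * \<omega>) * y powr of_real \<gamma> + of_real \<mu>)"
    using 2 complex_Re_le_cmod[of "y powr of_real \<gamma> + cis (- (\<gamma> * \<omega>)) * of_real \<mu>"] by linarith
qed

lemma ray_integrand_ml:
  assumes \<omega>: "pi / 4 < \<omega>" "\<omega> < \<phi>" "\<phi> < pi / 2" and \<gamma>: "0 < \<gamma>" "\<gamma> * \<phi> < pi / 2" and \<mu>: "0 \<le> \<mu>" and \<beta>: "0 \<le> \<beta>"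
  shows "ray_integrand \<omega> \<phi> (ml_integrand \<omega> \<gamma> \<beta> \<mu>)"
proof
  have \<omega>0: "0 < \<omega>" using \<omega>(1) pi_gt_zero by linarith
  note den = ml_denominator[OF _ \<omega>0 \<omega>(2,3) \<gamma> \<mu>]
  show "ml_integrand \<omega> \<gamma> \<beta> \<mu> holomorphic_on sector \<phi>"
    unfolding ml_integrand_def
  proof (intro holomorphic_intros)
    fix y assume "y \<in> sector \<phi>"
    from den(3,4)[OF this] show "cis (\<gamma> * \<omega>) * y powr of_real \<gamma> + of_real \<mu> \<noteq> 0" by auto
  qed (auto simp: sector_nonzero)
  show "\<exists>A. \<forall>y\<in>sector \<phi>. m \<le> Re y \<longrightarrow> norm (ml_integrand \<omega> \<gamma> \<beta> \<mu> y) \<le> A * exp (Re (cis \<omega> * y))" if m: "0 < m" for m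
  proof (intro exI[of _ "m powr (- \<beta>) / cos (\<gamma> * \<phi>)"] ballI impI)
    fix y assume y: "y \<in> sector \<phi>" "m \<le> Re y"
    have "norm y powr (- \<beta>) \<le> m powr (- \<beta>)"
      using sector_norm_ge[OF y] m assms by (intro powr_mono2') auto
    have ny: "0 < norm y" using sector_nonzero[OF y(1)] by simp
    have "norm (ml_integrand \<omega> \<gamma> \<beta> \<mu> y) = exp (Re (cis \<omega> * y)) * (norm y powr (\<gamma> - \<beta>) / norm (cis (\<gamma> * \<omega>) * y powr of_real \<gamma> + of_real \<mu>))"
      unfolding ml_integrand_def norm_mult norm_divide norm_powr_of_real[OF sector_nonzero(1)[OF y(1)]] by (simp add: norm_exp_eq_Re)
    also have "\<dots> \<le> exp (Re (cis \<omega> * y)) * (norm y powr (\<gamma> - \<beta>) / (norm y powr \<gamma> * cos (\<gamma> * \<phi>)))"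
    proof (intro mult_left_mono divide_left_mono)
      show "0 < norm (cis (\<gamma> * \<omega>) * y powr of_real \<gamma> + of_real \<mu>) * (norm y powr \<gamma> * cos (\<gamma> * \<phi>))"
        using den(3,4)[OF y(1)] by (intro mult_pos_pos[OF _ den(3)[OF y(1)]]) linarith
    qed (use den(4)[OF y(1)] in auto)
    also have "norm y powr (\<gamma> - \<beta>) / (norm y powr \<gamma> * cos (\<gamma> * \<phi>)) = norm y powr (- \<beta>) / cos (\<gamma> * \<phi>)"
      using ny by (simp add: powr_diff powr_minus field_simps)
    also have "exp (Re (cis \<omega> * y)) * (norm y powr (- \<beta>) / cos (\<gamma> * \<phi>)) \<le> exp (Re (cis \<omega> * y)) * (m powr (- \<beta>) / cos (\<gamma> * \<phi>))"
    proof (intro mult_left_mono divide_right_mono)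
      show "0 \<le> cos (\<gamma> * \<phi>)" using den(3)[OF y(1)] ny by (simp add: zero_less_mult_iff)
    qed (use \<open>norm y powr (- \<beta>) \<le> m powr (- \<beta>)\<close> in auto)
    finally show "norm (ml_integrand \<omega> \<gamma> \<beta> \<mu> y) \<le> m powr (- \<beta>) / cos (\<gamma> * \<phi>) * exp (Re (cis \<omega> * y))"
      by (simp add: mult.commute)
  qed
qed (use \<omega> in auto)

text \<open>The geometric series in \<open>- \<mu> / z\<^sup>\<gamma>\<close>; its terms are Hankel integrands.\<close>

lemma ml_integrand_sums:
  assumes y: "y \<in> sector \<phi>" and \<mu>: "0 \<le> \<mu>" "\<mu> < norm y powr \<gamma>"
  shows "(\<lambda>k. of_real ((- \<mu>) ^ k) * hankel_integrand \<omega> (\<gamma> * real k + \<beta>) y) sums ml_integrand \<omega> \<gamma> \<beta> \<mu> y"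
    and "norm (of_real ((- \<mu>) ^ k) * hankel_integrand \<omega> (\<gamma> * real k + \<beta>) y) = (\<mu> / norm y powr \<gamma>) ^ k * norm (hankel_integrand \<omega> \<beta> y)"
proof -
  note y0 = sector_nonzero[OF y]
  define x where "x = of_real (- \<mu>) * cis (- (\<gamma> * \<omega>)) * y powr of_real (- \<gamma>)"
  have nx: "norm x = \<mu> / norm y powr \<gamma>"
    unfolding x_def norm_mult norm_powr_of_real[OF y0(1)] using \<mu> by (simp add: powr_minus field_simps)
  then have nx1: "norm x < 1" using \<mu> y0 by simp
  have tm: "of_real ((- \<mu>) ^ k) * hankel_integrand \<omega> (\<gamma> * real k + \<beta>) y = hankel_integrand \<omega> \<beta> y * x ^ k" for k
  proof (induction k)
    case (Suc k)
    have "hankel_integrand \<omega> (\<gamma> * real (Suc k) + \<beta>) y = hankel_integrand \<omega> (\<gamma> * real k + \<beta>) y * (cis (- (\<gamma> * \<omega>)) * y powr of_real (- \<gamma>))"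
    proof -
      have "cis (- ((\<gamma> * real (Suc k) + \<beta>) * \<omega>)) = cis (- ((\<gamma> * real k + \<beta>) * \<omega>)) * cis (- (\<gamma> * \<omega>))"
        by (simp add: cis_mult algebra_simps)
      moreover have "y powr of_real (- (\<gamma> * real (Suc k) + \<beta>)) = y powr of_real (- (\<gamma> * real k + \<beta>)) * y powr of_real (- \<gamma>)"
        using y0(1) by (simp add: algebra_simps flip: powr_add)
      ultimately show ?thesis unfolding hankel_integrand_def by (simp only: mult_ac)
    qed
    then have "of_real ((- \<mu>) ^ Suc k) * hankel_integrand \<omega> (\<gamma> * real (Suc k) + \<beta>) y = (of_real ((- \<mu>) ^ k) * hankel_integrand \<omega> (\<gamma> * real k + \<beta>) y) * x"
      unfolding x_def by (simp add: mult_ac)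
    then show ?case unfolding Suc.IH by simp
  qed simp
  show "norm (of_real ((- \<mu>) ^ k) * hankel_integrand \<omega> (\<gamma> * real k + \<beta>) y) = (\<mu> / norm y powr \<gamma>) ^ k * norm (hankel_integrand \<omega> \<beta> y)"
    unfolding tm norm_mult norm_power nx by simp
  have "(\<lambda>k. hankel_integrand \<omega> \<beta> y * x ^ k) sums (hankel_integrand \<omega> \<beta> y * (1 / (1 - x)))"
    by (intro sums_mult geometric_sums nx1)
  also have "hankel_integrand \<omega> \<beta> y * (1 / (1 - x)) = ml_integrand \<omega> \<gamma> \<beta> \<mu> y"
  proof -
    have x1: "1 - x \<noteq> 0" using nx1 by auto
    define u where "u = cis (\<gamma> * \<omega>) * y powr of_real \<gamma>"
    have u0: "u \<noteq> 0" using y0(1) by (simp add: u_def)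
    have ux: "u * (1 - x) = u + of_real \<mu>"
    proof -
      have "cis (\<gamma> * \<omega>) * cis (- (\<gamma> * \<omega>)) = 1" by (simp add: cis_mult)
      moreover have "y powr of_real \<gamma> * y powr of_real (- \<gamma>) = 1" using y0(1) by (simp flip: powr_add)
      moreover have "u * x = - of_real \<mu> * (cis (\<gamma> * \<omega>) * cis (- (\<gamma> * \<omega>))) * (y powr of_real \<gamma> * y powr of_real (- \<gamma>))"
        by (simp add: u_def x_def)
      ultimately show ?thesis by (simp add: right_diff_distrib)
    qed
    have hu: "hankel_integrand \<omega> \<beta> y * u = exp (cis \<omega> * y) * cis ((\<gamma> - \<beta>) * \<omega>) * y powr of_real (\<gamma> - \<beta>)"
    proof -
      have "cis ((\<gamma> - \<beta>) * \<omega>) = cis (- (\<beta> * \<omega>)) * cis (\<gamma> * \<omega>)" by (simp add: cis_mult algebra_simps)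
      moreover have "y powr of_real (\<gamma> - \<beta>) = y powr of_real (- \<beta>) * y powr of_real \<gamma>"
        using y0(1) by (simp flip: powr_add)
      ultimately show ?thesis unfolding hankel_integrand_def u_def by (simp only: mult_ac)
    qed
    have "hankel_integrand \<omega> \<beta> y * (1 / (1 - x)) = hankel_integrand \<omega> \<beta> y * u / (u * (1 - x))"
      using x1 u0 by simp
    then show ?thesis unfolding ux hu unfolding ml_integrand_def u_def .
  qed
  finally show "(\<lambda>k. of_real ((- \<mu>) ^ k) * hankel_integrand \<omega> (\<gamma> * real k + \<beta>) y) sums ml_integrand \<omega> \<gamma> \<beta> \<mu> y"
    unfolding tm .
qed

lemma ml_integrand_real:
  assumes "0 < \<omega>" "\<omega> < pi" "0 < c"
  shows "Im (ml_integrand \<omega> \<gamma> \<beta> \<mu> (of_real c * cis (- \<omega>))) = 0"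
proof -
  have p: "cis (a * \<omega>) * (of_real c * cis (- \<omega>)) powr of_real a = of_real (c powr a)" for a
    using assms by (subst cis_powr) (auto simp: cis_mult mult.left_commute[of "cis _"])
  have e: "cis \<omega> * (of_real c * cis (- \<omega>)) = of_real c" by (simp add: cis_mult mult.left_commute[of "cis \<omega>"])
  have "ml_integrand \<omega> \<gamma> \<beta> \<mu> (of_real c * cis (- \<omega>)) = of_real (exp c * c powr (\<gamma> - \<beta>) / (c powr \<gamma> + \<mu>))"
    unfolding ml_integrand_def e p mult.assoc by (simp add: exp_of_real)
  then show ?thesis by simp
qed

text \<open>Far from the origin the geometric series may be integrated term by term, and Hankel's formula turns it into the
Mittag-Leffler series. The starting point of the ray is irrelevant by \<open>Im_I_const\<close>.\<close>

lemma mittag_leffler_ray_integral: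
  assumes \<omega>: "pi / 4 < \<omega>" "\<omega> < \<phi>" "\<phi> < pi / 2" and \<gamma>: "0 < \<gamma>" "\<gamma> * \<phi> < pi / 2" and \<mu>: "0 \<le> \<mu>" and \<beta>: "0 < \<beta>" and c: "0 < c"
  shows "Im (ray_integral \<omega> (ml_integrand \<omega> \<gamma> \<beta> \<mu>) (of_real c)) = pi * mittag_leffler \<gamma> \<beta> (- \<mu>)"
proof -
  interpret A: ray_integrand \<omega> \<phi> "ml_integrand \<omega> \<gamma> \<beta> \<mu>" using \<beta> by (intro ray_integrand_ml \<omega> \<gamma> \<mu>) auto
  interpret H: ray_integrand \<omega> \<phi> "hankel_integrand \<omega> \<beta>" using \<beta> by (intro ray_integrand_hankel \<omega>) auto
  (* From this starting point on, y to the power \<gamma> has modulus at least 2\<mu> + 1, so the ratio of the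
     geometric series is below 1/2. *)
  define c0 where "c0 = (2 * \<mu> + 1) powr (1 / \<gamma>) / cos \<omega>"
  have c0: "0 < c0" using A.cos1 \<mu> by (simp add: c0_def)
  let ?y = "\<lambda>r. yray \<omega> (of_real c0) r"
  have y: "?y r \<in> sector \<phi>" if "0 < r" for r using \<omega> A.\<omega>0 c0 that by (intro yray_sector_real) auto
  have yn: "2 * \<mu> + 1 \<le> norm (?y r) powr \<gamma>" if "0 < r" for r
  proof -
    have "c0 * cos \<omega> \<le> (c0 + r) * cos \<omega>" using that A.cos1 by (intro mult_right_mono) auto
    then have "(2 * \<mu> + 1) powr (1 / \<gamma>) \<le> norm (?y r)"
      using y[OF that] Re_yray_real[of \<omega> c0 r] A.cos1 by (intro sector_norm_ge) (auto simp: c0_def)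
    then have "((2 * \<mu> + 1) powr (1 / \<gamma>)) powr \<gamma> \<le> norm (?y r) powr \<gamma>" using \<gamma> by (intro powr_mono2) auto
    then show ?thesis using \<gamma> \<mu> by (simp add: powr_powr)
  qed
  define T where "T = (\<lambda>k r. indicator {0<..} r *\<^sub>R (of_real ((- \<mu>) ^ k) * (hankel_integrand \<omega> (\<gamma> * real k + \<beta>) (?y r) * cis (2 * \<omega>))))"
  define T0 where "T0 = (\<lambda>r. indicator {0<..} r *\<^sub>R (hankel_integrand \<omega> \<beta> (?y r) * cis (2 * \<omega>)))"
  have Ti: "integrable lborel (T k)" for k
  proof -
    interpret K: ray_integrand \<omega> \<phi> "hankel_integrand \<omega> (\<gamma> * real k + \<beta>)" using \<beta> \<gamma> by (intro ray_integrand_hankel \<omega>) auto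
    show ?thesis using set_integrable_mult_right[OF K.set_integrable_ray[OF c0], of "of_real ((- \<mu>) ^ k)"]
      unfolding T_def set_integrable_def by blast
  qed
  have T0i: "integrable lborel T0" using H.set_integrable_ray[OF c0] unfolding T0_def set_integrable_def .
  have nT: "norm (T k r) \<le> (1/2) ^ k * norm (T0 r)" for k r
  proof (cases "0 < r")
    case True
    have "0 < norm (?y r) powr \<gamma>" using yn[OF True] \<mu> by linarith
    then have "\<mu> / norm (?y r) powr \<gamma> \<le> 1 / 2" using yn[OF True] \<mu> by (simp add: divide_le_eq)
    then have "(\<mu> / norm (?y r) powr \<gamma>) ^ k \<le> (1 / 2) ^ k" using \<mu> by (intro power_mono) auto
    moreover have "norm (T k r) = (\<mu> / norm (?y r) powr \<gamma>) ^ k * norm (T0 r)"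
      using True ml_integrand_sums(2)[OF y[OF True], of \<mu> \<gamma> k \<omega> \<beta>] yn[OF True] \<mu> by (simp add: T_def T0_def norm_mult)
    ultimately show ?thesis by (simp add: mult_right_mono)
  qed (simp add: T_def)
  have Ts: "(\<lambda>k. T k r) sums (indicator {0<..} r *\<^sub>R (ml_integrand \<omega> \<gamma> \<beta> \<mu> (?y r) * cis (2 * \<omega>)))" for r
  proof (cases "0 < r")
    case True
    show ?thesis unfolding T_def
      using ml_integrand_sums(1)[OF y[OF True], of \<mu> \<gamma> \<omega> \<beta>] yn[OF True] \<mu>
      by (intro sums_scaleR_right) (simp add: sums_mult2 flip: mult.assoc)
  qed (simp add: T_def)
  have "(\<lambda>k. integral\<^sup>L lborel (T k)) sums (\<integral>r. (\<Sum>k. T k r) \<partial>lborel)"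
  proof (rule sums_integral[OF Ti])
    show "AE r in lborel. summable (\<lambda>k. norm (T k r))"
    proof (rule AE_I2, rule summable_comparison_test')
      fix r show "summable (\<lambda>k. (1/2) ^ k * norm (T0 r))" by (intro summable_mult2 summable_geometric) simp
      show "norm (norm (T k r)) \<le> (1/2) ^ k * norm (T0 r)" for k using nT by simp
    qed
    show "summable (\<lambda>k. \<integral>r. norm (T k r) \<partial>lborel)"
    proof (rule summable_comparison_test')
      show "summable (\<lambda>k. (1/2) ^ k * (\<integral>r. norm (T0 r) \<partial>lborel))" by (intro summable_mult2 summable_geometric) simp
      fix k :: nat
      have "(\<integral>r. norm (T k r) \<partial>lborel) \<le> (\<integral>r. (1/2) ^ k * norm (T0 r) \<partial>lborel)"
        using Ti T0i nT by (intro integral_mono) auto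
      then show "norm (\<integral>r. norm (T k r) \<partial>lborel) \<le> (1/2) ^ k * (\<integral>r. norm (T0 r) \<partial>lborel)" by simp
    qed
  qed
  also have "(\<integral>r. (\<Sum>k. T k r) \<partial>lborel) = ray_integral \<omega> (ml_integrand \<omega> \<gamma> \<beta> \<mu>) (of_real c0)"
    unfolding sums_unique[OF Ts, symmetric] ray_integral_def set_lebesgue_integral_def ..
  finally have "(\<lambda>k. Im (integral\<^sup>L lborel (T k))) sums Im (ray_integral \<omega> (ml_integrand \<omega> \<gamma> \<beta> \<mu>) (of_real c0))"
    by (rule sums_Im)
  moreover have "Im (integral\<^sup>L lborel (T k)) = pi * ((- \<mu>) ^ k / Gamma (\<gamma> * real k + \<beta>))" for k
  proof -
    have "integral\<^sup>L lborel (T k) = of_real ((- \<mu>) ^ k) * ray_integral \<omega> (hankel_integrand \<omega> (\<gamma> * real k + \<beta>)) (of_real c0)"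
      unfolding ray_integral_def set_integral_mult_right[symmetric] unfolding T_def set_lebesgue_integral_def ..
    moreover have "Im (ray_integral \<omega> (hankel_integrand \<omega> (\<gamma> * real k + \<beta>)) (of_real c0)) = pi / Gamma (\<gamma> * real k + \<beta>)"
      using \<gamma> \<beta> by (intro hankel_formula[OF \<omega> _ c0]) (auto intro: add_nonneg_pos)
    ultimately show ?thesis by simp
  qed
  ultimately have "(\<lambda>k. pi * ((- \<mu>) ^ k / Gamma (\<gamma> * real k + \<beta>))) sums Im (ray_integral \<omega> (ml_integrand \<omega> \<gamma> \<beta> \<mu>) (of_real c0))"
    by simp
  moreover from sums_mult[OF this, of "1 / pi"] have "summable (\<lambda>k. (- \<mu>) ^ k / Gamma (\<gamma> * real k + \<beta>))"
    by (auto simp: sums_iff)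
  ultimately have "Im (ray_integral \<omega> (ml_integrand \<omega> \<gamma> \<beta> \<mu>) (of_real c0)) = pi * mittag_leffler \<gamma> \<beta> (- \<mu>)"
    unfolding mittag_leffler_def using sums_unique suminf_mult by metis
  moreover have "Im (ray_integral \<omega> (ml_integrand \<omega> \<gamma> \<beta> \<mu>) (of_real c0)) = Im (ray_integral \<omega> (ml_integrand \<omega> \<gamma> \<beta> \<mu>) (of_real c))"
    using ml_integrand_real A.\<omega>0 \<omega> c0 c by (intro A.Im_I_const) auto
  ultimately show ?thesis by simp
qed

text \<open>Fubini's theorem under a bound by a product.\<close>

lemma
  fixes f :: "'a::euclidean_space \<Rightarrow> 'b::euclidean_space \<Rightarrow> complex" and g :: "'a \<Rightarrow> real" and h :: "'b \<Rightarrow> real"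
  assumes fm: "jointly_measurable f"
    and g: "integrable lborel g" and h: "integrable lborel h"
    and bound: "\<And>x y. norm (f x y) \<le> g x * h y"
  shows integrable_product_bound: "integrable (lborel \<Otimes>\<^sub>M lborel) (\<lambda>(x, y). f x y)"
    and integral_swap: "(\<integral>x. \<integral>y. f x y \<partial>lborel \<partial>lborel) = (\<integral>y. \<integral>x. f x y \<partial>lborel \<partial>lborel)"
proof -

  have sets_eq: "sets (lborel \<Otimes>\<^sub>M lborel) = sets ((borel :: 'a measure) \<Otimes>\<^sub>M (borel :: 'b measure))"
    by (intro sets_pair_measure_cong) auto
  have [measurable]: "g \<in> borel_measurable borel" "h \<in> borel_measurable borel" using g h by auto
  have fm': "(\<lambda>(x, y). f x y) \<in> borel_measurable (lborel \<Otimes>\<^sub>M lborel)"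
    unfolding measurable_cong_sets[OF sets_eq refl] by (rule fm)
  have gh: "integrable (lborel \<Otimes>\<^sub>M lborel) (\<lambda>z. g (fst z) * h (snd z))"
  proof (rule lborel_pair.Fubini_integrable)
    show "(\<lambda>z. g (fst z) * h (snd z)) \<in> borel_measurable (lborel \<Otimes>\<^sub>M lborel)"
      unfolding measurable_cong_sets[OF sets_eq refl] by measurable
    have "(\<lambda>x. \<integral>y. norm (g (fst (x, y)) * h (snd (x, y))) \<partial>lborel) = (\<lambda>x. \<bar>g x\<bar> * (\<integral>y. \<bar>h y\<bar> \<partial>lborel))"
      by (simp add: abs_mult)
    then show "integrable lborel (\<lambda>x. \<integral>y. norm (g (fst (x, y)) * h (snd (x, y))) \<partial>lborel)"
      using g by simp
  qed (use h in simp)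
  show i: "integrable (lborel \<Otimes>\<^sub>M lborel) (\<lambda>(x, y). f x y)"
    using gh fm' by (rule Bochner_Integration.integrable_bound)
      (auto intro!: AE_I2 order_trans[OF bound abs_ge_self])
  show "(\<integral>x. \<integral>y. f x y \<partial>lborel \<partial>lborel) = (\<integral>y. \<integral>x. f x y \<partial>lborel \<partial>lborel)"
    using lborel_pair.Fubini_integral[OF i] by simp
qed

text \<open>In the ray integral the denominator is, up to a rotation, \<open>y\<^sup>\<gamma> + \<sigma> \<mu>\<close> with positive real part. Writing its
inverse as \<open>\<integral> exp (- \<rho> (y\<^sup>\<gamma> + \<sigma> \<mu>)) d\<rho>\<close> and exchanging the integrals leaves the exponential
\<open>exp (- \<rho> \<sigma> \<mu>)\<close> with a weight that does not depend on \<open>\<mu>\<close>.\<close>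

theorem mittag_leffler_laplace_representation:
  assumes \<gamma>: "1 < \<gamma>" "\<gamma> < 2" and \<beta>: "0 < \<beta>"
  obtains w :: "real \<Rightarrow> complex" and \<sigma> :: complex and C \<kappa> :: real
  where "w \<in> borel_measurable borel" "0 < \<kappa>" "0 \<le> C" "norm \<sigma> = 1" "0 < Re \<sigma>"
    "\<And>\<rho>. 0 < \<rho> \<Longrightarrow> norm (w \<rho>) \<le> C * exp (- (\<kappa> * \<rho>))"
    "\<And>\<mu>. 0 \<le> \<mu> \<Longrightarrow> mittag_leffler \<gamma> \<beta> (- \<mu>) = Im (LINT \<rho>:{0<..}|lborel. w \<rho> * exp (- (\<sigma> * of_real \<mu> * of_real \<rho>)))"
proof -
  (* The angle \<omega> must exceed pi/4, so that the contour bends to the left, and stay below pi/(2\<gamma>), so that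
     \<sigma> lies in the right half plane; this is possible because \<gamma> < 2. *)
  define t where "t = pi / (2 * \<gamma>)"
  have t: "pi / 4 < t" "t < pi / 2" "\<gamma> * t = pi / 2" using \<gamma> by (auto simp: t_def field_simps)
  define \<omega> where "\<omega> = (pi / 4 + t) / 2"
  define \<phi> where "\<phi> = (\<omega> + t) / 2"
  have \<omega>t: "pi / 4 < \<omega>" "\<omega> < t" using t(1,2) by (simp_all add: \<omega>_def)
  then have "\<omega> < \<phi>" "\<phi> < t" by (simp_all add: \<phi>_def)
  with \<omega>t t have \<omega>: "pi / 4 < \<omega>" "\<omega> < \<phi>" "\<phi> < pi / 2" "\<phi> < t" by simp_all
  have \<omega>0: "0 < \<omega>" using \<omega>(1) pi_gt_zero by linarith
  have \<gamma>\<phi>: "\<gamma> * \<phi> < pi / 2" using \<omega>(4) \<gamma> unfolding t(3)[symmetric] by simp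
  interpret A: ray_integrand \<omega> \<phi> "hankel_integrand \<omega> 0" by (intro ray_integrand_hankel \<omega>) simp
  note cos1 = A.cos1
  have cos1': "cos \<omega> \<le> 1" by simp
  define \<sigma> where "\<sigma> = cis (- (\<gamma> * \<omega>))"
  let ?y = "\<lambda>r. yray \<omega> 1 r"
  have y: "?y r \<in> sector \<phi>" if "0 < r" for r using yray_sector_real[of \<omega> \<phi> 1 r] \<omega> \<omega>0 that by simp
  define B where "B = (\<lambda>r::real. indicator {0<..} r *\<^sub>R (exp (cis \<omega> * ?y r) * cis ((\<gamma> - \<beta>) * \<omega>) * ?y r powr of_real (\<gamma> - \<beta>) * cis (2 * \<omega>) * \<sigma>))"
  define Y where "Y = (\<lambda>r::real. indicator {0<..} r *\<^sub>R (?y r powr of_real \<gamma>))"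
  have ycont: "continuous_on {0<..} (\<lambda>r. ?y r powr of_real a)" for a
  proof -
    have "continuous_on {0<..} ?y" unfolding yray_def by (intro continuous_intros)
    moreover have "0 < Re (?y r)" "?y r \<noteq> 0" if "0 < r" for r
      using y[OF that] by (auto simp: sector_def)
    ultimately show ?thesis by (intro continuous_on_powr_complex) (auto intro: less_imp_le)
  qed
  have [measurable]: "Y \<in> borel_measurable borel" unfolding Y_def
    by (intro borel_measurable_continuous_on_indicator ycont) auto
  have [measurable]: "B \<in> borel_measurable borel" unfolding B_def
  proof (intro borel_measurable_continuous_on_indicator)
    show "continuous_on {0<..} (\<lambda>r. exp (cis \<omega> * ?y r) * cis ((\<gamma> - \<beta>) * \<omega>) * ?y r powr of_real (\<gamma> - \<beta>) * cis (2 * \<omega>) * \<sigma>)"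
      by (intro continuous_on_mult ycont continuous_on_const) (auto simp: yray_def intro!: continuous_intros)
  qed auto
  define d where "d = - cos (2 * \<omega>)"
  have d: "0 < d" using A.cos2 by (simp add: d_def)
  define K where "K = exp 1 * ((1 + 4 / d)\<^sup>2 + cos \<omega> powr (\<gamma> - \<beta>))"
  have K: "0 < K" unfolding K_def using cos1 by (intro mult_pos_pos add_nonneg_pos) auto
  define g where "g = (\<lambda>r::real. K * (indicator {0<..} r *\<^sub>R exp (- (d / 2 * r))))"
  have gi: "integrable lborel g"
    using set_integrable_exp_decay[of "d / 2"] d unfolding g_def set_integrable_def by simp
  have ylow: "cos \<omega> \<le> norm (?y r)" if "0 < r" for r
  proof -
    have "1 * cos \<omega> \<le> (1 + r) * cos \<omega>" using that cos1 by (intro mult_right_mono) auto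
    then show ?thesis using Re_yray_real[of \<omega> 1 r] y[OF that] by (intro sector_norm_ge) auto
  qed
  have yup: "norm (?y r) \<le> 1 + r" if "0 < r" for r
    using norm_triangle_ineq[of "cis (- \<omega>)" "of_real r * cis \<omega>"] that by (simp add: yray_def norm_mult)
  have Bg: "norm (B r) \<le> g r" for r
  proof (cases "0 < r")
    case True
    have dr: "1 + r \<le> (1 + 4 / d) * exp (d / 4 * r)"
    proof -
      have "1 + r \<le> (1 + 4 / d) * (1 + d / 4 * r)" using d True by (simp add: field_simps)
      also have "\<dots> \<le> (1 + 4 / d) * exp (d / 4 * r)" using d by (intro mult_left_mono exp_ge_add_one_self) auto
      finally show ?thesis .
    qed
    have e1: "1 \<le> exp (d / 2 * r)" using d True by simp
    have "norm (?y r) powr (\<gamma> - \<beta>) \<le> ((1 + 4 / d)\<^sup>2 + cos \<omega> powr (\<gamma> - \<beta>)) * exp (d / 2 * r)"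
    proof (cases "0 \<le> \<gamma> - \<beta>")
      case True1: True
      have "norm (?y r) powr (\<gamma> - \<beta>) \<le> (1 + r) powr (\<gamma> - \<beta>)" using True1 yup[OF True] by (intro powr_mono2) auto
      also have "\<dots> \<le> (1 + r) powr 2" using True \<gamma> \<beta> by (intro powr_mono) auto
      also have "\<dots> = (1 + r)\<^sup>2" using True by simp
      also have "\<dots> \<le> ((1 + 4 / d) * exp (d / 4 * r))\<^sup>2" using dr True by (intro power_mono) auto
      also have "\<dots> = (1 + 4 / d)\<^sup>2 * exp (d / 2 * r)" by (simp add: power_mult_distrib flip: exp_double)
      also have "\<dots> \<le> ((1 + 4 / d)\<^sup>2 + cos \<omega> powr (\<gamma> - \<beta>)) * exp (d / 2 * r)" by (intro mult_right_mono) auto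
      finally show ?thesis .
    next
      case False
      have "norm (?y r) powr (\<gamma> - \<beta>) \<le> cos \<omega> powr (\<gamma> - \<beta>)" using False ylow[OF True] cos1 by (intro powr_mono2') auto
      also have "\<dots> \<le> cos \<omega> powr (\<gamma> - \<beta>) * exp (d / 2 * r)" using e1 by (simp add: mult_le_cancel_left1)
      also have "\<dots> \<le> ((1 + 4 / d)\<^sup>2 + cos \<omega> powr (\<gamma> - \<beta>)) * exp (d / 2 * r)" by (intro mult_right_mono) auto
      finally show ?thesis .
    qed
    then have "exp (1 - d * r) * norm (?y r) powr (\<gamma> - \<beta>) \<le> exp (1 - d * r) * (((1 + 4 / d)\<^sup>2 + cos \<omega> powr (\<gamma> - \<beta>)) * exp (d / 2 * r))"
      by (intro mult_left_mono) auto
    also have "\<dots> = K * exp (- (d / 2 * r))"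
    proof -
      have "exp (1 - d * r) * exp (d / 2 * r) = exp 1 * exp (- (d / 2 * r))" by (simp flip: exp_add)
      then show ?thesis by (simp add: K_def mult_ac)
    qed
    also have "exp (1 - d * r) * norm (?y r) powr (\<gamma> - \<beta>) = norm (B r)"
      using True sector_nonzero(1)[OF y[OF True]]
      by (simp add: B_def norm_mult norm_powr_of_real norm_exp_eq_Re cis_times_yray \<sigma>_def d_def del: of_real_diff)
    finally show ?thesis using True by (simp add: g_def)
  qed (simp add: B_def g_def)
  define \<kappa> where "\<kappa> = cos \<omega> powr \<gamma> * cos (\<gamma> * \<phi>)"
  have "0 < \<gamma> * \<phi>" using \<gamma> \<omega> \<omega>0 by (intro mult_pos_pos) linarith+
  then have c\<phi>: "0 < cos (\<gamma> * \<phi>)" using \<gamma>\<phi> by (rule cos_gt_zero)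
  have \<kappa>: "0 < \<kappa>" using c\<phi> cos1 by (simp add: \<kappa>_def)
  have Yre: "\<kappa> \<le> Re (Y r)" if "0 < r" for r
  proof -
    have "cos \<omega> powr \<gamma> \<le> norm (?y r) powr \<gamma>" using ylow[OF that] cos1 \<gamma> by (intro powr_mono2) auto
    then have "\<kappa> \<le> norm (?y r) powr \<gamma> * cos (\<gamma> * \<phi>)" using c\<phi> by (simp add: \<kappa>_def)
    also have "\<dots> \<le> Re (?y r powr of_real \<gamma>)" using y[OF that] \<gamma> \<omega> \<omega>0 \<gamma>\<phi> by (intro Re_powr_sector) auto
    finally show ?thesis using that by (simp add: Y_def)
  qed
  have \<sigma>: "norm \<sigma> = 1" "0 < Re \<sigma>"
  proof -
    have "\<gamma> * \<omega> < \<gamma> * \<phi>" using \<omega> \<gamma> by simp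
    moreover have "0 < \<gamma> * \<omega>" using \<gamma> \<omega>0 by simp
    ultimately have "0 < cos (\<gamma> * \<omega>)" using \<gamma>\<phi> by (intro cos_gt_zero) auto
    then show "norm \<sigma> = 1" "0 < Re \<sigma>" by (auto simp: \<sigma>_def)
  qed
  have expb: "norm (B r * exp (- (of_real \<rho> * Y r))) \<le> g r * exp (- (\<kappa> * \<rho>))" if "0 < \<rho>" for \<rho> r
  proof (cases "0 < r")
    case True
    have "\<rho> * \<kappa> \<le> \<rho> * Re (Y r)" using Yre[OF True] that by simp
    then have "norm (exp (- (of_real \<rho> * Y r))) \<le> exp (- (\<kappa> * \<rho>))" by (simp add: norm_exp_eq_Re mult.commute)
    then show ?thesis unfolding norm_mult using Bg[of r] order_trans[OF norm_ge_zero Bg] by (intro mult_mono) auto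
  qed (simp add: B_def g_def)
  define w where "w = (\<lambda>\<rho>. of_real (1 / pi) * (\<integral>r. B r * exp (- (of_real \<rho> * Y r)) \<partial>lborel))"
  show thesis
  proof (rule that[of w \<kappa> "(1 / pi) * (\<integral>r. g r \<partial>lborel)" \<sigma>])
    show "w \<in> borel_measurable borel"
      unfolding w_def by (intro borel_measurable_times borel_measurable_const lborel.borel_measurable_lebesgue_integral) measurable
    have "0 \<le> (\<integral>r. g r \<partial>lborel)" by (intro integral_nonneg_AE) (use K in \<open>auto simp: g_def\<close>)
    then show "0 \<le> (1 / pi) * (\<integral>r. g r \<partial>lborel)" by simp
    show "norm (w \<rho>) \<le> (1 / pi) * (\<integral>r. g r \<partial>lborel) * exp (- (\<kappa> * \<rho>))" if "0 < \<rho>" for \<rho>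
    proof -
      have "norm (\<integral>r. B r * exp (- (of_real \<rho> * Y r)) \<partial>lborel) \<le> (\<integral>r. norm (B r * exp (- (of_real \<rho> * Y r))) \<partial>lborel)"
        by (rule integral_norm_bound)
      also have "\<dots> \<le> (\<integral>r. g r * exp (- (\<kappa> * \<rho>)) \<partial>lborel)"
      proof (rule integral_mono)
        show g: "integrable lborel (\<lambda>r. g r * exp (- (\<kappa> * \<rho>)))" using gi by simp
        show "integrable lborel (\<lambda>r. norm (B r * exp (- (of_real \<rho> * Y r))))"
        proof (rule integrable_norm, rule Bochner_Integration.integrable_bound[OF g])
          show "AE r in lborel. norm (B r * exp (- (of_real \<rho> * Y r))) \<le> norm (g r * exp (- (\<kappa> * \<rho>)))"
            unfolding real_norm_def by (rule AE_I2) (rule order_trans[OF expb[OF that] abs_ge_self])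
        qed measurable
      qed (rule expb[OF that])
      also have "\<dots> = (\<integral>r. g r \<partial>lborel) * exp (- (\<kappa> * \<rho>))" by simp
      finally show ?thesis unfolding w_def norm_mult by (simp add: norm_divide field_simps)
    qed
    fix \<mu> :: real assume \<mu>: "0 \<le> \<mu>"
    define f where "f = (\<lambda>r \<rho>. indicator {0<..} \<rho> *\<^sub>R (B r * exp (- (of_real \<rho> * Y r)) * exp (- (\<sigma> * of_real \<mu> * of_real \<rho>))))"
    have fm: "jointly_measurable f" unfolding f_def by measurable
    have fb: "norm (f r \<rho>) \<le> g r * (indicator {0<..} \<rho> *\<^sub>R exp (- (\<kappa> * \<rho>)))" for r \<rho>
    proof (cases "0 < \<rho>")
      case True
      have "norm (exp (- (\<sigma> * of_real \<mu> * of_real \<rho>))) \<le> 1" using True \<mu> \<sigma> by (simp add: norm_exp_eq_Re)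
      then have "norm (B r * exp (- (of_real \<rho> * Y r))) * norm (exp (- (\<sigma> * of_real \<mu> * of_real \<rho>))) \<le> (g r * exp (- (\<kappa> * \<rho>))) * 1"
        using expb[OF True] order_trans[OF norm_ge_zero expb[OF True]] by (intro mult_mono) auto
      then show ?thesis using True by (simp add: f_def norm_mult)
    qed (simp add: f_def)
    have "ray_integral \<omega> (ml_integrand \<omega> \<gamma> \<beta> \<mu>) 1 = (\<integral>r. \<integral>\<rho>. f r \<rho> \<partial>lborel \<partial>lborel)"
      unfolding ray_integral_def set_lebesgue_integral_def
    proof (rule Bochner_Integration.integral_cong)
      fix r :: real
      show "indicator {0<..} r *\<^sub>R (ml_integrand \<omega> \<gamma> \<beta> \<mu> (?y r) * cis (2 * \<omega>)) = (\<integral>\<rho>. f r \<rho> \<partial>lborel)"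
      proof (cases "0 < r")
        case True
        define W where "W = Y r + \<sigma> * of_real \<mu>"
        have W: "0 < Re W" using Yre[OF True] \<kappa> \<mu> \<sigma> by (auto simp: W_def intro: add_pos_nonneg)
        have "f r \<rho> = B r * (indicator {0<..} \<rho> *\<^sub>R exp (- (W * of_real \<rho>)))" for \<rho>
          by (simp add: f_def W_def algebra_simps flip: exp_add)
        then have "(\<integral>\<rho>. f r \<rho> \<partial>lborel) = B r * (LINT \<rho>:{0<..}|lborel. exp (- (W * of_real \<rho>)))"
          unfolding set_lebesgue_integral_def by (simp only: integral_mult_right_zero)
        also have "\<dots> = B r / W" using exp_integral_complex[OF W] by simp
        also have "\<dots> = ml_integrand \<omega> \<gamma> \<beta> \<mu> (?y r) * cis (2 * \<omega>)"
        proof -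
          have W': "?y r powr of_real \<gamma> + cis (- (\<gamma> * \<omega>)) * of_real \<mu> = W" using True by (simp add: W_def Y_def \<sigma>_def)
          have den: "cis (\<gamma> * \<omega>) * ?y r powr of_real \<gamma> + of_real \<mu> = cis (\<gamma> * \<omega>) * W"
            using ml_denominator(1)[OF y[OF True] \<omega>0 \<omega>(2,3) _ \<gamma>\<phi> \<mu>] \<gamma> unfolding W' by simp
          have "\<sigma> * cis (\<gamma> * \<omega>) = 1" by (simp add: \<sigma>_def cis_mult)
          then have \<sigma>_inv: "\<sigma> = 1 / cis (\<gamma> * \<omega>)" by (simp add: field_simps)
          have "a * c * p * v * \<sigma> / W = a * c * p / (cis (\<gamma> * \<omega>) * W) * v" for a c p v :: complex
            unfolding \<sigma>_inv by simp
          then show ?thesis unfolding ml_integrand_def den using True by (simp add: B_def del: of_real_diff)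
        qed
        finally show ?thesis using True by simp
      qed (simp add: f_def B_def)
    qed simp
    also have "\<dots> = (\<integral>\<rho>. \<integral>r. f r \<rho> \<partial>lborel \<partial>lborel)"
      using fm gi _ fb by (rule integral_swap)
        (use set_integrable_exp_decay[OF \<kappa>] in \<open>simp add: set_integrable_def\<close>)
    also have "\<dots> = (\<integral>\<rho>. of_real pi * (indicator {0<..} \<rho> *\<^sub>R (w \<rho> * exp (- (\<sigma> * of_real \<mu> * of_real \<rho>)))) \<partial>lborel)"
    proof (rule Bochner_Integration.integral_cong)
      fix \<rho> :: real
      have "(\<integral>r. f r \<rho> \<partial>lborel) = indicator {0<..} \<rho> *\<^sub>R ((\<integral>r. B r * exp (- (of_real \<rho> * Y r)) \<partial>lborel) * exp (- (\<sigma> * of_real \<mu> * of_real \<rho>)))"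
        unfolding f_def by (simp only: integral_scaleR_right integral_mult_left_zero)
      then show "(\<integral>r. f r \<rho> \<partial>lborel) = of_real pi * (indicator {0<..} \<rho> *\<^sub>R (w \<rho> * exp (- (\<sigma> * of_real \<mu> * of_real \<rho>))))"
        by (simp add: w_def)
    qed simp
    also have "\<dots> = of_real pi * (LINT \<rho>:{0<..}|lborel. w \<rho> * exp (- (\<sigma> * of_real \<mu> * of_real \<rho>)))"
      unfolding set_lebesgue_integral_def by (rule integral_mult_right_zero)
    finally have "pi * Im (LINT \<rho>:{0<..}|lborel. w \<rho> * exp (- (\<sigma> * of_real \<mu> * of_real \<rho>))) = Im (ray_integral \<omega> (ml_integrand \<omega> \<gamma> \<beta> \<mu>) 1)"
      by simp
    also have "\<dots> = pi * mittag_leffler \<gamma> \<beta> (- \<mu>)"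
      using mittag_leffler_ray_integral[OF \<omega>(1-3) _ \<gamma>\<phi> \<mu> \<beta>, of 1] \<gamma> by simp
    finally show "mittag_leffler \<gamma> \<beta> (- \<mu>) = Im (LINT \<rho>:{0<..}|lborel. w \<rho> * exp (- (\<sigma> * of_real \<mu> * of_real \<rho>)))"
      by simp
  qed (use \<kappa> \<sigma> in auto)
qed

section \<open>Heat kernels at complex times\<close>

text \<open>Fubini's theorem for a product over the coordinates.\<close>

lemma
  fixes f :: "'a::euclidean_space \<Rightarrow> real \<Rightarrow> complex"
  assumes f: "\<And>b. b \<in> Basis \<Longrightarrow> integrable lborel (f b)"
  shows integrable_lborel_prod: "integrable lborel (\<lambda>x::'a. \<Prod>b\<in>Basis. f b (x \<bullet> b))"
    and integral_lborel_prod: "(\<integral>x. (\<Prod>b\<in>Basis. f b (x \<bullet> b)) \<partial>lborel) = (\<Prod>b\<in>Basis. \<integral>y. f b y \<partial>lborel)"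
proof -
  interpret product_sigma_finite "\<lambda>_::'a. lborel :: real measure" ..
  have [measurable]: "f b \<in> borel_measurable borel" if "b \<in> Basis" for b using f[OF that] by auto
  let ?T = "\<lambda>g::'a \<Rightarrow> real. \<Sum>b\<in>Basis. g b *\<^sub>R b"
  have eq: "(\<Prod>b\<in>Basis. f b (?T g \<bullet> b)) = (\<Prod>b\<in>Basis. f b (g b))" for g
    by (intro prod.cong) auto
  have m: "(\<lambda>x::'a. \<Prod>b\<in>Basis. f b (x \<bullet> b)) \<in> borel_measurable borel" by measurable
  have T: "?T \<in> measurable (\<Pi>\<^sub>M b\<in>Basis. lborel) borel" by measurable
  have "integrable (distr (\<Pi>\<^sub>M b\<in>(Basis::'a set). lborel) borel ?T) (\<lambda>x::'a. \<Prod>b\<in>Basis. f b (x \<bullet> b))"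
    unfolding integrable_distr_eq[OF T m] eq
    by (rule product_integrable_prod) (use f in auto)
  then show "integrable lborel (\<lambda>x::'a. \<Prod>b\<in>Basis. f b (x \<bullet> b))"
    unfolding lborel_eq[where 'a='a, symmetric] .
  show "(\<integral>x. (\<Prod>b\<in>Basis. f b (x \<bullet> b)) \<partial>lborel) = (\<Prod>b\<in>Basis. \<integral>y. f b y \<partial>lborel)"
  proof -
    have "(\<integral>x. (\<Prod>b\<in>Basis. f b (x \<bullet> b)) \<partial>distr (\<Pi>\<^sub>M b\<in>(Basis::'a set). lborel) borel ?T) = (\<Prod>b\<in>Basis. \<integral>y. f b y \<partial>lborel)"
      unfolding integral_distr[OF T m] eq
      by (rule product_integral_prod) (use f in auto)
    then show ?thesis unfolding lborel_eq[where 'a='a, symmetric] .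
  qed
qed

text \<open>The characteristic function of the normal distribution.\<close>

lemma
  fixes s t :: real
  assumes s: "0 < s"
  shows integrable_gaussian_1d: "integrable lborel (\<lambda>y::real. exp (\<i> * of_real (t * y)) * of_real (exp (- (s * y\<^sup>2))))"
    and gaussian_fourier_1d: "(\<integral>y. exp (\<i> * of_real (t * y)) * of_real (exp (- (s * y\<^sup>2))) \<partial>lborel)
      = of_real (sqrt (pi / s) * exp (- (t\<^sup>2 / (4 * s))))"
proof -
  define c where "c = 1 / sqrt (2 * s)"
  have c: "0 < c" "s * c\<^sup>2 = 1 / 2" "t\<^sup>2 / (4 * s) = (t * c)\<^sup>2 / 2"
    using s by (auto simp: c_def power_divide power_mult_distrib)
  define F where "F = (\<lambda>y::real. exp (\<i> * of_real (t * y)) * complex_of_real (exp (- (s * y\<^sup>2))))"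
  have Fc: "F (0 + c * y) = of_real (sqrt (2 * pi)) * (std_normal_density y *\<^sub>R iexp (t * c * y))" for y
  proof -
    have "s * (c * y)\<^sup>2 = (s * c\<^sup>2) * y\<^sup>2" by (simp add: power_mult_distrib)
    then show ?thesis unfolding F_def std_normal_density_def using c(2)
      by (simp add: scaleR_conv_of_real mult_ac real_sqrt_mult)
  qed
  have "integrable lborel (\<lambda>y. std_normal_density y *\<^sub>R iexp (t * c * y))"
    by (rule Bochner_Integration.integrable_bound[OF integrable_normal_density[where \<mu>=0 and \<sigma>=1]]) (auto simp: norm_mult)
  then have "integrable lborel (\<lambda>y. F (0 + c * y))" unfolding Fc by (intro integrable_mult_right)
  then show "integrable lborel (\<lambda>y::real. exp (\<i> * of_real (t * y)) * of_real (exp (- (s * y\<^sup>2))))"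
    using lborel_integrable_real_affine_iff[of c F 0] c by (simp add: F_def)
  have "(\<integral>y. F y \<partial>lborel) = \<bar>c\<bar> *\<^sub>R (\<integral>y. F (0 + c * y) \<partial>lborel)"
    using c by (intro lborel_integral_real_affine) auto
  also have "(\<integral>y. F (0 + c * y) \<partial>lborel) = of_real (sqrt (2 * pi)) * (\<integral>y. std_normal_density y *\<^sub>R iexp (t * c * y) \<partial>lborel)"
    unfolding Fc by (rule integral_mult_right_zero)
  also have "(\<integral>y. std_normal_density y *\<^sub>R iexp (t * c * y) \<partial>lborel) = char std_normal_distribution (t * c)"
    unfolding char_def by (subst integral_density) auto
  also have "\<dots> = of_real (exp (- (t\<^sup>2 / (4 * s))))"
    unfolding char_std_normal_distribution c(3) by simp
  also have "\<bar>c\<bar> *\<^sub>R (of_real (sqrt (2 * pi)) * of_real (exp (- (t\<^sup>2 / (4 * s))))) = complex_of_real ((c * sqrt (2 * pi)) * exp (- (t\<^sup>2 / (4 * s))))"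
    using c(1) by (simp add: scaleR_conv_of_real)
  also have "c * sqrt (2 * pi) = sqrt (pi / s)"
    using s by (simp add: c_def real_sqrt_mult real_sqrt_divide)
  finally show "(\<integral>y. exp (\<i> * of_real (t * y)) * of_real (exp (- (s * y\<^sup>2))) \<partial>lborel)
      = of_real (sqrt (pi / s) * exp (- (t\<^sup>2 / (4 * s))))" by (simp add: F_def)
qed

lemma
  fixes x :: "'a::euclidean_space"
  assumes s: "0 < s"
  shows integrable_gaussian_real: "integrable lborel (\<lambda>\<xi>::'a. exp (\<i> * of_real (x \<bullet> \<xi>)) * of_real (exp (- (s * (norm \<xi>)\<^sup>2))))"
    and gaussian_fourier_real: "(\<integral>\<xi>. exp (\<i> * of_real (x \<bullet> \<xi>)) * of_real (exp (- (s * (norm \<xi>)\<^sup>2))) \<partial>lborel)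
      = of_real ((pi / s) powr (DIM('a) / 2) * exp (- ((norm x)\<^sup>2 / (4 * s))))"
proof -
  define f where "f = (\<lambda>(b::'a) (y::real). exp (\<i> * of_real ((x \<bullet> b) * y)) * complex_of_real (exp (- (s * y\<^sup>2))))"
  have nrm: "(norm z)\<^sup>2 = (\<Sum>b\<in>Basis. (z \<bullet> b)\<^sup>2)" for z :: 'a
    unfolding power2_norm_eq_inner by (subst euclidean_inner) (simp add: power2_eq_square)
  have F: "exp (\<i> * of_real (x \<bullet> \<xi>)) * of_real (exp (- (s * (norm \<xi>)\<^sup>2))) = (\<Prod>b\<in>Basis. f b (\<xi> \<bullet> b))" for \<xi> :: 'a
    unfolding f_def prod.distrib exp_sum[OF finite_Basis, symmetric] of_real_prod[symmetric]
    by (simp add: euclidean_inner[of x \<xi>] nrm sum_distrib_left sum_negf)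
  have fi: "integrable lborel (f b)" for b unfolding f_def by (rule integrable_gaussian_1d[OF s])
  show "integrable lborel (\<lambda>\<xi>::'a. exp (\<i> * of_real (x \<bullet> \<xi>)) * of_real (exp (- (s * (norm \<xi>)\<^sup>2))))"
    unfolding F by (rule integrable_lborel_prod[OF fi])
  have "(\<integral>\<xi>. exp (\<i> * of_real (x \<bullet> \<xi>)) * of_real (exp (- (s * (norm \<xi>)\<^sup>2))) \<partial>lborel) = (\<Prod>b\<in>Basis. \<integral>y. f b y \<partial>lborel)"
    unfolding F by (rule integral_lborel_prod[OF fi])
  also have "\<dots> = of_real (\<Prod>b\<in>(Basis::'a set). sqrt (pi / s) * exp (- ((x \<bullet> b)\<^sup>2 / (4 * s))))"
    unfolding f_def gaussian_fourier_1d[OF s] by simp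
  also have "(\<Prod>b\<in>(Basis::'a set). sqrt (pi / s) * exp (- ((x \<bullet> b)\<^sup>2 / (4 * s)))) = sqrt (pi / s) ^ DIM('a) * exp (- ((norm x)\<^sup>2 / (4 * s)))"
    unfolding prod.distrib exp_sum[OF finite_Basis, symmetric] by (simp add: nrm sum_negf sum_divide_distrib)
  also have "sqrt (pi / s) ^ DIM('a) = (pi / s) powr (DIM('a) / 2)"
    using s by (simp add: powr_half_sqrt[symmetric] powr_powr flip: powr_realpow)
  finally show "(\<integral>\<xi>. exp (\<i> * of_real (x \<bullet> \<xi>)) * of_real (exp (- (s * (norm \<xi>)\<^sup>2))) \<partial>lborel)
      = of_real ((pi / s) powr (DIM('a) / 2) * exp (- ((norm x)\<^sup>2 / (4 * s))))" .
qed

lemma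
  fixes x :: "'a::euclidean_space"
  assumes a: "0 < a"
  shows integrable_exp_norm_sq: "integrable lborel (\<lambda>x::'a. exp (- (a * (norm x)\<^sup>2)))"
    and integral_exp_norm_sq: "(\<integral>x. exp (- (a * (norm (x::'a))\<^sup>2)) \<partial>lborel) = (pi / a) powr (DIM('a) / 2)"
proof -
  have c: "integrable lborel (\<lambda>x::'a. complex_of_real (exp (- (a * (norm x)\<^sup>2))))"
    using integrable_gaussian_real[OF a, of "0::'a"] by simp
  then show "integrable lborel (\<lambda>x::'a. exp (- (a * (norm x)\<^sup>2)))"
    by (simp only: complex_of_real_integrable_eq)
  have "complex_of_real (\<integral>x. exp (- (a * (norm (x::'a))\<^sup>2)) \<partial>lborel) = of_real ((pi / a) powr (DIM('a) / 2))"
    using gaussian_fourier_real[OF a, of "0::'a"] by (simp flip: integral_complex_of_real)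
  then show "(\<integral>x. exp (- (a * (norm (x::'a))\<^sup>2)) \<partial>lborel) = (pi / a) powr (DIM('a) / 2)"
    by (simp only: of_real_eq_iff)
qed

definition heat_kernel :: "complex \<Rightarrow> 'a::euclidean_space \<Rightarrow> complex" where
  "heat_kernel s x = of_real ((4 * pi) powr (- (DIM('a) / 2))) * s powr of_real (- (DIM('a) / 2)) * exp (- (of_real ((norm x)\<^sup>2) / (4 * s)))"

text \<open>The formula for positive real \<open>s\<close> extends to the right half plane by analytic continuation of Laplace
transforms.\<close>

lemma
  fixes x :: "'a::euclidean_space"
  assumes s: "0 < Re s"
  shows integrable_gaussian: "integrable lborel (\<lambda>\<xi>::'a. exp (\<i> * of_real (x \<bullet> \<xi>)) * exp (- (s * of_real ((norm \<xi>)\<^sup>2))))"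
    and heat_kernel_fourier: "(\<integral>\<xi>. exp (\<i> * of_real (x \<bullet> \<xi>)) * exp (- (s * of_real ((norm \<xi>)\<^sup>2))) \<partial>lborel)
      = of_real ((2 * pi) ^ DIM('a)) * heat_kernel s x"
proof -
  have int: "integrable lborel (\<lambda>\<xi>::'a. norm (exp (\<i> * of_real (x \<bullet> \<xi>))) * exp (- (r * (norm \<xi>)\<^sup>2)))" if "0 < r" for r
    using integrable_exp_norm_sq[OF that] by simp
  show "integrable lborel (\<lambda>\<xi>::'a. exp (\<i> * of_real (x \<bullet> \<xi>)) * exp (- (s * of_real ((norm \<xi>)\<^sup>2))))"
    by (rule integrable_laplace[OF _ _ _ int s]) auto
  show "(\<integral>\<xi>. exp (\<i> * of_real (x \<bullet> \<xi>)) * exp (- (s * of_real ((norm \<xi>)\<^sup>2))) \<partial>lborel)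
      = of_real ((2 * pi) ^ DIM('a)) * heat_kernel s x"
  proof (rule laplace_eq_if_eq_on_reals[OF _ _ _ int s])
    show "(\<lambda>s. of_real ((2 * pi) ^ DIM('a)) * heat_kernel s x) holomorphic_on {w. 0 < Re w}"
      unfolding heat_kernel_def by (intro holomorphic_intros) (auto simp: complex_nonpos_Reals_iff)
    fix r :: real assume r: "0 < r"
    have e: "exp (- (of_real r * of_real ((norm \<xi>)\<^sup>2))) = complex_of_real (exp (- (r * (norm \<xi>)\<^sup>2)))" for \<xi> :: 'a
      by (simp add: exp_of_real[symmetric])
    have "(pi / r) powr (DIM('a) / 2) = (2 * pi) ^ DIM('a) * ((4 * pi) powr (- (DIM('a) / 2)) * r powr (- (DIM('a) / 2)))"
    proof -
      have "(2 * pi) ^ DIM('a) = (2 * pi) powr (2 * (DIM('a) / 2))" using powr_realpow[of "2 * pi" "DIM('a)"] by simp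
      also have "\<dots> = ((2 * pi) powr 2) powr (DIM('a) / 2)" by (simp only: powr_powr)
      also have "(2 * pi) powr 2 = 4 * pi * pi" by (simp add: power2_eq_square)
      finally have "(2 * pi) ^ DIM('a) = (4 * pi) powr (DIM('a) / 2) * pi powr (DIM('a) / 2)" by (simp add: powr_mult)
      then show ?thesis using r by (simp add: powr_minus powr_divide field_simps)
    qed
    moreover have "heat_kernel (of_real r) x = of_real ((4 * pi) powr (- (DIM('a) / 2)) * r powr (- (DIM('a) / 2)) * exp (- ((norm x)\<^sup>2 / (4 * r))))"
    proof -
      have "exp (- (of_real ((norm x)\<^sup>2) / (4 * complex_of_real r))) = of_real (exp (- ((norm x)\<^sup>2 / (4 * r))))"
        by (subst exp_of_real[symmetric]) simp
      then show ?thesis unfolding heat_kernel_def using r by (simp add: powr_of_real del: of_real_minus)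
    qed
    ultimately show "(\<integral>\<xi>. exp (\<i> * of_real (x \<bullet> \<xi>)) * exp (- (of_real r * of_real ((norm \<xi>)\<^sup>2))) \<partial>lborel) = of_real ((2 * pi) ^ DIM('a)) * heat_kernel (of_real r) x"
      unfolding e gaussian_fourier_real[OF r] by simp
  qed auto
qed

lemma norm_heat_kernel:
  fixes x :: "'a::euclidean_space"
  assumes \<sigma>: "norm \<sigma> = 1" and \<tau>: "0 < \<tau>"
  shows "norm (heat_kernel (\<sigma> * of_real \<tau>) x) = (4 * pi * \<tau>) powr (- (DIM('a) / 2)) * exp (- (Re \<sigma> / (4 * \<tau>) * (norm x)\<^sup>2))"
proof -
  have \<sigma>0: "\<sigma> * of_real \<tau> \<noteq> 0" using assms by auto
  have "1 / \<sigma> = cnj \<sigma>" using complex_div_cnj[of 1 \<sigma>] \<sigma> by simp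
  then have "of_real ((norm x)\<^sup>2) / (4 * (\<sigma> * of_real \<tau>)) = of_real ((norm x)\<^sup>2 / (4 * \<tau>)) * cnj \<sigma>"
    by (metis (no_types, lifting) divide_divide_eq_left' mult.commute of_real_divide of_real_mult of_real_numeral times_divide_eq_right mult.right_neutral)
  then have "norm (exp (- (of_real ((norm x)\<^sup>2) / (4 * (\<sigma> * of_real \<tau>))))) = exp (- (Re \<sigma> / (4 * \<tau>) * (norm x)\<^sup>2))"
    unfolding norm_exp_eq_Re by (simp add: mult.commute)
  then show ?thesis
    unfolding heat_kernel_def norm_mult norm_powr_of_real[OF \<sigma>0] using \<sigma> \<tau> by (simp add: powr_mult norm_mult)
qed

lemma Lq_le_gaussian:
  assumes a: "0 < a" and q: "1 \<le> q"
  shows "Lq_le q (\<lambda>x::'a::euclidean_space. exp (- (a * (norm x)\<^sup>2))) ((pi / (q * a)) powr (DIM('a) / (2 * q)))"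
proof -
  have qa: "0 < q * a" using a q by simp
  have "(\<integral>\<^sup>+x. ennreal (\<bar>exp (- (a * (norm (x::'a))\<^sup>2))\<bar> powr q) \<partial>lborel) = (\<integral>\<^sup>+x. ennreal (exp (- (q * a * (norm (x::'a))\<^sup>2))) \<partial>lborel)"
    by (simp add: powr_def mult_ac)
  also have "\<dots> = ennreal ((pi / (q * a)) powr (DIM('a) / 2))"
    using integrable_exp_norm_sq[OF qa, where 'a='a] integral_exp_norm_sq[OF qa, where 'a='a] by (subst nn_integral_eq_integral) auto
  also have "\<dots> = ennreal (((pi / (q * a)) powr (DIM('a) / (2 * q))) powr q)"
    using q by (simp add: powr_powr)
  finally show ?thesis by (simp add: Lq_le_def)
qed

text \<open>On a fixed ray in the right half plane the modulus of the heat kernel is again a Gaussian, with the width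
multiplied by a constant.\<close>

lemma Lq_le_norm_heat_kernel:
  assumes \<sigma>: "norm \<sigma> = 1" "0 < Re \<sigma>" and q: "1 \<le> q"
  obtains C where "0 \<le> C" "\<And>\<tau>. 0 < \<tau> \<Longrightarrow> Lq_le q (\<lambda>x::'a::euclidean_space. norm (heat_kernel (\<sigma> * of_real \<tau>) x)) (C * \<tau> powr (- (DIM('a) / 2 * (1 - 1 / q))))"
proof -
  define n where "n = real DIM('a)"
  define C where "C = (4 * pi) powr (- (n / 2)) * (4 * pi / (q * Re \<sigma>)) powr (n / (2 * q))"
  show thesis
  proof (rule that[of C])
    fix \<tau> :: real assume \<tau>: "0 < \<tau>"
    have a: "0 < Re \<sigma> / (4 * \<tau>)" using \<sigma> \<tau> by simp
    have "Lq_le q (\<lambda>x::'a. norm (heat_kernel (\<sigma> * of_real \<tau>) x)) (\<bar>(4 * pi * \<tau>) powr (- (n / 2))\<bar> * (pi / (q * (Re \<sigma> / (4 * \<tau>)))) powr (n / (2 * q)))"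
      unfolding norm_heat_kernel[OF \<sigma>(1) \<tau>] n_def by (rule Lq_le_cmult[OF Lq_le_gaussian[OF a q]])
    also have "pi / (q * (Re \<sigma> / (4 * \<tau>))) = 4 * pi / (q * Re \<sigma>) * \<tau>" by simp
    also have "\<bar>(4 * pi * \<tau>) powr (- (n / 2))\<bar> * (4 * pi / (q * Re \<sigma>) * \<tau>) powr (n / (2 * q)) = C * (\<tau> powr (- (n / 2)) * \<tau> powr (n / (2 * q)))"
    proof -
      have pm: "(A * \<tau>) powr e = A powr e * \<tau> powr e" if "0 \<le> A" for A e :: real
        using that \<tau> by (simp add: powr_mult)
      have "0 \<le> 4 * pi / (q * Re \<sigma>)" using \<sigma> q by simp
      then show ?thesis unfolding C_def by (subst (1 2) pm) simp_all
    qed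
    also have "\<tau> powr (- (n / 2)) * \<tau> powr (n / (2 * q)) = \<tau> powr (- (n / 2 * (1 - 1 / q)))"
    proof -
      have "- (n / 2) + n / (2 * q) = - (n / 2 * (1 - 1 / q))" using q by (simp add: field_simps)
      then show ?thesis by (simp only: powr_add[symmetric])
    qed
    finally show "Lq_le q (\<lambda>x::'a. norm (heat_kernel (\<sigma> * of_real \<tau>) x)) (C * \<tau> powr (- (DIM('a) / 2 * (1 - 1 / q))))"
      by (simp add: n_def)
  qed (simp add: C_def)
qed

section \<open>Schwartz functions and uniqueness of the representing function\<close>

lemma
  fixes f :: "'a::euclidean_space \<Rightarrow> 'b::euclidean_space \<Rightarrow> complex" and g :: "'a \<Rightarrow> real"
  assumes fm: "jointly_measurable f"
    and fi: "\<And>x. integrable lborel (f x)" and fb: "\<And>x. (\<integral>y. norm (f x y) \<partial>lborel) \<le> g x" and g: "integrable lborel g"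
  shows integrable_iterated: "integrable (lborel \<Otimes>\<^sub>M lborel) (\<lambda>(x, y). f x y)"
    and integral_swap_iterated: "(\<integral>x. \<integral>y. f x y \<partial>lborel \<partial>lborel) = (\<integral>y. \<integral>x. f x y \<partial>lborel \<partial>lborel)"
proof -
  have sets_eq: "sets (lborel \<Otimes>\<^sub>M lborel) = sets ((borel :: 'a measure) \<Otimes>\<^sub>M (borel :: 'b measure))"
    by (intro sets_pair_measure_cong) auto
  have fm': "(\<lambda>(x, y). f x y) \<in> borel_measurable (lborel \<Otimes>\<^sub>M lborel)"
    unfolding measurable_cong_sets[OF sets_eq refl] by (rule fm)
  show i: "integrable (lborel \<Otimes>\<^sub>M lborel) (\<lambda>(x, y). f x y)"
  proof (rule lborel_pair.Fubini_integrable[OF fm'])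
    show "integrable lborel (\<lambda>x. \<integral>y. norm (case (x, y) of (x, y) \<Rightarrow> f x y) \<partial>lborel)"
      using g
    proof (rule Bochner_Integration.integrable_bound)
      have "(\<lambda>(x, y). norm (f x y)) \<in> borel_measurable (borel \<Otimes>\<^sub>M lborel)"
        using fm by (simp cong: measurable_cong_sets)
      then show "(\<lambda>x. \<integral>y. norm (case (x, y) of (x, y) \<Rightarrow> f x y) \<partial>lborel) \<in> borel_measurable lborel"
        using lborel.borel_measurable_lebesgue_integral[of "\<lambda>x y. norm (f x y)" borel] by simp
    qed (use fb in \<open>auto intro!: AE_I2 intro: order_trans[OF fb abs_ge_self]\<close>)
  qed (use fi in auto)
  show "(\<integral>x. \<integral>y. f x y \<partial>lborel \<partial>lborel) = (\<integral>y. \<integral>x. f x y \<partial>lborel \<partial>lborel)"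
    using lborel_pair.Fubini_integral[OF i] by simp
qed

lemma integrable_inverse_one_plus_sq: "integrable lborel (\<lambda>y::real. 1 / (1 + y\<^sup>2))"
proof -
  have ei: "einterval 0 \<infinity> = {0::real<..}" by (auto simp: einterval_def)
  define f where "f = (\<lambda>y::real. indicator {0<..} y *\<^sub>R (1 / (1 + y\<^sup>2)))"
  have f: "integrable lborel f"
    using integrable_I0i_1_div_plus_square unfolding interval_lebesgue_integrable_def ei set_integrable_def f_def by simp
  have "integrable lborel (\<lambda>y. f (0 + (-1) * y))"
    using f by (rule lborel_integrable_real_affine) simp
  then have fs: "integrable lborel (\<lambda>y. f y + f (0 + (-1) * y))" using f by (rule Bochner_Integration.integrable_add[rotated])
  have "AE y in lborel. y \<noteq> (0::real)" by (rule AE_lborel_singleton)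
  then have ae: "AE y in lborel. f y + f (0 + (-1) * y) = 1 / (1 + y\<^sup>2)"
    by eventually_elim (auto simp: f_def indicator_def)
  show ?thesis
    by (rule integrable_cong_AE[THEN iffD1, OF _ _ ae fs]) (auto simp: f_def)
qed

lemma integrable_polynomial_decay:
  "integrable lborel (\<lambda>x::'a::euclidean_space. 1 / (1 + (norm x)\<^sup>2) ^ DIM('a))"
proof -
  have c: "integrable lborel (\<lambda>x::'a. \<Prod>b\<in>Basis. complex_of_real (1 / (1 + (x \<bullet> b)\<^sup>2)))"
    using integrable_inverse_one_plus_sq by (intro integrable_lborel_prod) (simp only: complex_of_real_integrable_eq)
  then have "integrable lborel (\<lambda>x::'a. \<Prod>b\<in>Basis. 1 / (1 + (x \<bullet> b)\<^sup>2))"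
    unfolding of_real_prod[symmetric] complex_of_real_integrable_eq .
  then show ?thesis
  proof (rule Bochner_Integration.integrable_bound)
    have "1 / (1 + (norm x)\<^sup>2) ^ DIM('a) \<le> (\<Prod>b\<in>Basis. 1 / (1 + (x \<bullet> b)\<^sup>2))" for x :: 'a
    proof -
      have "(\<Prod>b\<in>(Basis::'a set). 1 / (1 + (norm x)\<^sup>2)) \<le> (\<Prod>b\<in>Basis. 1 / (1 + (x \<bullet> b)\<^sup>2))"
      proof (intro prod_mono conjI frac_le)
        fix b :: 'a assume "b \<in> Basis"
        then have "\<bar>x \<bullet> b\<bar>\<^sup>2 \<le> (norm x)\<^sup>2" by (intro power_mono Basis_le_norm) auto
        then show "1 + (x \<bullet> b)\<^sup>2 \<le> 1 + (norm x)\<^sup>2" by simp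
      qed (auto intro: add_pos_nonneg add_nonneg_nonneg)
      then show ?thesis by (simp add: power_one_over)
    qed
    moreover have "0 \<le> 1 / (1 + (norm x)\<^sup>2) ^ DIM('a)" for x :: 'a by simp
    ultimately show "AE x::'a in lborel. norm (1 / (1 + (norm x)\<^sup>2) ^ DIM('a)) \<le> norm (\<Prod>b\<in>Basis. 1 / (1 + (x \<bullet> b)\<^sup>2))"
      by (intro AE_I2) (smt (verit) real_norm_def)
  qed simp
qed

lemma one_plus_power_le: "0 \<le> (y::real) \<Longrightarrow> (1 + y) ^ n \<le> 2 ^ n * (1 + y ^ n)"
proof -
  assume y: "0 \<le> y"
  have "(1 + y) ^ n \<le> (2 * max 1 y) ^ n" using y by (intro power_mono) auto
  also have "\<dots> = 2 ^ n * (max 1 y) ^ n" by (rule power_mult_distrib)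
  also have "(max 1 y) ^ n \<le> 1 + y ^ n" using y by (auto simp: max_def)
  finally show ?thesis by simp
qed

text \<open>A bounded function that stays bounded after multiplication by a high even power of \<open>r\<close> decays like that power.\<close>

lemma polynomial_decay_bound:
  fixes z :: "'b::real_normed_vector" and r :: real
  assumes "norm z \<le> B0" "r ^ (2 * n) * norm z \<le> B1"
  shows "norm z \<le> 2 ^ n * (B0 + B1) * (1 / (1 + r\<^sup>2) ^ n)"
proof -
  have "(1 + r\<^sup>2) ^ n * norm z \<le> 2 ^ n * (1 + (r\<^sup>2) ^ n) * norm z"
    by (intro mult_right_mono one_plus_power_le) auto
  also have "\<dots> = 2 ^ n * (norm z + r ^ (2 * n) * norm z)"
    unfolding power_mult[of r 2 n] by (simp only: algebra_simps mult_1_left)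
  also have "\<dots> \<le> 2 ^ n * (B0 + B1)" using assms by (intro mult_left_mono add_mono) auto
  finally have "(1 + r\<^sup>2) ^ n * norm z \<le> 2 ^ n * (B0 + B1)" .
  moreover have "0 < (1 + r\<^sup>2) ^ n" by (intro zero_less_power add_pos_nonneg) auto
  ultimately show ?thesis by (simp add: pos_le_divide_eq mult.commute)
qed

context
  fixes \<phi> :: "'a::euclidean_space \<Rightarrow> complex"
  assumes \<phi>: "\<phi> \<in> schwartz"
begin

lemma schwartz_differentiable: "set vs \<subseteq> Basis \<Longrightarrow> iter_deriv vs \<phi> differentiable (at x)"
  using \<phi> by (auto simp: schwartz_def)

lemma schwartz_continuous: "set vs \<subseteq> Basis \<Longrightarrow> continuous_on UNIV (iter_deriv vs \<phi>)"
  using differentiable_imp_continuous_within[OF schwartz_differentiable]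
  by (simp add: continuous_on_eq_continuous_within)

lemma schwartz_measurable: "set vs \<subseteq> Basis \<Longrightarrow> iter_deriv vs \<phi> \<in> borel_measurable borel"
  using schwartz_continuous by (rule borel_measurable_continuous_onI)

lemma schwartz_bounded:
  assumes "set vs \<subseteq> Basis"
  obtains B where "\<And>x. norm (iter_deriv vs \<phi> x) \<le> B"
proof -
  have "\<exists>B. \<forall>x. norm x ^ 0 * norm (iter_deriv vs \<phi> x) \<le> B" using \<phi> assms unfolding schwartz_def by blast
  then show thesis using that by auto
qed

lemma schwartz_integrable:
  assumes vs: "set vs \<subseteq> Basis"
  shows "integrable lborel (iter_deriv vs \<phi>)"
proof -
  obtain B0 where B0: "\<And>x. norm (iter_deriv vs \<phi> x) \<le> B0" using schwartz_bounded[OF vs] by blast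
  have "\<exists>B. \<forall>x. norm x ^ (2 * DIM('a)) * norm (iter_deriv vs \<phi> x) \<le> B" using \<phi> vs unfolding schwartz_def by blast
  then obtain B1 where B1: "\<And>x. norm x ^ (2 * DIM('a)) * norm (iter_deriv vs \<phi> x) \<le> B1" by blast
  have "integrable lborel (\<lambda>x::'a. 2 ^ DIM('a) * (B0 + B1) * (1 / (1 + (norm x)\<^sup>2) ^ DIM('a)))"
    by (intro integrable_mult_right integrable_polynomial_decay)
  then show ?thesis
  proof (rule Bochner_Integration.integrable_bound)
    show "AE x in lborel. norm (iter_deriv vs \<phi> x) \<le> norm (2 ^ DIM('a) * (B0 + B1) * (1 / (1 + (norm x)\<^sup>2) ^ DIM('a)))"
      unfolding real_norm_def by (rule AE_I2) (rule order_trans[OF polynomial_decay_bound[OF B0 B1] abs_ge_self])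
  qed (use schwartz_measurable[OF vs] in simp)
qed

end

text \<open>The integral over \<open>x\<close> of the difference quotient along \<open>v\<close> vanishes by translation invariance; by the
fundamental theorem it is an average of translates of the derivative.\<close>

lemma integral_directional_derivative_eq_0:
  fixes F DF :: "'a::euclidean_space \<Rightarrow> complex"
  assumes F: "integrable lborel F" and DF: "integrable lborel DF" "continuous_on UNIV DF"
    and der: "\<And>x. ((\<lambda>s::real. F (x + s *\<^sub>R v)) has_vector_derivative DF x) (at 0)"
  shows "(\<integral>x. DF x \<partial>lborel) = 0"
proof -
  have [measurable]: "DF \<in> borel_measurable borel" using DF(2) by (rule borel_measurable_continuous_onI)
  have line: "((\<lambda>s. F (x + s *\<^sub>R v)) has_vector_derivative DF (x + s *\<^sub>R v)) (at s)" for x s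
  proof -
    have "((\<lambda>r. F (x + s *\<^sub>R v + r *\<^sub>R v)) \<circ> (\<lambda>r. r - s) has_vector_derivative 1 *\<^sub>R DF (x + s *\<^sub>R v)) (at s)"
      by (rule vector_diff_chain_at) (use der[of "x + s *\<^sub>R v"] in \<open>auto intro!: derivative_eq_intros\<close>)
    then show ?thesis by (simp add: o_def algebra_simps)
  qed
  have shift: "integrable lborel (\<lambda>x. f (x + s *\<^sub>R v))" "(\<integral>x. f (x + s *\<^sub>R v) \<partial>lborel) = (\<integral>x. f x \<partial>lborel)"
    if "integrable lborel f" for f :: "'a \<Rightarrow> 'b::{banach, second_countable_topology}" and s
    using integrable_lborel_affine[OF that, of 1 "s *\<^sub>R v"] integral_lborel_affine[of 1 f "s *\<^sub>R v"] by (auto simp: add.commute)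
  define f where "f = (\<lambda>s x. indicator {0..1::real} s *\<^sub>R DF (x + s *\<^sub>R v))"
  have "(\<integral>s. \<integral>x. f s x \<partial>lborel \<partial>lborel) = (\<integral>x. \<integral>s. f s x \<partial>lborel \<partial>lborel)"
  proof (rule integral_swap_iterated)
    show "jointly_measurable f" unfolding f_def by measurable
    show "integrable lborel (f s)" for s unfolding f_def using shift(1)[OF DF(1)] by simp
    have "(\<integral>x. norm (DF (x + s *\<^sub>R v)) \<partial>lborel) = (\<integral>x. norm (DF x) \<partial>lborel)" for s
      by (rule shift(2)) (use DF in simp)
    then show "(\<integral>x. norm (f s x) \<partial>lborel) \<le> indicator {0..1} s * (\<integral>x. norm (DF x) \<partial>lborel)" for s
      unfolding f_def by (simp add: indicator_def)
    show "integrable lborel (\<lambda>s::real. indicator {0..1} s * (\<integral>x. norm (DF x) \<partial>lborel))" by simp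
  qed
  also have "(\<lambda>x. \<integral>s. f s x \<partial>lborel) = (\<lambda>x. F (x + 1 *\<^sub>R v) - F x)"
  proof
    fix x
    have "(LBINT s=ereal 0..ereal 1. DF (x + s *\<^sub>R v)) = F (x + 1 *\<^sub>R v) - F (x + 0 *\<^sub>R v)"
    proof (rule interval_integral_FTC_finite)
      show "continuous_on {min 0 1..max 0 1::real} (\<lambda>s. DF (x + s *\<^sub>R v))"
        by (rule continuous_on_compose2[OF DF(2)]) (auto intro!: continuous_intros)
    qed (rule has_vector_derivative_at_within[OF line])
    then show "(\<integral>s. f s x \<partial>lborel) = F (x + 1 *\<^sub>R v) - F x"
      unfolding f_def by (subst (asm) interval_integral_Icc) (auto simp: set_lebesgue_integral_def)
  qed
  also have "(\<integral>x. F (x + 1 *\<^sub>R v) - F x \<partial>lborel) = 0"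
    using shift[OF F, of 1] F by (subst Bochner_Integration.integral_diff) auto
  also have "(\<integral>s. \<integral>x. f s x \<partial>lborel \<partial>lborel) = (\<integral>s. indicator {0..1::real} s *\<^sub>R (\<integral>x. DF x \<partial>lborel) \<partial>lborel)"
    unfolding f_def using shift(2)[OF DF(1)] by simp
  also have "\<dots> = (\<integral>x. DF x \<partial>lborel)" by simp
  finally show ?thesis .
qed

text \<open>Integration by parts.\<close>

lemma fourier_iter_deriv:
  fixes \<phi> :: "'a::euclidean_space \<Rightarrow> complex"
  assumes \<phi>: "\<phi> \<in> schwartz" and b: "b \<in> Basis" and vs: "set vs \<subseteq> Basis"
  shows "(\<integral>x. exp (\<i> * of_real (\<xi> \<bullet> x)) * iter_deriv (b # vs) \<phi> x \<partial>lborel)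
    = - (\<i> * of_real (\<xi> \<bullet> b)) * (\<integral>x. exp (\<i> * of_real (\<xi> \<bullet> x)) * iter_deriv vs \<phi> x \<partial>lborel)"
proof -
  define e where "e = (\<lambda>x. exp (\<i> * complex_of_real (\<xi> \<bullet> x)))"
  define f where "f = iter_deriv vs \<phi>"
  define f' where "f' = iter_deriv (b # vs) \<phi>"
  have bvs: "set (b # vs) \<subseteq> Basis" using b vs by simp
  have ec: "continuous_on UNIV e" unfolding e_def by (intro continuous_intros)
  have [measurable]: "e \<in> borel_measurable borel" using ec by (rule borel_measurable_continuous_onI)
  have e1: "norm (e x) = 1" for x by (simp add: e_def)
  have int: "integrable lborel (\<lambda>x. e x * h x)" if "integrable lborel h" for h
    using that by (rule Bochner_Integration.integrable_bound) (use that e1 in \<open>auto simp: norm_mult\<close>)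
  have fi: "integrable lborel f" "integrable lborel f'"
    unfolding f_def f'_def using schwartz_integrable[OF \<phi>] vs bvs by blast+
  define DF where "DF = (\<lambda>x. e x * f' x + \<i> * of_real (\<xi> \<bullet> b) * (e x * f x))"
  have "(\<integral>x. DF x \<partial>lborel) = 0"
  proof (rule integral_directional_derivative_eq_0[where F="\<lambda>x. e x * f x" and v=b])
    show "integrable lborel (\<lambda>x. e x * f x)" by (rule int[OF fi(1)])
    show "integrable lborel DF" unfolding DF_def by (intro Bochner_Integration.integrable_add int fi integrable_mult_right)
    show "continuous_on UNIV DF"
    proof -
      have "continuous_on UNIV f" "continuous_on UNIV f'"
        unfolding f_def f'_def using schwartz_continuous[OF \<phi>] vs bvs by blast+
      then show ?thesis unfolding DF_def by (intro continuous_intros ec)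
    qed
    fix x
    have "(f has_derivative frechet_derivative f (at x)) (at x)"
      using schwartz_differentiable[OF \<phi> vs] frechet_derivative_works unfolding f_def by blast
    then have "(f has_derivative frechet_derivative f (at x)) (at (x + 0 *\<^sub>R b))" by simp
    then have "((\<lambda>s. f (x + s *\<^sub>R b)) has_derivative (\<lambda>s. frechet_derivative f (at x) (s *\<^sub>R b))) (at 0)"
      by (rule has_derivative_compose[rotated]) (auto intro!: derivative_eq_intros)
    then have "((\<lambda>s. f (x + s *\<^sub>R b)) has_derivative (\<lambda>s. s *\<^sub>R f' x)) (at 0)"
      using linear_cmul[OF linear_frechet_derivative[OF schwartz_differentiable[OF \<phi> vs]]]
      by (simp add: f'_def f_def)
    then have 1: "((\<lambda>s. f (x + s *\<^sub>R b)) has_vector_derivative f' x) (at 0)"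
      by (simp add: has_vector_derivative_def)
    have "((\<lambda>s. \<i> * complex_of_real (\<xi> \<bullet> (x + s *\<^sub>R b))) has_vector_derivative \<i> * of_real (\<xi> \<bullet> b)) (at 0)"
      unfolding inner_add_right inner_scaleR_right
      by (auto intro!: derivative_eq_intros simp: has_vector_derivative_def scaleR_conv_of_real algebra_simps)
    from field_vector_diff_chain_at[OF this DERIV_exp]
    have 2: "((\<lambda>s. e (x + s *\<^sub>R b)) has_vector_derivative \<i> * of_real (\<xi> \<bullet> b) * e x) (at 0)"
      by (simp add: e_def o_def)
    show "((\<lambda>s. e (x + s *\<^sub>R b) * f (x + s *\<^sub>R b)) has_vector_derivative DF x) (at 0)"
      using has_vector_derivative_mult[OF 2 1] by (simp add: DF_def algebra_simps)
  qed
  then have "(\<integral>x. e x * f' x \<partial>lborel) + \<i> * of_real (\<xi> \<bullet> b) * (\<integral>x. e x * f x \<partial>lborel) = 0"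
    unfolding DF_def using int[OF fi(1)] int[OF fi(2)]
    by (subst (asm) Bochner_Integration.integral_add) auto
  then show ?thesis unfolding e_def f_def f'_def by (simp add: add_eq_0_iff)
qed

lemma power_norm_le_sum:
  fixes x :: "'a::euclidean_space"
  shows "norm x ^ k \<le> real DIM('a) ^ k * (\<Sum>b\<in>Basis. \<bar>x \<bullet> b\<bar> ^ k)"
proof -
  obtain b0 where b0: "b0 \<in> (Basis :: 'a set)" "\<And>b. b \<in> Basis \<Longrightarrow> \<bar>x \<bullet> b\<bar> \<le> \<bar>x \<bullet> b0\<bar>"
  proof -
    define m where "m = Max ((\<lambda>b. \<bar>x \<bullet> b\<bar>) ` Basis)"
    have "m \<in> (\<lambda>b. \<bar>x \<bullet> b\<bar>) ` Basis" unfolding m_def by (intro Max_in) auto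
    moreover have "\<bar>x \<bullet> b\<bar> \<le> m" if "b \<in> Basis" for b unfolding m_def using that by (intro Max_ge) auto
    ultimately show thesis using that by auto
  qed
  have "norm x \<le> (\<Sum>b\<in>Basis. \<bar>x \<bullet> b\<bar>)" by (rule norm_le_l1)
  also have "\<dots> \<le> real DIM('a) * \<bar>x \<bullet> b0\<bar>" using sum_bounded_above[of Basis "\<lambda>b. \<bar>x \<bullet> b\<bar>" "\<bar>x \<bullet> b0\<bar>"] b0 by simp
  finally have "norm x ^ k \<le> (real DIM('a) * \<bar>x \<bullet> b0\<bar>) ^ k" by (intro power_mono) auto
  also have "\<dots> = real DIM('a) ^ k * \<bar>x \<bullet> b0\<bar> ^ k" by (rule power_mult_distrib)
  also have "\<bar>x \<bullet> b0\<bar> ^ k \<le> (\<Sum>b\<in>Basis. \<bar>x \<bullet> b\<bar> ^ k)"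
    using b0(1) by (intro member_le_sum) auto
  finally show ?thesis by (simp add: mult_left_mono)
qed

text \<open>High powers of the frequency times the transform are transforms of derivatives, hence bounded.\<close>

lemma inv_fourier_schwartz_integrable:
  fixes \<phi> :: "'a::euclidean_space \<Rightarrow> complex"
  assumes \<phi>: "\<phi> \<in> schwartz"
  shows "integrable lborel (inv_fourier \<phi>)"
proof -
  define J where "J = (\<lambda>vs (\<xi>::'a). \<integral>x. exp (\<i> * of_real (\<xi> \<bullet> x)) * iter_deriv vs \<phi> x \<partial>lborel)"
  define I where "I = (\<lambda>vs. \<integral>x. norm (iter_deriv vs \<phi> x) \<partial>lborel)"
  have JI: "norm (J vs \<xi>) \<le> I vs" for vs \<xi>
    unfolding J_def I_def by (rule order_trans[OF integral_norm_bound]) (simp add: norm_mult)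
  have Jrep: "J (replicate k b) \<xi> = (- (\<i> * of_real (\<xi> \<bullet> b))) ^ k * J [] \<xi>" if b: "b \<in> Basis" for b k \<xi>
  proof (induction k)
    case (Suc k)
    have "J (b # replicate k b) \<xi> = - (\<i> * of_real (\<xi> \<bullet> b)) * J (replicate k b) \<xi>"
      unfolding J_def by (rule fourier_iter_deriv[OF \<phi> b]) (use b in auto)
    then show ?case unfolding Suc.IH by simp
  qed simp
  have comp: "\<bar>\<xi> \<bullet> b\<bar> ^ k * norm (J [] \<xi>) \<le> I (replicate k b)" if "b \<in> Basis" for b k \<xi>
    using JI[of "replicate k b" \<xi>] unfolding Jrep[OF that] by (simp add: norm_mult norm_power)
  define B1 where "B1 = real DIM('a) ^ (2 * DIM('a)) * (\<Sum>b\<in>(Basis::'a set). I (replicate (2 * DIM('a)) b))"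
  have B1: "norm \<xi> ^ (2 * DIM('a)) * norm (J [] \<xi>) \<le> B1" for \<xi>
  proof -
    have "norm \<xi> ^ (2 * DIM('a)) * norm (J [] \<xi>) \<le> real DIM('a) ^ (2 * DIM('a)) * (\<Sum>b\<in>Basis. \<bar>\<xi> \<bullet> b\<bar> ^ (2 * DIM('a))) * norm (J [] \<xi>)"
      by (intro mult_right_mono power_norm_le_sum) auto
    also have "\<dots> = real DIM('a) ^ (2 * DIM('a)) * (\<Sum>b\<in>Basis. \<bar>\<xi> \<bullet> b\<bar> ^ (2 * DIM('a)) * norm (J [] \<xi>))"
      by (simp add: sum_distrib_right)
    also have "\<dots> \<le> B1" unfolding B1_def by (intro mult_left_mono sum_mono comp) auto
    finally show ?thesis .
  qed
  have Jm: "J [] \<in> borel_measurable borel"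
  proof -
    have [measurable]: "\<phi> \<in> borel_measurable borel" using schwartz_measurable[OF \<phi>, of "[]"] by simp
    show ?thesis unfolding J_def iter_deriv.simps
      by (rule lborel.borel_measurable_lebesgue_integral) measurable
  qed
  have "integrable lborel (\<lambda>x::'a. 2 ^ DIM('a) * (I [] + B1) * (1 / (1 + (norm x)\<^sup>2) ^ DIM('a)))"
    by (intro integrable_mult_right integrable_polynomial_decay)
  then have "integrable lborel (J [])"
  proof (rule Bochner_Integration.integrable_bound)
    show "AE x in lborel. norm (J [] x) \<le> norm (2 ^ DIM('a) * (I [] + B1) * (1 / (1 + (norm x)\<^sup>2) ^ DIM('a)))"
      unfolding real_norm_def by (rule AE_I2) (rule order_trans[OF polynomial_decay_bound[OF JI B1] abs_ge_self])
  qed (use Jm in simp)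
  moreover have "inv_fourier \<phi> = (\<lambda>\<xi>. (1 / of_real ((2 * pi) ^ DIM('a))) * J [] \<xi>)"
    by (simp add: fun_eq_iff inv_fourier_def J_def)
  ultimately show ?thesis by (simp only: integrable_mult_right)
qed

text \<open>Polynomial functions, as needed for the iterated derivatives of a Gaussian: a class that is closed under
differentiation and has polynomial growth.\<close>

inductive poly_fun :: "('a::euclidean_space \<Rightarrow> complex) \<Rightarrow> bool" where
  const: "poly_fun (\<lambda>x. c)"
| linear: "poly_fun (\<lambda>x. of_real (x \<bullet> v))"
| add: "poly_fun P \<Longrightarrow> poly_fun Q \<Longrightarrow> poly_fun (\<lambda>x. P x + Q x)"
| mult: "poly_fun P \<Longrightarrow> poly_fun Q \<Longrightarrow> poly_fun (\<lambda>x. P x * Q x)"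

lemma poly_fun_derivative:
  assumes "poly_fun P"
  shows "\<exists>P'. (\<forall>x. (P has_derivative P' x) (at x)) \<and> (\<forall>v. poly_fun (\<lambda>x. P' x v))"
  using assms
proof induction
  case (const c)
  then show ?case by (intro exI[of _ "\<lambda>x h. 0"]) (auto intro: poly_fun.intros)
next
  case (linear v)
  have "((\<lambda>x. complex_of_real (x \<bullet> v)) has_derivative (\<lambda>h. complex_of_real (h \<bullet> v))) (at x)" for x
    by (auto intro!: derivative_eq_intros)
  then show ?case by (intro exI[of _ "\<lambda>x h. complex_of_real (h \<bullet> v)"]) (auto intro: poly_fun.intros)
next
  case (add P Q)
  then obtain P' Q' where "\<And>x. (P has_derivative P' x) (at x)" "\<And>v. poly_fun (\<lambda>x. P' x v)"
    "\<And>x. (Q has_derivative Q' x) (at x)" "\<And>v. poly_fun (\<lambda>x. Q' x v)" by blast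
  then show ?case
    by (intro exI[of _ "\<lambda>x h. P' x h + Q' x h"]) (auto intro: poly_fun.intros has_derivative_add)
next
  case (mult P Q)
  then obtain P' Q' where d: "\<And>x. (P has_derivative P' x) (at x)" "\<And>v. poly_fun (\<lambda>x. P' x v)"
    "\<And>x. (Q has_derivative Q' x) (at x)" "\<And>v. poly_fun (\<lambda>x. Q' x v)" by blast
  show ?case
    by (intro exI[of _ "\<lambda>x h. P x * Q' x h + P' x h * Q x"] conjI allI has_derivative_mult poly_fun.add poly_fun.mult mult.hyps d)
qed

lemma poly_fun_growth:
  assumes "poly_fun P"
  shows "\<exists>C k. 0 \<le> C \<and> (\<forall>x. norm (P x) \<le> C * (1 + norm x) ^ k)"
  using assms
proof induction
  case (const c)
  then show ?case by (intro exI[of _ "norm c"] exI[of _ 0]) auto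
next
  case (linear v)
  have "norm (complex_of_real (x \<bullet> v)) \<le> norm v * (1 + norm x) ^ 1" for x
  proof -
    have "norm v * (1 + norm x) ^ 1 = norm v + norm x * norm v" by (simp add: algebra_simps)
    then show ?thesis using Cauchy_Schwarz_ineq2[of x v] norm_ge_zero[of v] unfolding norm_of_real by linarith
  qed
  then show ?case by (intro exI[of _ "norm v"] exI[of _ 1]) auto
next
  case (add P Q)
  then obtain C k D l where C: "0 \<le> C" "\<And>x. norm (P x) \<le> C * (1 + norm x) ^ k" and D: "0 \<le> D" "\<And>x. norm (Q x) \<le> D * (1 + norm x) ^ l"
    by blast
  have "norm (P x + Q x) \<le> (C + D) * (1 + norm x) ^ (k + l)" for x
  proof -
    have "norm (P x + Q x) \<le> C * (1 + norm x) ^ k + D * (1 + norm x) ^ l"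
      using norm_triangle_mono[OF C(2) D(2)] .
    also have "\<dots> \<le> C * (1 + norm x) ^ (k + l) + D * (1 + norm x) ^ (k + l)"
      using C D by (intro add_mono mult_left_mono power_increasing) auto
    finally show ?thesis by (simp add: algebra_simps)
  qed
  then show ?case using C D by (intro exI[of _ "C + D"] exI[of _ "k + l"]) auto
next
  case (mult P Q)
  then obtain C k D l where C: "0 \<le> C" "\<And>x. norm (P x) \<le> C * (1 + norm x) ^ k" and D: "0 \<le> D" "\<And>x. norm (Q x) \<le> D * (1 + norm x) ^ l"
    by blast
  have "norm (P x * Q x) \<le> (C * D) * (1 + norm x) ^ (k + l)" for x
    unfolding norm_mult using mult_mono[OF C(2)[of x] D(2)[of x]] C D by (simp add: power_add mult_ac)
  then show ?case using C D by (intro exI[of _ "C * D"] exI[of _ "k + l"]) auto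
qed

text \<open>Each iterated derivative is a polynomial times the Gaussian. The linear term in the exponent provides the
translates of a Gaussian that are used as test functions below.\<close>

lemma gaussian_schwartz:
  fixes b :: "'a::euclidean_space"
  assumes c: "0 < c"
  shows "(\<lambda>x::'a. complex_of_real (exp (b \<bullet> x - c * (norm x)\<^sup>2))) \<in> schwartz"
proof -
  define \<phi> where "\<phi> = (\<lambda>x::'a. complex_of_real (exp (b \<bullet> x - c * (norm x)\<^sup>2)))"
  have d\<phi>: "(\<phi> has_derivative (\<lambda>h. \<phi> x * of_real (b \<bullet> h - 2 * c * (x \<bullet> h)))) (at x)" for x
    unfolding \<phi>_def power2_norm_eq_inner
    by (auto intro!: derivative_eq_intros simp: inner_commute algebra_simps)
  have rep: "\<exists>P. poly_fun P \<and> iter_deriv vs \<phi> = (\<lambda>x. P x * \<phi> x)" for vs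
  proof (induction vs)
    case Nil
    show ?case by (intro exI[of _ "\<lambda>x. 1"]) (auto intro: poly_fun.intros)
  next
    case (Cons v vs)
    then obtain P where P: "poly_fun P" "iter_deriv vs \<phi> = (\<lambda>x. P x * \<phi> x)" by blast
    obtain P' where P': "\<And>x. (P has_derivative P' x) (at x)" "\<And>v. poly_fun (\<lambda>x. P' x v)"
      using poly_fun_derivative[OF P(1)] by blast
    define Q where "Q = (\<lambda>x. P x * (of_real (b \<bullet> v) + of_real (- 2 * c) * of_real (x \<bullet> v)) + P' x v)"
    have "frechet_derivative (\<lambda>x. P x * \<phi> x) (at x) v = Q x * \<phi> x" for x
    proof -
      have "((\<lambda>x. P x * \<phi> x) has_derivative (\<lambda>h. P x * (\<phi> x * of_real (b \<bullet> h - 2 * c * (x \<bullet> h))) + P' x h * \<phi> x)) (at x)"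
        by (rule has_derivative_mult[OF P'(1) d\<phi>])
      then have "frechet_derivative (\<lambda>x. P x * \<phi> x) (at x) = (\<lambda>h. P x * (\<phi> x * of_real (b \<bullet> h - 2 * c * (x \<bullet> h))) + P' x h * \<phi> x)"
        by (rule frechet_derivative_at[symmetric])
      then show ?thesis by (simp add: Q_def algebra_simps)
    qed
    moreover have "poly_fun Q" unfolding Q_def by (intro poly_fun.intros P P')
    ultimately show ?case using P(2) by (intro exI[of _ Q]) auto
  qed
  show ?thesis
    unfolding \<phi>_def[symmetric] schwartz_def
  proof (intro CollectI allI impI conjI)
    fix vs :: "'a list" and x :: 'a
    obtain P where P: "poly_fun P" "iter_deriv vs \<phi> = (\<lambda>x. P x * \<phi> x)" using rep by blast
    obtain P' where P': "\<And>x. (P has_derivative P' x) (at x)" using poly_fun_derivative[OF P(1)] by blast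
    show "iter_deriv vs \<phi> differentiable (at x)"
      unfolding P(2) using has_derivative_mult[OF P' d\<phi>] differentiable_def by blast
  next
    fix vs :: "'a list" and k :: nat
    obtain P where P: "poly_fun P" "iter_deriv vs \<phi> = (\<lambda>x. P x * \<phi> x)" using rep by blast
    obtain C l where C: "0 \<le> C" "\<And>x. norm (P x) \<le> C * (1 + norm x) ^ l" using poly_fun_growth[OF P(1)] by blast
    define E where "E = (norm b + 1)\<^sup>2 / (4 * c) + 1"
    have "norm x ^ k * norm (iter_deriv vs \<phi> x) \<le> C * fact (k + l) * exp E" for x
    proof -
      define y where "y = 1 + norm x"
      have y: "0 \<le> y" "norm x \<le> y" by (auto simp: y_def)
      have "norm x ^ k * norm (P x) \<le> y ^ k * (C * y ^ l)"
        using C y unfolding y_def[symmetric] by (intro mult_mono power_mono) (auto simp: y_def)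
      also have "\<dots> = C * y ^ (k + l)" by (simp add: power_add)
      also have "\<dots> \<le> C * (fact (k + l) * exp y)"
      proof (intro mult_left_mono C)
        have "y ^ (k + l) / fact (k + l) \<le> exp y"
          using sum_le_suminf[OF summable_exp, of "{k + l}" y] y by (simp add: exp_def divide_inverse mult.commute)
        then show "y ^ (k + l) \<le> fact (k + l) * exp y" by (simp add: field_simps)
      qed
      finally have 1: "norm x ^ k * norm (P x) \<le> C * (fact (k + l) * exp y)" .
      have "b \<bullet> x - c * (norm x)\<^sup>2 \<le> norm b * norm x - c * (norm x)\<^sup>2"
        using norm_cauchy_schwarz[of b x] by simp
      also have "\<dots> \<le> E - y"
      proof -
        have "0 \<le> (norm b + 1 - 2 * c * norm x)\<^sup>2 / (4 * c)" using c by simp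
        also have "\<dots> = (norm b + 1)\<^sup>2 / (4 * c) - (norm b + 1) * norm x + c * (norm x)\<^sup>2"
          using c by (simp add: power2_eq_square field_simps)
        finally show ?thesis by (simp add: E_def y_def algebra_simps)
      qed
      finally have 2: "norm (\<phi> x) \<le> exp (E - y)" by (simp add: \<phi>_def)
      have "norm x ^ k * norm (iter_deriv vs \<phi> x) = (norm x ^ k * norm (P x)) * norm (\<phi> x)"
        unfolding P(2) norm_mult by simp
      also have "\<dots> \<le> (C * (fact (k + l) * exp y)) * exp (E - y)"
        by (rule mult_mono[OF 1 2]) (use C in auto)
      also have "\<dots> = C * fact (k + l) * exp E" by (simp add: exp_diff)
      finally show ?thesis .
    qed
    then show "\<exists>B. \<forall>x. norm x ^ k * norm (iter_deriv vs \<phi> x) \<le> B" by blast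
  qed
qed

text \<open>Multiplied by a Gaussian, the difference of the two functions is integrable; its convolutions with narrow
Gaussians are pairings with Schwartz functions, hence zero, and they converge to a multiple of it in \<open>L\<^sup>1\<close>.\<close>

lemma represents_distr_unique:
  fixes g1 g2 :: "'a::euclidean_space \<Rightarrow> real"
  assumes g1: "represents_distr g1 T" and g2: "represents_distr g2 T"
  shows "AE x in lborel. g1 x = g2 x" and "g1 \<in> borel_measurable borel"
proof -
  have meas: "g \<in> borel_measurable borel" if "represents_distr g T" for g
  proof -
    have "integrable lborel (\<lambda>x. g x * exp (0 \<bullet> x - 1 * (norm x)\<^sup>2))"
      using bspec[OF that[unfolded represents_distr_def] gaussian_schwartz[OF zero_less_one, of 0]]
      unfolding of_real_mult[symmetric] complex_of_real_integrable_eq by blast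
    then have "integrable lborel (\<lambda>x. g x * exp (- (norm x)\<^sup>2))" by simp
    then have [measurable]: "(\<lambda>x. g x * exp (- (norm x)\<^sup>2)) \<in> borel_measurable borel" by auto
    have "(\<lambda>x. (g x * exp (- (norm x)\<^sup>2)) / exp (- (norm x)\<^sup>2)) \<in> borel_measurable borel" by measurable
    then show ?thesis by simp
  qed
  show "g1 \<in> borel_measurable borel" by (rule meas[OF g1])
  define d where "d = (\<lambda>x. g1 x - g2 x)"
  have test: "integrable lborel (\<lambda>x. d x * exp (b \<bullet> x - c * (norm x)\<^sup>2))" "(\<integral>x. d x * exp (b \<bullet> x - c * (norm x)\<^sup>2) \<partial>lborel) = 0"
    if c: "0 < c" for b c
  proof -
    let ?\<phi> = "\<lambda>x. exp (b \<bullet> x - c * (norm x)\<^sup>2)"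
    have i: "integrable lborel (\<lambda>x. g x * ?\<phi> x)" "complex_of_real (\<integral>x. g x * ?\<phi> x \<partial>lborel) = T (\<lambda>x. of_real (?\<phi> x))"
      if "represents_distr g T" for g
      using bspec[OF that[unfolded represents_distr_def] gaussian_schwartz[OF c, of b]]
      unfolding of_real_mult[symmetric] complex_of_real_integrable_eq integral_complex_of_real by blast+
    have "complex_of_real (\<integral>x. g1 x * ?\<phi> x \<partial>lborel) = of_real (\<integral>x. g2 x * ?\<phi> x \<partial>lborel)"
      unfolding i(2)[OF g1] i(2)[OF g2] ..
    then have "(\<integral>x. g1 x * ?\<phi> x \<partial>lborel) = (\<integral>x. g2 x * ?\<phi> x \<partial>lborel)"
      by (simp only: of_real_eq_iff)
    then show "integrable lborel (\<lambda>x. d x * ?\<phi> x)" "(\<integral>x. d x * ?\<phi> x \<partial>lborel) = 0"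
      using i(1)[OF g1] i(1)[OF g2] by (simp_all add: d_def left_diff_distrib)
  qed
  define h where "h = (\<lambda>x. d x * exp (- (norm x)\<^sup>2))"
  have hi: "integrable lborel h" using test(1)[of 1 0] by (simp add: h_def)
  have h1: "Lq_le 1 h (\<integral>x. \<bar>h x\<bar> \<partial>lborel)" using hi by (auto simp: Lq_le_1_iff)
  define \<gamma> where "\<gamma> = (\<lambda>y::'a. exp (- (norm y)\<^sup>2))"
  have \<gamma>i: "integrable lborel \<gamma>" "0 < (\<integral>y. \<gamma> y \<partial>lborel)"
    using integrable_exp_norm_sq[of 1, where 'a='a] integral_exp_norm_sq[of 1, where 'a='a] by (simp_all add: \<gamma>_def)
  have \<gamma>1: "Lq_le 1 \<gamma> (\<integral>x. \<bar>\<gamma> x\<bar> \<partial>lborel)" using \<gamma>i by (auto simp: Lq_le_1_iff)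
  have zero: "dilconv \<gamma> e h x = 0" if e: "0 < e" for e x
  proof -
    (* Completing the square: the narrow Gaussian around x times exp(-|z|^2) is a multiple of
       exp(b.z - c|z|^2). *)
    define c where "c = 1 + 1 / e\<^sup>2"
    define b where "b = (2 / e\<^sup>2) *\<^sub>R x"
    have c: "0 < c" using e by (simp add: c_def add_pos_pos)
    have "(\<integral>z. \<gamma> ((1 / e) *\<^sub>R (x - z)) * h z \<partial>lborel) = (\<integral>z. exp (- ((norm x)\<^sup>2 / e\<^sup>2)) * (d z * exp (b \<bullet> z - c * (norm z)\<^sup>2)) \<partial>lborel)"
    proof (rule Bochner_Integration.integral_cong)
      fix z
      have "(norm ((1 / e) *\<^sub>R (x - z)))\<^sup>2 = ((norm x)\<^sup>2 - 2 * (x \<bullet> z) + (norm z)\<^sup>2) / e\<^sup>2"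
        using e unfolding power2_norm_eq_inner
        by (simp add: inner_diff inner_commute power2_eq_square)
      then have "- (norm ((1 / e) *\<^sub>R (x - z)))\<^sup>2 + - (norm z)\<^sup>2 = - ((norm x)\<^sup>2 / e\<^sup>2) + (b \<bullet> z - c * (norm z)\<^sup>2)"
        using e by (simp add: b_def c_def add_divide_distrib diff_divide_distrib algebra_simps)
      then have "\<gamma> ((1 / e) *\<^sub>R (x - z)) * exp (- (norm z)\<^sup>2) = exp (- ((norm x)\<^sup>2 / e\<^sup>2)) * exp (b \<bullet> z - c * (norm z)\<^sup>2)"
        unfolding \<gamma>_def by (metis exp_add)
      then show "\<gamma> ((1 / e) *\<^sub>R (x - z)) * h z = exp (- ((norm x)\<^sup>2 / e\<^sup>2)) * (d z * exp (b \<bullet> z - c * (norm z)\<^sup>2))"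
        unfolding h_def by (metis (no_types, lifting) mult.assoc mult.left_commute)
    qed simp
    also have "\<dots> = 0" using test(2)[OF c, of b] by simp
    finally have "0 = \<bar>- e\<bar> ^ DIM('a) *\<^sub>R (\<integral>y. \<gamma> ((1 / e) *\<^sub>R (x - (x + (- e) *\<^sub>R y))) * h (x + (- e) *\<^sub>R y) \<partial>lborel)"
      using integral_lborel_affine[of "- e" "\<lambda>z. \<gamma> ((1 / e) *\<^sub>R (x - z)) * h z" x] e by simp
    then show ?thesis using e by (simp add: dilconv_def)
  qed
  have "Lq_le 1 (\<lambda>x. (\<integral>y. \<gamma> y \<partial>lborel) * h x) 0"
  proof (rule Lq_le_closed)
    fix e :: real assume "0 < e"
    from dilconv_continuous[OF \<gamma>1 h1 _ this, of 0] obtain \<delta> where \<delta>: "\<delta> > 0" "\<And>a. \<bar>a - 0\<bar> < \<delta> \<Longrightarrow> Lq_le 1 (\<lambda>x. dilconv \<gamma> a h x - dilconv \<gamma> 0 h x) e"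
      by auto
    from \<delta>(2)[of "\<delta> / 2"] \<delta>(1) have "Lq_le 1 (\<lambda>x. - ((\<integral>y. \<gamma> y \<partial>lborel) * h x)) e"
      by (simp add: zero dilconv_0)
    from Lq_le_minus[OF this] show "Lq_le 1 (\<lambda>x. (\<integral>y. \<gamma> y \<partial>lborel) * h x) e" by simp
  qed auto
  from Lq_le_0_imp_AE[OF this] have "AE x in lborel. (\<integral>y. \<gamma> y \<partial>lborel) * h x = 0" by simp
  then show "AE x in lborel. g1 x = g2 x"
    by eventually_elim (use \<gamma>i in \<open>simp add: h_def d_def\<close>)
qed

section \<open>The fractional kernels\<close>

text \<open>The heat kernel at time \<open>\<sigma> \<tau>\<close> for \<open>|\<sigma>| = 1\<close>. With the modulus and the direction of the complex time
separated, measurability in \<open>\<tau>\<close>, scaling and conjugation can be read off.\<close>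

definition rot_heat :: "complex \<Rightarrow> real \<Rightarrow> 'a::euclidean_space \<Rightarrow> complex" where
  "rot_heat \<sigma> \<tau> x = of_real ((4 * pi * \<tau>) powr (- (DIM('a) / 2))) * \<sigma> powr of_real (- (DIM('a) / 2)) * exp (- (of_real ((norm x)\<^sup>2 / (4 * \<tau>)) * cnj \<sigma>))"

lemma rot_heat_eq:
  assumes \<sigma>: "norm \<sigma> = 1" and \<tau>: "0 < \<tau>"
  shows "rot_heat \<sigma> \<tau> x = heat_kernel (\<sigma> * of_real \<tau>) x"
proof -
  have \<sigma>0: "\<sigma> \<noteq> 0" using \<sigma> by auto
  have "1 / \<sigma> = cnj \<sigma>" using complex_div_cnj[of 1 \<sigma>] \<sigma> by simp
  then have e1: "of_real ((norm x)\<^sup>2) / (4 * (\<sigma> * of_real \<tau>)) = of_real ((norm x)\<^sup>2 / (4 * \<tau>)) * cnj \<sigma>"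
    by (metis (no_types, lifting) divide_divide_eq_left' mult.commute of_real_divide of_real_mult of_real_numeral times_divide_eq_right mult.right_neutral)
  have e2: "(\<sigma> * of_real \<tau>) powr of_real a = \<sigma> powr of_real a * of_real (\<tau> powr a)" for a
    using \<tau> \<sigma>0 Ln_times_of_real[of \<tau> \<sigma>]
    by (simp add: powr_def mult.commute[of \<sigma>] distrib_left exp_add exp_of_real[symmetric] Ln_of_real)
  have e3: "(4 * pi * \<tau>) powr a = (4 * pi) powr a * \<tau> powr a" for a using \<tau> by (simp add: powr_mult)
  show ?thesis unfolding rot_heat_def heat_kernel_def e1 e2 e3 by (simp only: of_real_mult mult_ac)
qed

lemma rot_heat_scale:
  fixes x :: "'a::euclidean_space"
  assumes "0 < T" "0 < \<rho>"
  shows "rot_heat \<sigma> (\<rho> * T) x = of_real (T powr (- (DIM('a) / 2))) * rot_heat \<sigma> \<rho> (T powr (- (1 / 2)) *\<^sub>R x)"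
proof -
  have "(T powr (- (1 / 2)))\<^sup>2 = T powr (- (1 / 2) + - (1 / 2))"
    unfolding power2_eq_square powr_add ..
  also have "\<dots> = 1 / T" using assms by (simp add: powr_minus_divide)
  finally have "(norm (T powr (- (1 / 2)) *\<^sub>R x))\<^sup>2 / (4 * \<rho>) = (norm x)\<^sup>2 / (4 * (\<rho> * T))"
    using assms by (simp add: power_mult_distrib)
  moreover have "(4 * pi * (\<rho> * T)) powr a = (4 * pi * \<rho>) powr a * T powr a" for a
  proof -
    have "4 * pi * (\<rho> * T) = (4 * pi * \<rho>) * T" by simp
    then show ?thesis by (simp only: powr_mult)
  qed
  ultimately show ?thesis unfolding rot_heat_def by (simp add: mult_ac)
qed

lemma measurable_rot_heat[measurable]:
  assumes [measurable]: "f \<in> borel_measurable M" "g \<in> borel_measurable M"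
  shows "(\<lambda>z. rot_heat \<sigma> (f z) (g z :: 'a::euclidean_space)) \<in> borel_measurable M"
  unfolding rot_heat_def by measurable

lemma cnj_rot_heat:
  assumes "0 < Re \<sigma>"
  shows "cnj (rot_heat \<sigma> \<tau> x) = rot_heat (cnj \<sigma>) \<tau> x"
proof -
  have "\<sigma> \<notin> \<real>\<^sub>\<le>\<^sub>0" using assms by (auto simp: complex_nonpos_Reals_iff)
  then have "cnj (\<sigma> powr of_real a) = cnj \<sigma> powr of_real a" for a
    using assms by (auto simp: powr_def cnj_Ln exp_cnj)
  then show ?thesis by (simp add: rot_heat_def exp_cnj del: of_real_minus)
qed

lemma integral_rot_heat:
  fixes \<tau> :: real
  assumes \<sigma>: "norm \<sigma> = 1" "0 < Re \<sigma>" and \<tau>: "0 < \<tau>"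
  shows "(\<integral>x. rot_heat \<sigma> \<tau> (x::'a::euclidean_space) \<partial>lborel) = 1"
proof -
  define a where "a = real DIM('a) / 2"
  define s where "s = cnj \<sigma> * of_real (1 / (4 * \<tau>))"
  have s: "0 < Re s" using \<sigma> \<tau> by (simp add: s_def)
  have \<sigma>0: "\<sigma> \<noteq> 0" "\<sigma> \<notin> \<real>\<^sub>\<le>\<^sub>0" using \<sigma> by (auto simp: complex_nonpos_Reals_iff)
  have "(\<integral>x. exp (\<i> * of_real (0 \<bullet> x)) * exp (- (s * of_real ((norm (x::'a))\<^sup>2))) \<partial>lborel) = of_real ((2 * pi) ^ DIM('a)) * heat_kernel s (0::'a)"
    by (rule heat_kernel_fourier[OF s])
  also have "heat_kernel s (0::'a) = rot_heat (cnj \<sigma>) (1 / (4 * \<tau>)) (0::'a)"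
    unfolding s_def using \<sigma> \<tau> by (intro rot_heat_eq[symmetric]) auto
  also have "\<dots> = of_real ((pi / \<tau>) powr (- a)) * cnj \<sigma> powr of_real (- a)"
    by (simp add: rot_heat_def a_def)
  finally have I: "(\<integral>x. exp (- (s * of_real ((norm (x::'a))\<^sup>2))) \<partial>lborel) = of_real ((2 * pi) ^ DIM('a)) * (of_real ((pi / \<tau>) powr (- a)) * cnj \<sigma> powr of_real (- a))"
    by simp
  have "rot_heat \<sigma> \<tau> x = of_real ((4 * pi * \<tau>) powr (- a)) * \<sigma> powr of_real (- a) * exp (- (s * of_real ((norm x)\<^sup>2)))" for x :: 'a
    using \<tau> by (simp add: rot_heat_def a_def s_def mult_ac)
  then have "(\<integral>x. rot_heat \<sigma> \<tau> (x::'a) \<partial>lborel) = of_real ((4 * pi * \<tau>) powr (- a)) * \<sigma> powr of_real (- a) * (\<integral>x. exp (- (s * of_real ((norm (x::'a))\<^sup>2))) \<partial>lborel)"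
    by (simp only: integral_mult_right_zero)
  also have "\<dots> = of_real ((4 * pi * \<tau>) powr (- a) * (2 * pi) ^ DIM('a) * (pi / \<tau>) powr (- a)) * (\<sigma> powr of_real (- a) * cnj \<sigma> powr of_real (- a))"
    unfolding I by simp
  also have "(4 * pi * \<tau>) powr (- a) * (2 * pi) ^ DIM('a) * (pi / \<tau>) powr (- a) = 1"
  proof -
    have "(2 * pi) ^ DIM('a) = (2 * pi) powr (2 * a)" using powr_realpow[of "2 * pi" "DIM('a)"] by (simp add: a_def)
    also have "\<dots> = ((2 * pi) powr 2) powr a" by (simp only: powr_powr)
    also have "(2 * pi) powr 2 = (4 * pi * \<tau>) * (pi / \<tau>)" using \<tau> by (simp add: power2_eq_square)
    also have "\<dots> powr a = (4 * pi * \<tau>) powr a * (pi / \<tau>) powr a" using \<tau> by (intro powr_mult)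
    finally have E: "(2 * pi) ^ DIM('a) = (4 * pi * \<tau>) powr a * (pi / \<tau>) powr a" .
    have "X powr (- a) * (X powr a * Y powr a) * Y powr (- a) = 1" if "0 < X" "0 < Y" for X Y :: real
      using that by (simp add: powr_minus field_simps)
    then show ?thesis unfolding E using \<tau> by simp
  qed
  also have "\<sigma> powr of_real (- a) * cnj \<sigma> powr of_real (- a) = 1"
  proof -
    have "\<sigma> powr of_real (- a) * cnj \<sigma> powr of_real (- a) = exp (of_real (- a) * (Ln \<sigma> + cnj (Ln \<sigma>)))"
      using \<sigma>0 by (simp add: powr_def cnj_Ln exp_add[symmetric] distrib_left)
    also have "Ln \<sigma> + cnj (Ln \<sigma>) = 0" using \<sigma>0 \<sigma> by (simp add: complex_add_cnj)
    finally show ?thesis by simp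
  qed
  finally show ?thesis by simp
qed

text \<open>The heat kernel represents its Gaussian symbol as a distribution; this is Fubini's theorem.\<close>

lemma heat_kernel_schwartz:
  fixes \<phi> :: "'a::euclidean_space \<Rightarrow> complex"
  assumes \<phi>: "\<phi> \<in> schwartz" and s: "0 < Re s"
  shows "(\<integral>x. heat_kernel s x * \<phi> x \<partial>lborel) = (\<integral>\<xi>. exp (- (s * of_real ((norm \<xi>)\<^sup>2))) * inv_fourier \<phi> \<xi> \<partial>lborel)"
proof -
  define c where "c = 1 / complex_of_real ((2 * pi) ^ DIM('a))"
  have c: "c * of_real ((2 * pi) ^ DIM('a)) = 1" by (simp add: c_def)
  define f where "f = (\<lambda>x \<xi>. c * (exp (\<i> * of_real (x \<bullet> \<xi>)) * exp (- (s * of_real ((norm \<xi>)\<^sup>2)))) * \<phi> x)"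
  have \<phi>i: "integrable lborel \<phi>" using schwartz_integrable[OF \<phi>, of "[]"] by simp
  have [measurable]: "\<phi> \<in> borel_measurable borel" using \<phi>i by auto
  have "(\<integral>x. heat_kernel s x * \<phi> x \<partial>lborel) = (\<integral>x. \<integral>\<xi>. f x \<xi> \<partial>lborel \<partial>lborel)"
  proof (rule Bochner_Integration.integral_cong)
    fix x
    have "(\<integral>\<xi>. f x \<xi> \<partial>lborel) = c * (\<integral>\<xi>. exp (\<i> * of_real (x \<bullet> \<xi>)) * exp (- (s * of_real ((norm \<xi>)\<^sup>2))) \<partial>lborel) * \<phi> x"
      unfolding f_def by (simp only: integral_mult_right_zero integral_mult_left_zero)
    also have "\<dots> = heat_kernel s x * \<phi> x"
      unfolding heat_kernel_fourier[OF s] mult.assoc[symmetric] c by simp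
    finally show "heat_kernel s x * \<phi> x = (\<integral>\<xi>. f x \<xi> \<partial>lborel)" by simp
  qed simp
  also have "\<dots> = (\<integral>\<xi>. \<integral>x. f x \<xi> \<partial>lborel \<partial>lborel)"
  proof (rule integral_swap)
    show "jointly_measurable f" unfolding f_def by measurable
    show "integrable lborel (\<lambda>x. norm c * norm (\<phi> x))" using \<phi>i by simp
    show "integrable lborel (\<lambda>\<xi>::'a. exp (- (Re s * (norm \<xi>)\<^sup>2)))" by (rule integrable_exp_norm_sq[OF s])
    show "norm (f x \<xi>) \<le> norm c * norm (\<phi> x) * exp (- (Re s * (norm \<xi>)\<^sup>2))" for x \<xi>
      by (simp add: f_def norm_mult norm_exp_eq_Re)
  qed
  also have "\<dots> = (\<integral>\<xi>. exp (- (s * of_real ((norm \<xi>)\<^sup>2))) * inv_fourier \<phi> \<xi> \<partial>lborel)"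
  proof (rule Bochner_Integration.integral_cong)
    fix \<xi> :: 'a
    have "f x \<xi> = (exp (- (s * of_real ((norm \<xi>)\<^sup>2))) * c) * (exp (\<i> * of_real (\<xi> \<bullet> x)) * \<phi> x)" for x
      by (simp add: f_def inner_commute mult_ac)
    then show "(\<integral>x. f x \<xi> \<partial>lborel) = exp (- (s * of_real ((norm \<xi>)\<^sup>2))) * inv_fourier \<phi> \<xi>"
      unfolding inv_fourier_def c_def by (simp only: integral_mult_right_zero mult.assoc)
  qed simp
  finally show ?thesis .
qed

text \<open>The inverse Fourier transform of \<open>\<integral> w(\<rho>) exp (- \<rho> \<sigma> T |\<xi>|\<^sup>2) d\<rho>\<close>.\<close>

definition heat_mix :: "(real \<Rightarrow> complex) \<Rightarrow> complex \<Rightarrow> real \<Rightarrow> 'a::euclidean_space \<Rightarrow> complex" where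
  "heat_mix w \<sigma> T x = (LINT \<rho>:{0<..}|lborel. w \<rho> * rot_heat \<sigma> (\<rho> * T) x)"

lemma heat_mix_scale:
  fixes x :: "'a::euclidean_space"
  assumes "0 < T"
  shows "heat_mix w \<sigma> T x = of_real (T powr (- (DIM('a) / 2))) * heat_mix w \<sigma> 1 (T powr (- (1 / 2)) *\<^sub>R x)"
proof -
  have "heat_mix w \<sigma> T x = (LINT \<rho>:{0<..}|lborel. of_real (T powr (- (DIM('a) / 2))) * (w \<rho> * rot_heat \<sigma> (\<rho> * 1) (T powr (- (1 / 2)) *\<^sub>R x)))"
    unfolding heat_mix_def by (rule set_lebesgue_integral_cong) (auto simp: rot_heat_scale[OF assms])
  then show ?thesis unfolding heat_mix_def by (simp only: set_integral_mult_right)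
qed

context
  fixes w :: "real \<Rightarrow> complex" and \<sigma> :: complex and C \<kappa> :: real
  assumes w[measurable]: "w \<in> borel_measurable borel"
    and wb: "\<And>\<rho>. 0 < \<rho> \<Longrightarrow> norm (w \<rho>) \<le> C * exp (- (\<kappa> * \<rho>))"
    and C: "0 \<le> C" and \<kappa>: "0 < \<kappa>" and \<sigma>: "norm \<sigma> = 1" "0 < Re \<sigma>"
begin

lemma heat_mix_measurable:
  "(\<lambda>(T, x::'a::euclidean_space). heat_mix w \<sigma> T x) \<in> borel_measurable (borel \<Otimes>\<^sub>M borel)"
  unfolding heat_mix_def set_lebesgue_integral_def case_prod_beta
  by (rule lborel.borel_measurable_lebesgue_integral) measurable

text \<open>Minkowski's integral inequality with the bounds for the heat kernels. The condition on \<open>q\<close> is integrability at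
\<open>\<rho> = 0\<close> of the resulting power of \<open>\<rho>\<close>, and the weight makes the integral a Gamma integral.\<close>

lemma Lq_le_heat_mix:
  assumes q: "1 \<le> q" "DIM('a) / 2 * (1 - 1 / q) < 1"
  obtains B where "0 \<le> B" "\<And>T. 0 < T \<Longrightarrow> Lq_le q (\<lambda>x::'a::euclidean_space. norm (heat_mix w \<sigma> T x)) (B * T powr (- (DIM('a) / 2 * (1 - 1 / q))))"
proof -
  define \<theta> where "\<theta> = DIM('a) / 2 * (1 - 1 / q)"
  have \<theta>: "\<theta> < 1" "0 \<le> \<theta>" using q by (auto simp: \<theta>_def)
  obtain D where D: "0 \<le> D" "\<And>\<tau>. 0 < \<tau> \<Longrightarrow> Lq_le q (\<lambda>x::'a. norm (heat_kernel (\<sigma> * of_real \<tau>) x)) (D * \<tau> powr (- \<theta>))"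
    unfolding \<theta>_def by (rule Lq_le_norm_heat_kernel[OF \<sigma> q(1)]) blast
  define I where "I = C * (Gamma (1 - \<theta>) * \<kappa> powr (- (1 - \<theta>)))"
  have I: "0 \<le> I" using C \<kappa> Gamma_real_pos[of "1 - \<theta>"] \<theta> by (auto simp: I_def)
  show thesis
  proof (rule that[of "I * D"])
    fix T :: real assume T: "0 < T"
    define W where "W = (\<lambda>\<rho>. (C * T powr (- \<theta>)) * (indicator {0<..} \<rho> *\<^sub>R (\<rho> powr ((1 - \<theta>) - 1) * exp (- (\<kappa> * \<rho>)))))"
    define h where "h = (\<lambda>\<rho> x. (\<rho> * T) powr \<theta> * norm (rot_heat \<sigma> (\<rho> * T) (x::'a)))"
    have Wh: "W \<rho> * h \<rho> x = indicator {0<..} \<rho> *\<^sub>R (C * exp (- (\<kappa> * \<rho>)) * norm (rot_heat \<sigma> (\<rho> * T) x))" for \<rho> x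
    proof (cases "0 < \<rho>")
      case True
      have "T powr (- \<theta>) * \<rho> powr (- \<theta>) * (\<rho> * T) powr \<theta> = 1"
        using T True by (simp add: powr_mult powr_minus field_simps)
      then have "C * (T powr (- \<theta>) * \<rho> powr (- \<theta>) * (\<rho> * T) powr \<theta>) * e * r = C * e * r" for e r by simp
      from this[of "exp (- (\<kappa> * \<rho>))" "norm (rot_heat \<sigma> (\<rho> * T) x)"] show ?thesis using True
        by (simp add: W_def h_def mult_ac)
    qed (simp add: W_def)
    have Wi: "integrable lborel W" "(\<integral>\<rho>. W \<rho> \<partial>lborel) = I * T powr (- \<theta>)"
      using set_integrable_Gamma_real[of "1 - \<theta>" \<kappa>] Gamma_integral_scaled_real[of "1 - \<theta>" \<kappa>] \<theta> \<kappa>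
      unfolding W_def set_integrable_def set_lebesgue_integral_def by (simp_all add: I_def)
    have hm: "(\<lambda>(\<rho>, x). h \<rho> x) \<in> borel_measurable (lborel \<Otimes>\<^sub>M borel)" unfolding h_def by measurable
    have hD: "Lq_le q (h \<rho>) D" if "W \<rho> \<noteq> 0" for \<rho>
    proof -
      have \<rho>: "0 < \<rho>" using that by (auto simp: W_def indicator_def split: if_splits)
      then have \<tau>: "0 < \<rho> * T" using T by simp
      have "\<bar>(\<rho> * T) powr \<theta>\<bar> * (D * (\<rho> * T) powr (- \<theta>)) = D"
        using T \<rho> by (simp add: powr_minus)
      with Lq_le_cmult[OF D(2)[OF \<tau>], of "(\<rho> * T) powr \<theta>"] show ?thesis
        unfolding h_def rot_heat_eq[OF \<sigma>(1) \<tau>] by (simp only:)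
    qed
    have W0: "0 \<le> W \<rho>" for \<rho> using C by (simp add: W_def)
    have L: "Lq_le q (\<lambda>x. \<integral>\<rho>. W \<rho> * h \<rho> x \<partial>lborel) (I * T powr (- \<theta>) * D)"
      and ae: "AE x in lborel. integrable lborel (\<lambda>\<rho>. W \<rho> * h \<rho> x)"
      using Wi by (intro Lq_le_integral[where M=lborel and B="I * T powr (- \<theta>)", OF sigma_finite_lborel W0 _ _ hm hD q(1) D(1)]; simp)+
    have "AE x in lborel. \<bar>norm (heat_mix w \<sigma> T x)\<bar> \<le> \<bar>\<integral>\<rho>. W \<rho> * h \<rho> x \<partial>lborel\<bar>"
      using ae
    proof eventually_elim
      case (elim x)
      let ?f = "\<lambda>\<rho>. indicator {0<..} \<rho> *\<^sub>R (w \<rho> * rot_heat \<sigma> (\<rho> * T) x)"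
      have b: "norm (?f \<rho>) \<le> W \<rho> * h \<rho> x" for \<rho>
        unfolding Wh using wb[of \<rho>] by (auto simp: indicator_def norm_mult intro!: mult_right_mono)
      have "norm (heat_mix w \<sigma> T x) \<le> (\<integral>\<rho>. norm (?f \<rho>) \<partial>lborel)"
        unfolding heat_mix_def set_lebesgue_integral_def by (rule integral_norm_bound)
      also have "\<dots> \<le> (\<integral>\<rho>. W \<rho> * h \<rho> x \<partial>lborel)"
      proof (rule integral_mono[OF _ elim b])
        show "integrable lborel (\<lambda>\<rho>. norm (?f \<rho>))"
          using elim
        proof (rule Bochner_Integration.integrable_bound)
          show "AE \<rho> in lborel. norm (norm (?f \<rho>)) \<le> norm (W \<rho> * h \<rho> x)"
            unfolding real_norm_def abs_norm_cancel by (intro AE_I2 order_trans[OF b abs_ge_self])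
        qed measurable
      qed
      finally show ?case by simp
    qed
    moreover have "(\<lambda>x::'a. norm (heat_mix w \<sigma> T x)) \<in> borel_measurable borel"
      using measurable_compose[OF measurable_Pair1' heat_mix_measurable[where 'a='a], of T] by simp
    ultimately have "Lq_le q (\<lambda>x::'a. norm (heat_mix w \<sigma> T x)) (I * T powr (- \<theta>) * D)"
      using q by (intro Lq_le_mono[OF L]) auto
    then show "Lq_le q (\<lambda>x::'a. norm (heat_mix w \<sigma> T x)) (I * D * T powr (- (DIM('a) / 2 * (1 - 1 / q))))"
      unfolding \<theta>_def[symmetric] by (simp add: mult_ac)
  qed (use I D in simp)
qed

lemma heat_mix_measurable_slice: "heat_mix w \<sigma> T \<in> borel_measurable (borel :: 'a::euclidean_space measure)"
  using measurable_compose[OF measurable_Pair1' heat_mix_measurable[where 'a='a], of T] by simp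

lemma heat_mix_integrable:
  assumes "0 < T"
  shows "integrable lborel (heat_mix w \<sigma> T :: 'a::euclidean_space \<Rightarrow> complex)"
proof -
  obtain B where "\<And>T. 0 < T \<Longrightarrow> Lq_le 1 (\<lambda>x::'a. norm (heat_mix w \<sigma> T x)) (B * T powr (- (DIM('a) / 2 * (1 - 1 / 1))))"
    using Lq_le_heat_mix[of 1, where 'a='a] by auto
  from this[OF assms] have "integrable lborel (\<lambda>x::'a. norm (heat_mix w \<sigma> T x))" unfolding Lq_le_1_iff by blast
  then show ?thesis using heat_mix_measurable_slice[where 'a='a, of T]
    by (subst (asm) integrable_norm_iff) auto
qed

lemma heat_mix_pairing:
  fixes \<phi> :: "'a::euclidean_space \<Rightarrow> complex"
  assumes T: "0 < T" and [measurable]: "\<phi> \<in> borel_measurable borel" and \<phi>b: "\<And>x. norm (\<phi> x) \<le> B"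
  shows "(\<integral>x. heat_mix w \<sigma> T x * \<phi> x \<partial>lborel) = (LINT \<rho>:{0<..}|lborel. w \<rho> * (\<integral>x. rot_heat \<sigma> (\<rho> * T) x * \<phi> x \<partial>lborel))"
proof -
  obtain D where D: "0 \<le> D" "\<And>\<tau>. 0 < \<tau> \<Longrightarrow> Lq_le 1 (\<lambda>x::'a. norm (heat_kernel (\<sigma> * of_real \<tau>) x)) (D * \<tau> powr (- (DIM('a) / 2 * (1 - 1 / 1))))"
    by (rule Lq_le_norm_heat_kernel[OF \<sigma> order_refl]) blast
  have rh: "integrable lborel (\<lambda>x::'a. norm (rot_heat \<sigma> (\<rho> * T) x))" "(\<integral>x. norm (rot_heat \<sigma> (\<rho> * T) (x::'a)) \<partial>lborel) \<le> D" if "0 < \<rho>" for \<rho>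
  proof -
    have \<tau>: "0 < \<rho> * T" using that T by simp
    have "D * (\<rho> * T) powr (- (DIM('a) / 2 * (1 - 1 / 1))) = D" using that T by simp
    with D(2)[OF \<tau>] have "Lq_le 1 (\<lambda>x::'a. norm (heat_kernel (\<sigma> * of_real (\<rho> * T)) x)) D" by (simp only:)
    then show "integrable lborel (\<lambda>x::'a. norm (rot_heat \<sigma> (\<rho> * T) x))" "(\<integral>x. norm (rot_heat \<sigma> (\<rho> * T) (x::'a)) \<partial>lborel) \<le> D"
      unfolding Lq_le_1_iff rot_heat_eq[OF \<sigma>(1) \<tau>] by (simp_all only: abs_norm_cancel)
  qed
  define f where "f = (\<lambda>\<rho> x. indicator {0<..} \<rho> *\<^sub>R (w \<rho> * rot_heat \<sigma> (\<rho> * T) x) * \<phi> x)"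
  have nf: "norm (f \<rho> x) \<le> (indicator {0<..} \<rho> * norm (w \<rho>) * B) * norm (rot_heat \<sigma> (\<rho> * T) x)" for \<rho> x
    using mult_left_mono[OF \<phi>b[of x], of "norm (w \<rho>) * norm (rot_heat \<sigma> (\<rho> * T) x)"]
    by (simp add: f_def norm_mult indicator_def mult_ac)
  have B: "0 \<le> B" using order_trans[OF norm_ge_zero \<phi>b] .
  have fm: "jointly_measurable f" unfolding f_def by measurable
  have fi: "integrable lborel (f \<rho>)" for \<rho>
  proof (cases "0 < \<rho>")
    case True
    from integrable_mult_right[OF rh(1)[OF True], of "indicator {0<..} \<rho> * norm (w \<rho>) * B"]
    show ?thesis
    proof (rule Bochner_Integration.integrable_bound)
      show "f \<rho> \<in> borel_measurable lborel" unfolding f_def by measurable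
    qed (auto intro!: AE_I2 order_trans[OF nf abs_ge_self])
  qed (simp add: f_def)
  have "(\<integral>\<rho>. \<integral>x. f \<rho> x \<partial>lborel \<partial>lborel) = (\<integral>x. \<integral>\<rho>. f \<rho> x \<partial>lborel \<partial>lborel)"
  proof (rule integral_swap_iterated[OF fm fi])
    show "(\<integral>x. norm (f \<rho> x) \<partial>lborel) \<le> (C * B * D) * (indicator {0<..} \<rho> *\<^sub>R exp (- (\<kappa> * \<rho>)))" for \<rho>
    proof (cases "0 < \<rho>")
      case True
      have "(\<integral>x. norm (f \<rho> x) \<partial>lborel) \<le> (\<integral>x. (indicator {0<..} \<rho> * norm (w \<rho>) * B) * norm (rot_heat \<sigma> (\<rho> * T) (x::'a)) \<partial>lborel)"
        using fi rh(1)[OF True] nf by (intro integral_mono) auto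
      also have "\<dots> = norm (w \<rho>) * B * (\<integral>x. norm (rot_heat \<sigma> (\<rho> * T) (x::'a)) \<partial>lborel)" using True by simp
      also have "\<dots> \<le> (C * exp (- (\<kappa> * \<rho>))) * B * D"
        using wb[OF True] rh(2)[OF True] B C D by (intro mult_mono) auto
      finally show ?thesis using True by (simp add: mult_ac)
    qed (simp add: f_def)
    show "integrable lborel (\<lambda>\<rho>. (C * B * D) * (indicator {0<..} \<rho> *\<^sub>R exp (- (\<kappa> * \<rho>))))"
      using set_integrable_exp_decay[OF \<kappa>] unfolding set_integrable_def by simp
  qed
  also have "(\<integral>x. \<integral>\<rho>. f \<rho> x \<partial>lborel \<partial>lborel) = (\<integral>x. heat_mix w \<sigma> T x * \<phi> x \<partial>lborel)"
    unfolding f_def heat_mix_def set_lebesgue_integral_def by (simp only: integral_mult_left_zero)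
  also have "(\<integral>\<rho>. \<integral>x. f \<rho> x \<partial>lborel \<partial>lborel) = (LINT \<rho>:{0<..}|lborel. w \<rho> * (\<integral>x. rot_heat \<sigma> (\<rho> * T) x * \<phi> x \<partial>lborel))"
    unfolding f_def set_lebesgue_integral_def
    by (simp only: integral_mult_right_zero integral_scaleR_right mult_scaleR_left mult.assoc)
  finally show ?thesis by simp
qed

lemma integral_heat_mix:
  assumes T: "0 < T"
  shows "(\<integral>x. heat_mix w \<sigma> T (x::'a::euclidean_space) \<partial>lborel) = (LINT \<rho>:{0<..}|lborel. w \<rho>)"
proof -
  have "(\<integral>x. heat_mix w \<sigma> T (x::'a) * 1 \<partial>lborel) = (LINT \<rho>:{0<..}|lborel. w \<rho> * (\<integral>x. rot_heat \<sigma> (\<rho> * T) (x::'a) * 1 \<partial>lborel))"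
    by (rule heat_mix_pairing[OF T, of _ 1]) auto
  also have "\<dots> = (LINT \<rho>:{0<..}|lborel. w \<rho>)"
    using T by (intro set_lebesgue_integral_cong) (auto simp: integral_rot_heat[OF \<sigma>])
  finally show ?thesis by simp
qed

lemma heat_mix_schwartz:
  fixes \<phi> :: "'a::euclidean_space \<Rightarrow> complex"
  assumes T: "0 < T" and \<phi>: "\<phi> \<in> schwartz"
  shows "integrable lborel (\<lambda>x. heat_mix w \<sigma> T x * \<phi> x)"
    and "(\<integral>x. heat_mix w \<sigma> T x * \<phi> x \<partial>lborel)
      = (\<integral>\<xi>. (LINT \<rho>:{0<..}|lborel. w \<rho> * exp (- (\<sigma> * of_real (T * (norm \<xi>)\<^sup>2) * of_real \<rho>))) * inv_fourier \<phi> \<xi> \<partial>lborel)"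
    and "integrable lborel (\<lambda>\<xi>. (LINT \<rho>:{0<..}|lborel. w \<rho> * exp (- (\<sigma> * of_real (T * (norm \<xi>)\<^sup>2) * of_real \<rho>))) * inv_fourier \<phi> \<xi>)"
proof -
  have \<phi>m[measurable]: "\<phi> \<in> borel_measurable borel" using schwartz_measurable[OF \<phi>, of "[]"] by simp
  obtain B where B: "\<And>x. norm (\<phi> x) \<le> B" using schwartz_bounded[OF \<phi>, of "[]"] by auto
  have [measurable]: "(heat_mix w \<sigma> T :: 'a \<Rightarrow> complex) \<in> borel_measurable borel" by (rule heat_mix_measurable_slice)
  have "integrable lborel (\<lambda>x. B * norm (heat_mix w \<sigma> T (x::'a)))"    by (intro integrable_mult_right integrable_norm heat_mix_integrable T)
  then show "integrable lborel (\<lambda>x. heat_mix w \<sigma> T x * \<phi> x)"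
  proof (rule Bochner_Integration.integrable_bound)
    have "norm (heat_mix w \<sigma> T x * \<phi> x) \<le> B * norm (heat_mix w \<sigma> T x)" for x
      using mult_left_mono[OF B[of x] norm_ge_zero[of "heat_mix w \<sigma> T x"]] by (simp add: norm_mult mult.commute)
    then show "AE x in lborel. norm (heat_mix w \<sigma> T x * \<phi> x) \<le> norm (B * norm (heat_mix w \<sigma> T x))"
      unfolding real_norm_def by (intro AE_I2 order_trans[OF _ abs_ge_self])
  qed simp
  have Fi: "integrable lborel (inv_fourier \<phi>)" by (rule inv_fourier_schwartz_integrable[OF \<phi>])
  then have [measurable]: "inv_fourier \<phi> \<in> borel_measurable borel" by auto
  define f where "f = (\<lambda>\<rho> \<xi>. indicator {0<..} \<rho> *\<^sub>R (w \<rho> * exp (- (\<sigma> * of_real (T * (norm \<xi>)\<^sup>2) * of_real \<rho>))) * inv_fourier \<phi> \<xi>)"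
  have fm: "jointly_measurable f" unfolding f_def by measurable
  have gi: "integrable lborel (\<lambda>\<rho>. C * (indicator {0<..} \<rho> *\<^sub>R exp (- (\<kappa> * \<rho>))))"
    using set_integrable_exp_decay[OF \<kappa>] unfolding set_integrable_def by simp
  have fb: "norm (f \<rho> \<xi>) \<le> (C * (indicator {0<..} \<rho> *\<^sub>R exp (- (\<kappa> * \<rho>)))) * norm (inv_fourier \<phi> \<xi>)" for \<rho> \<xi>
  proof (cases "0 < \<rho>")
    case True
    have "norm (exp (- (\<sigma> * of_real (T * (norm \<xi>)\<^sup>2) * of_real \<rho>))) \<le> 1"
      using True T \<sigma> by (simp add: norm_exp_eq_Re)
    then have "norm (w \<rho>) * norm (exp (- (\<sigma> * of_real (T * (norm \<xi>)\<^sup>2) * of_real \<rho>))) \<le> (C * exp (- (\<kappa> * \<rho>))) * 1"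
      using wb[OF True] C by (intro mult_mono) auto
    then show ?thesis using True unfolding f_def norm_mult by (auto simp: norm_mult intro!: mult_right_mono)
  qed (simp add: f_def)
  have eq: "(\<lambda>\<xi>. (LINT \<rho>:{0<..}|lborel. w \<rho> * exp (- (\<sigma> * of_real (T * (norm \<xi>)\<^sup>2) * of_real \<rho>))) * inv_fourier \<phi> \<xi>) = (\<lambda>\<xi>. \<integral>\<rho>. f \<rho> \<xi> \<partial>lborel)"
    unfolding f_def set_lebesgue_integral_def by (simp only: integral_mult_left_zero)
  have fp: "integrable (lborel \<Otimes>\<^sub>M lborel) (\<lambda>(\<rho>, \<xi>). f \<rho> \<xi>)"
    by (rule integrable_product_bound[OF fm gi _ fb]) (use Fi in simp)
  show "integrable lborel (\<lambda>\<xi>. (LINT \<rho>:{0<..}|lborel. w \<rho> * exp (- (\<sigma> * of_real (T * (norm \<xi>)\<^sup>2) * of_real \<rho>))) * inv_fourier \<phi> \<xi>)"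
    unfolding eq using lborel_pair.integrable_snd[OF fp] by simp
  have "(\<integral>x. heat_mix w \<sigma> T x * \<phi> x \<partial>lborel) = (LINT \<rho>:{0<..}|lborel. w \<rho> * (\<integral>x. rot_heat \<sigma> (\<rho> * T) x * \<phi> x \<partial>lborel))"
    by (rule heat_mix_pairing[OF T \<phi>m B])
  also have "\<dots> = (\<integral>\<rho>. \<integral>\<xi>. f \<rho> \<xi> \<partial>lborel \<partial>lborel)"
    unfolding set_lebesgue_integral_def
  proof (rule Bochner_Integration.integral_cong)
    fix \<rho> :: real
    show "indicator {0<..} \<rho> *\<^sub>R (w \<rho> * (\<integral>x. rot_heat \<sigma> (\<rho> * T) x * \<phi> x \<partial>lborel)) = (\<integral>\<xi>. f \<rho> \<xi> \<partial>lborel)"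
    proof (cases "0 < \<rho>")
      case True
      then have \<tau>: "0 < \<rho> * T" using T by simp
      have "(\<integral>x. rot_heat \<sigma> (\<rho> * T) x * \<phi> x \<partial>lborel) = (\<integral>\<xi>. exp (- (\<sigma> * of_real (\<rho> * T) * of_real ((norm \<xi>)\<^sup>2))) * inv_fourier \<phi> \<xi> \<partial>lborel)"
        unfolding rot_heat_eq[OF \<sigma>(1) \<tau>] by (rule heat_kernel_schwartz[OF \<phi>]) (use \<sigma> \<tau> in simp)
      moreover have "f \<rho> \<xi> = w \<rho> * (exp (- (\<sigma> * of_real (\<rho> * T) * of_real ((norm \<xi>)\<^sup>2))) * inv_fourier \<phi> \<xi>)" for \<xi>
        using True by (simp add: f_def mult_ac)
      ultimately show ?thesis using True by (simp only: integral_mult_right_zero) simp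
    qed (simp add: f_def)
  qed simp
  also have "\<dots> = (\<integral>\<xi>. \<integral>\<rho>. f \<rho> \<xi> \<partial>lborel \<partial>lborel)"
    by (rule integral_swap[OF fm gi _ fb]) (use Fi in simp)
  finally show "(\<integral>x. heat_mix w \<sigma> T x * \<phi> x \<partial>lborel)
      = (\<integral>\<xi>. (LINT \<rho>:{0<..}|lborel. w \<rho> * exp (- (\<sigma> * of_real (T * (norm \<xi>)\<^sup>2) * of_real \<rho>))) * inv_fourier \<phi> \<xi> \<partial>lborel)"
    unfolding eq .
qed

end

text \<open>The imaginary part of a mixture is thus a combination of two mixtures, to which the preceding lemmas apply.\<close>

lemma cnj_heat_mix:
  assumes "0 < Re \<sigma>"
  shows "cnj (heat_mix w \<sigma> T x) = heat_mix (\<lambda>\<rho>. cnj (w \<rho>)) (cnj \<sigma>) T x"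
proof -
  have "cnj (indicator {0<..} \<rho> *\<^sub>R (w \<rho> * rot_heat \<sigma> (\<rho> * T) x)) = indicator {0<..} \<rho> *\<^sub>R (cnj (w \<rho>) * rot_heat (cnj \<sigma>) (\<rho> * T) x)" for \<rho>
    by (simp add: cnj_rot_heat[OF assms])
  then show ?thesis unfolding heat_mix_def set_lebesgue_integral_def Bochner_Integration.integral_cnj[symmetric] by (simp only:)
qed

text \<open>The kernel is the imaginary part of the heat mixture with the weight from the Laplace representation of the
Mittag-Leffler function. Its total mass is the value of the symbol at the origin.\<close>

theorem fractional_kernel:
  assumes \<gamma>: "1 < \<gamma>" "\<gamma> < 2" and \<beta>: "0 < \<beta>"
  obtains K :: "real \<Rightarrow> 'a::euclidean_space \<Rightarrow> real"
  where "jointly_measurable K"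
    "\<And>T x. 0 < T \<Longrightarrow> K T x = T powr (- (DIM('a) / 2)) * K 1 (T powr (- (1 / 2)) *\<^sub>R x)"
    "\<And>T. 0 < T \<Longrightarrow> represents_distr (K T) (inv_fourier_distr (\<lambda>\<xi>. mittag_leffler \<gamma> \<beta> (- T * (norm \<xi>)\<^sup>2)))"
    "\<And>q. 1 \<le> q \<Longrightarrow> DIM('a) / 2 * (1 - 1 / q) < 1 \<Longrightarrow>
        \<exists>B\<ge>0. \<forall>T>0. Lq_le q (K T) (B * T powr (- (DIM('a) / 2 * (1 - 1 / q))))"
    "(\<integral>x. K 1 x \<partial>lborel) = mittag_leffler \<gamma> \<beta> 0"
proof -
  obtain w \<sigma> C \<kappa> where w[measurable]: "w \<in> borel_measurable borel" and k: "0 < \<kappa>" "0 \<le> C" and \<sigma>: "norm \<sigma> = 1" "0 < Re \<sigma>"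
    and wb: "\<And>\<rho>. 0 < \<rho> \<Longrightarrow> norm (w \<rho>) \<le> C * exp (- (\<kappa> * \<rho>))"
    and ml: "\<And>\<mu>. 0 \<le> \<mu> \<Longrightarrow> mittag_leffler \<gamma> \<beta> (- \<mu>) = Im (LINT \<rho>:{0<..}|lborel. w \<rho> * exp (- (\<sigma> * of_real \<mu> * of_real \<rho>)))"
    by (rule mittag_leffler_laplace_representation[OF \<gamma> \<beta>]) blast
  note h = w wb k(2,1) \<sigma>
  have hc: "(\<lambda>\<rho>. cnj (w \<rho>)) \<in> borel_measurable borel" "\<And>\<rho>. 0 < \<rho> \<Longrightarrow> norm (cnj (w \<rho>)) \<le> C * exp (- (\<kappa> * \<rho>))"
    "0 \<le> C" "0 < \<kappa>" "norm (cnj \<sigma>) = 1" "0 < Re (cnj \<sigma>)"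
    using wb k \<sigma> measurable_compose[OF w borel_measurable_continuous_onI[of cnj]] by (auto intro!: continuous_intros)
  define K where "K = (\<lambda>T (x::'a). Im (heat_mix w \<sigma> T x))"
  show thesis
  proof (rule that[of K])
    show "jointly_measurable K"
      using heat_mix_measurable[OF h, where 'a='a] unfolding K_def case_prod_beta by measurable
    show "K T x = T powr (- (DIM('a) / 2)) * K 1 (T powr (- (1 / 2)) *\<^sub>R x)" if "0 < T" for T x
      unfolding K_def heat_mix_scale[OF that] by simp
    show "\<exists>B\<ge>0. \<forall>T>0. Lq_le q (K T) (B * T powr (- (DIM('a) / 2 * (1 - 1 / q))))"
      if q: "1 \<le> q" "DIM('a) / 2 * (1 - 1 / q) < 1" for q
    proof -
      obtain B where B: "0 \<le> B" "\<And>T. 0 < T \<Longrightarrow> Lq_le q (\<lambda>x::'a. norm (heat_mix w \<sigma> T x)) (B * T powr (- (DIM('a) / 2 * (1 - 1 / q))))"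
        using Lq_le_heat_mix[OF h q] by blast
      have "Lq_le q (K T) (B * T powr (- (DIM('a) / 2 * (1 - 1 / q))))" if "0 < T" for T
        by (rule Lq_le_mono[OF B(2)[OF that]])
          (use q heat_mix_measurable_slice[OF h, where 'a='a] in \<open>auto simp: K_def abs_Im_le_cmod\<close>)
      then show ?thesis using B(1) by blast
    qed
    show "(\<integral>x. K 1 x \<partial>lborel) = mittag_leffler \<gamma> \<beta> 0"
    proof -
      have "(\<integral>x. K 1 x \<partial>lborel) = Im (\<integral>x. heat_mix w \<sigma> 1 (x::'a) \<partial>lborel)"
        unfolding K_def by (rule integral_Im[OF heat_mix_integrable[OF h zero_less_one]])
      then show ?thesis using integral_heat_mix[OF h, of 1, where 'a='a] ml[of 0] by simp
    qed
    fix T :: real assume T: "0 < T"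
    show "represents_distr (K T) (inv_fourier_distr (\<lambda>\<xi>. mittag_leffler \<gamma> \<beta> (- T * (norm \<xi>)\<^sup>2)))"
      unfolding represents_distr_def inv_fourier_distr_def
    proof
      fix \<phi> :: "'a \<Rightarrow> complex" assume \<phi>: "\<phi> \<in> schwartz"
      define M where "M = (\<lambda>\<xi>::'a. LINT \<rho>:{0<..}|lborel. w \<rho> * exp (- (\<sigma> * of_real (T * (norm \<xi>)\<^sup>2) * of_real \<rho>)))"
      have cM: "(LINT \<rho>:{0<..}|lborel. cnj (w \<rho>) * exp (- (cnj \<sigma> * of_real (T * (norm \<xi>)\<^sup>2) * of_real \<rho>))) = cnj (M \<xi>)" for \<xi> :: 'a
      proof -
        have "cnj (indicator {0<..} \<rho> *\<^sub>R (w \<rho> * exp (- (\<sigma> * of_real (T * (norm \<xi>)\<^sup>2) * of_real \<rho>)))) = indicator {0<..} \<rho> *\<^sub>R (cnj (w \<rho>) * exp (- (cnj \<sigma> * of_real (T * (norm \<xi>)\<^sup>2) * of_real \<rho>)))" for \<rho>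
          by (simp add: exp_cnj)
        then show ?thesis unfolding M_def set_lebesgue_integral_def Bochner_Integration.integral_cnj[symmetric] by (simp only:)
      qed
      have MI: "Im (M \<xi>) = mittag_leffler \<gamma> \<beta> (- T * (norm \<xi>)\<^sup>2)" for \<xi>
        using ml[of "T * (norm \<xi>)\<^sup>2"] T by (simp add: M_def)
      have Im: "of_real (Im z) = 1 / (2 * \<i>) * z - 1 / (2 * \<i>) * cnj z" for z
        by (simp add: complex_eq_iff)
      have A: "integrable lborel (\<lambda>x. heat_mix w \<sigma> T x * \<phi> x)"
        "(\<integral>x. heat_mix w \<sigma> T x * \<phi> x \<partial>lborel) = (\<integral>\<xi>. M \<xi> * inv_fourier \<phi> \<xi> \<partial>lborel)"
        "integrable lborel (\<lambda>\<xi>. M \<xi> * inv_fourier \<phi> \<xi>)"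
        unfolding M_def by (rule heat_mix_schwartz[OF h T \<phi>]; assumption)+
      have B: "integrable lborel (\<lambda>x. heat_mix (\<lambda>\<rho>. cnj (w \<rho>)) (cnj \<sigma>) T x * \<phi> x)"
        "(\<integral>x. heat_mix (\<lambda>\<rho>. cnj (w \<rho>)) (cnj \<sigma>) T x * \<phi> x \<partial>lborel) = (\<integral>\<xi>. cnj (M \<xi>) * inv_fourier \<phi> \<xi> \<partial>lborel)"
        "integrable lborel (\<lambda>\<xi>. cnj (M \<xi>) * inv_fourier \<phi> \<xi>)"
        unfolding cM[symmetric] by (rule heat_mix_schwartz[OF hc T \<phi>]; assumption)+
      have lin: "(\<integral>x. a * X x - a * Y x \<partial>lborel) = a * (\<integral>x. X x \<partial>lborel) - a * (\<integral>x. Y x \<partial>lborel)"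
        if "integrable lborel X" "integrable lborel Y" for a :: complex and X Y :: "'a \<Rightarrow> complex"
        using that by (simp del: integral_mult_left integral_mult_left_zero integral_mult_right add: integral_mult_right_zero)
      have Kc: "of_real (K T x) * \<phi> x = 1 / (2 * \<i>) * (heat_mix w \<sigma> T x * \<phi> x) - 1 / (2 * \<i>) * (heat_mix (\<lambda>\<rho>. cnj (w \<rho>)) (cnj \<sigma>) T x * \<phi> x)" for x
        unfolding K_def Im cnj_heat_mix[OF \<sigma>(2)] by (simp add: algebra_simps)
      have Mc: "of_real (mittag_leffler \<gamma> \<beta> (- T * (norm \<xi>)\<^sup>2)) * inv_fourier \<phi> \<xi> = 1 / (2 * \<i>) * (M \<xi> * inv_fourier \<phi> \<xi>) - 1 / (2 * \<i>) * (cnj (M \<xi>) * inv_fourier \<phi> \<xi>)" for \<xi>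
        unfolding MI[symmetric] Im by (simp add: algebra_simps)
      show "integrable lborel (\<lambda>x. of_real (K T x) * \<phi> x) \<and>
          (\<integral>x. of_real (K T x) * \<phi> x \<partial>lborel) = (\<integral>\<xi>. of_real (mittag_leffler \<gamma> \<beta> (- T * (norm \<xi>)\<^sup>2)) * inv_fourier \<phi> \<xi> \<partial>lborel)"
      proof
        show "integrable lborel (\<lambda>x. of_real (K T x) * \<phi> x)"
          unfolding Kc by (intro Bochner_Integration.integrable_diff integrable_mult_right A(1) B(1))
        have "(\<integral>x. of_real (K T x) * \<phi> x \<partial>lborel) = 1 / (2 * \<i>) * (\<integral>x. heat_mix w \<sigma> T x * \<phi> x \<partial>lborel) - 1 / (2 * \<i>) * (\<integral>x. heat_mix (\<lambda>\<rho>. cnj (w \<rho>)) (cnj \<sigma>) T x * \<phi> x \<partial>lborel)"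
          unfolding Kc by (rule lin[OF A(1) B(1)])
        also have "\<dots> = 1 / (2 * \<i>) * (\<integral>\<xi>. M \<xi> * inv_fourier \<phi> \<xi> \<partial>lborel) - 1 / (2 * \<i>) * (\<integral>\<xi>. cnj (M \<xi>) * inv_fourier \<phi> \<xi> \<partial>lborel)"
          by (simp only: A(2) B(2))
        also have "\<dots> = (\<integral>\<xi>. of_real (mittag_leffler \<gamma> \<beta> (- T * (norm \<xi>)\<^sup>2)) * inv_fourier \<phi> \<xi> \<partial>lborel)"
          unfolding Mc by (rule lin[OF A(3) B(3), symmetric])
        finally show "(\<integral>x. of_real (K T x) * \<phi> x \<partial>lborel) = (\<integral>\<xi>. of_real (mittag_leffler \<gamma> \<beta> (- T * (norm \<xi>)\<^sup>2)) * inv_fourier \<phi> \<xi> \<partial>lborel)" .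
      qed
    qed
  qed
qed

section \<open>The Duhamel integral\<close>

lemma joint_measurable_compose:
  assumes "jointly_measurable H"
    and "f \<in> borel_measurable M" "g \<in> borel_measurable M"
  shows "(\<lambda>z. H (f z) (g z)) \<in> borel_measurable M"
  using measurable_compose[OF measurable_Pair[OF assms(2,3)] assms(1)] by simp

text \<open>Euler's Beta integral on an interval of length \<open>t\<close>.\<close>

lemma
  fixes a b t :: real
  assumes a: "0 < a" and b: "0 < b" and t: "0 \<le> t"
  shows integrable_Beta_scaled: "integrable lborel (\<lambda>\<tau>. indicator {0..t} \<tau> * (\<tau> powr (a - 1) * (t - \<tau>) powr (b - 1)))"
    and integral_Beta_scaled: "(\<integral>\<tau>. indicator {0..t} \<tau> * (\<tau> powr (a - 1) * (t - \<tau>) powr (b - 1)) \<partial>lborel) = t powr (a + b - 1) * Beta a b"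
proof -
  define f where "f = (\<lambda>s::real. indicator {0..1} s * (s powr (a - 1) * (1 - s) powr (b - 1)))"
  have fm: "f \<in> borel_measurable borel" unfolding f_def by measurable
  have f0: "0 \<le> f r" for r by (simp add: f_def)
  have "f = (\<lambda>r. if r \<in> {0..1} then r powr (a - 1) * (1 - r) powr (b - 1) else 0)"
    by (auto simp: f_def fun_eq_iff)
  then have "(f has_integral Beta a b) UNIV"
    using has_integral_Beta_real[OF a b] by (simp only: has_integral_restrict_UNIV)
  then have nn: "(\<integral>\<^sup>+r. f r \<partial>lborel) = ennreal (Beta a b)"
    by (rule nn_integral_has_integral_lborel[OF fm f0])
  have fi: "integrable lborel f"
    using nn f0 fm by (intro integrableI_nonneg) auto
  have "0 \<le> Beta a b" using Gamma_real_pos a b by (simp add: Beta_def)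
  moreover have "ennreal (\<integral>r. f r \<partial>lborel) = ennreal (Beta a b)"
    using nn fi f0 by (simp add: nn_integral_eq_integral)
  ultimately have f1: "(\<integral>r. f r \<partial>lborel) = Beta a b"
    using f0 by (simp add: ennreal_inj)
  let ?g = "\<lambda>\<tau>. indicator {0..t} \<tau> * (\<tau> powr (a - 1) * (t - \<tau>) powr (b - 1))"
  have "integrable lborel ?g \<and> (\<integral>\<tau>. ?g \<tau> \<partial>lborel) = t powr (a + b - 1) * Beta a b"
  proof (cases "t = 0")
    case True
    then have "?g = (\<lambda>\<tau>. 0)" by (auto simp: fun_eq_iff indicator_def)
    then show ?thesis using True by simp
  next
    case False
    then have t: "0 < t" using t by simp
    have g: "?g (0 + t * s) = t powr (a + b - 2) * f s" for s
    proof (cases "s \<in> {0..1}")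
      case True
      have "t - t * s = t * (1 - s)" by (simp add: algebra_simps)
      moreover have "t * s \<in> {0..t}" using True t by (simp add: mult_left_le)
      moreover have "a + b - 2 = (a - 1) + (b - 1)" by simp
      ultimately show ?thesis using True t by (simp only: f_def powr_add) (simp add: powr_mult)
    next
      case False
      then have "t * s \<notin> {0..t}" using t by (auto simp: zero_le_mult_iff)
      then show ?thesis using False by (simp add: f_def)
    qed
    have "integrable lborel (\<lambda>s. ?g (0 + t * s))" unfolding g using fi by simp
    then have i: "integrable lborel ?g" using lborel_integrable_real_affine_iff[of t ?g 0] t by simp
    have "(\<integral>\<tau>. ?g \<tau> \<partial>lborel) = \<bar>t\<bar> *\<^sub>R (\<integral>s. ?g (0 + t * s) \<partial>lborel)"
      using t by (intro lborel_integral_real_affine) simp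
    also have "\<dots> = t * t powr (a + b - 2) * Beta a b" unfolding g using t f1 by simp
    also have "t * t powr (a + b - 2) = t powr (a + b - 1)" using t powr_add[of t 1 "a + b - 2"] by simp
    finally show ?thesis using i by simp
  qed
  then show "integrable lborel ?g" "(\<integral>\<tau>. ?g \<tau> \<partial>lborel) = t powr (a + b - 1) * Beta a b" by auto
qed

lemma
  fixes a T :: real
  assumes a: "0 < a" and T: "0 \<le> T"
  shows integrable_powr_Ioo: "integrable lborel (\<lambda>\<tau>. indicator {0<..<T} \<tau> * \<tau> powr (a - 1))"
    and integral_powr_Ioo: "(\<integral>\<tau>. indicator {0<..<T} \<tau> * \<tau> powr (a - 1) \<partial>lborel) = T powr a * Beta a 1"
proof -
  have ae: "AE \<tau> in lborel. indicator {0..T} \<tau> * (\<tau> powr (a - 1) * (T - \<tau>) powr (1 - 1)) = indicator {0<..<T} \<tau> * \<tau> powr (a - 1)"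
    using AE_lborel_singleton[of 0] AE_lborel_singleton[of T]
    by eventually_elim (auto simp: indicator_def)
  show "integrable lborel (\<lambda>\<tau>. indicator {0<..<T} \<tau> * \<tau> powr (a - 1))"
    by (rule integrable_cong_AE[THEN iffD1, OF _ _ ae integrable_Beta_scaled[OF a _ T]]) auto
  have "(\<integral>\<tau>. indicator {0<..<T} \<tau> * \<tau> powr (a - 1) \<partial>lborel) = (\<integral>\<tau>. indicator {0..T} \<tau> * (\<tau> powr (a - 1) * (T - \<tau>) powr (1 - 1)) \<partial>lborel)"
    by (rule integral_cong_AE[symmetric, OF _ _ ae]) auto
  also have "\<dots> = T powr a * Beta a 1" using integral_Beta_scaled[OF a zero_less_one T] by simp
  finally show "(\<integral>\<tau>. indicator {0<..<T} \<tau> * \<tau> powr (a - 1) \<partial>lborel) = T powr a * Beta a 1" .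
qed

text \<open>The abstract setting of the nonlinear problem. The kernel \<open>K \<tau>\<close> maps \<open>L\<^sup>1\<close> to \<open>L\<^sup>1\<close> without loss and to
\<open>L\<^sup>p\<close> at the cost \<open>\<tau>\<close> to the power \<open>-D\<close>. The condition \<open>D < 1 + \<alpha>\<close> makes this singularity
integrable against \<open>\<tau>\<^sup>\<alpha>\<close>; the condition \<open>decay\<close> closes the nonlinear estimate.\<close>

locale duhamel =
  fixes \<alpha> p D CK :: real and K :: "real \<Rightarrow> 'a::euclidean_space \<Rightarrow> real"
  assumes \<alpha>: "0 < \<alpha>" "\<alpha> < 1" and p: "1 < p" and D: "0 \<le> D" "D < 1 + \<alpha>"
    and decay: "p * (1 - D) \<le> - \<alpha>"
    and Kmeas: "jointly_measurable K"
    and CK: "0 \<le> CK"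
    and K1: "\<And>\<tau>. 0 < \<tau> \<Longrightarrow> Lq_le 1 (K \<tau>) CK"
    and Kp: "\<And>\<tau>. 0 < \<tau> \<Longrightarrow> Lq_le p (K \<tau>) (CK * \<tau> powr (- D))"
begin

text \<open>The two estimates for the kernel have the same shape, so that statements about the Duhamel integral need only one
proof for \<open>(q, d) = (1, 0)\<close> and \<open>(q, d) = (p, D)\<close>.\<close>

definition smoothing :: "real \<Rightarrow> real \<Rightarrow> bool" where
  "smoothing q d \<longleftrightarrow> 1 \<le> q \<and> 0 \<le> d \<and> d < 1 + \<alpha> \<and> (\<forall>\<tau>>0. Lq_le q (K \<tau>) (CK * \<tau> powr (- d)))"

lemma smoothing_1: "smoothing 1 0" using \<alpha> K1 by (auto simp: smoothing_def)
lemma smoothing_p: "smoothing p D" using p D Kp by (auto simp: smoothing_def)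

lemmas measurable_K[measurable] = joint_measurable_compose[OF Kmeas]

definition Duhamel :: "(real \<Rightarrow> 'a \<Rightarrow> real) \<Rightarrow> real \<Rightarrow> 'a \<Rightarrow> real" where
  "Duhamel h t x = (LINT s:{0..t}|lborel. (t - s) powr \<alpha> * convol (K (t - s)) (h s) x)"

definition space_time_integrand :: "(real \<Rightarrow> 'a \<Rightarrow> real) \<Rightarrow> real \<Rightarrow> 'a \<Rightarrow> real \<times> 'a \<Rightarrow> real" where
  "space_time_integrand h t x = (\<lambda>(\<tau>, y). indicator {0<..<t} \<tau> * \<tau> powr \<alpha> * K \<tau> (x - y) * h (t - \<tau>) y)"

lemma measurable_Duhamel:
  assumes h: "jointly_measurable h"
  shows "jointly_measurable (\<lambda>t x. Duhamel h t x)"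
proof -
  note [measurable] = joint_measurable_compose[OF h]
  have [measurable]: "(\<lambda>z. convol (K (f z)) (h (g z)) (k z)) \<in> borel_measurable N"
    if [measurable]: "f \<in> borel_measurable N" "g \<in> borel_measurable N" "k \<in> borel_measurable N"
    for f g k and N :: "'n measure"
    unfolding convol_def by (rule lborel.borel_measurable_lebesgue_integral) measurable
  have eq: "Duhamel h t x = (\<integral>s. indicator {0..} s * indicator {0..} (t - s) * ((t - s) powr \<alpha> * convol (K (t - s)) (h s) x) \<partial>lborel)" for t x
    unfolding Duhamel_def set_lebesgue_integral_def by (intro Bochner_Integration.integral_cong) (auto simp: indicator_def)
  show ?thesis
    unfolding eq case_prod_beta by (rule lborel.borel_measurable_lebesgue_integral) measurable
qed

text \<open>Estimates are easier for a single integral over space and time in the variable \<open>\<tau> = t - s\<close>; the two forms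
agree wherever Fubini's theorem applies, which is almost everywhere in the cases below.\<close>

lemma Duhamel_eq_space_time:
  assumes h: "jointly_measurable h"
    and i: "integrable (lborel \<Otimes>\<^sub>M lborel) (space_time_integrand h t x)"
  shows "Duhamel h t x = (\<integral>z. space_time_integrand h t x z \<partial>(lborel \<Otimes>\<^sub>M lborel))"
proof -
  have "Duhamel h t x = \<bar>-1\<bar> *\<^sub>R (\<integral>\<tau>. indicator {0..t} (t + (-1) * \<tau>) *\<^sub>R ((t - (t + (-1) * \<tau>)) powr \<alpha> * convol (K (t - (t + (-1) * \<tau>))) (h (t + (-1) * \<tau>)) x) \<partial>lborel)"
    unfolding Duhamel_def set_lebesgue_integral_def by (rule lborel_integral_real_affine) simp
  also have "\<dots> = (\<integral>\<tau>. indicator {0..t} (t - \<tau>) *\<^sub>R (\<tau> powr \<alpha> * convol (K \<tau>) (h (t - \<tau>)) x) \<partial>lborel)"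
    by simp
  also have "\<dots> = (\<integral>\<tau>. indicator {0<..<t} \<tau> *\<^sub>R (\<tau> powr \<alpha> * convol (K \<tau>) (h (t - \<tau>)) x) \<partial>lborel)"
  proof -
    note [measurable] = joint_measurable_compose[OF h]
    have [measurable]: "(\<lambda>\<tau>. convol (K \<tau>) (h (t - \<tau>)) x) \<in> borel_measurable borel"
      unfolding convol_def by (rule lborel.borel_measurable_lebesgue_integral) measurable
    have [measurable]: "(\<lambda>\<tau>. indicator {0..t} (t - \<tau>) :: real) \<in> borel_measurable borel"
      unfolding atLeastAtMost_iff indicator_def by measurable
    show ?thesis
    proof (rule integral_cong_AE)
      show "AE \<tau> in lborel. indicator {0..t} (t - \<tau>) *\<^sub>R (\<tau> powr \<alpha> * convol (K \<tau>) (h (t - \<tau>)) x) = indicator {0<..<t} \<tau> *\<^sub>R (\<tau> powr \<alpha> * convol (K \<tau>) (h (t - \<tau>)) x)"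
        using AE_lborel_singleton[of 0] AE_lborel_singleton[of t]
        by eventually_elim (auto simp: indicator_def)
    qed measurable
  qed
  also have "\<dots> = (\<integral>\<tau>. \<integral>y. space_time_integrand h t x (\<tau>, y) \<partial>lborel \<partial>lborel)"
    unfolding space_time_integrand_def convol_def by (simp add: mult.assoc)
  also have "\<dots> = (\<integral>z. space_time_integrand h t x z \<partial>(lborel \<Otimes>\<^sub>M lborel))"
    by (rule lborel_pair.integral_fst'[OF i])
  finally show ?thesis .
qed

text \<open>Minkowski's integral inequality on space-time, the modulus of the source being the weight and the kernel, multiplied by
\<open>\<tau>\<^sup>d\<close>, being bounded in \<open>L\<^sup>q\<close>.\<close>

lemma
  assumes sm: "smoothing q d" and h: "jointly_measurable h" and t: "0 \<le> t"
    and h1: "\<And>\<tau>. 0 < \<tau> \<Longrightarrow> \<tau> < t \<Longrightarrow> Lq_le 1 (h (t - \<tau>)) (\<beta> \<tau>)"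
    and \<beta>: "integrable lborel (\<lambda>\<tau>. indicator {0<..<t} \<tau> * (\<tau> powr (\<alpha> - d) * \<beta> \<tau>))"
      "(\<integral>\<tau>. indicator {0<..<t} \<tau> * (\<tau> powr (\<alpha> - d) * \<beta> \<tau>) \<partial>lborel) \<le> I"
  shows Lq_le_Duhamel: "Lq_le q (Duhamel h t) (I * CK)"
    and AE_integrable_Duhamel: "AE x in lborel. integrable (lborel \<Otimes>\<^sub>M lborel) (space_time_integrand h t x)"
proof -
  note [measurable] = joint_measurable_compose[OF h]
  have q: "1 \<le> q" "0 \<le> d" and Kq: "\<And>\<tau>. 0 < \<tau> \<Longrightarrow> Lq_le q (K \<tau>) (CK * \<tau> powr (- d))"
    using sm by (auto simp: smoothing_def)
  have M: "sigma_finite_measure (lborel \<Otimes>\<^sub>M lborel :: (real \<times> 'a) measure)"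
    unfolding lborel_prod by (rule sigma_finite_lborel)
  define w where "w = (\<lambda>z::real \<times> 'a. indicator {0<..<t} (fst z) * (fst z powr (\<alpha> - d) * \<bar>h (t - fst z) (snd z)\<bar>))"
  define k where "k = (\<lambda>(z::real \<times> 'a) x. (sgn (h (t - fst z) (snd z)) * fst z powr d) * K (fst z) (x - snd z))"
  have w0: "0 \<le> w z" for z by (simp add: w_def)
  have wm: "w \<in> borel_measurable (lborel \<Otimes>\<^sub>M lborel)"
    unfolding w_def by measurable
  have \<beta>i: "(\<integral>y. w (\<tau>, y) \<partial>lborel) \<le> indicator {0<..<t} \<tau> * (\<tau> powr (\<alpha> - d) * \<beta> \<tau>)" "integrable lborel (\<lambda>y. w (\<tau>, y))" for \<tau>
  proof -
    have "integrable lborel (\<lambda>y. w (\<tau>, y)) \<and> (\<integral>y. w (\<tau>, y) \<partial>lborel) \<le> indicator {0<..<t} \<tau> * (\<tau> powr (\<alpha> - d) * \<beta> \<tau>)"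
    proof (cases "0 < \<tau> \<and> \<tau> < t")
      case True
      then have "integrable lborel (h (t - \<tau>))" "(\<integral>y. \<bar>h (t - \<tau>) y\<bar> \<partial>lborel) \<le> \<beta> \<tau>" using h1[of \<tau>] by (auto simp: Lq_le_1_iff)
      then show ?thesis using True by (simp add: w_def mult_left_mono)
    qed (auto simp: w_def)
    then show "(\<integral>y. w (\<tau>, y) \<partial>lborel) \<le> indicator {0<..<t} \<tau> * (\<tau> powr (\<alpha> - d) * \<beta> \<tau>)" "integrable lborel (\<lambda>y. w (\<tau>, y))" by auto
  qed
  have nw: "norm (w z) = w z" for z using w0 by simp
  have wmi: "integrable lborel (\<lambda>\<tau>. \<integral>y. w (\<tau>, y) \<partial>lborel)"
    using \<beta>(1)
  proof (rule Bochner_Integration.integrable_bound)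
    show "(\<lambda>\<tau>. \<integral>y. w (\<tau>, y) \<partial>lborel) \<in> borel_measurable lborel"
      unfolding measurable_lborel2 w_def by (rule lborel.borel_measurable_lebesgue_integral) measurable
    have "norm (\<integral>y. w (\<tau>, y) \<partial>lborel) = (\<integral>y. w (\<tau>, y) \<partial>lborel)" for \<tau>
      using w0 by (simp add: integral_nonneg_AE)
    then show "AE \<tau> in lborel. norm (\<integral>y. w (\<tau>, y) \<partial>lborel) \<le> norm (indicator {0<..<t} \<tau> * (\<tau> powr (\<alpha> - d) * \<beta> \<tau>))"
      using \<beta>i(1) unfolding real_norm_def by (intro AE_I2) (metis abs_ge_self order_trans)
  qed
  have wint: "integrable (lborel \<Otimes>\<^sub>M lborel) w"
    by (rule lborel_pair.Fubini_integrable[OF wm]) (use \<beta>i wmi in \<open>simp_all only: nw AE_I2\<close>)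
  have "(\<integral>z. w z \<partial>(lborel \<Otimes>\<^sub>M lborel)) = (\<integral>\<tau>. \<integral>y. w (\<tau>, y) \<partial>lborel \<partial>lborel)"
    by (rule lborel_pair.integral_fst'[OF wint, symmetric])
  also have "\<dots> \<le> (\<integral>\<tau>. indicator {0<..<t} \<tau> * (\<tau> powr (\<alpha> - d) * \<beta> \<tau>) \<partial>lborel)"
    using wmi \<beta> \<beta>i by (intro integral_mono) auto
  finally have wI: "(\<integral>z. w z \<partial>(lborel \<Otimes>\<^sub>M lborel)) \<le> I" using \<beta>(2) by simp
  have km: "(\<lambda>(z, x). k z x) \<in> borel_measurable ((lborel \<Otimes>\<^sub>M lborel) \<Otimes>\<^sub>M borel)"
    unfolding k_def by measurable
  have kq: "Lq_le q (k z) CK" if "w z \<noteq> 0" for z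
  proof -
    have \<tau>: "0 < fst z" using that by (auto simp: w_def indicator_def split: if_splits)
    let ?c = "sgn (h (t - fst z) (snd z)) * fst z powr d"
    have "Lq_le q (\<lambda>x. ?c * K (fst z) (x - snd z)) (\<bar>?c\<bar> * (CK * fst z powr (- d)))"
      by (intro Lq_le_cmult Lq_le_shift Kq \<tau>)
    moreover have "\<bar>?c\<bar> * (CK * fst z powr (- d)) \<le> CK"
    proof -
      have "fst z powr d * (CK * fst z powr (- d)) = CK" using \<tau> by (simp add: powr_minus field_simps)
      moreover have "\<bar>?c\<bar> * (CK * fst z powr (- d)) \<le> fst z powr d * (CK * fst z powr (- d))"
        using CK by (intro mult_right_mono) (auto simp: abs_mult sgn_real_def)
      ultimately show ?thesis by linarith
    qed
    ultimately show ?thesis unfolding k_def by (rule Lq_le_weaken) (use q in simp)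
  qed
  have wk: "w z * k z x = space_time_integrand h t x z" for z x
  proof (cases z)
    case (Pair \<tau> y)
    have "\<tau> powr (\<alpha> - d) * \<tau> powr d = \<tau> powr \<alpha>" by (simp flip: powr_add)
    moreover have "\<bar>b\<bar> * sgn b = b" for b :: real by (simp add: abs_mult_sgn)
    moreover have "w (\<tau>, y) * k (\<tau>, y) x = indicator {0<..<t} \<tau> * (\<tau> powr (\<alpha> - d) * \<tau> powr d) * K \<tau> (x - y) * (\<bar>h (t - \<tau>) y\<bar> * sgn (h (t - \<tau>) y))"
      by (simp only: w_def k_def fst_conv snd_conv mult_ac)
    ultimately show ?thesis unfolding Pair space_time_integrand_def by (simp only: prod.case)
  qed
  have L: "Lq_le q (\<lambda>x. \<integral>z. w z * k z x \<partial>(lborel \<Otimes>\<^sub>M lborel)) (I * CK)"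
    by (rule Lq_le_integral(1)[OF M w0 wint wI km kq q(1) CK])
  have ae: "AE x in lborel. integrable (lborel \<Otimes>\<^sub>M lborel) (\<lambda>z. w z * k z x)"
    by (rule Lq_le_integral(2)[OF M w0 wint wI km kq q(1) CK])
  then show ae': "AE x in lborel. integrable (lborel \<Otimes>\<^sub>M lborel) (space_time_integrand h t x)"
    unfolding wk .
  show "Lq_le q (Duhamel h t) (I * CK)"
  proof (rule Lq_le_AE_cong[OF L])
    show "Duhamel h t \<in> borel_measurable borel"
      using joint_measurable_compose[OF measurable_Duhamel[OF h], of "\<lambda>x. t" borel "\<lambda>x. x"] by simp
    show "AE x in lborel. Duhamel h t x = (\<integral>z. w z * k z x \<partial>(lborel \<Otimes>\<^sub>M lborel))"
      using ae' by eventually_elim (simp add: wk Duhamel_eq_space_time[OF h])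
  qed (use q in simp)
qed

lemma Lq_le_Duhamel_const:
  assumes sm: "smoothing q d" and h: "jointly_measurable h" and t: "0 \<le> t"
    and h1: "\<And>s. 0 \<le> s \<Longrightarrow> s \<le> t \<Longrightarrow> Lq_le 1 (h s) M"
  shows "Lq_le q (Duhamel h t) (M * (t powr (1 + \<alpha> - d) * Beta (1 + \<alpha> - d) 1) * CK)"
    and "AE x in lborel. integrable (lborel \<Otimes>\<^sub>M lborel) (space_time_integrand h t x)"
proof -
  have a: "0 < 1 + \<alpha> - d" using sm by (auto simp: smoothing_def)
  have eq: "(\<lambda>\<tau>. indicator {0<..<t} \<tau> * (\<tau> powr (\<alpha> - d) * M)) = (\<lambda>\<tau>. M * (indicator {0<..<t} \<tau> * \<tau> powr (1 + \<alpha> - d - 1)))"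
    by (simp add: fun_eq_iff mult_ac)
  have \<beta>: "integrable lborel (\<lambda>\<tau>. indicator {0<..<t} \<tau> * (\<tau> powr (\<alpha> - d) * M))"
    "(\<integral>\<tau>. indicator {0<..<t} \<tau> * (\<tau> powr (\<alpha> - d) * M) \<partial>lborel) \<le> M * (t powr (1 + \<alpha> - d) * Beta (1 + \<alpha> - d) 1)"
    unfolding eq using integrable_powr_Ioo[OF a t] integral_powr_Ioo[OF a t] by auto
  show "Lq_le q (Duhamel h t) (M * (t powr (1 + \<alpha> - d) * Beta (1 + \<alpha> - d) 1) * CK)"
    "AE x in lborel. integrable (lborel \<Otimes>\<^sub>M lborel) (space_time_integrand h t x)"
    using h1 by (auto intro!: Lq_le_Duhamel[OF sm h t _ \<beta>] AE_integrable_Duhamel[OF sm h t _ \<beta>])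
qed

lemma AE_Duhamel_diff:
  assumes g: "jointly_measurable g" and h: "jointly_measurable h"
    and t: "0 \<le> t" and b: "\<And>s. 0 \<le> s \<Longrightarrow> s \<le> t \<Longrightarrow> Lq_le 1 (g s) M" "\<And>s. 0 \<le> s \<Longrightarrow> s \<le> t \<Longrightarrow> Lq_le 1 (h s) M"
  shows "AE x in lborel. Duhamel (\<lambda>s y. g s y - h s y) t x = Duhamel g t x - Duhamel h t x"
proof -
  have gh: "jointly_measurable (\<lambda>s y. g s y - h s y)"
    using g h unfolding case_prod_beta by measurable
  have "AE x in lborel. integrable (lborel \<Otimes>\<^sub>M lborel) (space_time_integrand g t x)"
    by (rule Lq_le_Duhamel_const(2)[OF smoothing_1 g t]) (rule b(1))
  moreover have "AE x in lborel. integrable (lborel \<Otimes>\<^sub>M lborel) (space_time_integrand h t x)"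
    by (rule Lq_le_Duhamel_const(2)[OF smoothing_1 h t]) (rule b(2))
  ultimately show ?thesis
  proof eventually_elim
    case (elim x)
    have eq: "space_time_integrand (\<lambda>s y. g s y - h s y) t x = (\<lambda>z. space_time_integrand g t x z - space_time_integrand h t x z)"
      by (auto simp: space_time_integrand_def algebra_simps)
    have "integrable (lborel \<Otimes>\<^sub>M lborel) (space_time_integrand (\<lambda>s y. g s y - h s y) t x)"
      unfolding eq using elim by simp
    from Duhamel_eq_space_time[OF gh this] Duhamel_eq_space_time[OF g elim(1)] Duhamel_eq_space_time[OF h elim(2)] elim
    show ?case unfolding eq by simp
  qed
qed

text \<open>The factor with the maximum serves to compare both \<open>1\<close> for \<open>t \<le> 1\<close> and \<open>t\<close> to the power \<open>1 - d\<close> for \<open>t \<ge> 1\<close> with \<open>1 + t\<close>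
to the power \<open>1 - d\<close>, an exponent of either sign.\<close>

definition decay_const :: "real \<Rightarrow> real" where
  "decay_const d = (max 1 (2 powr (d - 1))) * (Beta (1 + \<alpha> - d) 1 + Beta (1 + \<alpha> - d) (1 - \<alpha>))"

lemma Beta_pos: "0 < a \<Longrightarrow> 0 < b \<Longrightarrow> 0 < Beta a (b::real)"
  using Gamma_real_pos by (simp add: Beta_def)

text \<open>For \<open>t \<le> 1\<close> the decaying factor is bounded by \<open>1\<close>. For larger \<open>t\<close> it is bounded by
\<open>(t - \<tau>)\<close> to the power \<open>- \<alpha>\<close>, which leaves a Beta integral that is homogeneous of degree \<open>1 - d\<close>.\<close>

lemma decaying_source:
  assumes d: "0 \<le> d" "d < 1 + \<alpha>" and t: "0 \<le> t"
  shows "integrable lborel (\<lambda>\<tau>. indicator {0<..<t} \<tau> * (\<tau> powr (\<alpha> - d) * (1 + (t - \<tau>)) powr (- \<alpha>)))"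
    and "(\<integral>\<tau>. indicator {0<..<t} \<tau> * (\<tau> powr (\<alpha> - d) * (1 + (t - \<tau>)) powr (- \<alpha>)) \<partial>lborel) \<le> decay_const d * (1 + t) powr (1 - d)"
proof -
  let ?f = "\<lambda>\<tau>. indicator {0<..<t} \<tau> * (\<tau> powr (\<alpha> - d) * (1 + (t - \<tau>)) powr (- \<alpha>))"
  have a: "0 < 1 + \<alpha> - d" "0 < 1 - \<alpha>" using d \<alpha> by auto
  have f0: "0 \<le> ?f \<tau>" for \<tau> by simp
  have le1: "?f \<tau> \<le> indicator {0<..<t} \<tau> * \<tau> powr (1 + \<alpha> - d - 1)" for \<tau>
  proof (cases "0 < \<tau> \<and> \<tau> < t")
    case True
    then have "(1 + (t - \<tau>)) powr (- \<alpha>) \<le> 1 powr (- \<alpha>)" using \<alpha> by (intro powr_mono2') auto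
    then show ?thesis using True by (simp add: mult_left_le)
  qed auto
  have le2: "?f \<tau> \<le> indicator {0..t} \<tau> * (\<tau> powr (1 + \<alpha> - d - 1) * (t - \<tau>) powr (1 - \<alpha> - 1))" for \<tau>
  proof (cases "0 < \<tau> \<and> \<tau> < t")
    case True
    then have "(1 + (t - \<tau>)) powr (- \<alpha>) \<le> (t - \<tau>) powr (- \<alpha>)" using \<alpha> by (intro powr_mono2') auto
    then show ?thesis using True by (simp add: mult_left_mono)
  qed auto
  note i1 = integrable_powr_Ioo[OF a(1) t] and i2 = integrable_Beta_scaled[OF a t]
  show fi: "integrable lborel ?f"
    using i1 by (rule Bochner_Integration.integrable_bound) (use le1 in \<open>auto intro!: AE_I2 order_trans[OF _ abs_ge_self]\<close>)
  have B: "0 < Beta (1 + \<alpha> - d) 1" "0 < Beta (1 + \<alpha> - d) (1 - \<alpha>)" using a by (auto intro: Beta_pos)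
  show "(\<integral>\<tau>. ?f \<tau> \<partial>lborel) \<le> decay_const d * (1 + t) powr (1 - d)"
  proof (cases "t \<le> 1")
    case True
    have "(\<integral>\<tau>. ?f \<tau> \<partial>lborel) \<le> t powr (1 + \<alpha> - d) * Beta (1 + \<alpha> - d) 1"
      unfolding integral_powr_Ioo[OF a(1) t, symmetric] using fi i1 le1 by (intro integral_mono) auto
    also have "\<dots> \<le> 1 * Beta (1 + \<alpha> - d) 1"
      using True t a B by (intro mult_right_mono powr_le1) auto
    also have "\<dots> \<le> (max 1 (2 powr (d - 1)) * (1 + t) powr (1 - d)) * (Beta (1 + \<alpha> - d) 1 + Beta (1 + \<alpha> - d) (1 - \<alpha>))"
    proof (intro mult_mono)
      show "1 \<le> max 1 (2 powr (d - 1)) * (1 + t) powr (1 - d)"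
      proof (cases "d \<le> 1")
        case True
        then have "1 \<le> (1 + t) powr (1 - d)" using t by (intro ge_one_powr_ge_zero) auto
        then show ?thesis using mult_mono[of 1 "max 1 (2 powr (d - 1))" 1 "(1 + t) powr (1 - d)"] by simp
      next
        case False
        have "2 powr (1 - d) \<le> (1 + t) powr (1 - d)" using True t False by (intro powr_mono2') auto
        then have "2 powr (d - 1) * 2 powr (1 - d) \<le> max 1 (2 powr (d - 1)) * (1 + t) powr (1 - d)"
          by (intro mult_mono) auto
        then show ?thesis by (simp flip: powr_add)
      qed
    qed (use B in auto)
    finally show ?thesis by (simp add: decay_const_def mult_ac)
  next
    case False
    have "(\<integral>\<tau>. ?f \<tau> \<partial>lborel) \<le> t powr (1 + \<alpha> - d + (1 - \<alpha>) - 1) * Beta (1 + \<alpha> - d) (1 - \<alpha>)"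
      unfolding integral_Beta_scaled[OF a t, symmetric] using fi i2 le2 by (intro integral_mono) auto
    also have "t powr (1 + \<alpha> - d + (1 - \<alpha>) - 1) = t powr (1 - d)" by simp
    also have "t powr (1 - d) * Beta (1 + \<alpha> - d) (1 - \<alpha>) \<le> (max 1 (2 powr (d - 1)) * (1 + t) powr (1 - d)) * (Beta (1 + \<alpha> - d) 1 + Beta (1 + \<alpha> - d) (1 - \<alpha>))"
    proof (intro mult_mono)
      show "t powr (1 - d) \<le> max 1 (2 powr (d - 1)) * (1 + t) powr (1 - d)"
      proof (cases "d \<le> 1")
        case True
        then have "t powr (1 - d) \<le> (1 + t) powr (1 - d)" using t by (intro powr_mono2) auto
        then show ?thesis using mult_mono[of 1 "max 1 (2 powr (d - 1))" "t powr (1 - d)" "(1 + t) powr (1 - d)"] by simp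
      next
        case F: False
        have "t powr (1 - d) \<le> ((1 + t) / 2) powr (1 - d)" using F False by (intro powr_mono2') auto
        also have "\<dots> = 2 powr (d - 1) * (1 + t) powr (1 - d)"
        proof -
          have "2 powr (d - 1) = 1 / 2 powr (1 - d)" by (simp flip: powr_minus_divide)
          then show ?thesis using t by (simp add: powr_divide)
        qed
        also have "\<dots> \<le> max 1 (2 powr (d - 1)) * (1 + t) powr (1 - d)" by (intro mult_right_mono) auto
        finally show ?thesis .
      qed
    qed (use B in auto)
    finally show ?thesis by (simp add: decay_const_def mult_ac)
  qed
qed

lemma Lq_le_Duhamel_decay:
  assumes sm: "smoothing q d" and h: "jointly_measurable h" and t: "0 \<le> t" and b: "0 \<le> b"
    and h1: "\<And>s. 0 \<le> s \<Longrightarrow> Lq_le 1 (h s) (b * (1 + s) powr (- \<alpha>))"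
  shows "Lq_le q (Duhamel h t) (CK * decay_const d * b * (1 + t) powr (1 - d))"
proof -
  have d: "0 \<le> d" "d < 1 + \<alpha>" using sm by (auto simp: smoothing_def)
  have eq: "(\<lambda>\<tau>. indicator {0<..<t} \<tau> * (\<tau> powr (\<alpha> - d) * (b * (1 + (t - \<tau>)) powr (- \<alpha>)))) = (\<lambda>\<tau>. b * (indicator {0<..<t} \<tau> * (\<tau> powr (\<alpha> - d) * (1 + (t - \<tau>)) powr (- \<alpha>))))"
    by (simp add: fun_eq_iff mult_ac)
  have "Lq_le q (Duhamel h t) ((b * (decay_const d * (1 + t) powr (1 - d))) * CK)"
  proof (rule Lq_le_Duhamel[OF sm h t])
    show "Lq_le 1 (h (t - \<tau>)) (b * (1 + (t - \<tau>)) powr (- \<alpha>))" if "\<tau> < t" for \<tau> using that by (intro h1) auto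
    show "integrable lborel (\<lambda>\<tau>. indicator {0<..<t} \<tau> * (\<tau> powr (\<alpha> - d) * (b * (1 + (t - \<tau>)) powr (- \<alpha>))))"
      unfolding eq by (intro integrable_mult_right decaying_source(1) d t)
    show "(\<integral>\<tau>. indicator {0<..<t} \<tau> * (\<tau> powr (\<alpha> - d) * (b * (1 + (t - \<tau>)) powr (- \<alpha>))) \<partial>lborel) \<le> b * (decay_const d * (1 + t) powr (1 - d))"
      unfolding eq integral_mult_right_zero by (intro mult_left_mono decaying_source(2) d t b)
  qed
  then show ?thesis by (simp add: mult_ac)
qed

text \<open>Let \<open>s \<le> r\<close>. The Duhamel integral up to time \<open>s\<close> is the one up to time \<open>r\<close> for the source delayed by \<open>r - s\<close>, so
the increment is the Duhamel integral of a difference of sources. By uniform continuity in \<open>L\<^sup>1\<close> this difference is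
small except on the initial interval of length \<open>r - s\<close>, on which it is bounded and the kernel has small mass.\<close>

lemma Lq_cont_Duhamel:
  assumes sm: "smoothing q d" and h: "jointly_measurable h"
    and hc: "Lq_cont 1 h" and hq: "\<And>s. 0 \<le> s \<Longrightarrow> h s \<in> Lq_space 1"
  shows "Lq_cont q (Duhamel h)"
  unfolding Lq_cont_def
proof (intro allI impI)
  fix t e :: real assume t: "0 \<le> t" and e: "0 < e"
  have q: "1 \<le> q" and a: "0 < 1 + \<alpha> - d" using sm by (auto simp: smoothing_def)
  define a where "a = 1 + \<alpha> - d"
  have a0: "0 < a" and ad: "\<alpha> - d = a - 1" using a by (auto simp: a_def)
  define T where "T = t + 1"
  obtain M where M: "M > 0" "\<And>s. s \<in> {0..T} \<Longrightarrow> Lq_le 1 (h s) M"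
    using Lq_cont_bounded[OF hc hq, of T] by auto
  define e1 where "e1 = e / (2 * (T powr a * Beta a 1 * CK + 1))"
  define e2 where "e2 = e / (2 * (M * Beta a 1 * CK + 1))"
  have B: "0 < Beta a 1" using a0 by (auto intro: Beta_pos)
  have pos: "0 < T powr a * Beta a 1 * CK + 1" "0 < M * Beta a 1 * CK + 1" using B CK M by (auto intro!: add_nonneg_pos)
  have e12: "0 < e1" "0 < e2" using e pos by (auto simp: e1_def e2_def)
  have half: "x / (2 * y) * y = x / 2" if "0 < y" for x y :: real using that by simp
  obtain \<delta>1 where \<delta>1: "\<delta>1 > 0" "\<And>s r. s \<in> {0..T} \<Longrightarrow> r \<in> {0..T} \<Longrightarrow> \<bar>s - r\<bar> < \<delta>1 \<Longrightarrow> Lq_le 1 (\<lambda>x. h s x - h r x) e1"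
    using Lq_cont_uniform[OF hc _ e12(1), of T] by auto
  have "((\<lambda>s. s powr a) \<longlongrightarrow> t powr a) (at t within {0..})"
    using a0 t by (intro tendsto_powr' tendsto_intros) (auto simp: eventually_at_filter)
  then obtain \<delta>2 where \<delta>2: "\<delta>2 > 0" "\<And>s. s \<ge> 0 \<Longrightarrow> s \<noteq> t \<Longrightarrow> dist s t < \<delta>2 \<Longrightarrow> dist (s powr a) (t powr a) < e2"
    using e12(2) unfolding tendsto_iff eventually_at by (metis atLeast_iff)
  have main: "Lq_le q (\<lambda>x. Duhamel h r x - Duhamel h s x) e"
    if sr: "0 \<le> s" "s \<le> r" "r \<le> T" "r - s < \<delta>1" "r powr a - s powr a \<le> e2" for s r
  proof -
    (* hs is h delayed by r - s and extended by 0. *)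
    define hs where "hs = (\<lambda>\<rho> y. if r - s < \<rho> then h (\<rho> - (r - s)) y else 0)"
    define h' where "h' = (\<lambda>\<rho> y. h \<rho> y - hs \<rho> y)"
    have [measurable]: "(\<lambda>z. h (f z) (g z)) \<in> borel_measurable N" if "f \<in> borel_measurable N" "g \<in> borel_measurable N" for f g and N :: "'n measure"
      by (rule joint_measurable_compose[OF h that])
    have hsm: "jointly_measurable hs"
    proof -
      have "(\<lambda>z::real \<times> 'a. h (fst z - (r - s)) (snd z)) \<in> borel_measurable (borel \<Otimes>\<^sub>M borel)"
        by (rule joint_measurable_compose[OF h]) measurable
      then show ?thesis unfolding hs_def case_prod_beta by measurable
    qed
    have h'm: "jointly_measurable h'"
      using h hsm unfolding h'_def case_prod_beta by measurable
    have st: "space_time_integrand hs r x = space_time_integrand h s x" for x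
      using sr by (auto simp: fun_eq_iff space_time_integrand_def hs_def indicator_def)
    have hsM: "Lq_le 1 (hs \<rho>) M" if "0 \<le> \<rho>" "\<rho> \<le> r" for \<rho>
    proof (cases "r - s < \<rho>")
      case True
      then show ?thesis unfolding hs_def using that sr by (simp add: M(2))
    qed (use M in \<open>simp add: hs_def Lq_le_zero\<close>)
    have hM: "Lq_le 1 (h \<rho>) M" if "0 \<le> \<rho>" "\<rho> \<le> r" for \<rho> using that sr by (intro M(2)) auto
    have hM': "Lq_le 1 (h \<rho>) M" if "0 \<le> \<rho>" "\<rho> \<le> s" for \<rho> using that sr by (intro M(2)) auto
    have "AE x in lborel. integrable (lborel \<Otimes>\<^sub>M lborel) (space_time_integrand h s x)"
      by (rule Lq_le_Duhamel_const(2)[OF sm h sr(1)]) (rule hM')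
    then have shift: "AE x in lborel. Duhamel hs r x = Duhamel h s x"
      by eventually_elim (simp add: Duhamel_eq_space_time[OF h] Duhamel_eq_space_time[OF hsm] st)
    have diff: "AE x in lborel. Duhamel h' r x = Duhamel h r x - Duhamel hs r x"
      unfolding h'_def using sr by (intro AE_Duhamel_diff[OF h hsm _ hM hsM]) auto
    define \<beta> where "\<beta> = (\<lambda>\<tau>. if \<tau> < s then e1 else M)"
    have \<beta>eq: "indicator {0<..<r} \<tau> * (\<tau> powr (\<alpha> - d) * \<beta> \<tau>) = e1 * (indicator {0<..<s} \<tau> * \<tau> powr (a - 1)) + M * (indicator {0<..<r} \<tau> * \<tau> powr (a - 1) - indicator {0<..<s} \<tau> * \<tau> powr (a - 1))" for \<tau>
      unfolding ad using sr by (auto simp: \<beta>_def indicator_def)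
    have r0: "0 \<le> r" using sr by simp
    note i = integrable_powr_Ioo[OF a0 sr(1)] integrable_powr_Ioo[OF a0 r0]
    have "Lq_le q (Duhamel h' r) ((e1 * (s powr a * Beta a 1) + M * (r powr a * Beta a 1 - s powr a * Beta a 1)) * CK)"
    proof (rule Lq_le_Duhamel[OF sm h'm r0])
      show "integrable lborel (\<lambda>\<tau>. indicator {0<..<r} \<tau> * (\<tau> powr (\<alpha> - d) * \<beta> \<tau>))"
        unfolding \<beta>eq using i by simp
      show "(\<integral>\<tau>. indicator {0<..<r} \<tau> * (\<tau> powr (\<alpha> - d) * \<beta> \<tau>) \<partial>lborel) \<le> e1 * (s powr a * Beta a 1) + M * (r powr a * Beta a 1 - s powr a * Beta a 1)"
        unfolding \<beta>eq using i integral_powr_Ioo[OF a0 sr(1)] integral_powr_Ioo[OF a0 r0] by simp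
      fix \<tau> assume \<tau>: "0 < \<tau>" "\<tau> < r"
      show "Lq_le 1 (h' (r - \<tau>)) (\<beta> \<tau>)"
      proof (cases "\<tau> < s")
        case True
        have "Lq_le 1 (\<lambda>x. h (r - \<tau>) x - h (s - \<tau>) x) e1" using \<tau> sr True by (intro \<delta>1(2)) auto
        then show ?thesis using True by (simp add: h'_def hs_def \<beta>_def)
      next
        case False
        then show ?thesis using \<tau> hM[of "r - \<tau>"] by (simp add: h'_def hs_def \<beta>_def)
      qed
    qed
    moreover have "(e1 * (s powr a * Beta a 1) + M * (r powr a * Beta a 1 - s powr a * Beta a 1)) * CK \<le> e"
    proof -
      have "e1 * (s powr a * Beta a 1) * CK \<le> e1 * (T powr a * Beta a 1) * CK"
        using sr e12 B CK a0 by (intro mult_right_mono mult_left_mono powr_mono2) auto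
      also have "\<dots> \<le> e1 * (T powr a * Beta a 1 * CK + 1)" using e12 by (simp add: algebra_simps)
      also have "\<dots> = e / 2" unfolding e1_def by (rule half[OF pos(1)])
      finally have 1: "e1 * (s powr a * Beta a 1) * CK \<le> e / 2" .
      have "M * (r powr a * Beta a 1 - s powr a * Beta a 1) * CK = (r powr a - s powr a) * (M * Beta a 1 * CK)"
        by (simp add: algebra_simps)
      also have "\<dots> \<le> e2 * (M * Beta a 1 * CK)" using sr M B CK by (intro mult_right_mono) auto
      also have "\<dots> \<le> e2 * (M * Beta a 1 * CK + 1)" using e12 by (simp add: algebra_simps)
      also have "\<dots> = e / 2" unfolding e2_def by (rule half[OF pos(2)])
      finally have 2: "M * (r powr a * Beta a 1 - s powr a * Beta a 1) * CK \<le> e / 2" .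
      show ?thesis using 1 2 by (simp add: distrib_right)
    qed
    ultimately have L: "Lq_le q (Duhamel h' r) e" by (rule Lq_le_weaken) (use q in simp)
    have Dm: "Duhamel h x \<in> borel_measurable borel" for x
      using joint_measurable_compose[OF measurable_Duhamel[OF h], of "\<lambda>y. x" borel "\<lambda>x. x"] by simp
    show ?thesis
    proof (rule Lq_le_AE_cong[OF L])
      show "(\<lambda>x. Duhamel h r x - Duhamel h s x) \<in> borel_measurable borel" using Dm by simp
      show "AE x in lborel. Duhamel h r x - Duhamel h s x = Duhamel h' r x" using diff shift by eventually_elim simp
    qed (use q in simp)
  qed
  show "\<exists>\<delta>>0. \<forall>s\<ge>0. \<bar>s - t\<bar> < \<delta> \<longrightarrow> Lq_le q (\<lambda>x. Duhamel h s x - Duhamel h t x) e"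
  proof (intro exI[of _ "min 1 (min \<delta>1 \<delta>2)"] conjI allI impI)
    fix s assume s: "0 \<le> s" "\<bar>s - t\<bar> < min 1 (min \<delta>1 \<delta>2)"
    have pw: "\<bar>s powr a - t powr a\<bar> \<le> e2"
      using \<delta>2(2)[OF s(1)] s(2) e12 by (cases "s = t") (auto simp: dist_real_def)
    show "Lq_le q (\<lambda>x. Duhamel h s x - Duhamel h t x) e"
    proof (cases "t \<le> s")
      case True
      then show ?thesis using s t pw by (intro main) (auto simp: T_def)
    next
      case False
      then have "Lq_le q (\<lambda>x. Duhamel h t x - Duhamel h s x) e" using s t pw by (intro main) (auto simp: T_def)
      from Lq_le_minus[OF this] show ?thesis by simp
    qed
  qed (use \<delta>1 \<delta>2 in simp)
qed

end

section \<open>The fixed point problem\<close>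

lemma AE_summable_if_L1_geometric:
  assumes f: "\<And>k. Lq_le 1 (f k) (c * (1/2) ^ k)"
  shows "AE x in lborel. summable (\<lambda>k. f k x)"
proof -
  note [measurable] = Lq_le_measurable[OF f]
  have c: "0 \<le> c" using Lq_le_nonneg[OF f[of 0]] by simp
  have "(\<integral>\<^sup>+x. (\<Sum>k. ennreal \<bar>f k x\<bar>) \<partial>lborel) = (\<Sum>k. \<integral>\<^sup>+x. ennreal \<bar>f k x\<bar> \<partial>lborel)"
    by (rule nn_integral_suminf) simp
  also have "\<dots> \<le> (\<Sum>k. ennreal (c * (1/2) ^ k))"
    using Lq_le_nn_integral[OF f] c by (intro suminf_le summableI) auto
  also have "\<dots> = ennreal (\<Sum>k. c * (1/2) ^ k)"
    using c by (intro suminf_ennreal2 summable_mult summable_geometric) auto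
  also have "\<dots> < \<infinity>" by simp
  finally have "AE x in lborel. (\<Sum>k. ennreal \<bar>f k x\<bar>) \<noteq> \<infinity>"
    by (intro nn_integral_PInf_AE) auto
  then show ?thesis
  proof eventually_elim
    case (elim x)
    then have "summable (\<lambda>k. \<bar>f k x\<bar>)" by (intro summable_suminf_not_top) auto
    then show ?case by (rule summable_rabs_cancel)
  qed
qed

lemma Lq_cont_abs_powr:
  assumes v: "Lq_cont p v" and vp: "\<And>t. 0 \<le> t \<Longrightarrow> v t \<in> Lq_space p" and p: "1 < p"
  shows "Lq_cont 1 (\<lambda>s x. \<bar>v s x\<bar> powr p)"
  unfolding Lq_cont_def
proof (intro allI impI)
  fix t e :: real assume t: "0 \<le> t" and e: "0 < e"
  obtain M where M: "M > 0" "\<And>s. s \<in> {0..t + 1} \<Longrightarrow> Lq_le p (v s) M"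
    using Lq_cont_bounded[OF v vp, of "t + 1"] p by auto
  define d where "d = e / (2 * p * M powr (p - 1))"
  have pos: "0 < 2 * p * M powr (p - 1)" using p M by simp
  have d: "0 < d" "2 * p * M powr (p - 1) * d = e" using e pos p by (auto simp: d_def)
  obtain \<delta> where \<delta>: "\<delta> > 0" "\<And>s. 0 \<le> s \<Longrightarrow> \<bar>s - t\<bar> < \<delta> \<Longrightarrow> Lq_le p (\<lambda>x. v s x - v t x) d"
    using v t d(1) unfolding Lq_cont_def by blast
  show "\<exists>\<delta>>0. \<forall>s\<ge>0. \<bar>s - t\<bar> < \<delta> \<longrightarrow> Lq_le 1 (\<lambda>x. \<bar>v s x\<bar> powr p - \<bar>v t x\<bar> powr p) e"
  proof (intro exI[of _ "min 1 \<delta>"] conjI allI impI)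
    fix s assume s: "0 \<le> s" "\<bar>s - t\<bar> < min 1 \<delta>"
    have "Lq_le 1 (\<lambda>x. \<bar>v s x\<bar> powr p - \<bar>v t x\<bar> powr p) (2 * p * M powr (p - 1) * d)"
      using s t by (intro Lq_le_powr_diff M(2) \<delta>(2) p) auto
    then show "Lq_le 1 (\<lambda>x. \<bar>v s x\<bar> powr p - \<bar>v t x\<bar> powr p) e" unfolding d(2) .
  qed (use \<delta> in simp)
qed

lemma Lq_cont_add:
  assumes u: "Lq_cont q u" and v: "Lq_cont q v" and q: "1 \<le> q"
  shows "Lq_cont q (\<lambda>t x. u t x + v t x)"
  unfolding Lq_cont_def
proof (intro allI impI)
  fix t e :: real assume t: "0 \<le> t" and e: "0 < e"
  then have e2: "0 < e / 2" by simp
  obtain \<delta>1 where \<delta>1: "\<delta>1 > 0" "\<And>s. 0 \<le> s \<Longrightarrow> \<bar>s - t\<bar> < \<delta>1 \<Longrightarrow> Lq_le q (\<lambda>x. u s x - u t x) (e/2)"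
    using u t e2 unfolding Lq_cont_def by blast
  obtain \<delta>2 where \<delta>2: "\<delta>2 > 0" "\<And>s. 0 \<le> s \<Longrightarrow> \<bar>s - t\<bar> < \<delta>2 \<Longrightarrow> Lq_le q (\<lambda>x. v s x - v t x) (e/2)"
    using v t e2 unfolding Lq_cont_def by blast
  show "\<exists>\<delta>>0. \<forall>s\<ge>0. \<bar>s - t\<bar> < \<delta> \<longrightarrow> Lq_le q (\<lambda>x. u s x + v s x - (u t x + v t x)) e"
  proof (intro exI[of _ "min \<delta>1 \<delta>2"] conjI allI impI)
    fix s assume "0 \<le> s" "\<bar>s - t\<bar> < min \<delta>1 \<delta>2"
    then have "Lq_le q (\<lambda>x. (u s x - u t x) + (v s x - v t x)) (e/2 + e/2)"
      by (intro Lq_le_add \<delta>1(2) \<delta>2(2) q) auto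
    then show "Lq_le q (\<lambda>x. u s x + v s x - (u t x + v t x)) e" by (simp add: algebra_simps)
  qed (use \<delta>1 \<delta>2 in simp)
qed

context duhamel
begin

text \<open>The ball in which the fixed point is found: the growth in \<open>L\<^sup>1\<close> and \<open>L\<^sup>p\<close> is that of the solution of the linear
equation.\<close>

definition decay_ball :: "(real \<Rightarrow> 'a \<Rightarrow> real) \<Rightarrow> real \<Rightarrow> bool" where
  "decay_ball u M \<longleftrightarrow> jointly_measurable u \<and> 0 \<le> M \<and>
     (\<forall>t\<ge>0. Lq_le 1 (u t) (M * (1 + t)) \<and> Lq_le p (u t) (M * (1 + t) powr (1 - D)))"

definition nonlin :: "(real \<Rightarrow> 'a \<Rightarrow> real) \<Rightarrow> real \<Rightarrow> 'a \<Rightarrow> real" where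
  "nonlin u = Duhamel (\<lambda>s y. \<bar>u s y\<bar> powr p)"

definition nonlin_const :: real where "nonlin_const = 2 * p * (CK * (decay_const 0 + decay_const D))"

lemma p_nonneg: "0 \<le> p" using p by simp

lemma decay_const_pos: "d < 1 + \<alpha> \<Longrightarrow> 0 < decay_const d"
  unfolding decay_const_def using \<alpha> by (intro mult_pos_pos add_pos_pos Beta_pos) auto

lemma nonlin_const: "0 \<le> nonlin_const"
  unfolding nonlin_const_def using decay_const_pos[of 0] decay_const_pos[of D] \<alpha> D CK p by (intro mult_nonneg_nonneg add_nonneg_nonneg) auto

lemma decay_ball_measurable: "decay_ball u M \<Longrightarrow> jointly_measurable u"
  by (simp add: decay_ball_def)

lemma measurable_abs_powr:
  assumes "jointly_measurable u"
  shows "jointly_measurable (\<lambda>s y. \<bar>u s y\<bar> powr p)"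
  using assms unfolding case_prod_beta by measurable

lemma measurable_nonlin:
  "jointly_measurable u \<Longrightarrow> jointly_measurable (\<lambda>t x. nonlin u t x)"
  unfolding nonlin_def by (intro measurable_Duhamel measurable_abs_powr)

lemma slice_measurable:
  "jointly_measurable u \<Longrightarrow> u t \<in> borel_measurable borel"
  using joint_measurable_compose[of u "\<lambda>x. t" borel "\<lambda>x. x"] by simp

lemma decay_ball_D:
  assumes "decay_ball u M"
  shows "0 \<le> M" "0 \<le> t \<Longrightarrow> Lq_le 1 (u t) (M * (1 + t))"
    "0 \<le> t \<Longrightarrow> Lq_le p (u t) (M * (1 + t) powr (1 - D))"
  using assms by (simp_all add: decay_ball_def)

lemma decay_ball_mono:
  assumes u: "decay_ball u M" and M: "M \<le> M'"
  shows "decay_ball u M'"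
  unfolding decay_ball_def
proof (intro conjI allI impI)
  show "jointly_measurable u" by (rule decay_ball_measurable[OF u])
  show "0 \<le> M'" using decay_ball_D(1)[OF u] M by simp
  fix t :: real assume t: "0 \<le> t"
  show "Lq_le 1 (u t) (M' * (1 + t))"
    by (rule Lq_le_weaken[OF decay_ball_D(2)[OF u t] mult_right_mono[OF M]]) (use t in simp_all)
  show "Lq_le p (u t) (M' * (1 + t) powr (1 - D))"
    by (rule Lq_le_weaken[OF decay_ball_D(3)[OF u t] mult_right_mono[OF M]]) (use p in simp_all)
qed

lemma decay_ball_add:
  assumes u: "decay_ball u A" and v: "decay_ball v B"
  shows "decay_ball (\<lambda>t x. u t x + v t x) (A + B)"
  unfolding decay_ball_def
proof (intro conjI allI impI)
  show "jointly_measurable (\<lambda>t x. u t x + v t x)"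
    using decay_ball_measurable[OF u] decay_ball_measurable[OF v] unfolding case_prod_beta by measurable
  show "0 \<le> A + B" using decay_ball_D(1)[OF u] decay_ball_D(1)[OF v] by simp
  fix t :: real assume t: "0 \<le> t"
  show "Lq_le 1 (\<lambda>x. u t x + v t x) ((A + B) * (1 + t))"
    unfolding distrib_right by (rule Lq_le_add[OF decay_ball_D(2)[OF u t] decay_ball_D(2)[OF v t]]) simp
  show "Lq_le p (\<lambda>x. u t x + v t x) ((A + B) * (1 + t) powr (1 - D))"
    unfolding distrib_right by (rule Lq_le_add[OF decay_ball_D(3)[OF u t] decay_ball_D(3)[OF v t]]) (use p in simp)
qed

lemma decay_ball_abs_powr:
  assumes "decay_ball u M" "0 \<le> s" "s \<le> t"
  shows "Lq_le 1 (\<lambda>x. \<bar>u s x\<bar> powr p) ((M * (1 + t)) powr p)"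
proof -
  have "(1 + s) powr (1 - D) \<le> (1 + s) powr 1" using assms D by (intro powr_mono) auto
  also have "\<dots> \<le> 1 + t" using assms by simp
  finally have "M * (1 + s) powr (1 - D) \<le> M * (1 + t)" using assms by (intro mult_left_mono) (auto simp: decay_ball_def)
  moreover have "Lq_le p (u s) (M * (1 + s) powr (1 - D))" using assms by (auto simp: decay_ball_def)
  ultimately have "Lq_le p (u s) (M * (1 + t))" using p by (metis Lq_le_weaken less_imp_le zero_less_one order.strict_trans)
  then show ?thesis by (rule Lq_le_powr)
qed

text \<open>The source has \<open>L\<^sup>1\<close> norm of order \<open>(1 + s)\<close> to the power \<open>p (1 - D)\<close>, which by the assumption
\<open>decay\<close> is at most \<open>(1 + s)\<close> to the power \<open>- \<alpha>\<close>; the Duhamel integral of such a source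
has the growth that defines the ball.\<close>

lemma decay_ball_nonlin_diff:
  assumes u: "decay_ball u M" and v: "decay_ball v M" and uv: "decay_ball (\<lambda>t x. u t x - v t x) \<delta>"
  shows "decay_ball (\<lambda>t x. nonlin u t x - nonlin v t x) (nonlin_const * M powr (p - 1) * \<delta>)"
proof -
  have M: "0 \<le> M" "0 \<le> \<delta>" using u uv by (auto simp: decay_ball_def)
  note um = measurable_abs_powr[OF decay_ball_measurable[OF u]] and vm = measurable_abs_powr[OF decay_ball_measurable[OF v]]
  define g where "g = (\<lambda>s y. \<bar>u s y\<bar> powr p - \<bar>v s y\<bar> powr p)"
  have gm: "jointly_measurable g"
    using um vm unfolding g_def case_prod_beta by measurable
  define b where "b = 2 * p * M powr (p - 1) * \<delta>"
  have b: "0 \<le> b" using M p by (simp add: b_def)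
  have g1: "Lq_le 1 (g s) (b * (1 + s) powr (- \<alpha>))" if s: "0 \<le> s" for s
  proof -
    define Y where "Y = (1 + s) powr (1 - D)"
    have "Lq_le 1 (g s) (2 * p * (M * Y) powr (p - 1) * (\<delta> * Y))"
      unfolding g_def Y_def using u v uv s p by (intro Lq_le_powr_diff) (auto simp: decay_ball_def)
    moreover have "2 * p * (M * Y) powr (p - 1) * (\<delta> * Y) \<le> b * (1 + s) powr (- \<alpha>)"
    proof -
      have "(M * Y) powr (p - 1) * Y = M powr (p - 1) * (Y powr (p - 1) * Y)"
        using M by (simp add: powr_mult Y_def)
      also have "Y powr (p - 1) * Y = (1 + s) powr (p * (1 - D))"
        using s by (simp add: Y_def powr_powr algebra_simps flip: powr_add)
      finally have "2 * p * (M * Y) powr (p - 1) * (\<delta> * Y) = b * (1 + s) powr (p * (1 - D))"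
        by (simp add: b_def mult_ac)
      also have "\<dots> \<le> b * (1 + s) powr (- \<alpha>)" using s decay b by (intro mult_left_mono powr_mono) auto
      finally show ?thesis .
    qed
    ultimately show ?thesis by (rule Lq_le_weaken) simp
  qed
  have NN: "Lq_le q (\<lambda>x. nonlin u t x - nonlin v t x) (nonlin_const * M powr (p - 1) * \<delta> * (1 + t) powr (1 - d))"
    if sm: "smoothing q d" and dd: "d = 0 \<or> d = D" and t: "0 \<le> t" for q d t
  proof -
    have "Lq_le q (Duhamel g t) (CK * decay_const d * b * (1 + t) powr (1 - d))"
      by (rule Lq_le_Duhamel_decay[OF sm gm t b g1])
    moreover have "CK * decay_const d * b * (1 + t) powr (1 - d) \<le> nonlin_const * M powr (p - 1) * \<delta> * (1 + t) powr (1 - d)"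
    proof -
      have "CK * decay_const d * b \<le> CK * (decay_const 0 + decay_const D) * b"
        using dd CK b decay_const_pos[of 0] decay_const_pos[of D] \<alpha> D by (intro mult_right_mono mult_left_mono) auto
      moreover have "CK * (decay_const 0 + decay_const D) * b = nonlin_const * M powr (p - 1) * \<delta>"
        unfolding nonlin_const_def b_def by (simp only: mult_ac)
      ultimately show ?thesis by (intro mult_right_mono) (simp_all only: powr_ge_zero)
    qed
    ultimately have L: "Lq_le q (Duhamel g t) (nonlin_const * M powr (p - 1) * \<delta> * (1 + t) powr (1 - d))"
      by (rule Lq_le_weaken) (use sm in \<open>simp add: smoothing_def\<close>)
    show ?thesis
    proof (rule Lq_le_AE_cong[OF L])
      show "(\<lambda>x. nonlin u t x - nonlin v t x) \<in> borel_measurable borel"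
        using slice_measurable[OF measurable_nonlin[OF decay_ball_measurable[OF u]]] slice_measurable[OF measurable_nonlin[OF decay_ball_measurable[OF v]]]
        by measurable
      show "AE x in lborel. nonlin u t x - nonlin v t x = Duhamel g t x"
        using AE_Duhamel_diff[OF um vm t, of "(M * (1 + t)) powr p"] decay_ball_abs_powr[OF u] decay_ball_abs_powr[OF v]
        unfolding nonlin_def g_def by (auto elim!: eventually_mono)
    qed (use sm in \<open>simp add: smoothing_def\<close>)
  qed
  show ?thesis
    unfolding decay_ball_def
  proof (intro conjI allI impI)
    show "jointly_measurable (\<lambda>t x. nonlin u t x - nonlin v t x)"
      using measurable_nonlin[OF decay_ball_measurable[OF u]] measurable_nonlin[OF decay_ball_measurable[OF v]] unfolding case_prod_beta by measurable
    show "0 \<le> nonlin_const * M powr (p - 1) * \<delta>" using nonlin_const M by simp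
    fix t :: real assume t: "0 \<le> t"
    show "Lq_le 1 (\<lambda>x. nonlin u t x - nonlin v t x) (nonlin_const * M powr (p - 1) * \<delta> * (1 + t))"
      using NN[OF smoothing_1 _ t] t by simp
    show "Lq_le p (\<lambda>x. nonlin u t x - nonlin v t x) (nonlin_const * M powr (p - 1) * \<delta> * (1 + t) powr (1 - D))"
      using NN[OF smoothing_p _ t] by simp
  qed
qed

lemma Duhamel_0: "Duhamel (\<lambda>s y. 0) t x = 0"
  by (simp add: Duhamel_def convol_def set_lebesgue_integral_def)

lemma decay_ball_nonlin:
  assumes u: "decay_ball u M"
  shows "decay_ball (nonlin u) (nonlin_const * M powr (p - 1) * M)"
proof -
  have 0: "decay_ball (\<lambda>t x. 0) M" using u by (auto simp: decay_ball_def Lq_le_zero)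
  have "decay_ball (\<lambda>t x. nonlin u t x - nonlin (\<lambda>t x. 0) t x) (nonlin_const * M powr (p - 1) * M)"
    by (rule decay_ball_nonlin_diff[OF u 0]) (use u in simp)
  moreover have "nonlin (\<lambda>t x. 0) t x = 0" for t x using p by (simp add: nonlin_def Duhamel_0)
  ultimately show ?thesis by simp
qed

lemma decay_ball_Lq_space: "decay_ball u M \<Longrightarrow> 0 \<le> t \<Longrightarrow> u t \<in> Lq_space 1" "decay_ball u M \<Longrightarrow> 0 \<le> t \<Longrightarrow> u t \<in> Lq_space p"
  unfolding decay_ball_def using p Lq_le_imp_Lq(1) by (meson zero_less_one order.strict_trans)+

lemma Lq_cont_nonlin:
  assumes u: "decay_ball u M" "Lq_cont p u" and sm: "smoothing q d"
  shows "Lq_cont q (nonlin u)"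
  unfolding nonlin_def
proof (rule Lq_cont_Duhamel[OF sm measurable_abs_powr[OF decay_ball_measurable[OF u(1)]]])
  show "Lq_cont 1 (\<lambda>s y. \<bar>u s y\<bar> powr p)" by (rule Lq_cont_abs_powr[OF u(2) decay_ball_Lq_space(2)[OF u(1)] p])
  show "(\<lambda>y. \<bar>u s y\<bar> powr p) \<in> Lq_space 1" if "0 \<le> s" for s
    by (rule Lq_le_imp_Lq(1)[OF decay_ball_abs_powr[OF u(1) that order_refl]]) simp
qed

text \<open>The factor \<open>1 + t\<close> is bounded near each time, so the limit is locally uniform.\<close>

lemma Lq_cont_uniform_limit:
  assumes U: "\<And>k. Lq_cont q (U k)" and q: "1 \<le> q"
    and lim: "\<And>t k. 0 \<le> t \<Longrightarrow> Lq_le q (\<lambda>x. u t x - U k t x) (c * (1/2) ^ k * (1 + t))" and c: "0 \<le> c"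
  shows "Lq_cont q u"
  unfolding Lq_cont_def
proof (intro allI impI)
  fix t e :: real assume t: "0 \<le> t" and e: "0 < e"
  have "(\<lambda>k. c * (1/2) ^ k * (2 + t)) \<longlonglongrightarrow> c * 0 * (2 + t)"
    by (intro tendsto_intros LIMSEQ_power_zero) auto
  then have "\<forall>\<^sub>F k in sequentially. c * (1/2) ^ k * (2 + t) < e / 3" using e by (intro order_tendstoD(2)) auto
  then obtain k where k: "c * (1/2) ^ k * (2 + t) < e / 3" by (auto simp: eventually_sequentially)
  have near: "Lq_le q (\<lambda>x. u s x - U k s x) (e / 3)" if "0 \<le> s" "s \<le> t + 1" for s
  proof (rule Lq_le_weaken[OF lim[OF that(1), of k]])
    have "c * (1/2) ^ k * (1 + s) \<le> c * (1/2) ^ k * (2 + t)" using that c by (intro mult_left_mono) auto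
    then show "c * (1/2) ^ k * (1 + s) \<le> e / 3" using k by simp
  qed (use q in simp)
  obtain \<delta> where \<delta>: "\<delta> > 0" "\<And>s. 0 \<le> s \<Longrightarrow> \<bar>s - t\<bar> < \<delta> \<Longrightarrow> Lq_le q (\<lambda>x. U k s x - U k t x) (e / 3)"
    using U[of k] t e unfolding Lq_cont_def by (metis divide_pos_pos zero_less_numeral)
  show "\<exists>\<delta>>0. \<forall>s\<ge>0. \<bar>s - t\<bar> < \<delta> \<longrightarrow> Lq_le q (\<lambda>x. u s x - u t x) e"
  proof (intro exI[of _ "min 1 \<delta>"] conjI allI impI)
    fix s assume s: "0 \<le> s" "\<bar>s - t\<bar> < min 1 \<delta>"
    have "Lq_le q (\<lambda>x. ((u s x - U k s x) + (U k s x - U k t x)) - (u t x - U k t x)) ((e/3 + e/3) + e/3)"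
      using s t by (intro Lq_le_diff Lq_le_add near \<delta>(2) q) auto
    then show "Lq_le q (\<lambda>x. u s x - u t x) e" by simp
  qed (use \<delta> in simp)
qed

lemma AE_eq_0_if_L1_geometric:
  assumes "\<And>k::nat. Lq_le 1 f (c * (1/2) ^ k)"
  shows "AE x in lborel. f x = (0::real)"
proof (rule Lq_le_0_imp_AE[of 1])
  show "Lq_le 1 f 0"
  proof (rule Lq_le_closed)
    fix e :: real assume e: "0 < e"
    have "(\<lambda>k. c * (1/2) ^ k) \<longlonglongrightarrow> c * 0" by (intro tendsto_intros LIMSEQ_power_zero) auto
    then have "\<forall>\<^sub>F k in sequentially. c * (1/2) ^ k < e" using e by (intro order_tendstoD(2)) auto
    then obtain k where "c * (1/2) ^ k < e" by (auto simp: eventually_sequentially)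
    then show "Lq_le 1 f e" by (intro Lq_le_weaken[OF assms[of k]]) simp_all
  qed auto
qed simp

text \<open>Picard iteration. Under the smallness condition the map \<open>u \<mapsto> L + nonlin u\<close> sends the ball of radius \<open>2 a\<close> to itself
and halves distances there. The limit is formed pointwise, at almost every point of each time slice, since this
keeps it jointly measurable.\<close>

theorem small_data_solution:
  assumes L: "decay_ball L a" and Lc: "Lq_cont 1 L" "Lq_cont p L" and small: "nonlin_const * (2 * a) powr (p - 1) \<le> 1 / 2"
  obtains u where "decay_ball u (2 * a)" "Lq_cont 1 u" "Lq_cont p u"
    "\<And>t. 0 \<le> t \<Longrightarrow> AE x in lborel. u t x = L t x + nonlin u t x"
proof -
  have a: "0 \<le> a" using L by (simp add: decay_ball_def)
  have contr: "decay_ball (\<lambda>t x. nonlin v t x - nonlin w t x) (\<delta> / 2)" if "decay_ball v (2 * a)" "decay_ball w (2 * a)" "decay_ball (\<lambda>t x. v t x - w t x) \<delta>" for v w \<delta>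
  proof -
    have \<delta>: "0 \<le> \<delta>" using that by (simp add: decay_ball_def)
    have "nonlin_const * (2 * a) powr (p - 1) * \<delta> \<le> 1 / 2 * \<delta>" using small \<delta> by (intro mult_right_mono)
    then show ?thesis by (intro decay_ball_mono[OF decay_ball_nonlin_diff[OF that]]) simp
  qed
  have Nbound: "decay_ball (nonlin v) a" if "decay_ball v (2 * a)" for v
  proof -
    have "nonlin_const * (2 * a) powr (p - 1) * (2 * a) \<le> 1 / 2 * (2 * a)" using small a by (intro mult_right_mono) auto
    then show ?thesis by (intro decay_ball_mono[OF decay_ball_nonlin[OF that]]) simp
  qed
  define U where "U = rec_nat L (\<lambda>k v t x. L t x + nonlin v t x)"
  have U0: "U 0 = L" and USuc: "U (Suc k) = (\<lambda>t x. L t x + nonlin (U k) t x)" for k by (simp_all add: U_def)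
  have UX: "decay_ball (U k) (2 * a)" for k
  proof (induction k)
    case 0
    show ?case unfolding U0 by (rule decay_ball_mono[OF L]) (use a in simp)
  next
    case (Suc k)
    show ?case unfolding USuc using decay_ball_add[OF L Nbound[OF Suc]] by simp
  qed
  have Ud: "decay_ball (\<lambda>t x. U (Suc k) t x - U k t x) (a * (1/2) ^ k)" for k
  proof (induction k)
    case 0
    show ?case unfolding USuc U0 using Nbound[OF UX[of 0]] by (simp add: U0)
  next
    case (Suc k)
    have "decay_ball (\<lambda>t x. nonlin (U (Suc k)) t x - nonlin (U k) t x) ((a * (1/2) ^ k) / 2)"
      by (rule contr[OF UX UX Suc])
    moreover have "U (Suc (Suc k)) t x - U (Suc k) t x = nonlin (U (Suc k)) t x - nonlin (U k) t x" for t x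
      unfolding USuc[of "Suc k"] by (subst (2) USuc) simp
    ultimately show ?case by simp
  qed
  have Um: "decay_ball (\<lambda>t x. U (k + m) t x - U k t x) (2 * a * (1/2) ^ k - 2 * a * (1/2) ^ (k + m))" for k m
  proof (induction m)
    case 0
    show ?case by (auto simp: decay_ball_def Lq_le_zero)
  next
    case (Suc m)
    from decay_ball_add[OF this Ud[of "k + m"]] show ?case by (simp add: algebra_simps)
  qed
  define u where "u = (\<lambda>t x. lim (\<lambda>k. U k t x))"
  have um: "jointly_measurable u"
    unfolding u_def case_prod_beta
    by (rule borel_measurable_lim_metric) (use decay_ball_measurable[OF UX] in \<open>simp add: case_prod_beta\<close>)
  have conv: "AE x in lborel. (\<lambda>k. U k t x) \<longlonglongrightarrow> u t x" if t: "0 \<le> t" for t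
  proof -
    have "Lq_le 1 (\<lambda>x. U (Suc k) t x - U k t x) ((a * (1 + t)) * (1/2) ^ k)" for k
      using Ud[of k] t by (auto simp: decay_ball_def mult_ac)
    from AE_summable_if_L1_geometric[of "\<lambda>k x. U (Suc k) t x - U k t x", OF this] show ?thesis
    proof eventually_elim
      case (elim x)
      have "(\<lambda>k. \<Sum>j<k. U (Suc j) t x - U j t x) \<longlonglongrightarrow> (\<Sum>j. U (Suc j) t x - U j t x)"
        using elim by (rule summable_LIMSEQ)
      then have "(\<lambda>k. (U k t x - U 0 t x) + U 0 t x) \<longlonglongrightarrow> (\<Sum>j. U (Suc j) t x - U j t x) + U 0 t x"
        unfolding sum_lessThan_telescope[of "\<lambda>j. U j t x"] by (rule tendsto_add[OF _ tendsto_const])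
      then have "convergent (\<lambda>k. U k t x)" by (auto simp: convergent_def)
      then show ?case unfolding u_def by (simp add: convergent_LIMSEQ_iff)
    qed
  qed
  have uU: "decay_ball (\<lambda>t x. u t x - U k t x) (2 * a * (1/2) ^ k)" for k
    unfolding decay_ball_def
  proof (intro conjI allI impI)
    show "jointly_measurable (\<lambda>t x. u t x - U k t x)"
      using um decay_ball_measurable[OF UX[of k]] unfolding case_prod_beta by measurable
    then have dm: "(\<lambda>x. u t x - U k t x) \<in> borel_measurable borel" for t by (rule slice_measurable)
    show "0 \<le> 2 * a * (1/2) ^ k" using a by simp
    fix t :: real assume t: "0 \<le> t"
    have lim: "AE x in lborel. (\<lambda>m. U (k + m) t x - U k t x) \<longlonglongrightarrow> u t x - U k t x"
      using conv[OF t]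
    proof eventually_elim
      case (elim x)
      have "(\<lambda>m. U (m + k) t x) \<longlonglongrightarrow> u t x" using elim by (rule LIMSEQ_ignore_initial_segment)
      then show ?case by (intro tendsto_intros) (simp add: add.commute)
    qed
    have b: "decay_ball (\<lambda>t x. U (k + m) t x - U k t x) (2 * a * (1/2) ^ k)" for m
      by (rule decay_ball_mono[OF Um]) (use a in simp)
    show "Lq_le 1 (\<lambda>x. u t x - U k t x) (2 * a * (1/2) ^ k * (1 + t))"
      using b t by (intro Lq_le_LIMSEQ[OF _ lim dm]) (auto simp: decay_ball_def)
    show "Lq_le p (\<lambda>x. u t x - U k t x) (2 * a * (1/2) ^ k * (1 + t) powr (1 - D))"
      using b t p by (intro Lq_le_LIMSEQ[OF _ lim dm]) (auto simp: decay_ball_def)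
  qed
  have uX: "decay_ball u (2 * a)"
    unfolding decay_ball_def
  proof (intro conjI allI impI um)
    fix t :: real assume t: "0 \<le> t"
    show "Lq_le 1 (u t) (2 * a * (1 + t))"
      using UX t by (intro Lq_le_LIMSEQ[OF _ conv[OF t] slice_measurable[OF um]]) (auto simp: decay_ball_def)
    show "Lq_le p (u t) (2 * a * (1 + t) powr (1 - D))"
      using UX t p by (intro Lq_le_LIMSEQ[OF _ conv[OF t] slice_measurable[OF um]]) (auto simp: decay_ball_def)
  qed (use a in simp)
  have Uc: "Lq_cont p (U k) \<and> Lq_cont 1 (U k)" for k
  proof (induction k)
    case 0
    then show ?case using Lc by (simp add: U0)
  next
    case (Suc k)
    then show ?case unfolding USuc using p
      by (intro conjI Lq_cont_add Lc Lq_cont_nonlin[OF UX _ smoothing_1] Lq_cont_nonlin[OF UX _ smoothing_p]) auto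
  qed
  have c1: "Lq_cont 1 u"
  proof (rule Lq_cont_uniform_limit)
    show "Lq_le 1 (\<lambda>x. u t x - U k t x) (2 * a * (1/2) ^ k * (1 + t))" if "0 \<le> t" for t k
      using uU[of k] that by (auto simp: decay_ball_def)
  qed (use Uc a in auto)
  have cp: "Lq_cont p u"
  proof (rule Lq_cont_uniform_limit)
    fix t :: real and k assume t: "0 \<le> t"
    have "Lq_le p (\<lambda>x. u t x - U k t x) (2 * a * (1/2) ^ k * (1 + t) powr (1 - D))" using uU[of k] t by (auto simp: decay_ball_def)
    moreover have "2 * a * (1/2) ^ k * (1 + t) powr (1 - D) \<le> 2 * a * (1/2) ^ k * (1 + t)"
      using powr_mono[of "1 - D" 1 "1 + t"] t D a by (intro mult_left_mono) auto
    ultimately show "Lq_le p (\<lambda>x. u t x - U k t x) (2 * a * (1/2) ^ k * (1 + t))"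
      by (rule Lq_le_weaken) (use p in simp)
  qed (use Uc a p in auto)
  have fixed: "AE x in lborel. u t x = L t x + nonlin u t x" if t: "0 \<le> t" for t
  proof -
    have "Lq_le 1 (\<lambda>x. u t x - (L t x + nonlin u t x)) (2 * a * (1 + t) * (1/2) ^ k)" for k
    proof -
      have "decay_ball (\<lambda>t x. nonlin u t x - nonlin (U k) t x) ((2 * a * (1/2) ^ k) / 2)" by (rule contr[OF uX UX uU])
      then have 1: "Lq_le 1 (\<lambda>x. nonlin u t x - nonlin (U k) t x) ((2 * a * (1/2) ^ k) / 2 * (1 + t))" using t by (auto simp: decay_ball_def)
      have 2: "Lq_le 1 (\<lambda>x. u t x - U (Suc k) t x) (2 * a * (1/2) ^ Suc k * (1 + t))"
        using uU[of "Suc k"] t by (auto simp: decay_ball_def)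
      from Lq_le_diff[OF 2 1] show ?thesis by (simp add: USuc algebra_simps)
    qed
    from AE_eq_0_if_L1_geometric[OF this] show ?thesis by eventually_elim simp
  qed
  show thesis by (rule that[OF uX c1 cp fixed])
qed

text \<open>On \<open>[0, T]\<close> both solutions are bounded in \<open>L\<^sup>p\<close>, so the nonlinearity is Lipschitz from \<open>L\<^sup>p\<close> to \<open>L\<^sup>1\<close>. With the weight
\<open>exp (l t)\<close> the Duhamel integral of the difference is controlled by a Gamma integral, which is a multiple of
\<open>l\<close> to the power \<open>D - 1 - \<alpha>\<close>; for large \<open>l\<close> each application of the equation halves the bound on the difference.\<close>

theorem solution_unique:
  assumes um: "jointly_measurable u" and vm: "jointly_measurable v"
    and uc: "Lq_cont p u" and vc: "Lq_cont p v"
    and us: "\<And>t. 0 \<le> t \<Longrightarrow> u t \<in> Lq_space p" and vs: "\<And>t. 0 \<le> t \<Longrightarrow> v t \<in> Lq_space p"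
    and ueq: "\<And>t. 0 \<le> t \<Longrightarrow> AE x in lborel. u t x = L t x + nonlin u t x"
    and veq: "\<And>t. 0 \<le> t \<Longrightarrow> AE x in lborel. v t x = L t x + nonlin v t x"
    and T: "0 \<le> T"
  shows "AE x in lborel. u T x = v T x"
proof -
  have p1: "1 \<le> p" using p by simp
  obtain M1 where M1: "M1 > 0" "\<And>s. s \<in> {0..T} \<Longrightarrow> Lq_le p (u s) M1"
    using Lq_cont_bounded[OF uc us p1, of T] by auto
  obtain M2 where M2: "M2 > 0" "\<And>s. s \<in> {0..T} \<Longrightarrow> Lq_le p (v s) M2"
    using Lq_cont_bounded[OF vc vs p1, of T] by auto
  define M where "M = max M1 M2"
  have M: "0 < M" "\<And>s. s \<in> {0..T} \<Longrightarrow> Lq_le p (u s) M" "\<And>s. s \<in> {0..T} \<Longrightarrow> Lq_le p (v s) M"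
    using M1 by (simp_all add: M_def less_max_iff_disj Lq_le_weaken[OF M1(2)] Lq_le_weaken[OF M2(2)] p_nonneg)
  note up = measurable_abs_powr[OF um] and vp = measurable_abs_powr[OF vm]
  define g where "g = (\<lambda>s y. \<bar>u s y\<bar> powr p - \<bar>v s y\<bar> powr p)"
  have gm: "jointly_measurable g"
    using up vp unfolding g_def case_prod_beta by measurable
  define a where "a = 1 + \<alpha> - D"
  have a: "0 < a" "\<alpha> - D = a - 1" using D by (auto simp: a_def)
  have Ga: "0 < Gamma a" using a by simp
  (* Q exceeds twice the constant in front of the power -a of l in the estimate of the Duhamel
     integral; l is chosen such that this power equals 1/Q. *)
  define Q where "Q = 4 * p * M powr (p - 1) * CK * Gamma a + 1"
  have Q: "1 \<le> Q" using p M CK Ga by (simp add: Q_def)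
  define l where "l = Q powr (1 / a)"
  have l: "0 < l" using Q by (simp add: l_def)
  have lQ: "l powr (- a) = 1 / Q" using Q a by (simp add: l_def powr_powr powr_minus divide_inverse)
  have half: "2 * p * M powr (p - 1) * (Gamma a * l powr (- a)) * CK \<le> 1 / 2"
  proof -
    have "4 * p * M powr (p - 1) * CK * Gamma a \<le> Q" by (simp add: Q_def)
    then show ?thesis unfolding lQ using Q by (simp add: divide_le_eq mult_ac)
  qed
  have step: "Lq_le p (\<lambda>x. u t x - v t x) (B / 2 * exp (l * t))"
    if B: "0 \<le> B" and IH: "\<And>s. s \<in> {0..T} \<Longrightarrow> Lq_le p (\<lambda>x. u s x - v s x) (B * exp (l * s))" and t: "t \<in> {0..T}" for B t
  proof -
    have t0: "0 \<le> t" using t by simp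
    define c where "c = 2 * p * M powr (p - 1) * B"
    have c: "0 \<le> c" using p B by (simp add: c_def)
    have g1: "Lq_le 1 (g (t - \<tau>)) (c * exp (l * t) * exp (- (l * \<tau>)))" if "0 < \<tau>" "\<tau> < t" for \<tau>
    proof -
      have "Lq_le 1 (g (t - \<tau>)) (2 * p * M powr (p - 1) * (B * exp (l * (t - \<tau>))))"
        unfolding g_def using that t by (intro Lq_le_powr_diff M IH p) auto
      moreover have "exp (l * (t - \<tau>)) = exp (l * t) * exp (- (l * \<tau>))" by (simp add: right_diff_distrib exp_diff exp_minus divide_inverse)
      ultimately show ?thesis by (simp add: c_def mult_ac)
    qed
    let ?f = "\<lambda>\<tau>. indicator {0<..<t} \<tau> * (\<tau> powr (\<alpha> - D) * (c * exp (l * t) * exp (- (l * \<tau>))))"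
    let ?F = "\<lambda>\<tau>. (c * exp (l * t)) * (indicator {0<..} \<tau> *\<^sub>R (\<tau> powr (a - 1) * exp (- (l * \<tau>))))"
    have F: "integrable lborel ?F" "(\<integral>\<tau>. ?F \<tau> \<partial>lborel) = (c * exp (l * t)) * (Gamma a * l powr (- a))"
      using set_integrable_Gamma_real[OF a(1) l] Gamma_integral_scaled_real[OF a(1) l]
      unfolding set_integrable_def set_lebesgue_integral_def by simp_all
    have fF: "?f \<tau> \<le> ?F \<tau>" "0 \<le> ?f \<tau>" for \<tau> using c unfolding a(2) by (auto simp: indicator_def)
    have fi: "integrable lborel ?f"
      using F(1)
    proof (rule Bochner_Integration.integrable_bound)
      show "AE \<tau> in lborel. norm (?f \<tau>) \<le> norm (?F \<tau>)"
        unfolding real_norm_def abs_of_nonneg[OF fF(2)] by (intro AE_I2 order_trans[OF fF(1) abs_ge_self])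
    qed measurable
    have "Lq_le p (Duhamel g t) ((c * exp (l * t)) * (Gamma a * l powr (- a)) * CK)"
    proof (rule Lq_le_Duhamel[OF smoothing_p gm t0 g1 fi])
      show "(\<integral>\<tau>. ?f \<tau> \<partial>lborel) \<le> (c * exp (l * t)) * (Gamma a * l powr (- a))"
        unfolding F(2)[symmetric] using fi F(1) fF(1) by (rule integral_mono)
    qed
    moreover have "(c * exp (l * t)) * (Gamma a * l powr (- a)) * CK \<le> B / 2 * exp (l * t)"
    proof -
      have "(c * exp (l * t)) * (Gamma a * l powr (- a)) * CK = (2 * p * M powr (p - 1) * (Gamma a * l powr (- a)) * CK) * (B * exp (l * t))"
        by (simp add: c_def mult_ac)
      also have "\<dots> \<le> 1 / 2 * (B * exp (l * t))" using half B by (intro mult_right_mono) auto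
      finally show ?thesis by simp
    qed
    ultimately have L: "Lq_le p (Duhamel g t) (B / 2 * exp (l * t))" by (rule Lq_le_weaken) (use p in simp)
    show ?thesis
    proof (rule Lq_le_AE_cong[OF L])
      show "(\<lambda>x. u t x - v t x) \<in> borel_measurable borel" using slice_measurable[OF um] slice_measurable[OF vm] by measurable
      have pu: "Lq_le 1 (\<lambda>x. \<bar>u s x\<bar> powr p) (M powr p)" "Lq_le 1 (\<lambda>x. \<bar>v s x\<bar> powr p) (M powr p)" if "0 \<le> s" "s \<le> t" for s
        using that t by (auto intro!: Lq_le_powr M)
      have "AE x in lborel. Duhamel (\<lambda>s y. \<bar>u s y\<bar> powr p - \<bar>v s y\<bar> powr p) t x = Duhamel (\<lambda>s y. \<bar>u s y\<bar> powr p) t x - Duhamel (\<lambda>s y. \<bar>v s y\<bar> powr p) t x"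
        by (rule AE_Duhamel_diff[OF up vp t0]) (auto intro: pu)
      then show "AE x in lborel. u t x - v t x = Duhamel g t x"
        using ueq[OF t0] veq[OF t0] unfolding g_def nonlin_def by eventually_elim simp
    qed (use p in simp)
  qed
  have iter: "Lq_le p (\<lambda>x. u t x - v t x) (2 * M * (1/2) ^ k * exp (l * t))" if "t \<in> {0..T}" for t k
    using that
  proof (induction k arbitrary: t)
    case 0
    have "Lq_le p (\<lambda>x. u t x - v t x) (M + M)" using 0 p by (intro Lq_le_diff M) auto
    moreover have "M + M \<le> 2 * M * (1/2) ^ 0 * exp (l * t)" using M l 0 by simp
    ultimately show ?case by (rule Lq_le_weaken) (use p in simp)
  next
    case (Suc k)
    have "Lq_le p (\<lambda>x. u t x - v t x) ((2 * M * (1/2) ^ k) / 2 * exp (l * t))"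
      by (rule step) (use M Suc in auto)
    then show ?case by simp
  qed
  have "Lq_le p (\<lambda>x. u T x - v T x) 0"
  proof (rule Lq_le_closed)
    fix e :: real assume e: "0 < e"
    have "(\<lambda>k. 2 * M * (1/2) ^ k * exp (l * T)) \<longlonglongrightarrow> 2 * M * 0 * exp (l * T)" by (intro tendsto_intros LIMSEQ_power_zero) auto
    then have "\<forall>\<^sub>F k in sequentially. 2 * M * (1/2) ^ k * exp (l * T) < e" using e by (intro order_tendstoD(2)) auto
    then obtain k where "2 * M * (1/2) ^ k * exp (l * T) < e" by (auto simp: eventually_sequentially)
    then show "Lq_le p (\<lambda>x. u T x - v T x) e" by (intro Lq_le_weaken[OF iter[of T k]]) (use T p in simp_all)
  qed (use p in auto)
  from Lq_le_0_imp_AE[OF this] show ?thesis using p by (auto elim: eventually_mono)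
qed

end

section \<open>The linear evolution\<close>

lemma convol_eq_dilconv:
  fixes k g f :: "'a::euclidean_space \<Rightarrow> real"
  assumes T: "0 < T" and g: "\<And>y. g y = T powr (- (DIM('a) / 2)) * k (T powr (- (1 / 2)) *\<^sub>R y)"
  shows "convol g f x = dilconv k (T powr (1 / 2)) f x"
proof -
  define c where "c = T powr (1 / 2)"
  have c: "0 < c" using T by (simp add: c_def)
  have ci: "T powr (- (1 / 2)) = inverse c" by (simp add: c_def powr_minus)
  have cn: "T powr (- (DIM('a) / 2)) = inverse (c ^ DIM('a))"
    using T by (simp add: c_def powr_minus powr_powr flip: powr_realpow)
  have "convol g f x = \<bar>c\<bar> ^ DIM('a) *\<^sub>R (\<integral>y. f (x - (0 + c *\<^sub>R y)) * g (0 + c *\<^sub>R y) \<partial>lborel)"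
    unfolding convol_commute[of g f x] unfolding convol_def by (rule integral_lborel_affine) (use c in simp)
  also have "\<dots> = (\<integral>y. c ^ DIM('a) * (f (x - c *\<^sub>R y) * (inverse (c ^ DIM('a)) * k y)) \<partial>lborel)"
    using c unfolding g ci cn by simp
  also have "\<dots> = dilconv k c f x"
    unfolding dilconv_def using c by (intro Bochner_Integration.integral_cong) (simp_all add: field_simps)
  finally show ?thesis unfolding c_def .
qed

lemma Lq_cont_dilconv:
  fixes g f :: "'a::euclidean_space \<Rightarrow> real"
  assumes g: "Lq_le 1 g A" and f: "Lq_le q f B" and q: "1 \<le> q" and a: "continuous_on {0..} a"
  shows "Lq_cont q (\<lambda>t. dilconv g (a t) f)"
  unfolding Lq_cont_def
proof (intro allI impI)
  fix t e :: real assume t: "0 \<le> t" and e: "0 < e"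
  obtain \<delta> where \<delta>: "\<delta> > 0" "\<And>b. \<bar>b - a t\<bar> < \<delta> \<Longrightarrow> Lq_le q (\<lambda>x. dilconv g b f x - dilconv g (a t) f x) e"
    using dilconv_continuous[OF g f q e] by blast
  obtain d where d: "d > 0" "\<And>s. 0 \<le> s \<Longrightarrow> \<bar>s - t\<bar> < d \<Longrightarrow> \<bar>a s - a t\<bar> < \<delta>"
    using a t \<delta>(1) unfolding continuous_on_iff dist_real_def by (metis atLeast_iff)
  show "\<exists>\<delta>>0. \<forall>s\<ge>0. \<bar>s - t\<bar> < \<delta> \<longrightarrow> Lq_le q (\<lambda>x. dilconv g (a s) f x - dilconv g (a t) f x) e"
    using d \<delta>(2) by blast
qed

lemma Lq_cont_times:
  assumes v: "Lq_cont q v" and b: "\<And>t. 0 \<le> t \<Longrightarrow> Lq_le q (v t) M" and q: "1 \<le> q"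
  shows "Lq_cont q (\<lambda>t x. t * v t x)"
  unfolding Lq_cont_def
proof (intro allI impI)
  fix t e :: real assume t: "0 \<le> t" and e: "0 < e"
  have M: "0 \<le> M" using Lq_le_nonneg[OF b[OF t]] .
  define d where "d = e / (2 * (t + 1))"
  have d: "0 < d" "(t + 1) * d = e / 2" using e t by (auto simp: d_def divide_simps)
  define r where "r = e / (2 * (M + 1))"
  have r: "0 < r" "(M + 1) * r = e / 2" using e M by (auto simp: r_def divide_simps)
  obtain \<delta> where \<delta>: "\<delta> > 0" "\<And>s. 0 \<le> s \<Longrightarrow> \<bar>s - t\<bar> < \<delta> \<Longrightarrow> Lq_le q (\<lambda>x. v s x - v t x) d"
    using v t d(1) unfolding Lq_cont_def by blast
  show "\<exists>\<delta>>0. \<forall>s\<ge>0. \<bar>s - t\<bar> < \<delta> \<longrightarrow> Lq_le q (\<lambda>x. s * v s x - t * v t x) e"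
  proof (intro exI[of _ "min (min 1 r) \<delta>"] conjI allI impI)
    fix s assume s: "0 \<le> s" "\<bar>s - t\<bar> < min (min 1 r) \<delta>"
    have "Lq_le q (\<lambda>x. s * (v s x - v t x) + (s - t) * v t x) (\<bar>s\<bar> * d + \<bar>s - t\<bar> * M)"
      using s t by (intro Lq_le_add Lq_le_cmult \<delta>(2) b q) auto
    moreover have "\<bar>s\<bar> * d \<le> (t + 1) * d" "\<bar>s - t\<bar> * M \<le> r * (M + 1)"
      using s t d r M by (auto intro!: mult_right_mono mult_mono)
    then have "\<bar>s\<bar> * d + \<bar>s - t\<bar> * M \<le> e" using d(2) r(2) by (simp add: mult.commute)
    ultimately have "Lq_le q (\<lambda>x. s * (v s x - v t x) + (s - t) * v t x) e"
      by (rule Lq_le_weaken) (use q in simp)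
    moreover have "s * (v s x - v t x) + (s - t) * v t x = s * v s x - t * v t x" for x
      by (simp add: algebra_simps)
    ultimately show "Lq_le q (\<lambda>x. s * v s x - t * v t x) e" by simp
  qed (use \<delta> r in simp)
qed

lemma measurable_dilconv:
  fixes g f :: "'a::euclidean_space \<Rightarrow> real"
  assumes [measurable]: "g \<in> borel_measurable borel" "f \<in> borel_measurable borel" "a \<in> borel_measurable borel"
  shows "jointly_measurable (\<lambda>t x. dilconv g (a t) f x)"
  unfolding dilconv_def case_prod_beta by (rule lborel.borel_measurable_lebesgue_integral) measurable

text \<open>Convergence of the sum of the two norms is convergence in both. Membership of the differences in \<open>L\<^sup>q\<close> has to be supplied, since the
norm of a function outside of \<open>L\<^sup>q\<close> is zero by convention.\<close>

lemma C_L1p_iff: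
  assumes p: "1 < p"
  shows "u \<in> C_L1p p \<longleftrightarrow> (\<forall>t\<ge>0. u t \<in> Lq_space 1 \<and> u t \<in> Lq_space p) \<and> Lq_cont 1 u \<and> Lq_cont p u"
    (is "?l \<longleftrightarrow> ?r")
proof
  have nn: "0 \<le> Lq_norm q g" for q and g :: "'a \<Rightarrow> real" by (simp add: Lq_norm_def)
  {
    assume l: ?l
    then have sp: "u t \<in> Lq_space q" if "0 \<le> t" "q = 1 \<or> q = p" for t q using that by (auto simp: C_L1p_def L1p_space_def)
    have "Lq_cont q u" if q: "q = 1 \<or> q = p" for q
      unfolding Lq_cont_def
    proof (intro allI impI)
      fix t e :: real assume t: "0 \<le> t" and e: "0 < e"
      have q0: "0 < q" "1 \<le> q" using q p by auto
      have "((\<lambda>s. L1p_norm p (\<lambda>x. u s x - u t x)) \<longlongrightarrow> 0) (at t within {0..})"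
        using l t by (auto simp: C_L1p_def)
      then obtain \<delta> where \<delta>: "\<delta> > 0"
        "\<And>s. 0 \<le> s \<Longrightarrow> s \<noteq> t \<Longrightarrow> \<bar>s - t\<bar> < \<delta> \<Longrightarrow> \<bar>L1p_norm p (\<lambda>x. u s x - u t x)\<bar> < e"
        using e unfolding Lim_within by (force simp: dist_real_def)
      show "\<exists>\<delta>>0. \<forall>s\<ge>0. \<bar>s - t\<bar> < \<delta> \<longrightarrow> Lq_le q (\<lambda>x. u s x - u t x) e"
      proof (intro exI[of _ \<delta>] conjI allI impI \<delta>(1))
        fix s assume s: "0 \<le> s" "\<bar>s - t\<bar> < \<delta>"
        show "Lq_le q (\<lambda>x. u s x - u t x) e"
        proof (cases "s = t")
          case True
          then show ?thesis using Lq_le_zero[of e q] e by simp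
        next
          case False
          have "Lq_le q (\<lambda>x. u s x - u t x) (Lq_norm q (u s) + Lq_norm q (u t))"
            by (intro Lq_le_diff Lq_le_Lq_norm sp s t q q0)
          then have "(\<lambda>x. u s x - u t x) \<in> Lq_space q" by (rule Lq_le_imp_Lq(1)) (rule q0)
          then have "Lq_le q (\<lambda>x. u s x - u t x) (Lq_norm q (\<lambda>x. u s x - u t x))" by (rule Lq_le_Lq_norm) (rule q0)
          moreover have "Lq_norm q (\<lambda>x. u s x - u t x) \<le> e"
            using \<delta>(2)[OF s(1) False s(2)] nn[of 1 "\<lambda>x. u s x - u t x"] nn[of p "\<lambda>x. u s x - u t x"] q by (auto simp: L1p_norm_def)
          ultimately show ?thesis by (rule Lq_le_weaken) (use q0 in simp)
        qed
      qed
    qed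
    then show ?r using sp by auto
  }
  assume r: ?r
  then have r1: "Lq_cont 1 u" and rp: "Lq_cont p u" by auto
  have "((\<lambda>s. L1p_norm p (\<lambda>x. u s x - u t x)) \<longlongrightarrow> 0) (at t within {0..})" if t: "0 \<le> t" for t
    unfolding Lim_within
  proof (intro allI impI)
    fix e :: real assume e: "0 < e"
    then have e3: "0 < e / 3" by simp
    obtain \<delta>1 where \<delta>1: "\<delta>1 > 0" "\<And>s. 0 \<le> s \<Longrightarrow> \<bar>s - t\<bar> < \<delta>1 \<Longrightarrow> Lq_le 1 (\<lambda>x. u s x - u t x) (e/3)"
      using r1 t e3 unfolding Lq_cont_def by blast
    obtain \<delta>2 where \<delta>2: "\<delta>2 > 0" "\<And>s. 0 \<le> s \<Longrightarrow> \<bar>s - t\<bar> < \<delta>2 \<Longrightarrow> Lq_le p (\<lambda>x. u s x - u t x) (e/3)"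
      using rp t e3 unfolding Lq_cont_def by blast
    show "\<exists>d>0. \<forall>s\<in>{0..}. 0 < dist s t \<and> dist s t < d \<longrightarrow> dist (L1p_norm p (\<lambda>x. u s x - u t x)) 0 < e"
    proof (intro exI[of _ "min \<delta>1 \<delta>2"] conjI ballI impI)
      fix s assume s: "s \<in> {0..}" "0 < dist s t \<and> dist s t < min \<delta>1 \<delta>2"
      then have s': "0 \<le> s" "\<bar>s - t\<bar> < \<delta>1" "\<bar>s - t\<bar> < \<delta>2" by (auto simp: dist_real_def)
      have "Lq_norm 1 (\<lambda>x. u s x - u t x) \<le> e / 3"
        by (rule Lq_le_imp_Lq(2)[OF \<delta>1(2)[OF s'(1,2)]]) simp
      moreover have "Lq_norm p (\<lambda>x. u s x - u t x) \<le> e / 3"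
        by (rule Lq_le_imp_Lq(2)[OF \<delta>2(2)[OF s'(1,3)]]) (use p in simp)
      ultimately show "dist (L1p_norm p (\<lambda>x. u s x - u t x)) 0 < e"
        using e nn[of 1 "\<lambda>x. u s x - u t x"] nn[of p "\<lambda>x. u s x - u t x"] by (simp add: L1p_norm_def dist_real_def)
    qed (use \<delta>1 \<delta>2 in simp)
  qed
  then show ?l using r by (auto simp: C_L1p_def L1p_space_def)
qed

text \<open>A self-similar family of kernels at the time \<open>T = \<tau>\<^sup>\<gamma>\<close>, with the two bounds that enter the fixed point argument.\<close>

locale scaling_kernel =
  fixes K :: "real \<Rightarrow> 'a::euclidean_space \<Rightarrow> real" and \<gamma> p D A :: real
  assumes \<gamma>: "0 < \<gamma>" and p: "1 < p" and D: "0 \<le> D"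
    and scaling: "\<And>T x. 0 < T \<Longrightarrow> K T x = T powr (- (DIM('a) / 2)) * K 1 (T powr (- (1 / 2)) *\<^sub>R x)"
    and K1: "\<And>\<tau>. 0 < \<tau> \<Longrightarrow> Lq_le 1 (K (\<tau> powr \<gamma>)) A"
    and Kp: "\<And>\<tau>. 0 < \<tau> \<Longrightarrow> Lq_le p (K (\<tau> powr \<gamma>)) (A * \<tau> powr (- D))"
begin

text \<open>For \<open>t > 0\<close> this is the convolution with \<open>K (t\<^sup>\<gamma>)\<close>; the dilated form extends it continuously to \<open>t = 0\<close>.\<close>

definition propagator :: "('a \<Rightarrow> real) \<Rightarrow> real \<Rightarrow> 'a \<Rightarrow> real" where
  "propagator f t = dilconv (K 1) (t powr (\<gamma> / 2)) f"

lemma K_1: "Lq_le 1 (K 1) A" using K1[of 1] by simp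
lemma A: "0 \<le> A" by (rule Lq_le_nonneg[OF K_1])

lemma propagator_eq_convol: "0 < t \<Longrightarrow> propagator f t x = convol (K (t powr \<gamma>)) f x"
  unfolding propagator_def by (subst convol_eq_dilconv[where T = "t powr \<gamma>" and k = "K 1"]) (auto simp: powr_powr scaling[of "t powr \<gamma>"])

lemma propagator_0: "propagator f 0 x = (\<integral>y. K 1 y \<partial>lborel) * f x"
  using \<gamma> by (simp add: propagator_def dilconv_0)

lemma measurable_propagator: "f \<in> borel_measurable borel \<Longrightarrow> jointly_measurable (\<lambda>t x. propagator f t x)"
  unfolding propagator_def by (rule measurable_dilconv[OF Lq_le_measurable[OF K_1]]) simp_all

lemma Lq_le_propagator: "Lq_le q f F \<Longrightarrow> 1 \<le> q \<Longrightarrow> Lq_le q (propagator f t) (A * F)"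
  unfolding propagator_def by (rule Lq_le_dilconv[OF K_1])

lemma Lq_cont_propagator: "Lq_le q f F \<Longrightarrow> 1 \<le> q \<Longrightarrow> Lq_cont q (propagator f)"
  unfolding propagator_def using \<gamma> by (intro Lq_cont_dilconv[OF K_1] continuous_on_powr' continuous_intros) auto

text \<open>For \<open>t \<le> 1\<close> the bound comes from \<open>f\<close> in \<open>L\<^sup>p\<close> and the kernel in \<open>L\<^sup>1\<close>, for \<open>t \<ge> 1\<close> from \<open>f\<close> in
\<open>L\<^sup>1\<close> and the kernel in \<open>L\<^sup>p\<close>. In both cases \<open>1 + t\<close> exceeds \<open>max 1 t\<close> at most by the factor \<open>2\<close>.\<close>

lemma Lq_le_propagator_decay:
  assumes f1: "Lq_le 1 f F" and fp: "Lq_le p f F" and t: "0 \<le> t"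
  shows "Lq_le p (propagator f t) (A * 2 powr D * F * (1 + t) powr (- D))"
proof -
  have F: "0 \<le> F" by (rule Lq_le_nonneg[OF f1])
  have eq: "2 powr D * (1 + t) powr (- D) = ((1 + t) / 2) powr (- D)"
  proof -
    have "((1 + t) / 2) powr (- D) = (1 + t) powr (- D) / 2 powr (- D)" by (rule powr_divide)
    also have "\<dots> = 2 powr D * (1 + t) powr (- D)" unfolding powr_minus[of 2 D] by (simp only: divide_inverse inverse_inverse_eq mult.commute)
    finally show ?thesis ..
  qed
  show ?thesis
  proof (cases "t \<le> 1")
    case True
    have "1 powr (- D) \<le> ((1 + t) / 2) powr (- D)" using True t D by (intro powr_mono2') auto
    then have "A * F * 1 \<le> A * F * (2 powr D * (1 + t) powr (- D))" unfolding eq using A F by (intro mult_left_mono) auto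
    then have le: "A * F \<le> A * 2 powr D * F * (1 + t) powr (- D)" by (simp add: mult_ac)
    show ?thesis by (rule Lq_le_weaken[OF Lq_le_propagator[OF fp] le]) (use p in simp_all)
  next
    case False
    then have t1: "0 < t" by simp
    have "convol (K (t powr \<gamma>)) f = propagator f t" using propagator_eq_convol[OF t1] by (simp add: fun_eq_iff)
    moreover have "Lq_le p (convol (K (t powr \<gamma>)) f) (F * (A * t powr (- D)))"
      by (rule Lq_le_convol(1)[OF f1 Kp[OF t1]]) (use p in simp)
    ultimately have "Lq_le p (propagator f t) (F * (A * t powr (- D)))" by (simp only:)
    moreover have "F * (A * t powr (- D)) \<le> A * 2 powr D * F * (1 + t) powr (- D)"
    proof -
      have "t powr (- D) \<le> ((1 + t) / 2) powr (- D)" using False D by (intro powr_mono2') auto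
      then have "A * F * t powr (- D) \<le> A * F * (2 powr D * (1 + t) powr (- D))" unfolding eq using A F by (intro mult_left_mono) auto
      then show ?thesis by (simp add: mult_ac)
    qed
    ultimately show ?thesis by (rule Lq_le_weaken) (use p in simp)
  qed
qed

end

lemma scaling_fractional_kernel:
  fixes \<alpha> \<beta> p :: real
  assumes \<alpha>: "0 < \<alpha>" "\<alpha> < 1" and \<beta>: "0 < \<beta>" and p: "1 < p" "DIM('a::euclidean_space) / 2 * (1 - 1 / p) < 1"
  obtains K :: "real \<Rightarrow> 'a::euclidean_space \<Rightarrow> real" and A where
    "scaling_kernel K (1 + \<alpha>) p ((1 + \<alpha>) * (DIM('a) / 2 * (1 - 1 / p))) A"
    "jointly_measurable K"
    "\<And>T. 0 < T \<Longrightarrow> represents_distr (K T) (inv_fourier_distr (\<lambda>\<xi>. mittag_leffler (1 + \<alpha>) \<beta> (- T * (norm \<xi>)\<^sup>2)))"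
    "(\<integral>x. K 1 x \<partial>lborel) = mittag_leffler (1 + \<alpha>) \<beta> 0"
proof -
  have \<gamma>: "1 < 1 + \<alpha>" "1 + \<alpha> < 2" using \<alpha> by auto
  obtain K :: "real \<Rightarrow> 'a \<Rightarrow> real" where K: "jointly_measurable K"
    "\<And>T x. 0 < T \<Longrightarrow> K T x = T powr (- (DIM('a) / 2)) * K 1 (T powr (- (1 / 2)) *\<^sub>R x)"
    "\<And>T. 0 < T \<Longrightarrow> represents_distr (K T) (inv_fourier_distr (\<lambda>\<xi>. mittag_leffler (1 + \<alpha>) \<beta> (- T * (norm \<xi>)\<^sup>2)))"
    "\<And>q. 1 \<le> q \<Longrightarrow> DIM('a) / 2 * (1 - 1 / q) < 1 \<Longrightarrow>
        \<exists>B\<ge>0. \<forall>T>0. Lq_le q (K T) (B * T powr (- (DIM('a) / 2 * (1 - 1 / q))))"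
    "(\<integral>x. K 1 x \<partial>lborel) = mittag_leffler (1 + \<alpha>) \<beta> 0"
    by (rule fractional_kernel[OF \<gamma> \<beta>, where 'a = 'a]) blast
  obtain B1 where B1: "B1 \<ge> 0" "\<And>T. 0 < T \<Longrightarrow> Lq_le 1 (K T) B1"
    using K(4)[of 1] by auto
  obtain Bp where Bp: "Bp \<ge> 0" "\<And>T. 0 < T \<Longrightarrow> Lq_le p (K T) (Bp * T powr (- (DIM('a) / 2 * (1 - 1 / p))))"
    using K(4)[of p] p by auto
  define A where "A = max B1 Bp"
  have A: "B1 \<le> A" "Bp \<le> A" by (simp_all add: A_def)
  show thesis
  proof (rule that[of K A])
    show "scaling_kernel K (1 + \<alpha>) p ((1 + \<alpha>) * (DIM('a) / 2 * (1 - 1 / p))) A"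
    proof
      show "0 < 1 + \<alpha>" "1 < p" using \<alpha> p by auto
      show "0 \<le> (1 + \<alpha>) * (DIM('a) / 2 * (1 - 1 / p))" using \<alpha> p by (intro mult_nonneg_nonneg) auto
      show "K T x = T powr (- (DIM('a) / 2)) * K 1 (T powr (- (1 / 2)) *\<^sub>R x)" if "0 < T" for T x by (rule K(2)[OF that])
      fix \<tau> :: real assume "0 < \<tau>"
      then have T: "0 < \<tau> powr (1 + \<alpha>)" by simp
      show "Lq_le 1 (K (\<tau> powr (1 + \<alpha>))) A" by (rule Lq_le_weaken[OF B1(2)[OF T] A(1)]) simp
      have "(\<tau> powr (1 + \<alpha>)) powr (- (DIM('a) / 2 * (1 - 1 / p))) = \<tau> powr (- ((1 + \<alpha>) * (DIM('a) / 2 * (1 - 1 / p))))"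
        by (simp add: powr_powr)
      with Bp(2)[OF T] have "Lq_le p (K (\<tau> powr (1 + \<alpha>))) (Bp * \<tau> powr (- ((1 + \<alpha>) * (DIM('a) / 2 * (1 - 1 / p)))))" by simp
      then show "Lq_le p (K (\<tau> powr (1 + \<alpha>))) (A * \<tau> powr (- ((1 + \<alpha>) * (DIM('a) / 2 * (1 - 1 / p)))))"
        by (rule Lq_le_weaken) (use p in \<open>auto intro!: mult_right_mono A(2)\<close>)
    qed
  qed (rule K(1), erule K(3), rule K(5))
qed

text \<open>The choice in \<open>G_kernel\<close> is determined up to a null set, which a convolution does not see.\<close>

lemma convol_G_kernel:
  fixes g :: "'a::euclidean_space \<Rightarrow> real"
  assumes K: "represents_distr g (inv_fourier_distr (\<lambda>\<xi>. mittag_leffler (1 + \<alpha>) \<beta> (- (t powr (1 + \<alpha>)) * (norm \<xi>)\<^sup>2)))"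
    and f: "f \<in> borel_measurable borel"
  shows "convol (G_kernel \<alpha> \<beta> t) f x = convol g f x"
proof -
  have G: "represents_distr (G_kernel \<alpha> \<beta> t) (inv_fourier_distr (\<lambda>\<xi>::'a. mittag_leffler (1 + \<alpha>) \<beta> (- (t powr (1 + \<alpha>)) * (norm \<xi>)\<^sup>2)))"
    unfolding G_kernel_def by (rule someI[of "\<lambda>g. represents_distr g _", OF K])
  show ?thesis
    by (rule convol_cong_AE_left[OF represents_distr_unique(2)[OF G G] represents_distr_unique(2)[OF K K] f represents_distr_unique(1)[OF G K]])
qed

context duhamel
begin

section \<open>Global solutions for small data\<close>

lemma nonlin_cong_AE:
  assumes u: "\<And>s. 0 \<le> s \<Longrightarrow> u s \<in> borel_measurable borel" and v: "\<And>s. 0 \<le> s \<Longrightarrow> v s \<in> borel_measurable borel"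
    and uv: "\<And>s. 0 \<le> s \<Longrightarrow> AE x in lborel. u s x = v s x"
  shows "nonlin u t x = nonlin v t x"
proof -
  have "convol (K (t - s)) (\<lambda>y. \<bar>u s y\<bar> powr p) x = convol (K (t - s)) (\<lambda>y. \<bar>v s y\<bar> powr p) x" if "0 \<le> s" for s
  proof (rule convol_cong_AE_right)
    show "AE y in lborel. \<bar>u s y\<bar> powr p = \<bar>v s y\<bar> powr p" using uv[OF that] by eventually_elim simp
    show "K (t - s) \<in> borel_measurable borel" using measurable_K[of "\<lambda>x. t - s" borel "\<lambda>x. x"] by simp
  qed (use u[OF that] v[OF that] in measurable)
  then show ?thesis unfolding nonlin_def Duhamel_def by (intro set_lebesgue_integral_cong) auto
qed

text \<open>At \<open>s = t\<close> the factor \<open>(t - s)\<^sup>\<alpha>\<close> is zero, hence the integrand vanishes on the one-point interval.\<close>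

lemma nonlin_0: "nonlin u 0 x = 0"
proof -
  have "nonlin u 0 x = (LINT s:{0..0::real}|lborel. 0)"
    unfolding nonlin_def Duhamel_def by (intro set_lebesgue_integral_cong) auto
  then show ?thesis by (simp add: set_lebesgue_integral_def)
qed

lemma Lq_le_if_decay_ball:
  assumes u: "decay_ball u M" and t: "0 \<le> t" and q: "1 \<le> q" "q \<le> p" and e: "D = e * (1 - 1 / p)"
  shows "Lq_le q (u t) (M * (1 + t) powr (1 - e * (1 - 1 / q)))"
proof (rule Lq_le_closed)
  define w where "w = (1 + t) powr (1 - e * (1 - 1 / q))"
  have w: "0 < w" using t by (simp add: w_def)
  have M: "0 \<le> M" by (rule decay_ball_D(1)[OF u])
  show "0 \<le> M * (1 + t) powr (1 - e * (1 - 1 / q))" using M by simp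
  fix B' assume "M * (1 + t) powr (1 - e * (1 - 1 / q)) < B'"
  then have B': "M * w < B'" by (simp add: w_def)
  (* Interpolation needs positive bounds; the radius M may be zero and is therefore enlarged. *)
  define M' where "M' = B' / w"
  have M': "M < M'" "B' = M' * w" using B' w by (auto simp: M'_def field_simps)
  have M'0: "0 < M'" using M M' by simp
  define a where "a = (p - q) / (p - 1)"
  define b where "b = (q - 1) / (p - 1)"
  have pb: "p * b = q - a" using p by (simp add: a_def b_def field_simps)
  have Db: "(1 - D) * (p * b) + a = (1 - e * (1 - 1 / q)) * q"
  proof -
    have "D * p = e * (p - 1)" using p by (simp add: e field_simps)
    then have "D * (p * b) = e * ((p - 1) * b)" by (metis mult.assoc)
    moreover have "(p - 1) * b = q - 1" using p by (simp add: b_def)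
    ultimately have "D * (p * b) = e * (q - 1)" by simp
    moreover have "(1 - e * (1 - 1 / q)) * q = q - e * (q - 1)" using q by (simp add: field_simps)
    moreover have "(1 - D) * (p * b) + a = p * b + a - D * (p * b)" by (simp add: algebra_simps)
    ultimately show ?thesis using pb by simp
  qed
  show "Lq_le q (u t) B'"
  proof (rule Lq_le_interpolate[of _ "M' * (1 + t)" p "M' * (1 + t) powr (1 - D)"])
    show "Lq_le 1 (u t) (M' * (1 + t))"
      by (rule decay_ball_D(2)[OF decay_ball_mono[OF u] t]) (use M' in simp)
    show "Lq_le p (u t) (M' * (1 + t) powr (1 - D))"
      by (rule decay_ball_D(3)[OF decay_ball_mono[OF u] t]) (use M' in simp)
    have "(M' * (1 + t)) powr a * ((M' * (1 + t) powr (1 - D)) powr p) powr b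
        = (M' powr a * M' powr (p * b)) * ((1 + t) powr ((1 - D) * (p * b)) * (1 + t) powr a)"
      using M'0 t by (simp add: powr_mult powr_powr mult_ac)
    also have "\<dots> = M' powr (a + p * b) * (1 + t) powr ((1 - D) * (p * b) + a)"
      unfolding powr_add ..
    also have "\<dots> = M' powr q * ((1 + t) powr (1 - e * (1 - 1 / q))) powr q"
      unfolding Db unfolding pb powr_powr by simp
    also have "\<dots> = B' powr q" unfolding M'(2) w_def using M'0 by (simp add: powr_mult)
    finally show "(M' * (1 + t)) powr ((p - q) / (p - 1)) * ((M' * (1 + t) powr (1 - D)) powr p) powr ((q - 1) / (p - 1)) = B' powr q"
      unfolding a_def b_def .
  qed (use p q M'0 M' w t in auto)
qed (use q in simp)

end

text \<open>The lower bound on \<open>p\<close> is equivalent to \<open>(p - 1) (\<gamma> n / 2 - 1) \<ge> \<gamma>\<close>, that is to the last conclusion, and the upper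
bound to the second one. For \<open>n = 2\<close> the second one holds for every \<open>p > 1\<close>.\<close>

lemma exponent_conditions:
  fixes \<alpha> p n :: real
  assumes n: "2 \<le> n" "n = 2 \<or> 3 \<le> n" and \<alpha>: "0 < \<alpha>" "\<alpha> < 1" and pl: "p \<ge> 1 + 2 / (n - 2 * inverse (1 + \<alpha>))"
    and pu: "3 \<le> n \<Longrightarrow> p < 1 + 2 / (n - 2)"
  defines "D \<equiv> (1 + \<alpha>) * (n / 2 * (1 - 1 / p))"
  shows "1 < p" "n / 2 * (1 - 1 / p) < 1" "0 \<le> D" "D < 1 + \<alpha>" "p * (1 - D) \<le> - \<alpha>"
proof -
  have "inverse (1 + \<alpha>) < 1" using \<alpha> by (simp add: inverse_less_1_iff)
  then have pos: "0 < n - 2 * inverse (1 + \<alpha>)" using n by simp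
  then have "0 < 2 / (n - 2 * inverse (1 + \<alpha>))" by simp
  then show p1: "1 < p" using pl by linarith
  have "(p - 1) * (n - 2) < 2"
    using n(2)
  proof
    assume n3: "3 \<le> n"
    then have "p - 1 < 2 / (n - 2)" using pu by simp
    then show ?thesis using n3 by (simp add: less_divide_eq)
  qed simp
  then have "n * (p - 1) < 2 * p" by (simp add: algebra_simps)
  then show sub: "n / 2 * (1 - 1 / p) < 1" using p1 by (simp add: field_simps)
  show "0 \<le> D" unfolding D_def using \<alpha> n p1 by (intro mult_nonneg_nonneg) auto
  show "D < 1 + \<alpha>" unfolding D_def using mult_strict_left_mono[OF sub, of "1 + \<alpha>"] \<alpha> by simp
  have "2 / (n - 2 * inverse (1 + \<alpha>)) \<le> p - 1" using pl by simp
  then have "2 \<le> (p - 1) * (n - 2 * inverse (1 + \<alpha>))" using pos by (simp add: divide_le_eq)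
  then have "2 * ((1 + \<alpha>) / 2) \<le> (p - 1) * (n - 2 * inverse (1 + \<alpha>)) * ((1 + \<alpha>) / 2)"
    using \<alpha> by (intro mult_right_mono) auto
  also have "\<dots> = (p - 1) * ((1 + \<alpha>) * n / 2 - 1)" using \<alpha> by (simp add: field_simps)
  finally have "1 + \<alpha> \<le> (p - 1) * ((1 + \<alpha>) * n / 2 - 1)" by simp
  moreover have "p * (1 - D) = p - (1 + \<alpha>) * n / 2 * (p - 1)" unfolding D_def using p1 by (simp add: field_simps)
  ultimately show "p * (1 - D) \<le> - \<alpha>" by (simp add: algebra_simps)
qed

lemma mittag_leffler_0: "mittag_leffler \<gamma> 1 0 = 1"
proof -
  have "mittag_leffler \<gamma> 1 0 = (\<Sum>k\<in>{0}. 0 ^ k / Gamma (\<gamma> * real k + 1))"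
    unfolding mittag_leffler_def by (rule suminf_finite) auto
  then show ?thesis by simp
qed

text \<open>By uniqueness of the representing functions, the equation for \<open>global_solution\<close> is the abstract fixed point equation with
the linear part given by two propagators. A solution in the sense of \<open>global_solution\<close> need not be jointly measurable, so
for uniqueness it is replaced by a jointly measurable version, which satisfies the same equation.\<close>

theorem small_data_global_solution:
  fixes \<alpha> p :: real
  defines "n \<equiv> real (DIM('a::euclidean_space))"
  assumes n2: "DIM('a::euclidean_space) \<ge> 2" and \<alpha>: "0 < \<alpha>" "\<alpha> < 1"
    and pl: "p \<ge> 1 + 2 / (n - 2 * inverse (1 + \<alpha>))" and pu: "DIM('a) \<ge> 3 \<Longrightarrow> p < 1 + 2 / (n - 2)"
  shows "\<exists>\<epsilon>>0. \<exists>C>0. \<forall>u0 u1 :: 'a::euclidean_space \<Rightarrow> real.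
    u0 \<in> L1p_space p \<and> u1 \<in> L1p_space p \<and> L1p_norm p u0 \<le> \<epsilon> \<and> L1p_norm p u1 \<le> \<epsilon> \<longrightarrow>
    (\<exists>u. global_solution \<alpha> p u0 u1 u \<and>
      (\<forall>v. global_solution \<alpha> p u0 u1 v \<longrightarrow> (\<forall>t\<ge>0. AE x in lborel. v t x = u t x)) \<and>
      (\<forall>q\<in>{1..p}. \<forall>t\<ge>0. Lq_norm q (u t) \<le>
         C * (1 + t) powr (1 - n / 2 * (1 + \<alpha>) * (1 - 1 / q)) * (L1p_norm p u0 + L1p_norm p u1)))"
proof -
  define D where "D = (1 + \<alpha>) * (n / 2 * (1 - 1 / p))"
  have ns: "2 \<le> n" "n = 2 \<or> 3 \<le> n" "3 \<le> n \<Longrightarrow> p < 1 + 2 / (n - 2)" using n2 pu by (auto simp: n_def)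
  note ec = exponent_conditions[OF ns(1,2) \<alpha> pl ns(3), folded D_def]
  have p: "1 < p" by (rule ec(1)) assumption
  have sub: "n / 2 * (1 - 1 / p) < 1" by (rule ec(2)) assumption
  have D: "0 \<le> D" "D < 1 + \<alpha>" by (rule ec(3), assumption) (rule ec(4), assumption)
  have decay: "p * (1 - D) \<le> - \<alpha>" by (rule ec(5)) assumption
  have Dn: "D = n / 2 * (1 + \<alpha>) * (1 - 1 / p)" by (simp add: D_def)
  obtain K1 :: "real \<Rightarrow> 'a \<Rightarrow> real" and A1 where K1: "scaling_kernel K1 (1 + \<alpha>) p D A1"
    "\<And>T. 0 < T \<Longrightarrow> represents_distr (K1 T) (inv_fourier_distr (\<lambda>\<xi>. mittag_leffler (1 + \<alpha>) 1 (- T * (norm \<xi>)\<^sup>2)))"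
    "(\<integral>x. K1 1 x \<partial>lborel) = mittag_leffler (1 + \<alpha>) 1 0"
    by (rule scaling_fractional_kernel[OF \<alpha> zero_less_one p sub[unfolded n_def], folded n_def, folded D_def]) blast
  obtain K2 :: "real \<Rightarrow> 'a \<Rightarrow> real" and A2 where K2: "scaling_kernel K2 (1 + \<alpha>) p D A2"
    "\<And>T. 0 < T \<Longrightarrow> represents_distr (K2 T) (inv_fourier_distr (\<lambda>\<xi>. mittag_leffler (1 + \<alpha>) 2 (- T * (norm \<xi>)\<^sup>2)))"
    by (rule scaling_fractional_kernel[OF \<alpha> zero_less_numeral p sub[unfolded n_def], folded n_def, folded D_def]) blast
  have \<alpha>1: "0 < 1 + \<alpha>" using \<alpha> by simp
  obtain K3 :: "real \<Rightarrow> 'a \<Rightarrow> real" and A3 where K3: "scaling_kernel K3 (1 + \<alpha>) p D A3"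
    "jointly_measurable K3"
    "\<And>T. 0 < T \<Longrightarrow> represents_distr (K3 T) (inv_fourier_distr (\<lambda>\<xi>. mittag_leffler (1 + \<alpha>) (1 + \<alpha>) (- T * (norm \<xi>)\<^sup>2)))"
    by (rule scaling_fractional_kernel[OF \<alpha> \<alpha>1 p sub[unfolded n_def], folded n_def, folded D_def]) blast
  interpret k1: scaling_kernel K1 "1 + \<alpha>" p D A1 by (rule K1(1))
  interpret k2: scaling_kernel K2 "1 + \<alpha>" p D A2 by (rule K2(1))
  interpret k3: scaling_kernel K3 "1 + \<alpha>" p D A3 by (rule K3(1))
  interpret d: duhamel \<alpha> p D A3 "\<lambda>\<tau>. K3 (\<tau> powr (1 + \<alpha>))"
  proof
    show "jointly_measurable (\<lambda>\<tau> x. K3 (\<tau> powr (1 + \<alpha>)) x)"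
      unfolding case_prod_beta by (rule joint_measurable_compose[OF K3(2)]) measurable
    show "0 \<le> A3" by (rule k3.A)
  qed (use \<alpha> p D decay k3.K1 k3.Kp in simp_all)
  define L where "L = (\<lambda>u0 u1 t x. k1.propagator u0 t x + t * k2.propagator u1 t x)"
  (* The summand 1 makes the constant positive even for vanishing kernel bounds. *)
  define CL where "CL = (A1 + A2) * 2 powr D + 1"
  have CL: "0 < CL" using k1.A k2.A by (simp add: CL_def add_nonneg_pos)
  have lin: "d.decay_ball (L u0 u1) (CL * F) \<and> Lq_cont 1 (L u0 u1) \<and> Lq_cont p (L u0 u1)"
    if u0: "Lq_le 1 u0 F" "Lq_le p u0 F" and u1: "Lq_le 1 u1 F" "Lq_le p u1 F" for u0 u1 F
  proof -
    have F: "0 \<le> F" by (rule Lq_le_nonneg[OF u0(1)])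
    have p1: "1 \<le> p" "0 \<le> p" using p by auto
    have pw: "1 \<le> 2 powr D" using D by (intro ge_one_powr_ge_zero) auto
    note m1 = k1.measurable_propagator[OF Lq_le_measurable[OF u0(1)]] and m2 = k2.measurable_propagator[OF Lq_le_measurable[OF u1(1)]]
    have A1F: "A1 * F \<le> A1 * 2 powr D * F" and A2F: "A2 * F \<le> A2 * 2 powr D * F"
      using mult_left_mono[OF pw, of "A1 * F"] mult_left_mono[OF pw, of "A2 * F"] k1.A k2.A F by (simp_all add: mult_ac)
    have X1: "d.decay_ball (k1.propagator u0) (A1 * 2 powr D * F)"
      unfolding d.decay_ball_def
    proof (intro conjI allI impI)
      show "jointly_measurable (\<lambda>t x. k1.propagator u0 t x)" by (rule m1)
      show n0: "0 \<le> A1 * 2 powr D * F" using k1.A F by simp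
      fix t :: real assume t: "0 \<le> t"
      have "A1 * 2 powr D * F * 1 \<le> A1 * 2 powr D * F * (1 + t)" using n0 t by (intro mult_left_mono) auto
      then have "A1 * F \<le> A1 * 2 powr D * F * (1 + t)" using A1F by linarith
      then show "Lq_le 1 (k1.propagator u0 t) (A1 * 2 powr D * F * (1 + t))"
        by (rule Lq_le_weaken[OF k1.Lq_le_propagator[OF u0(1) order_refl]]) simp
      have "A1 * 2 powr D * F * (1 + t) powr (- D) \<le> A1 * 2 powr D * F * (1 + t) powr (1 - D)"
        using n0 t by (intro mult_left_mono powr_mono) auto
      then show "Lq_le p (k1.propagator u0 t) (A1 * 2 powr D * F * (1 + t) powr (1 - D))"
        by (rule Lq_le_weaken[OF k1.Lq_le_propagator_decay[OF u0 t]]) (rule p1(2))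
    qed
    have X2: "d.decay_ball (\<lambda>t x. t * k2.propagator u1 t x) (A2 * 2 powr D * F)"
      unfolding d.decay_ball_def
    proof (intro conjI allI impI)
      show "jointly_measurable (\<lambda>t x. t * k2.propagator u1 t x)"
        using m2 unfolding case_prod_beta by measurable
      show n0: "0 \<le> A2 * 2 powr D * F" using k2.A F by simp
      fix t :: real assume t: "0 \<le> t"
      have "\<bar>t\<bar> * (A2 * F) \<le> (1 + t) * (A2 * 2 powr D * F)"
        using t k2.A F by (intro mult_mono[OF _ A2F]) auto
      then have "\<bar>t\<bar> * (A2 * F) \<le> A2 * 2 powr D * F * (1 + t)" by (simp add: mult_ac)
      then show "Lq_le 1 (\<lambda>x. t * k2.propagator u1 t x) (A2 * 2 powr D * F * (1 + t))"
        by (rule Lq_le_weaken[OF Lq_le_cmult[OF k2.Lq_le_propagator[OF u1(1) order_refl]]]) simp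
      have "\<bar>t\<bar> * (A2 * 2 powr D * F * (1 + t) powr (- D)) \<le> (1 + t) * (A2 * 2 powr D * F * (1 + t) powr (- D))"
        using n0 t by (intro mult_right_mono mult_nonneg_nonneg[OF n0]) auto
      also have "\<dots> = A2 * 2 powr D * F * (1 + t) powr (1 - D)"
      proof -
        have "(1 + t) powr (1 - D) = (1 + t) * (1 + t) powr (- D)" using powr_add[of "1 + t" 1 "- D"] t by simp
        then show ?thesis by (simp only: mult_ac)
      qed
      finally show "Lq_le p (\<lambda>x. t * k2.propagator u1 t x) (A2 * 2 powr D * F * (1 + t) powr (1 - D))"
        by (rule Lq_le_weaken[OF Lq_le_cmult[OF k2.Lq_le_propagator_decay[OF u1 t]]]) (rule p1(2))
    qed
    have "d.decay_ball (L u0 u1) (CL * F)"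
      unfolding L_def by (rule d.decay_ball_mono[OF d.decay_ball_add[OF X1 X2]]) (use F in \<open>simp add: CL_def algebra_simps\<close>)
    moreover have "Lq_cont q (L u0 u1)" if "Lq_le q u0 F" "Lq_le q u1 F" "1 \<le> q" for q
      unfolding L_def
      by (rule Lq_cont_add[OF k1.Lq_cont_propagator[OF that(1,3)]
            Lq_cont_times[OF k2.Lq_cont_propagator[OF that(2,3)] k2.Lq_le_propagator[OF that(2,3)] that(3)] that(3)])
    ultimately show ?thesis using u0 u1 p1 by blast
  qed
  have mild: "global_solution \<alpha> p u0 u1 u \<longleftrightarrow> u \<in> C_L1p p \<and> (\<forall>t\<ge>0. AE x in lborel. u t x = L u0 u1 t x + d.nonlin u t x)"
    if u0: "u0 \<in> borel_measurable borel" and u1: "u1 \<in> borel_measurable borel" for u0 u1 u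
  proof -
    have at0: "L u0 u1 0 x + d.nonlin u 0 x = u0 x" for x
      by (simp add: L_def k1.propagator_0 K1(3) mittag_leffler_0 d.nonlin_0)
    have pos: "convol (G_kernel \<alpha> 1 t) u0 x + t * convol (G_kernel \<alpha> 2 t) u1 x
              + (LINT s:{0..t}|lborel. (t - s) powr \<alpha> *
                   convol (G_kernel \<alpha> (1 + \<alpha>) (t - s)) (\<lambda>y. \<bar>u s y\<bar> powr p) x) = L u0 u1 t x + d.nonlin u t x"
      if t: "0 < t" and um: "\<And>s. 0 \<le> s \<Longrightarrow> u s \<in> borel_measurable borel" for t x
    proof -
      have tp: "0 < t powr (1 + \<alpha>)" using t by simp
      have "convol (G_kernel \<alpha> 1 t) u0 x = k1.propagator u0 t x"
        unfolding k1.propagator_eq_convol[OF t] by (rule convol_G_kernel[OF K1(2)[OF tp] u0])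
      moreover have "convol (G_kernel \<alpha> 2 t) u1 x = k2.propagator u1 t x"
        unfolding k2.propagator_eq_convol[OF t] by (rule convol_G_kernel[OF K2(2)[OF tp] u1])
      moreover have "(LINT s:{0..t}|lborel. (t - s) powr \<alpha> * convol (G_kernel \<alpha> (1 + \<alpha>) (t - s)) (\<lambda>y. \<bar>u s y\<bar> powr p) x) = d.nonlin u t x"
        unfolding d.nonlin_def d.Duhamel_def
      proof (rule set_lebesgue_integral_cong, simp, intro allI impI)
        fix s assume s: "s \<in> {0..t}"
        show "(t - s) powr \<alpha> * convol (G_kernel \<alpha> (1 + \<alpha>) (t - s)) (\<lambda>y. \<bar>u s y\<bar> powr p) x
            = (t - s) powr \<alpha> * convol (K3 ((t - s) powr (1 + \<alpha>))) (\<lambda>y. \<bar>u s y\<bar> powr p) x"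
        (* At s = t the kernel is not defined by its symbol at a positive time, but there the factor
           (t - s) to the power \<alpha> is zero. *)
        proof (cases "s = t")
          case False
          then have T: "0 < (t - s) powr (1 + \<alpha>)" using s by simp
          have "u s \<in> borel_measurable borel" by (rule um) (use s in simp)
          then have "(\<lambda>y. \<bar>u s y\<bar> powr p) \<in> borel_measurable borel" by simp
          then show ?thesis using convol_G_kernel[OF K3(3)[OF T]] by simp
        qed simp
      qed
      ultimately show ?thesis by (simp add: L_def)
    qed
    have um: "u s \<in> borel_measurable borel" if "u \<in> C_L1p p" "0 \<le> s" for s
      using that by (auto simp: C_L1p_def L1p_space_def Lq_space_def)
    show ?thesis
    proof (cases "u \<in> C_L1p p")
      case True
      define Q where "Q t \<longleftrightarrow> (AE x in lborel. u t x = L u0 u1 t x + d.nonlin u t x)" for t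
      have "global_solution \<alpha> p u0 u1 u \<longleftrightarrow> Q 0 \<and> (\<forall>t>0. Q t)"
        unfolding global_solution_def Q_def at0 using True pos[OF _ um[OF True]] by simp
      also have "\<dots> \<longleftrightarrow> (\<forall>t\<ge>0. Q t)" unfolding le_less by blast
      finally show ?thesis using True unfolding Q_def by simp
    qed (simp add: global_solution_def)
  qed
  (* m is a radius on which the nonlinearity has Lipschitz constant at most 1/2. *)
  define m where "m = (1 / (2 * (d.nonlin_const + 1))) powr (1 / (p - 1))"
  have m: "0 < m" using d.nonlin_const by (simp add: m_def)
  have mp: "d.nonlin_const * m powr (p - 1) \<le> 1 / 2"
    using d.nonlin_const p by (simp add: m_def powr_powr field_simps)
  show ?thesis
  proof (rule exI[of _ "m / (4 * CL)"], rule conjI, use m CL in simp, rule exI[of _ "2 * CL"], intro conjI allI impI)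
    show "0 < 2 * CL" using CL by simp
    fix u0 u1 :: "'a \<Rightarrow> real"
    assume asm: "u0 \<in> L1p_space p \<and> u1 \<in> L1p_space p \<and> L1p_norm p u0 \<le> m / (4 * CL) \<and> L1p_norm p u1 \<le> m / (4 * CL)"
    define F where "F = L1p_norm p u0 + L1p_norm p u1"
    have nn: "0 \<le> Lq_norm q g" for q and g :: "'a \<Rightarrow> real" by (simp add: Lq_norm_def)
    have b0: "Lq_le q u0 F" and b1: "Lq_le q u1 F" if q: "q = 1 \<or> q = p" for q
    proof -
      have q0: "0 < q" "0 \<le> q" using q p by auto
      have "u0 \<in> Lq_space q" "u1 \<in> Lq_space q" using asm q by (auto simp: L1p_space_def)
      note * = Lq_le_Lq_norm[OF this(1) q0(1)] Lq_le_Lq_norm[OF this(2) q0(1)]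
      have le: "Lq_norm q u0 \<le> F" "Lq_norm q u1 \<le> F"
        using q nn[of 1 u0] nn[of p u0] nn[of 1 u1] nn[of p u1] by (auto simp: F_def L1p_norm_def)
      show "Lq_le q u0 F" by (rule Lq_le_weaken[OF *(1) le(1) q0(2)])
      show "Lq_le q u1 F" by (rule Lq_le_weaken[OF *(2) le(2) q0(2)])
    qed
    note b0' = b0[of 1, simplified] b0[of p, simplified] and b1' = b1[of 1, simplified] b1[of p, simplified]
    have F0: "0 \<le> F" by (rule Lq_le_nonneg[OF b0'(1)])
    have Lx: "d.decay_ball (L u0 u1) (CL * F)" "Lq_cont 1 (L u0 u1)" "Lq_cont p (L u0 u1)" using lin[OF b0' b1'] by auto
    have "F \<le> m / (4 * CL) + m / (4 * CL)" unfolding F_def using asm by (intro add_mono) auto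
    then have "2 * (CL * F) \<le> m" using CL by (simp add: field_simps)
    then have "d.nonlin_const * (2 * (CL * F)) powr (p - 1) \<le> d.nonlin_const * m powr (p - 1)"
      using d.nonlin_const CL F0 p by (intro mult_left_mono powr_mono2) auto
    then have small: "d.nonlin_const * (2 * (CL * F)) powr (p - 1) \<le> 1 / 2" using mp by linarith
    obtain u where u: "d.decay_ball u (2 * (CL * F))" "Lq_cont 1 u" "Lq_cont p u"
      "\<And>t. 0 \<le> t \<Longrightarrow> AE x in lborel. u t x = L u0 u1 t x + d.nonlin u t x"
      by (rule d.small_data_solution[OF Lx small]) blast
    have um: "u0 \<in> borel_measurable borel" "u1 \<in> borel_measurable borel"
      by (rule Lq_le_measurable[OF b0'(1)], rule Lq_le_measurable[OF b1'(1)])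
    have uC: "u \<in> C_L1p p" unfolding C_L1p_iff[OF p] using d.decay_ball_Lq_space[OF u(1)] u(2,3) by blast
    show "\<exists>u. global_solution \<alpha> p u0 u1 u \<and>
      (\<forall>v. global_solution \<alpha> p u0 u1 v \<longrightarrow> (\<forall>t\<ge>0. AE x in lborel. v t x = u t x)) \<and>
      (\<forall>q\<in>{1..p}. \<forall>t\<ge>0. Lq_norm q (u t) \<le>
         2 * CL * (1 + t) powr (1 - n / 2 * (1 + \<alpha>) * (1 - 1 / q)) * (L1p_norm p u0 + L1p_norm p u1))"
    proof (intro exI[of _ u] conjI allI impI ballI)
      show "global_solution \<alpha> p u0 u1 u" unfolding mild[OF um] using uC u(4) by blast
    next
      fix v and t :: real assume v: "global_solution \<alpha> p u0 u1 v" and t: "0 \<le> t"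
      have vC: "v \<in> C_L1p p" and veq: "\<And>t. 0 \<le> t \<Longrightarrow> AE x in lborel. v t x = L u0 u1 t x + d.nonlin v t x"
        using v unfolding mild[OF um] by auto
      have vs: "\<And>t. 0 \<le> t \<Longrightarrow> v t \<in> Lq_space p" and vc: "Lq_cont p v" using vC unfolding C_L1p_iff[OF p] by auto
      have vm: "\<And>t. t \<ge> 0 \<Longrightarrow> v t \<in> borel_measurable borel" using vs by (simp add: Lq_space_def)
      have p1: "1 \<le> p" "0 < p" "0 \<le> p" using p by auto
      obtain V where V: "jointly_measurable V" "\<And>t. t \<ge> 0 \<Longrightarrow> AE x in lborel. V t x = v t x"
        using jointly_measurable_version[OF vc vm p1(1)] by blast
      have Vm: "V t \<in> borel_measurable borel" for t by (rule d.slice_measurable[OF V(1)])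
      have VN: "d.nonlin V s x = d.nonlin v s x" for s x by (rule d.nonlin_cong_AE[OF Vm vm V(2)])
      have "AE x in lborel. V t x = u t x"
      proof (rule d.solution_unique[OF V(1) d.decay_ball_measurable[OF u(1)] _ u(3) _ d.decay_ball_Lq_space(2)[OF u(1)] _ u(4) t])
        show "Lq_cont p V"
          unfolding Lq_cont_def
        proof (intro allI impI)
          fix t e :: real assume te: "0 \<le> t" "0 < e"
          obtain \<delta> where \<delta>: "\<delta> > 0" "\<And>s. 0 \<le> s \<Longrightarrow> \<bar>s - t\<bar> < \<delta> \<Longrightarrow> Lq_le p (\<lambda>x. v s x - v t x) e"
            using vc te unfolding Lq_cont_def by blast
          show "\<exists>\<delta>>0. \<forall>s\<ge>0. \<bar>s - t\<bar> < \<delta> \<longrightarrow> Lq_le p (\<lambda>x. V s x - V t x) e"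
          proof (intro exI[of _ \<delta>] conjI allI impI \<delta>(1))
            fix s assume s: "0 \<le> s" "\<bar>s - t\<bar> < \<delta>"
            show "Lq_le p (\<lambda>x. V s x - V t x) e"
            proof (rule Lq_le_AE_cong[OF \<delta>(2)[OF s]])
              show "(\<lambda>x. V s x - V t x) \<in> borel_measurable borel" using Vm by measurable
              show "AE x in lborel. V s x - V t x = v s x - v t x"
                using V(2)[OF s(1)] V(2)[OF te(1)] by eventually_elim simp
            qed (rule p1(3))
          qed
        qed
        show "V s \<in> Lq_space p" if "0 \<le> s" for s
          by (rule Lq_le_imp_Lq(1)[OF Lq_le_AE_cong[OF Lq_le_Lq_norm[OF vs[OF that] p1(2)] Vm V(2)[OF that] p1(3)] p1(2)])
        show "AE x in lborel. V s x = L u0 u1 s x + d.nonlin V s x" if "0 \<le> s" for s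
          using V(2)[OF that] veq[OF that] unfolding VN by eventually_elim simp
      qed
      then show "AE x in lborel. v t x = u t x" using V(2)[OF t] by eventually_elim simp
    next
      fix q t :: real assume q: "q \<in> {1..p}" and t: "0 \<le> t"
      have "Lq_le q (u t) (2 * (CL * F) * (1 + t) powr (1 - n / 2 * (1 + \<alpha>) * (1 - 1 / q)))"
        by (rule d.Lq_le_if_decay_ball[OF u(1) t _ _ Dn]) (use q in simp_all)
      then have "Lq_norm q (u t) \<le> 2 * (CL * F) * (1 + t) powr (1 - n / 2 * (1 + \<alpha>) * (1 - 1 / q))"
        by (rule Lq_le_imp_Lq(2)) (use q in simp)
      then show "Lq_norm q (u t) \<le> 2 * CL * (1 + t) powr (1 - n / 2 * (1 + \<alpha>) * (1 - 1 / q)) * (L1p_norm p u0 + L1p_norm p u1)"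
        unfolding F_def by (simp only: mult_ac)
    qed
  qed
qed

theorem theorem2:
  fixes \<alpha> p :: real
  assumes "CARD('n::finite) \<ge> 2"
    and "0 < \<alpha>" and "\<alpha> < 1"
    and "p \<ge> 1 + 2 / (real CARD('n) - 2 * inverse (1 + \<alpha>))"
    and "CARD('n) \<ge> 3 \<Longrightarrow> p < 1 + 2 / (real CARD('n) - 2)"
  shows "\<exists>\<epsilon>>0. \<exists>C>0. \<forall>u0 u1 :: real^'n \<Rightarrow> real.
    u0 \<in> L1p_space p \<and> u1 \<in> L1p_space p \<and> L1p_norm p u0 \<le> \<epsilon> \<and> L1p_norm p u1 \<le> \<epsilon> \<longrightarrow>
    (\<exists>u. global_solution \<alpha> p u0 u1 u \<and>
      (\<forall>v. global_solution \<alpha> p u0 u1 v \<longrightarrow> (\<forall>t\<ge>0. AE x in lborel. v t x = u t x)) \<and>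
      (\<forall>q\<in>{1..p}. \<forall>t\<ge>0. Lq_norm q (u t) \<le>
         C * (1 + t) powr (1 - real CARD('n) / 2 * (1 + \<alpha>) * (1 - 1 / q))
           * (L1p_norm p u0 + L1p_norm p u1)))"
  using small_data_global_solution[where 'a = "real^'n", of \<alpha> p] assms by simp

end
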